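(* Let $u \in L^\infty(\Omega\times(0,T)) \cap L^1((0,T); BV(\Omega))$ be a weak solution to the incompressible Euler equations with $p, f \in L^1(\Omega\times(0,T))$. Then the Duchon--Robert defect distribution vanishes: $\mathrm{D} \equiv 0$.
   Context: Let $\Omega \subset \mathbb{R}^d$ be open and $T>0$. The incompressible Euler equations with force $f$ are $$\partial_t u + \operatorname{div}(u\otimes u) + \nabla p = f, \qquad \operatorname{div}(u) = 0 \qquad \text{in } \Omega\times(0,T),$$ with velocity $u$ and pressure $p$ (no boundary or initial conditions are prescribed; the analysis is interior). Weak solutions $u \in L^\infty(\Omega\times(0,T))$, $p,f\in L^1(\Omega\times(0,T))$ satisfy the local energy balance $$\partial_t \frac{|u|^2}{2} + \operatorname{div}\Big( u\Big(\frac{|u|^2}{2} + p\Big)\Big) = -\mathrm{D} + f\cdot u \qquad \text{in } \mathcal{D}'(\Omega\times(0,T)),$$ where $\mathrm{D}$ is a (possibly nontrivial) distribution, the Duchon--Robert defect. A function $u \in L^1(\Omega)$ is in $BV(\Omega)$ if its distributional gradient $Du$ is a (vector-valued) Radon measure on $\Omega$; $L^1((0,T);BV(\Omega))$ means $u(\cdot,t)\in BV(\Omega)$ for a.e. $t$ with $\int_0^T |Du(\cdot,t)|(\Omega)\,dt<\infty$. *)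

theory Defs
  imports "HOL-Analysis.Analysis"
begin

coinductive smooth_on :: "'a::real_normed_vector set \<Rightarrow> ('a \<Rightarrow> 'b::real_normed_vector) \<Rightarrow> bool"
  for S where
  "f differentiable_on S \<Longrightarrow> (\<forall>v. smooth_on S (\<lambda>x. frechet_derivative f (at x) v))
     \<Longrightarrow> smooth_on S f"

definition test_fn :: "'a::real_normed_vector set \<Rightarrow> ('a \<Rightarrow> 'b::real_normed_vector) \<Rightarrow> bool" where
  "test_fn U \<phi> \<longleftrightarrow> smooth_on UNIV \<phi> \<and> compact (closure {z. \<phi> z \<noteq> 0})
      \<and> closure {z. \<phi> z \<noteq> 0} \<subseteq> U"

definition dd :: "('a::real_normed_vector \<Rightarrow> 'b::real_normed_vector) \<Rightarrow> 'a \<Rightarrow> 'a \<Rightarrow> 'b" where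
  "dd g z v = frechet_derivative g (at z) v"

definition xdir :: "'n::finite \<Rightarrow> (real^'n) \<times> real" where
  "xdir j = (axis j 1, 0)"
definition tdir :: "(real^'n::finite) \<times> real" where
  "tdir = (0, 1)"

text \<open>Total variation |Dg|(Omega) of a vector field g on Omega (De Giorgi's definition):
  sup of int g . div Phi over matrix-valued test fields with |Phi| <= 1 (Frobenius norm).\<close>
definition total_variation :: "(real^'n::finite) set \<Rightarrow> (real^'n \<Rightarrow> real^'n) \<Rightarrow> ennreal" where
  "total_variation \<Omega> g =
     (SUP \<Phi> \<in> {\<Phi> :: real^'n \<Rightarrow> real^'n^'n. test_fn \<Omega> \<Phi> \<and> (\<forall>x. norm (\<Phi> x) \<le> 1)}.
        ennreal (\<integral>x. (\<Sum>i\<in>UNIV. g x $ i * (\<Sum>j\<in>UNIV. dd (\<lambda>y. \<Phi> y $ i $ j) x (axis j 1))) \<partial>lborel))"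

definition BV_on :: "(real^'n::finite) set \<Rightarrow> (real^'n \<Rightarrow> real^'n) \<Rightarrow> bool" where
  "BV_on \<Omega> g \<longleftrightarrow> set_integrable lborel \<Omega> g \<and> total_variation \<Omega> g < \<infinity>"

definition Linfty_on :: "('a::euclidean_space) set \<Rightarrow> ('a \<Rightarrow> 'b::real_normed_vector) \<Rightarrow> bool" where
  "Linfty_on U g \<longleftrightarrow> set_borel_measurable lborel U g \<and> (\<exists>M. AE z in lborel. z \<in> U \<longrightarrow> norm (g z) \<le> M)"

definition L1_BV :: "(real^'n::finite) set \<Rightarrow> real \<Rightarrow> ((real^'n) \<times> real \<Rightarrow> real^'n) \<Rightarrow> bool" where
  "L1_BV \<Omega> T u \<longleftrightarrow> (AE t in lborel. t \<in> {0<..<T} \<longrightarrow> BV_on \<Omega> (\<lambda>x. u (x, t)))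
     \<and> (\<integral>\<^sup>+ t. indicator {0<..<T} t * total_variation \<Omega> (\<lambda>x. u (x, t)) \<partial>lborel) < \<infinity>"

text \<open>Distributional (weak) solution of the incompressible Euler equations in Omega x (0,T):
  d_t u + div(u (x) u) + grad p = f and div u = 0 in D'.\<close>
definition weak_Euler ::
  "(real^'n::finite) set \<Rightarrow> real \<Rightarrow> ((real^'n) \<times> real \<Rightarrow> real^'n) \<Rightarrow> ((real^'n) \<times> real \<Rightarrow> real)
     \<Rightarrow> ((real^'n) \<times> real \<Rightarrow> real^'n) \<Rightarrow> bool" where
  "weak_Euler \<Omega> T u p f \<longleftrightarrow>
     (\<forall>\<phi> :: (real^'n) \<times> real \<Rightarrow> real^'n. test_fn (\<Omega> \<times> {0<..<T}) \<phi> \<longrightarrow>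
        (\<integral>z. u z \<bullet> dd \<phi> z tdir
             + (\<Sum>i\<in>UNIV. \<Sum>j\<in>UNIV. u z $ i * u z $ j * dd (\<lambda>w. \<phi> w $ i) z (xdir j))
             + p z * (\<Sum>i\<in>UNIV. dd (\<lambda>w. \<phi> w $ i) z (xdir i))
             + f z \<bullet> \<phi> z \<partial>lborel) = 0)
   \<and> (\<forall>\<psi> :: (real^'n) \<times> real \<Rightarrow> real. test_fn (\<Omega> \<times> {0<..<T}) \<psi> \<longrightarrow>
        (\<integral>z. (\<Sum>j\<in>UNIV. u z $ j * dd \<psi> z (xdir j)) \<partial>lborel) = 0)"

text \<open>The Duchon--Robert defect D, defined through the local energy balance
  d_t(|u|^2/2) + div(u(|u|^2/2 + p)) = -D + f.u, evaluated on a scalar test function psi.\<close>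
definition DR_defect ::
  "((real^'n::finite) \<times> real \<Rightarrow> real^'n) \<Rightarrow> ((real^'n) \<times> real \<Rightarrow> real)
     \<Rightarrow> ((real^'n) \<times> real \<Rightarrow> real^'n) \<Rightarrow> ((real^'n) \<times> real \<Rightarrow> real) \<Rightarrow> real" where
  "DR_defect u p f \<psi> =
     (\<integral>z. (norm (u z))\<^sup>2 / 2 * dd \<psi> z tdir
          + ((norm (u z))\<^sup>2 / 2 + p z) * (\<Sum>j\<in>UNIV. u z $ j * dd \<psi> z (xdir j))
          + (f z \<bullet> u z) * \<psi> z \<partial>lborel)"

end

theory Submission
  imports Defs
begin

text \<open>
  Testing the equation at two space-time points \<open>w\<close> and \<open>z\<close> with a mollifier \<open>\<eta> (z - w)\<close>, and letting the support of \<open>\<eta>\<close>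
  shrink, gives the Duchon--Robert formula: four times the defect tested with \<open>\<psi>\<close> is the limit of
  \<open>\<integral>\<integral> \<psi>(w) |\<delta>u|\<^sup>2 \<delta>u \<bullet> \<nabla>\<eta>(z - w)\<close>. If \<open>\<eta>\<close> is a product kernel \<open>\<rho>(x) \<zeta>(t)\<close>, sending \<open>\<zeta>\<close> to a Dirac mass first leaves
  only spatial increments, which the \<open>BV\<close> bound controls; as \<open>|\<delta>u|\<^sup>2\<close> is bounded, the limit is at most
  a constant times \<open>\<integral>\<integral> |\<psi>| |\<nabla>\<rho>(y) \<bullet> M y| dy d|Du|\<close>, where \<open>M\<close> is the polar density of \<open>Du\<close>.
  Since \<open>div u = 0\<close>, \<open>M\<close> is trace free, so the flow \<open>exp (t M)\<close> preserves volume and averaging a bump along it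
  (Alberti) makes the inner integral as small as we like, by a kernel that may depend on \<open>M\<close> but not on the scale.

  The measure \<open>Du\<close> and its density are never constructed. The role of \<open>M\<close> is played by a test field \<open>\<Phi>\<close> that almost attains
  the total variation, made trace free by a pointwise projection: a field \<open>\<Psi>\<close> almost orthogonal to \<open>\<Phi>\<close> pairs
  with \<open>Du\<close> to almost nothing, as otherwise \<open>\<Phi> + s \<Psi>\<close> would exceed the supremum. The kernels are chosen from a finite
  net of trace free matrices, by a partition of unity in the value of \<open>\<Phi>\<close>.
\<close>

section \<open>Algebra of smooth functions\<close>

text \<open>The formula for the defect holds for every bump of small support, with a threshold
  radius that depends on the test function but not on the shape of the bump. This freedom is what
  the proof spends: the shape may follow the matrix, and the time kernel may be chosen after the
  space kernel. A fixed radial bump would in general only bound the defect by a multiple of |Du|.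

  The obstacle is the order of the choices. The optimality gap of \<open>\<Phi>\<close> gets divided
  by a step size \<open>t\<close> adapted to a sup norm bound \<open>C\<close> of the competing
  field, so \<open>C\<close> must be known before \<open>\<Phi>\<close>; the scale \<open>r\<close>
  must come after \<open>\<Phi>\<close>, because the partition of unity has a Lipschitz constant
  that depends on it. Both are compatible only because the moment of |grad rho| against |y| is
  invariant under rescaling: an averaged bump for \<open>N\<close> has moment at most
  \<open>R N\<close> at every scale, so \<open>C\<close> does not involve \<open>r\<close>.

  Increments become gradients only after mollifying the velocity. The mollifier is then moved onto
  the field, so that the supremum over smooth fields also controls bounded measurable ones, as the
  weights contain |delta u| squared.\<close>

abbreviation smooth :: "('a::real_normed_vector \<Rightarrow> 'b::real_normed_vector) \<Rightarrow> bool" where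
  "smooth \<equiv> smooth_on UNIV"

lemma dd_eq: "(f has_derivative D) (at x) \<Longrightarrow> dd f x v = D v"
  unfolding dd_def using frechet_derivative_at by metis

lemma smooth_has_derivative:
  assumes "smooth f" shows "(f has_derivative dd f x) (at x)"
proof -
  from assms have "f differentiable (at x)"
    by (auto elim!: smooth_on.cases simp: differentiable_on_def)
  then show ?thesis
    unfolding dd_def frechet_derivative_works .
qed

lemma smooth_dd: "smooth f \<Longrightarrow> smooth (\<lambda>x. dd f x v)"
  unfolding dd_def by (erule smooth_on.cases) auto

text \<open>Coinduction up to smoothness: an invariant only has to survive differentiation in each
  fixed direction, or land among functions already known to be smooth. Uniqueness of the derivative
  identifies the witness \<open>D\<close> with \<open>frechet_derivative\<close>.\<close>

lemma smooth_coinduct: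
  assumes X: "X f"
    and step: "\<And>f. X f \<Longrightarrow> \<exists>D. (\<forall>x. (f has_derivative D x) (at x)) \<and> (\<forall>v. X (\<lambda>x. D x v) \<or> smooth (\<lambda>x. D x v))"
  shows "smooth f"
  using X
proof (coinduction arbitrary: f rule: smooth_on.coinduct)
  case (smooth_on f)
  then obtain D where D: "\<And>x. (f has_derivative D x) (at x)"
    and X': "\<And>v. X (\<lambda>x. D x v) \<or> smooth (\<lambda>x. D x v)" using step by blast
  have eq: "frechet_derivative f (at x) = D x" for x
    using frechet_derivative_at[OF D] by simp
  show ?case
    using D X' by (auto simp: eq differentiable_on_def differentiable_def)
qed

lemma smoothI:
  assumes "\<And>x. (f has_derivative D x) (at x)" "\<And>v. smooth (\<lambda>x. D x v)"
  shows "smooth f"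
  by (rule smooth_coinduct[of "\<lambda>g. g = f"]) (use assms in auto)

lemma smooth_const [simp]: "smooth (\<lambda>x. c)"
  by (rule smooth_coinduct[of "\<lambda>g. \<exists>c. g = (\<lambda>x. c)"]) (auto intro!: exI[of _ "\<lambda>_ _. 0"])

lemma smooth_linear: "bounded_linear f \<Longrightarrow> smooth f"
  by (rule smoothI[of _ "\<lambda>_. f"]) (auto intro: bounded_linear_imp_has_derivative)

lemma smooth_add:
  assumes "smooth f" "smooth g" shows "smooth (\<lambda>x. f x + g x)"
proof (rule smooth_coinduct[of "\<lambda>h. \<exists>f g. smooth f \<and> smooth g \<and> h = (\<lambda>x. f x + g x)"], goal_cases)
  case 1 then show ?case using assms by blast
next
  case (2 h)
  then obtain f g where fg: "smooth f" "smooth g" "h = (\<lambda>x. f x + g x)" by blast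
  show ?case
    by (rule exI[of _ "\<lambda>x v. dd f x v + dd g x v"])
       (use fg in \<open>auto intro!: has_derivative_add smooth_has_derivative smooth_dd\<close>)
qed

lemma smooth_sum: "(\<And>i. i \<in> I \<Longrightarrow> smooth (f i)) \<Longrightarrow> smooth (\<lambda>x. \<Sum>i\<in>I. f i x)"
  by (induction I rule: infinite_finite_induct) (auto intro: smooth_add)

lemma smooth_bounded_linear:
  assumes L: "bounded_linear L" and "smooth f" shows "smooth (\<lambda>x. L (f x))"
proof (rule smooth_coinduct[of "\<lambda>h. \<exists>f. smooth f \<and> h = (\<lambda>x. L (f x))"], goal_cases)
  case 1 then show ?case using assms by blast
next
  case (2 h)
  then obtain f where f: "smooth f" "h = (\<lambda>x. L (f x))" by blast
  have "(h has_derivative (\<lambda>v. L (dd f x v))) (at x)" for x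
    unfolding f by (rule bounded_linear.has_derivative[OF L smooth_has_derivative[OF f(1)]])
  moreover have "smooth (\<lambda>x. dd f x v)" for v by (rule smooth_dd[OF f(1)])
  ultimately show ?case
    by (intro exI[of _ "\<lambda>x v. L (dd f x v)"] conjI allI disjI1) blast+
qed

lemma smooth_affine:
  assumes L: "bounded_linear L" and "smooth f" shows "smooth (\<lambda>x. f (L x + c))"
proof (rule smooth_coinduct[of "\<lambda>h. \<exists>f. smooth f \<and> h = (\<lambda>x. f (L x + c))"], goal_cases)
  case 1 then show ?case using assms by blast
next
  case (2 h)
  then obtain f where f: "smooth f" "h = (\<lambda>x. f (L x + c))" by blast
  have "((\<lambda>x. f (L x + c)) has_derivative (\<lambda>v. dd f (L x + c) (L v))) (at x)" for x
    by (rule has_derivative_compose[OF has_derivative_add_const[OF bounded_linear_imp_has_derivative[OF L]]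
          smooth_has_derivative[OF f(1)]])
  moreover have "smooth (\<lambda>x. dd f x (L v))" for v by (rule smooth_dd[OF f(1)])
  ultimately show ?case
    unfolding f by (intro exI[of _ "\<lambda>x v. dd f (L x + c) (L v)"] conjI allI disjI1) blast+
qed

lemma dd_affine:
  assumes L: "bounded_linear L" and "smooth f"
  shows "dd (\<lambda>x. f (L x + c)) x v = dd f (L x + c) (L v)"
proof -
  have "((\<lambda>x. f (L x + c)) has_derivative (\<lambda>v. dd f (L x + c) (L v))) (at x)"
    by (rule has_derivative_compose[OF has_derivative_add_const[OF bounded_linear_imp_has_derivative[OF L]]
          smooth_has_derivative[OF assms(2)]])
  then show ?thesis by (rule dd_eq)
qed

text \<open>The closure is needed because the derivative of a product is only a sum of products.\<close>

inductive smooth_alg :: "('a::real_normed_vector \<Rightarrow> real) \<Rightarrow> bool" where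
  base: "smooth f \<Longrightarrow> smooth_alg f"
| add: "smooth_alg f \<Longrightarrow> smooth_alg g \<Longrightarrow> smooth_alg (\<lambda>x. f x + g x)"
| mult: "smooth_alg f \<Longrightarrow> smooth_alg g \<Longrightarrow> smooth_alg (\<lambda>x. f x * g x)"
| comp: "smooth_alg f \<Longrightarrow> smooth (h::real\<Rightarrow>real) \<Longrightarrow> smooth_alg (\<lambda>x. h (f x))"
| recip: "smooth_alg f \<Longrightarrow> (\<And>x. f x \<noteq> 0) \<Longrightarrow> smooth_alg (\<lambda>x. inverse (f x))"

text \<open>The closure was defined so that sum, product, chain and quotient rules never leave it;
  this is the invariant needed for coinduction.\<close>

lemma smooth_alg_derivative:
  assumes "smooth_alg f"
  shows "\<exists>D. (\<forall>x. (f has_derivative D x) (at x)) \<and> (\<forall>v. smooth_alg (\<lambda>x. D x v))"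
  using assms
proof induction
  case (base f)
  then show ?case
    by (intro exI[of _ "dd f"]) (auto intro: smooth_has_derivative smooth_dd smooth_alg.base)
next
  case (add f g)
  then obtain D E where "\<forall>x. (f has_derivative D x) (at x)" "\<forall>v. smooth_alg (\<lambda>x. D x v)"
    "\<forall>x. (g has_derivative E x) (at x)" "\<forall>v. smooth_alg (\<lambda>x. E x v)" by blast
  then show ?case
    by (intro exI[of _ "\<lambda>x v. D x v + E x v"]) (auto intro: smooth_alg.add has_derivative_add)
next
  case (mult f g)
  then obtain D E where "\<forall>x. (f has_derivative D x) (at x)" "\<forall>v. smooth_alg (\<lambda>x. D x v)"
    "\<forall>x. (g has_derivative E x) (at x)" "\<forall>v. smooth_alg (\<lambda>x. E x v)" by blast
  with mult.hyps show ?case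
    by (intro exI[of _ "\<lambda>x v. f x * E x v + D x v * g x"])
       (simp add: smooth_alg.add smooth_alg.mult has_derivative_mult)
next
  case (comp f h)
  then obtain D where D: "\<forall>x. (f has_derivative D x) (at x)" "\<forall>v. smooth_alg (\<lambda>x. D x v)" by blast
  \<comment> \<open>In one real variable a derivative is multiplication by a number. This turns the
    chain rule into a product, which the algebra contains.\<close>
  have lin: "dd h y t = dd h y 1 * t" for y t
  proof -
    have "linear (dd h y)"
      using smooth_has_derivative[OF comp(2)] by (rule has_derivative_linear)
    from linear_cmul[OF this, of t 1] show ?thesis by simp
  qed
  have 1: "((\<lambda>x. h (f x)) has_derivative (\<lambda>v. dd h (f x) 1 * D x v)) (at x)" for x
  proof (rule has_derivative_eq_rhs)
    show "((\<lambda>x. h (f x)) has_derivative (\<lambda>v. dd h (f x) (D x v))) (at x)"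
      by (rule has_derivative_compose[OF D(1)[rule_format] smooth_has_derivative[OF comp(2)]])
    show "(\<lambda>v. dd h (f x) (D x v)) = (\<lambda>v. dd h (f x) 1 * D x v)"
      by (rule ext, rule lin)
  qed
  have "smooth_alg (\<lambda>x. dd h (f x) 1)"
    by (rule smooth_alg.comp[OF comp(1) smooth_dd[OF comp(2)]])
  then have 2: "smooth_alg (\<lambda>x. dd h (f x) 1 * D x v)" for v
    by (rule smooth_alg.mult[OF _ D(2)[rule_format]])
  show ?case
    by (rule exI[of _ "\<lambda>x v. dd h (f x) 1 * D x v"]) (use 1 2 in simp)
next
  case (recip f)
  then obtain D where D: "\<forall>x. (f has_derivative D x) (at x)" "\<forall>v. smooth_alg (\<lambda>x. D x v)" by blast
  have 1: "((\<lambda>x. inverse (f x)) has_derivative (\<lambda>v. (inverse (f x) * inverse (f x)) * ((-1) * D x v))) (at x)" for x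
    using Deriv.has_derivative_inverse[OF recip(2)[of x] spec[OF D(1), of x]]
    by (rule has_derivative_eq_rhs) (auto simp: algebra_simps)
  have 2: "smooth_alg (\<lambda>x. (inverse (f x) * inverse (f x)) * ((-1) * D x v))" for v
    by (rule smooth_alg.mult[OF smooth_alg.mult[OF smooth_alg.recip[OF recip(1,2)] smooth_alg.recip[OF recip(1,2)]]
          smooth_alg.mult[OF smooth_alg.base[OF smooth_const] D(2)[rule_format]]])
  show ?case
    by (rule exI[of _ "\<lambda>x v. (inverse (f x) * inverse (f x)) * ((-1) * D x v)"]) (use 1 2 in simp)
qed

lemma smooth_alg_smooth: "smooth_alg f \<Longrightarrow> smooth f"
proof (rule smooth_coinduct[of smooth_alg], assumption)
  fix f :: "'a \<Rightarrow> real" assume "smooth_alg f"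
  then obtain D where "\<forall>x. (f has_derivative D x) (at x)" "\<forall>v. smooth_alg (\<lambda>x. D x v)"
    using smooth_alg_derivative by blast
  then show "\<exists>D. (\<forall>x. (f has_derivative D x) (at x)) \<and> (\<forall>v. smooth_alg (\<lambda>x. D x v) \<or> smooth (\<lambda>x. D x v))"
    by (intro exI[of _ D]) simp
qed

lemma smooth_mult: "smooth f \<Longrightarrow> smooth g \<Longrightarrow> smooth (\<lambda>x. f x * g x :: real)"
  by (rule smooth_alg_smooth[OF smooth_alg.mult[OF smooth_alg.base smooth_alg.base]])

lemma smooth_comp: "smooth f \<Longrightarrow> smooth (h::real\<Rightarrow>real) \<Longrightarrow> smooth (\<lambda>x. h (f x))"
  by (rule smooth_alg_smooth[OF smooth_alg.comp[OF smooth_alg.base]])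

lemma smooth_inverse: "smooth f \<Longrightarrow> (\<And>x. f x \<noteq> 0) \<Longrightarrow> smooth (\<lambda>x. inverse (f x :: real))"
  by (rule smooth_alg_smooth[OF smooth_alg.recip[OF smooth_alg.base]])

lemma smooth_minus: "smooth f \<Longrightarrow> smooth (\<lambda>x. - f x)"
  by (rule smooth_bounded_linear[OF bounded_linear_minus[OF bounded_linear_ident]])

lemma smooth_diff: "smooth f \<Longrightarrow> smooth g \<Longrightarrow> smooth (\<lambda>x. f x - g x)"
  using smooth_add[of f "\<lambda>x. - g x"] smooth_minus[of g] by simp

lemma smooth_norm_sq: "smooth (\<lambda>x::'a::euclidean_space. (norm x)\<^sup>2)"
proof -
  have "(\<lambda>x::'a. (norm x)\<^sup>2) = (\<lambda>x. \<Sum>b\<in>Basis. (x \<bullet> b) * (x \<bullet> b))"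
    by (rule ext) (metis power2_norm_eq_inner euclidean_inner)
  then show ?thesis
    by (auto intro!: smooth_sum smooth_mult[OF smooth_linear smooth_linear] bounded_linear_inner_left)
qed

lemma smooth_continuous: "smooth f \<Longrightarrow> continuous_on S f"
  using smooth_has_derivative by (meson continuous_at_imp_continuous_on has_derivative_continuous)

lemma smooth_dd_linear: "smooth f \<Longrightarrow> bounded_linear (dd f x)"
  using smooth_has_derivative has_derivative_bounded_linear by blast

lemma dd_mult:
  assumes "smooth f" "smooth g"
  shows "dd (\<lambda>x. f x * g x :: real) x v = f x * dd g x v + dd f x v * g x"
  by (rule dd_eq[OF has_derivative_mult[OF smooth_has_derivative[OF assms(1)] smooth_has_derivative[OF assms(2)]]])

lemma dd_bounded_linear:
  assumes "bounded_linear L" "smooth f"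
  shows "dd (\<lambda>x. L (f x)) x v = L (dd f x v)"
  by (rule dd_eq[OF bounded_linear.has_derivative[OF assms(1) smooth_has_derivative[OF assms(2)]]])

text \<open>Derivatives of \<open>exp (-1/x)\<close> stay in the class of products of a polynomial in \<open>1/x\<close> with it.\<close>

definition flat :: "real poly \<Rightarrow> real \<Rightarrow> real" where
  "flat q x = (if x > 0 then poly q (inverse x) * exp (- inverse x) else 0)"

text \<open>With y = 1/x this says that the exponential beats every polynomial at infinity.\<close>

lemma flat_tendsto_0: "((\<lambda>x. poly q (inverse x) * exp (- inverse x)) \<longlongrightarrow> 0) (at_right (0::real))"
proof -
  have "((\<lambda>y. poly q y * exp (- y)) \<longlongrightarrow> 0) (at_top :: real filter)"
  proof -
    have "((\<lambda>y. \<Sum>i\<le>degree q. coeff q i * (y ^ i / exp y)) \<longlongrightarrow> (\<Sum>i\<le>degree q. coeff q i * 0)) (at_top :: real filter)"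
      by (intro tendsto_sum tendsto_mult_left tendsto_power_div_exp_0)
    then show ?thesis
      by (simp add: poly_altdef sum_divide_distrib exp_minus field_simps)
  qed
  then show ?thesis
    using filterlim_compose filterlim_inverse_at_top_right by fastforce
qed

text \<open>With y = 1/x one has d/dx = - y^2 d/dy, and d/dy of q(y) exp(-y) is (q' - q)(y) exp(-y);
  hence the polynomial y^2 (q - q').\<close>

lemma flat_deriv:
  "(flat q has_field_derivative flat (monom 1 2 * (q - pderiv q)) x) (at x)"
proof (cases "x = 0")
  case False
  show ?thesis
  proof (cases "x > 0")
    case True
    have "((\<lambda>x. poly q (inverse x) * exp (- inverse x)) has_field_derivative
        flat (monom 1 2 * (q - pderiv q)) x) (at x)"
      using True by (auto intro!: derivative_eq_intros DERIV_chain2[OF poly_DERIV]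
          simp: flat_def poly_monom field_simps power2_eq_square)
    then show ?thesis
      by (rule has_field_derivative_transform_within_open[of _ _ _ "{0<..}"]) (use True in \<open>auto simp: flat_def\<close>)
  next
    case F: False
    have "((\<lambda>x. 0) has_field_derivative flat (monom 1 2 * (q - pderiv q)) x) (at x)"
      using F by (auto simp: flat_def)
    then show ?thesis
      by (rule has_field_derivative_transform_within_open[of _ _ _ "{..<0}"]) (use F False in \<open>auto simp: flat_def\<close>)
  qed
next
  case True
  have "((\<lambda>y. (flat q y - flat q 0) / (y - 0)) \<longlongrightarrow> 0) (at 0)"
  proof (rule filterlim_split_at)
    \<comment> \<open>Dividing by x multiplies the polynomial in 1/x by its variable, so the
      difference quotient at 0 is again of the form treated in
      \<open>flat_tendsto_0\<close>.\<close>
    have "((\<lambda>x. poly (pCons 0 q) (inverse x) * exp (- inverse x)) \<longlongrightarrow> 0) (at_right (0::real))"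
      by (rule flat_tendsto_0)
    then show "((\<lambda>y. (flat q y - flat q 0) / (y - 0)) \<longlongrightarrow> 0) (at_right 0)"
      by (rule Lim_transform_eventually) (auto simp: eventually_at_filter flat_def field_simps)
    show "((\<lambda>y. (flat q y - flat q 0) / (y - 0)) \<longlongrightarrow> 0) (at_left 0)"
      by (rule Lim_transform_eventually[OF tendsto_const]) (auto simp: eventually_at_filter flat_def)
  qed
  then show ?thesis using True by (simp add: has_field_derivative_iff flat_def)
qed

lemma smooth_flat: "smooth (flat q)"
proof (rule smooth_coinduct[of "\<lambda>h. \<exists>q. h = flat q"], goal_cases)
  case 1 then show ?case by blast
next
  case (2 h)
  then obtain q where q: "h = flat q" by blast
  have "(\<lambda>x. flat (monom 1 2 * (q - pderiv q)) x * v) = flat (smult v (monom 1 2 * (q - pderiv q)))" for v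
    by (auto simp: flat_def fun_eq_iff)
  then show ?case
    using flat_deriv[of q] unfolding has_field_derivative_def q
    by (intro exI[of _ "\<lambda>x v. flat (monom 1 2 * (q - pderiv q)) x * v"]) auto
qed

text \<open>The classical exp(-1/x), cut off at 0. Being positive exactly on the positive half line,
  it serves both for the mollifiers and for the partition of unity over matrices.\<close>

definition bump1 :: "real \<Rightarrow> real" where "bump1 = flat 1"

lemma bump1: "smooth bump1" "bump1 x \<ge> 0" "x > 0 \<Longrightarrow> bump1 x > 0" "x \<le> 0 \<Longrightarrow> bump1 x = 0"
  unfolding bump1_def using smooth_flat[of 1] by (auto simp: flat_def[of 1 x])

section \<open>Test functions and translations in L1\<close>

text \<open>Any compact set outside which the function vanishes can replace the closure in
  \<open>test_fn\<close>; with the converse \<open>test_fnD\<close> no support is ever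
  computed.\<close>

lemma test_fnI:
  assumes "smooth \<phi>" "compact K" "K \<subseteq> U" "\<And>x. x \<notin> K \<Longrightarrow> \<phi> x = 0"
  shows "test_fn U \<phi>"
proof -
  have "closure {z. \<phi> z \<noteq> 0} \<subseteq> K"
    using assms by (intro closure_minimal compact_imp_closed) auto
  then show ?thesis
    using assms compact_Int_closed[of K "closure {z. \<phi> z \<noteq> 0}"]
    unfolding test_fn_def by (auto simp: Int_absorb1)
qed

lemma test_fnD:
  assumes "test_fn U \<phi>"
  shows "\<exists>K. smooth \<phi> \<and> compact K \<and> K \<subseteq> U \<and> (\<forall>x. x \<notin> K \<longrightarrow> \<phi> x = 0)"
  using assms closure_subset[of "{z. \<phi> z \<noteq> 0}"] unfolding test_fn_def
  by (intro exI[of _ "closure {z. \<phi> z \<noteq> 0}"]) blast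

lemma test_fn_smooth: "test_fn U \<phi> \<Longrightarrow> smooth \<phi>"
  by (simp add: test_fn_def)

lemma dd_eq_0_outside:
  assumes "compact K" "\<And>x. x \<notin> K \<Longrightarrow> \<phi> x = 0" "x \<notin> K"
  shows "dd \<phi> x v = 0"
proof (rule dd_eq)
  have "open (- K)" using assms(1) compact_imp_closed by blast
  then show "(\<phi> has_derivative (\<lambda>_. 0)) (at x)"
    by (rule has_derivative_transform_within_open[OF has_derivative_const[of 0]]) (use assms in auto)
qed

lemma test_fn_dd:
  assumes "test_fn U \<phi>" shows "test_fn U (\<lambda>x. dd \<phi> x v)"
proof -
  from test_fnD[OF assms] obtain K where "smooth \<phi>" "compact K" "K \<subseteq> U" "\<And>x. x \<notin> K \<Longrightarrow> \<phi> x = 0"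
    by auto
  then show ?thesis
    by (intro test_fnI[of _ K] smooth_dd dd_eq_0_outside) auto
qed

lemma test_fn_mono: "test_fn U \<phi> \<Longrightarrow> U \<subseteq> V \<Longrightarrow> test_fn V \<phi>"
  by (auto simp: test_fn_def)

lemma test_fn_mult:
  assumes "test_fn U \<phi>" "smooth g" shows "test_fn U (\<lambda>x. \<phi> x * g x :: real)"
proof -
  from test_fnD[OF assms(1)] obtain K where "smooth \<phi>" "compact K" "K \<subseteq> U" "\<And>x. x \<notin> K \<Longrightarrow> \<phi> x = 0"
    by auto
  then show ?thesis using assms(2)
    by (intro test_fnI[of _ K] smooth_mult) auto
qed

lemma test_fn_add:
  assumes "test_fn U f" "test_fn U g" shows "test_fn U (\<lambda>x. f x + g x)"
proof -
  from test_fnD[OF assms(1)] obtain K where "smooth f" "compact K" "K \<subseteq> U" "\<And>x. x \<notin> K \<Longrightarrow> f x = 0"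
    by auto
  moreover from test_fnD[OF assms(2)] obtain L where "smooth g" "compact L" "L \<subseteq> U" "\<And>x. x \<notin> L \<Longrightarrow> g x = 0"
    by auto
  ultimately show ?thesis
    by (intro test_fnI[of _ "K \<union> L"] smooth_add) auto
qed

lemma test_fn_bounded_linear:
  assumes "bounded_linear L" "test_fn U f" shows "test_fn U (\<lambda>x. L (f x))"
proof -
  from test_fnD[OF assms(2)] obtain K where "smooth f" "compact K" "K \<subseteq> U" "\<And>x. x \<notin> K \<Longrightarrow> f x = 0"
    by auto
  then show ?thesis using linear_0[OF bounded_linear.linear[OF assms(1)]]
    by (intro test_fnI[of _ K]) (auto intro: smooth_bounded_linear[OF assms(1)])
qed

lemma test_fn_zero: "test_fn U (\<lambda>x. 0)"
  by (rule test_fnI[of _ "{}"]) auto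

lemma test_fn_sum: "(\<And>i. i \<in> I \<Longrightarrow> test_fn U (f i)) \<Longrightarrow> test_fn U (\<lambda>x. \<Sum>i\<in>I. f i x)"
  by (induction I rule: infinite_finite_induct) (auto intro: test_fn_add test_fn_zero)

lemma test_fn_bounded:
  assumes "test_fn U \<phi>" shows "\<exists>B\<ge>0. \<forall>x. norm (\<phi> x) \<le> B"
proof -
  from test_fnD[OF assms] obtain K where K: "smooth \<phi>" "compact K" "K \<subseteq> U" "\<And>x. x \<notin> K \<Longrightarrow> \<phi> x = 0"
    by auto
  have "bounded (\<phi> ` K)"
    using K by (intro compact_imp_bounded compact_continuous_image smooth_continuous)
  then obtain B where "\<forall>x\<in>K. norm (\<phi> x) \<le> B" by (auto simp: bounded_iff)
  then have "\<forall>x. norm (\<phi> x) \<le> max B 0" using K(4) by (metis max.coboundedI1 max.cobounded2 norm_zero)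
  then show ?thesis by (intro exI[of _ "max B 0"]) auto
qed

lemma smooth_measurable: "smooth f \<Longrightarrow> f \<in> borel_measurable borel"
  by (intro borel_measurable_continuous_onI smooth_continuous)

lemma test_fn_measurable: "test_fn U f \<Longrightarrow> f \<in> borel_measurable borel"
  by (intro smooth_measurable test_fn_smooth)

lemma integrable_compact_support:
  fixes \<phi> :: "'a::euclidean_space \<Rightarrow> 'b::{banach,second_countable_topology}"
  assumes "\<phi> \<in> borel_measurable borel" "compact K" "\<And>x. x \<notin> K \<Longrightarrow> \<phi> x = 0" "\<And>x. norm (\<phi> x) \<le> B"
  shows "integrable lborel \<phi>"
proof (rule Bochner_Integration.integrable_bound)
  show "integrable lborel (\<lambda>x. indicator K x *\<^sub>R B)"
    using assms emeasure_compact_finite[of K] by (auto simp: borel_compact)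
  show "AE x in lborel. norm (\<phi> x) \<le> norm (indicator K x *\<^sub>R B)"
  proof (rule AE_I2)
    fix x show "norm (\<phi> x) \<le> norm (indicator K x *\<^sub>R B)"
      using assms(3)[of x] assms(4)[of x] by (cases "x \<in> K") auto
  qed
qed (use assms in auto)

lemma test_fn_integrable:
  fixes \<phi> :: "'a::euclidean_space \<Rightarrow> 'b::{banach,second_countable_topology}"
  assumes "test_fn U \<phi>" shows "integrable lborel \<phi>"
proof -
  from test_fnD[OF assms] obtain K where K: "smooth \<phi>" "compact K" "K \<subseteq> U" "\<And>x. x \<notin> K \<Longrightarrow> \<phi> x = 0"
    by auto
  then show ?thesis
    using test_fn_bounded[OF assms] by (auto intro: integrable_compact_support smooth_measurable)
qed

text \<open>Expanding the direction in the basis reduces a bound uniform in \<open>v\<close> to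
  finitely many test functions, each of them bounded.\<close>

lemma test_fn_dd_bound:
  fixes \<phi> :: "'a::euclidean_space \<Rightarrow> 'b::real_normed_vector"
  assumes "test_fn U \<phi>" shows "\<exists>B\<ge>0. \<forall>x v. norm (dd \<phi> x v) \<le> B * norm v"
proof -
  have sm: "smooth \<phi>" using assms by (rule test_fn_smooth)
  have "\<forall>b. \<exists>B\<ge>0. \<forall>x. norm (dd \<phi> x b) \<le> B"
    using test_fn_bounded[OF test_fn_dd[OF assms]] by blast
  then obtain B where B: "\<And>b. B b \<ge> 0" "\<And>b x. norm (dd \<phi> x b) \<le> B b" by metis
  have "norm (dd \<phi> x v) \<le> (\<Sum>b\<in>Basis. B b) * norm v" for x v
  proof -
    have lin: "linear (dd \<phi> x)" using smooth_dd_linear[OF sm] by (rule bounded_linear.linear)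
    have "dd \<phi> x v = dd \<phi> x (\<Sum>b\<in>Basis. (v \<bullet> b) *\<^sub>R b)" by (simp add: euclidean_representation)
    also have "\<dots> = (\<Sum>b\<in>Basis. (v \<bullet> b) *\<^sub>R dd \<phi> x b)"
      by (simp add: linear_sum[OF lin] linear_cmul[OF lin])
    also have "norm \<dots> \<le> (\<Sum>b\<in>Basis. norm v * B b)"
      by (rule sum_norm_le) (use B in \<open>auto intro!: mult_mono Basis_le_norm\<close>)
    finally show ?thesis by (simp add: sum_distrib_left mult.commute)
  qed
  then show ?thesis using B by (intro exI[of _ "\<Sum>b\<in>Basis. B b"]) (auto intro: sum_nonneg)
qed

lemma test_fn_lipschitz:
  fixes \<phi> :: "'a::euclidean_space \<Rightarrow> 'b::real_normed_vector"
  assumes "test_fn U \<phi>" shows "\<exists>B\<ge>0. \<forall>x y. norm (\<phi> x - \<phi> y) \<le> B * norm (x - y)"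
proof -
  obtain B where B: "B \<ge> 0" "\<And>x v. norm (dd \<phi> x v) \<le> B * norm v"
    using test_fn_dd_bound[OF assms] by blast
  have "norm (\<phi> x - \<phi> y) \<le> B * norm (x - y)" for x y
    by (rule differentiable_bound[of UNIV _ "dd \<phi>"])
       (use B smooth_has_derivative[OF test_fn_smooth[OF assms]] in \<open>auto intro: onorm_bound\<close>)
  then show ?thesis using B by blast
qed

text \<open>A Taylor remainder uniform in \<open>x\<close>. It is what later allows differentiation
  under an integral: a quadratic remainder survives integration.\<close>

lemma test_fn_quadratic:
  fixes \<phi> :: "'a::euclidean_space \<Rightarrow> 'b::real_normed_vector"
  assumes "test_fn U \<phi>" shows "\<exists>B\<ge>0. \<forall>x h. norm (\<phi> (x + h) - \<phi> x - dd \<phi> x h) \<le> B * (norm h)\<^sup>2"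
proof -
  have sm: "smooth \<phi>" using assms by (rule test_fn_smooth)
  have "\<forall>b. \<exists>B\<ge>0. \<forall>x y. norm (dd \<phi> x b - dd \<phi> y b) \<le> B * norm (x - y)"
    using test_fn_lipschitz[OF test_fn_dd[OF assms]] by blast
  then obtain B where B: "\<And>b. B b \<ge> 0" "\<And>b x y. norm (dd \<phi> x b - dd \<phi> y b) \<le> B b * norm (x - y)" by metis
  define C where "C = (\<Sum>b\<in>Basis. B b)"
  have C0: "C \<ge> 0" using B by (auto simp: C_def intro: sum_nonneg)
  have lin: "linear (dd \<phi> x)" for x using smooth_dd_linear[OF sm] by (rule bounded_linear.linear)
  have L: "norm (dd \<phi> x v - dd \<phi> y v) \<le> C * norm (x - y) * norm v" for x y v
  proof -
    have "dd \<phi> x v - dd \<phi> y v = dd \<phi> x (\<Sum>b\<in>Basis. (v \<bullet> b) *\<^sub>R b) - dd \<phi> y (\<Sum>b\<in>Basis. (v \<bullet> b) *\<^sub>R b)"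
      by (simp add: euclidean_representation)
    also have "\<dots> = (\<Sum>b\<in>Basis. (v \<bullet> b) *\<^sub>R (dd \<phi> x b - dd \<phi> y b))"
      by (simp add: linear_sum[OF lin] linear_cmul[OF lin] sum_subtractf scaleR_diff_right)
    also have "norm \<dots> \<le> (\<Sum>b\<in>Basis. norm v * (B b * norm (x - y)))"
      by (rule sum_norm_le) (use B in \<open>auto intro!: mult_mono Basis_le_norm\<close>)
    finally show ?thesis by (simp add: C_def sum_distrib_left sum_distrib_right mult_ac)
  qed
  have "norm (\<phi> (x + h) - \<phi> x - dd \<phi> x h) \<le> C * (norm h)\<^sup>2" for x h
  proof -
    have "norm (\<phi> (x + h) - \<phi> x - dd \<phi> x ((x + h) - x)) \<le> norm ((x + h) - x) * (C * norm h)"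
    proof (rule differentiable_bound_linearization[where S="cball x (norm h)" and f'="dd \<phi>"])
      fix t :: real assume "t \<in> {0..1}"
      then show "x + t *\<^sub>R (x + h - x) \<in> cball x (norm h)"
        by (auto simp: dist_norm mult_left_le_one_le)
    next
      fix y assume y: "y \<in> cball x (norm h)"
      show "onorm (dd \<phi> y - dd \<phi> x) \<le> C * norm h"
      proof (rule onorm_bound)
        fix v
        have "norm (dd \<phi> y v - dd \<phi> x v) \<le> C * norm (y - x) * norm v" by (rule L)
        also have "\<dots> \<le> C * norm h * norm v"
          using y C0 by (intro mult_right_mono mult_left_mono) (auto simp: dist_norm norm_minus_commute)
        finally show "norm ((dd \<phi> y - dd \<phi> x) v) \<le> C * norm h * norm v" by simp
      qed (use C0 in auto)
    qed (use sm in \<open>auto intro: has_derivative_at_withinI smooth_has_derivative\<close>)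
    then show ?thesis by (simp add: power2_eq_square mult_ac)
  qed
  then show ?thesis using C0 by blast
qed

lemma lborel_translate:
  fixes f :: "'a::euclidean_space \<Rightarrow> 'b::{banach,second_countable_topology}"
  assumes "f \<in> borel_measurable borel"
  shows "(\<integral>x. f (c + x) \<partial>lborel) = (\<integral>x. f x \<partial>lborel)"
    and "integrable lborel (\<lambda>x. f (c + x)) \<longleftrightarrow> integrable lborel f"
  using assms
  by (subst (2) lborel_distr_plus[of c, symmetric], simp add: integral_distr integrable_distr_eq)+

lemma lborel_distr_reflect: "distr lborel borel (\<lambda>x. c - x) = (lborel :: 'a::euclidean_space measure)"
  by (subst lborel_affine[of "-1" c], auto simp: density_1)

lemma lborel_reflect:
  fixes f :: "'a::euclidean_space \<Rightarrow> 'b::{banach,second_countable_topology}"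
  assumes "f \<in> borel_measurable borel"
  shows "(\<integral>x. f (c - x) \<partial>lborel) = (\<integral>x. f x \<partial>lborel)"
    and "integrable lborel (\<lambda>x. f (c - x)) \<longleftrightarrow> integrable lborel f"
  using assms
  by (subst (2) lborel_distr_reflect[of c, symmetric], simp add: integral_distr integrable_distr_eq)+

lemma small_quadratic_imp_zero:
  assumes "\<And>h::real. 0 < h \<Longrightarrow> h < 1 \<Longrightarrow> \<bar>h * I\<bar> \<le> C * h\<^sup>2"
  shows "I = 0"
proof (rule ccontr)
  assume "I \<noteq> 0"
  \<comment> \<open>Small enough that \<open>C * h\<close> is at most half of
    \<open>\<bar>I\<bar>\<close>; the 1 added to \<open>\<bar>C\<bar>\<close> avoids division by
    zero.\<close>
  define h where "h = min (1/2) (\<bar>I\<bar> / (2 * (\<bar>C\<bar> + 1)))"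
  have h: "0 < h" "h < 1" using \<open>I \<noteq> 0\<close> by (auto simp: h_def)
  have "h * \<bar>I\<bar> \<le> C * h\<^sup>2" using assms[OF h] h by (simp add: abs_mult)
  then have "\<bar>I\<bar> \<le> C * h" using h by (simp add: power2_eq_square)
  also have "\<dots> \<le> (\<bar>C\<bar> + 1) * (\<bar>I\<bar> / (2 * (\<bar>C\<bar> + 1)))"
    using h by (intro mult_mono) (auto simp: h_def)
  also have "\<dots> = \<bar>I\<bar> / 2" by (simp add: field_simps)
  finally show False using \<open>I \<noteq> 0\<close> by simp
qed

text \<open>By translation invariance the increments \<phi>(x + h v) - \<phi>(x) integrate to 0, so
  h times the integral in question equals the integral of a Taylor remainder, which is of order
  h^2.\<close>

lemma test_fn_integral_dd:
  fixes \<phi> :: "'a::euclidean_space \<Rightarrow> real"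
  assumes \<phi>: "test_fn U \<phi>" shows "(\<integral>x. dd \<phi> x v \<partial>lborel) = 0"
proof -
  from test_fnD[OF \<phi>] obtain K where K: "smooth \<phi>" "compact K" "K \<subseteq> U" "\<And>x. x \<notin> K \<Longrightarrow> \<phi> x = 0"
    by auto
  obtain B where B: "B \<ge> 0" "\<And>x h. norm (\<phi> (x + h) - \<phi> x - dd \<phi> x h) \<le> B * (norm h)\<^sup>2"
    using test_fn_quadratic[OF \<phi>] by blast
  obtain R where R: "R > 0" "K \<subseteq> cball 0 R"
    using compact_imp_bounded[OF K(2)] by (auto simp: bounded_pos subset_iff)
  \<comment> \<open>As h < 1, both \<open>\<phi>\<close> and its translate vanish outside this ball,
    so the remainder is integrated over a set of fixed finite measure.\<close>
  define S where "S = cball (0::'a) (R + norm v)"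
  note [measurable] = smooth_measurable[OF K(1)] smooth_measurable[OF smooth_dd[OF K(1)]]
  have cS: "compact S" by (simp add: S_def)
  have iS: "integrable lborel (indicator S :: 'a \<Rightarrow> real)"
    using cS emeasure_compact_finite[of S] by (intro integrable_real_indicator) (auto simp: borel_compact)
  show ?thesis
  proof (rule small_quadratic_imp_zero)
    fix h :: real assume h: "0 < h" "h < 1"
    have i1: "integrable lborel \<phi>" by (rule test_fn_integrable[OF \<phi>])
    have i2: "integrable lborel (\<lambda>x. \<phi> (x + h *\<^sub>R v))"
      using lborel_translate(2)[of \<phi> "h *\<^sub>R v"] i1 by (simp add: add.commute)
    have i3: "integrable lborel (\<lambda>x. dd \<phi> x v)"
      by (rule test_fn_integrable[OF test_fn_dd[OF \<phi>]])
    have lin: "dd \<phi> x (h *\<^sub>R v) = h * dd \<phi> x v" for x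
      using linear_cmul[OF bounded_linear.linear[OF smooth_dd_linear[OF K(1)]]] by simp
    have "(\<integral>x. \<phi> (x + h *\<^sub>R v) - \<phi> x - h * dd \<phi> x v \<partial>lborel) = - h * (\<integral>x. dd \<phi> x v \<partial>lborel)"
      using i1 i2 i3 lborel_translate(1)[of \<phi> "h *\<^sub>R v"] by (simp add: add.commute)
    then have "\<bar>h * (\<integral>x. dd \<phi> x v \<partial>lborel)\<bar> = \<bar>\<integral>x. \<phi> (x + h *\<^sub>R v) - \<phi> x - h * dd \<phi> x v \<partial>lborel\<bar>"
      by simp
    also have "\<dots> \<le> (\<integral>x. indicator S x * (B * (norm (h *\<^sub>R v))\<^sup>2) \<partial>lborel)"
    proof (rule order.trans[OF integral_abs_bound integral_mono])
      show "integrable lborel (\<lambda>x. \<bar>\<phi> (x + h *\<^sub>R v) - \<phi> x - h * dd \<phi> x v\<bar>)"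
        using i1 i2 i3 by auto
      show "integrable lborel (\<lambda>x. indicator S x * (B * (norm (h *\<^sub>R v))\<^sup>2))"
        using iS by simp
      fix x
      show "\<bar>\<phi> (x + h *\<^sub>R v) - \<phi> x - h * dd \<phi> x v\<bar> \<le> indicator S x * (B * (norm (h *\<^sub>R v))\<^sup>2)"
      proof (cases "x \<in> S")
        case True
        then show ?thesis using B(2)[of x "h *\<^sub>R v"] by (simp add: lin)
      next
        case False
        then have x: "norm x > R + norm v" by (simp add: S_def)
        have "norm x \<le> norm (x + h *\<^sub>R v) + norm (h *\<^sub>R v)" by (metis add_diff_cancel norm_triangle_ineq4)
        moreover have "norm (h *\<^sub>R v) \<le> norm v" using h by (simp add: mult_left_le_one_le)
        ultimately have "norm (x + h *\<^sub>R v) > R" using x by linarith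
        then have "x + h *\<^sub>R v \<notin> K" using R(2) by auto
        moreover have "norm x > R" using x norm_ge_zero[of v] by linarith
        then have "x \<notin> K" using R(2) by auto
        ultimately show ?thesis
          using K(4) dd_eq_0_outside[OF K(2), of \<phi> x v] by (simp add: B(1))
      qed
    qed
    also have "\<dots> = measure lborel S * B * (norm v)\<^sup>2 * h\<^sup>2"
      using cS by (simp add: borel_compact power_mult_distrib)
    finally show "\<bar>h * (\<integral>x. dd \<phi> x v \<partial>lborel)\<bar> \<le> measure lborel S * B * (norm v)\<^sup>2 * h\<^sup>2" .
  qed
qed

section \<open>Continuity of translations in L1\<close>

definition L1_shift :: "('a::euclidean_space \<Rightarrow> real) \<Rightarrow> 'a \<Rightarrow> real" where
  "L1_shift f h = (\<integral>x. \<bar>f (x + h) - f x\<bar> \<partial>lborel)"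

lemma integrable_shift:
  fixes f :: "'a::euclidean_space \<Rightarrow> 'b::{banach,second_countable_topology}"
  assumes "integrable lborel f"
  shows "integrable lborel (\<lambda>x. f (x + h))" "integrable lborel (\<lambda>x. f (h + x))" 
    "integrable lborel (\<lambda>x. f (h - x))" "integrable lborel (\<lambda>x. f (x - h))"
proof -
  have m: "f \<in> borel_measurable borel" using borel_measurable_integrable[OF assms] by simp
  show 1: "integrable lborel (\<lambda>x. f (h + x))" for h using lborel_translate(2)[OF m] assms by simp
  from 1[of h] show "integrable lborel (\<lambda>x. f (x + h))" by (simp add: add.commute)
  show "integrable lborel (\<lambda>x. f (h - x))" using lborel_reflect(2)[OF m] assms by simp
  from 1[of "-h"] show "integrable lborel (\<lambda>x. f (x - h))" by (simp)
qed

lemma integral_shift: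
  fixes f :: "'a::euclidean_space \<Rightarrow> 'b::{banach,second_countable_topology}"
  assumes "f \<in> borel_measurable borel"
  shows "(\<integral>x. f (x + h) \<partial>lborel) = integral\<^sup>L lborel f" "(\<integral>x. f (x - h) \<partial>lborel) = integral\<^sup>L lborel f"
  using lborel_translate(1)[OF assms, of h] lborel_translate(1)[OF assms, of "-h"]
  by (auto simp: add.commute)

lemma L1_shift_nonneg: "L1_shift f h \<ge> 0" by (simp add: L1_shift_def)

lemma L1_shift_le_diff:
  assumes f: "integrable lborel f" and g: "integrable lborel g"
  shows "L1_shift f h \<le> 2 * (\<integral>x. \<bar>f x - g x\<bar> \<partial>lborel) + L1_shift g h"
proof -
  note i = f g integrable_shift(1)[OF f, of h] integrable_shift(1)[OF g, of h]
  have [measurable]: "f \<in> borel_measurable borel" "g \<in> borel_measurable borel"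
    using f g by auto
  have "L1_shift f h \<le> (\<integral>x. \<bar>f (x + h) - g (x + h)\<bar> + \<bar>f x - g x\<bar> + \<bar>g (x + h) - g x\<bar> \<partial>lborel)"
    unfolding L1_shift_def by (rule integral_mono) (use i in auto)
  also have "\<dots> = (\<integral>x. \<bar>f (x + h) - g (x + h)\<bar> \<partial>lborel) + (\<integral>x. \<bar>f x - g x\<bar> \<partial>lborel) + L1_shift g h"
    unfolding L1_shift_def using i by simp
  also have "(\<integral>x. \<bar>f (x + h) - g (x + h)\<bar> \<partial>lborel) = (\<integral>x. \<bar>f x - g x\<bar> \<partial>lborel)"
    by (rule integral_shift(1)[of "\<lambda>x. \<bar>f x - g x\<bar>"]) measurable
  finally show ?thesis by simp
qed

text \<open>Functions whose modulus tends to 0 form a closed subset of L1, since translation is an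
  isometry. The induction over integrable functions rests on this.\<close>

lemma L1_shift_approx:
  assumes f: "integrable lborel f"
    and ap: "\<And>e. e > 0 \<Longrightarrow> \<exists>g. integrable lborel g \<and> (\<integral>x. \<bar>f x - g x\<bar> \<partial>lborel) < e \<and> (L1_shift g \<longlongrightarrow> 0) (at 0)"
  shows "(L1_shift f \<longlongrightarrow> 0) (at 0)"
proof (rule tendstoI)
  fix e :: real assume "e > 0"
  then obtain g where g: "integrable lborel g" "(\<integral>x. \<bar>f x - g x\<bar> \<partial>lborel) < e/3" "(L1_shift g \<longlongrightarrow> 0) (at 0)"
    using ap[of "e/3"] by auto
  have "eventually (\<lambda>h. dist (L1_shift g h) 0 < e/3) (at 0)"
    using g(3) \<open>e > 0\<close> by (intro tendstoD) auto
  then show "eventually (\<lambda>h. dist (L1_shift f h) 0 < e) (at 0)"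
  proof eventually_elim
    case (elim h)
    then show ?case using L1_shift_le_diff[OF f g(1), of h] g(2) by (simp add: L1_shift_nonneg)
  qed
qed

text \<open>A point of an open set stays inside under small shifts, so dominated convergence makes
  the mass that leaves tend to 0. The mass that enters is equal to it by translation invariance,
  whence the factor 2.\<close>

lemma L1_shift_open:
  assumes U: "open U" "emeasure lborel U < \<infinity>"
  shows "(L1_shift (indicator U) \<longlongrightarrow> 0) (at (0::'a::euclidean_space))"
proof -
  define q :: "'a \<Rightarrow> real" where "q h = (\<integral>x. indicator U x * (1 - indicator U (x + h)) \<partial>lborel)" for h
  have [measurable]: "U \<in> sets borel" using U by simp
  have iU: "integrable lborel (indicator U :: 'a \<Rightarrow> real)"
    using U by (intro integrable_real_indicator) auto
  have iUh: "integrable lborel (\<lambda>x. indicator U (x + h) :: real)" for h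
    by (rule integrable_shift[OF iU])
  have iUU: "integrable lborel (\<lambda>x. indicator U x * indicator U (x + h) :: real)" for h
    by (rule Bochner_Integration.integrable_bound[OF iU]) (auto simp: indicator_def)
  have eq: "L1_shift (indicator U) h = 2 * q h" for h
  proof -
    have "L1_shift (indicator U) h = (\<integral>x. indicator U (x + h) + indicator U x - 2 * (indicator U x * indicator U (x + h)) \<partial>lborel)"
      unfolding L1_shift_def by (rule Bochner_Integration.integral_cong) (auto simp: indicator_def)
    also have "\<dots> = 2 * (\<integral>x. indicator U x \<partial>lborel) - 2 * (\<integral>x. indicator U x * indicator U (x + h) \<partial>lborel)"
      using iU iUh iUU integral_shift(1)[of "indicator U :: 'a \<Rightarrow> real" h] by simp
    also have "\<dots> = 2 * q h"
      unfolding q_def using iU iUU by (simp add: right_diff_distrib)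
    finally show ?thesis .
  qed
  have "(q \<longlongrightarrow> 0) (at 0)"
    unfolding tendsto_at_iff_sequentially comp_def
  proof (intro allI impI)
    fix X :: "nat \<Rightarrow> 'a" assume X: "\<forall>i. X i \<in> UNIV - {0}" "X \<longlonglongrightarrow> 0"
    have "(\<lambda>n. q (X n)) \<longlonglongrightarrow> (\<integral>x. (0::real) \<partial>(lborel::'a measure))"
      unfolding q_def
    proof (rule integral_dominated_convergence[where w="indicator U"])
      show "AE x in lborel. (\<lambda>i. indicator U x * (1 - indicator U (x + X i))) \<longlonglongrightarrow> (0::real)"
      proof (rule AE_I2)
        fix x :: 'a
        show "(\<lambda>i. indicator U x * (1 - indicator U (x + X i))) \<longlonglongrightarrow> (0::real)"
        proof (cases "x \<in> U")
          case True
          have "(\<lambda>i. x + X i) \<longlonglongrightarrow> x" using tendsto_add[OF tendsto_const X(2), of x] by simp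
          then have "eventually (\<lambda>i. x + X i \<in> U) sequentially"
            by (rule topological_tendstoD[OF _ U(1) True])
          then have "eventually (\<lambda>i. indicator U x * (1 - indicator U (x + X i)) = (0::real)) sequentially"
            by eventually_elim simp
          then show ?thesis by (rule tendsto_eventually)
        qed simp
      qed
    qed (use iU in \<open>auto simp: indicator_def\<close>)
    then show "(\<lambda>n. q (X n)) \<longlonglongrightarrow> 0" by simp
  qed
  moreover have "L1_shift (indicator U) = (\<lambda>h. 2 * q h)" by (rule ext) (rule eq)
  ultimately show ?thesis using tendsto_mult_left[of q 0 _ 2] by simp
qed

lemma L1_shift_scale: "L1_shift (\<lambda>x. f x * c) h = L1_shift f h * \<bar>c\<bar>"
  unfolding L1_shift_def by (simp add: left_diff_distrib[symmetric] abs_mult)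

lemma L1_shift_add:
  assumes "integrable lborel f" "integrable lborel g"
  shows "L1_shift (\<lambda>x. f x + g x) h \<le> L1_shift f h + L1_shift g h"
proof -
  note i = assms integrable_shift(1)[OF assms(1), of h] integrable_shift(1)[OF assms(2), of h]
  show ?thesis
  proof -
    have "L1_shift (\<lambda>x. f x + g x) h \<le> (\<integral>x. \<bar>f (x + h) - f x\<bar> + \<bar>g (x + h) - g x\<bar> \<partial>lborel)"
      unfolding L1_shift_def by (rule integral_mono) (use i in auto)
    also have "\<dots> = L1_shift f h + L1_shift g h"
      unfolding L1_shift_def by (rule Bochner_Integration.integral_add) (use i in auto)
    finally show ?thesis .
  qed
qed

text \<open>Outer regularity replaces the set by an open one at arbitrarily small cost in
  L1.\<close>

lemma L1_shift_indicator:
  fixes A :: "'a::euclidean_space set"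
  assumes A: "A \<in> sets borel" "emeasure lborel A < \<infinity>"
  shows "(L1_shift (indicator A) \<longlongrightarrow> 0) (at 0)"
proof (rule L1_shift_approx)
  show "integrable lborel (indicator A :: 'a \<Rightarrow> real)"
    using A by (intro integrable_real_indicator) auto
  fix e :: real assume "e > 0"
  then obtain U where U: "open U" "A \<subseteq> U" "emeasure lborel (U - A) < e"
    using outer_regular_lborel[OF A(1)] by blast
  have [measurable]: "U \<in> sets borel" "A \<in> sets borel" using U A by auto
  have "emeasure lborel U \<le> emeasure lborel A + emeasure lborel (U - A)"
    using U A by (subst plus_emeasure) (auto simp: Un_absorb1)
  also have "\<dots> < \<infinity>" using U(3) A(2) by (auto intro: order.strict_trans)
  finally have fU: "emeasure lborel U < \<infinity>" .
  have "(\<integral>x. \<bar>indicator A x - indicator U x :: real\<bar> \<partial>lborel) = (\<integral>x. indicator (U - A) x \<partial>lborel)"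
    using U(2) by (intro Bochner_Integration.integral_cong) (auto simp: indicator_def)
  also have "\<dots> = measure lborel (U - A)" by simp
  also have "\<dots> < e"
  proof -
    have "emeasure lborel (U - A) \<noteq> top" using U(3) by (metis ennreal_less_top top.not_eq_extremum order_less_trans)
    then show ?thesis using U(3) \<open>e > 0\<close> by (simp add: emeasure_eq_ennreal_measure ennreal_less_iff)
  qed
  finally show "\<exists>g. integrable lborel g \<and> (\<integral>x. \<bar>indicator A x - g x\<bar> \<partial>lborel) < e \<and> (L1_shift g \<longlongrightarrow> 0) (at 0)"
    using L1_shift_open[OF U(1) fU] fU by (intro exI[of _ "indicator U"]) (auto intro: integrable_real_indicator)
qed

theorem L1_shift_tendsto_0:
  fixes f :: "'a::euclidean_space \<Rightarrow> real"
  assumes "integrable lborel f"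
  shows "(L1_shift f \<longlongrightarrow> 0) (at 0)"
  using assms
proof (induction rule: integrable_induct)
  case (base A c)
  have "((\<lambda>h. L1_shift (indicator A) h * \<bar>c\<bar>) \<longlongrightarrow> 0 * \<bar>c\<bar>) (at (0::'a))"
    using base by (intro tendsto_mult tendsto_const L1_shift_indicator) auto
  moreover have "L1_shift (\<lambda>x. indicator A x *\<^sub>R c) = (\<lambda>h. L1_shift (indicator A) h * \<bar>c\<bar>)"
    by (rule ext) (simp add: L1_shift_scale)
  ultimately show ?case by simp
next
  case (add f g)
  have "((\<lambda>h. L1_shift f h + L1_shift g h) \<longlongrightarrow> 0) (at (0::'a))"
    using tendsto_add[OF add(3,4)] by (simp add: add.IH)
  then show ?case
    by (rule tendsto_sandwich[OF _ _ tendsto_const, rotated 2])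
       (auto simp: L1_shift_nonneg L1_shift_add[OF add(1,2)])
next
  case (lim f s)
  show ?case
  proof (rule L1_shift_approx[OF lim(4)])
    fix e :: real assume "e > 0"
    have "(\<lambda>i. \<integral>x. \<bar>f x - s i x\<bar> \<partial>lborel) \<longlonglongrightarrow> (\<integral>x. (0::real) \<partial>(lborel::'a measure))"
    \<comment> \<open>The approximating simple functions are bounded by twice
      \<open>\<bar>f x\<bar>\<close>, hence the factor 3.\<close>
    proof (rule integral_dominated_convergence[where w="\<lambda>x. 3 * \<bar>f x\<bar>"])
      show "AE x in lborel. (\<lambda>i. \<bar>f x - s i x\<bar>) \<longlonglongrightarrow> 0"
      proof (rule AE_I2)
        fix x :: 'a
        have "(\<lambda>i. \<bar>f x - s i x\<bar>) \<longlonglongrightarrow> \<bar>f x - f x\<bar>"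
          using lim(2) by (intro tendsto_intros) auto
        then show "(\<lambda>i. \<bar>f x - s i x\<bar>) \<longlonglongrightarrow> 0" by simp
      qed
      show "AE x in lborel. norm \<bar>f x - s i x\<bar> \<le> 3 * \<bar>f x\<bar>" for i
        using lim(3)[of _ i] by (intro AE_I2) (auto intro: order.trans[OF abs_triangle_ineq4])
    qed (use lim in auto)
    then have "(\<lambda>i. \<integral>x. \<bar>f x - s i x\<bar> \<partial>lborel) \<longlonglongrightarrow> 0" by simp
    then obtain i where "(\<integral>x. \<bar>f x - s i x\<bar> \<partial>lborel) < e"
      using order_tendstoD(2)[of _ 0 sequentially e] \<open>e > 0\<close> by (auto simp: eventually_sequentially)
    then show "\<exists>g. integrable lborel g \<and> (\<integral>x. \<bar>f x - g x\<bar> \<partial>lborel) < e \<and> (L1_shift g \<longlongrightarrow> 0) (at 0)"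
      using lim by blast
  qed
qed

lemma L1_shift_small:
  assumes "integrable lborel f" "e > 0"
  obtains d where "d > 0" "\<And>h. norm h < d \<Longrightarrow> L1_shift f h \<le> e"
proof -
  have "eventually (\<lambda>h. dist (L1_shift f h) 0 < e) (at 0)"
    using L1_shift_tendsto_0[OF assms(1)] assms(2) by (rule tendstoD)
  then obtain d where d: "d > 0" "\<And>h. h \<noteq> 0 \<Longrightarrow> norm h < d \<Longrightarrow> L1_shift f h < e"
    unfolding eventually_at by (auto simp: L1_shift_nonneg)
  show ?thesis
  proof (rule that[OF d(1)])
    fix h :: 'a assume "norm h < d"
    then show "L1_shift f h \<le> e"
      using d(2)[of h] assms(2) by (cases "h = 0") (auto simp: L1_shift_def)
  qed
qed

section \<open>Convolution and mollifiers\<close>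

lemma has_derivative_quadratic:
  fixes f :: "'a::real_normed_vector \<Rightarrow> 'b::real_normed_vector"
  assumes D: "bounded_linear D" and Q: "\<And>h. norm (f (x + h) - f x - D h) \<le> C * (norm h)\<^sup>2"
  shows "(f has_derivative D) (at x)"
  unfolding has_derivative_at
proof (intro conjI D)
  show "(\<lambda>h. norm (f (x + h) - f x - D h) / norm h) \<midarrow>0\<rightarrow> 0"
  proof (rule tendsto_sandwich[OF _ _ tendsto_const])
    have "((\<lambda>h::'a. C * norm h) \<longlongrightarrow> C * norm (0::'a)) (at 0)" by (intro tendsto_intros)
    then show "((\<lambda>h::'a. C * norm h) \<longlongrightarrow> 0) (at 0)" by simp
    show "eventually (\<lambda>h. norm (f (x + h) - f x - D h) / norm h \<le> C * norm h) (at 0)"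
    proof (rule eventually_at_filter[THEN iffD2], rule always_eventually, intro allI impI)
      fix h :: 'a assume "h \<noteq> 0"
      then show "norm (f (x + h) - f x - D h) / norm h \<le> C * norm h"
        using Q[of h] by (simp add: divide_le_eq power2_eq_square mult.assoc)
    qed
  qed auto
qed

lemma dd_expand:
  fixes f :: "'a::euclidean_space \<Rightarrow> real"
  assumes "smooth f" shows "dd f x v = (\<Sum>b\<in>Basis. (v \<bullet> b) * dd f x b)"
proof -
  have lin: "linear (dd f x)" using smooth_dd_linear[OF assms] by (rule bounded_linear.linear)
  have "dd f x v = dd f x (\<Sum>b\<in>Basis. (v \<bullet> b) *\<^sub>R b)" by (simp add: euclidean_representation)
  also have "\<dots> = (\<Sum>b\<in>Basis. (v \<bullet> b) * dd f x b)"
    by (simp add: linear_sum[OF lin] linear_cmul[OF lin])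
  finally show ?thesis .
qed

text \<open>One form that covers correlation (\<open>A\<close> is minus the identity), convolution
  (\<open>A\<close> is the identity) and averages along a linear flow, so that differentiation under
  the integral is carried out once.\<close>

definition par_int ::
  "'s measure \<Rightarrow> ('s \<Rightarrow> 'a \<Rightarrow> 'a) \<Rightarrow> ('s \<Rightarrow> 'a) \<Rightarrow> ('s \<Rightarrow> real) \<Rightarrow> ('a::euclidean_space \<Rightarrow> real) \<Rightarrow> 'a \<Rightarrow> real" where
  "par_int M A a c \<eta> w = (\<integral>\<omega>. c \<omega> * \<eta> (A \<omega> w + a \<omega>) \<partial>M)"

context
  fixes M :: "'s measure" and A :: "'s \<Rightarrow> 'a::euclidean_space \<Rightarrow> 'a" and a :: "'s \<Rightarrow> 'a" and B :: real
  assumes A_lin: "\<And>\<omega>. linear (A \<omega>)" and A_bd: "\<And>\<omega> v. \<omega> \<in> space M \<Longrightarrow> norm (A \<omega> v) \<le> B * norm v" and B0: "B \<ge> 0"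
    and A_meas: "\<And>v. (\<lambda>\<omega>. A \<omega> v) \<in> borel_measurable M" and a_meas: "a \<in> borel_measurable M"
begin

lemma par_int_integrable:
  fixes c :: "'s \<Rightarrow> real" and \<eta> :: "'a \<Rightarrow> real"
  assumes "integrable M c" "test_fn V \<eta>"
  shows "integrable M (\<lambda>\<omega>. c \<omega> * \<eta> (A \<omega> w + a \<omega>))"
proof -
  obtain C where C: "\<And>x. norm (\<eta> x) \<le> C" using test_fn_bounded[OF assms(2)] by blast
  note [measurable] = A_meas a_meas borel_measurable_integrable[OF assms(1)] test_fn_measurable[OF assms(2)]
  show ?thesis
  proof (rule Bochner_Integration.integrable_bound)
    show "integrable M (\<lambda>\<omega>. c \<omega> * C)" using assms by simp
    show "AE \<omega> in M. norm (c \<omega> * \<eta> (A \<omega> w + a \<omega>)) \<le> norm (c \<omega> * C)"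
      using C by (intro AE_I2) (auto simp: abs_mult intro!: mult_left_mono intro: order_trans[OF _ abs_ge_self])
  qed measurable
qed

lemma par_int_coeff:
  fixes c :: "'s \<Rightarrow> real"
  assumes "integrable M c" "norm b \<le> 1"
  shows "integrable M (\<lambda>\<omega>. c \<omega> * (A \<omega> v \<bullet> b))"
proof -
  note [measurable] = A_meas borel_measurable_integrable[OF assms(1)]
  show ?thesis
  proof (rule Bochner_Integration.integrable_bound)
    show "integrable M (\<lambda>\<omega>. c \<omega> * (B * norm v))" using assms by simp
    show "AE \<omega> in M. norm (c \<omega> * (A \<omega> v \<bullet> b)) \<le> norm (c \<omega> * (B * norm v))"
    proof (rule AE_I2)
      fix \<omega> assume "\<omega> \<in> space M"
      have "\<bar>A \<omega> v \<bullet> b\<bar> \<le> norm (A \<omega> v) * norm b" by (rule Cauchy_Schwarz_ineq2)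
      also have "\<dots> \<le> B * norm v * 1"
        using A_bd[OF \<open>\<omega> \<in> space M\<close>] assms(2) B0 by (intro mult_mono) auto
      finally show "norm (c \<omega> * (A \<omega> v \<bullet> b)) \<le> norm (c \<omega> * (B * norm v))"
        using B0 by (auto simp: abs_mult intro!: mult_left_mono)
    qed
  qed measurable
qed

lemma par_int_dd_expand:
  assumes "integrable M c" "test_fn V \<eta>"
  shows "integrable M (\<lambda>\<omega>. c \<omega> * dd \<eta> (A \<omega> w + a \<omega>) (A \<omega> v))"
    and "(\<integral>\<omega>. c \<omega> * dd \<eta> (A \<omega> w + a \<omega>) (A \<omega> v) \<partial>M) =
      (\<Sum>b\<in>Basis. par_int M A a (\<lambda>\<omega>. c \<omega> * (A \<omega> v \<bullet> b)) (\<lambda>x. dd \<eta> x b) w)"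
proof -
  have eq: "c \<omega> * dd \<eta> (A \<omega> w + a \<omega>) (A \<omega> v) =
    (\<Sum>b\<in>Basis. (c \<omega> * (A \<omega> v \<bullet> b)) * dd \<eta> (A \<omega> w + a \<omega>) b)" for \<omega>
    by (subst dd_expand[OF test_fn_smooth[OF assms(2)]]) (simp add: sum_distrib_left mult.assoc)
  have i: "integrable M (\<lambda>\<omega>. (c \<omega> * (A \<omega> v \<bullet> b)) * dd \<eta> (A \<omega> w + a \<omega>) b)" if "b \<in> Basis" for b
    by (rule par_int_integrable[OF par_int_coeff test_fn_dd[OF assms(2)]]) (use assms that in auto)
  show "integrable M (\<lambda>\<omega>. c \<omega> * dd \<eta> (A \<omega> w + a \<omega>) (A \<omega> v))"
    unfolding eq by (intro Bochner_Integration.integrable_sum i)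
  show "(\<integral>\<omega>. c \<omega> * dd \<eta> (A \<omega> w + a \<omega>) (A \<omega> v) \<partial>M) =
      (\<Sum>b\<in>Basis. par_int M A a (\<lambda>\<omega>. c \<omega> * (A \<omega> v \<bullet> b)) (\<lambda>x. dd \<eta> x b) w)"
    unfolding eq par_int_def by (intro Bochner_Integration.integral_sum i)
qed

text \<open>The quadratic remainder of \<open>\<eta>\<close> at
  \<open>A \<omega> w + a \<omega>\<close> is at most Q B^2 |h|^2 uniformly in the parameter;
  integrating against \<open>c\<close> gives a quadratic remainder for the integral itself.\<close>

lemma par_int_has_derivative:
  assumes c: "integrable M c" and \<eta>: "test_fn V \<eta>"
  shows "(par_int M A a c \<eta> has_derivative (\<lambda>v. \<integral>\<omega>. c \<omega> * dd \<eta> (A \<omega> w + a \<omega>) (A \<omega> v) \<partial>M)) (at w)"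
proof -
  obtain Q where Q: "Q \<ge> 0" "\<And>x h. norm (\<eta> (x + h) - \<eta> x - dd \<eta> x h) \<le> Q * (norm h)\<^sup>2"
    using test_fn_quadratic[OF \<eta>] by blast
  let ?D = "\<lambda>v. \<integral>\<omega>. c \<omega> * dd \<eta> (A \<omega> w + a \<omega>) (A \<omega> v) \<partial>M"
  have sm: "smooth \<eta>" using \<eta> by (rule test_fn_smooth)
  have lin: "linear (dd \<eta> x)" for x using smooth_dd_linear[OF sm] by (rule bounded_linear.linear)
  note i = par_int_dd_expand(1)[OF c \<eta>]
  have "linear ?D"
  proof
    show "?D (v + v') = ?D v + ?D v'" for v v'
      by (subst Bochner_Integration.integral_add[symmetric, OF i i])
         (simp add: linear_add[OF lin] linear_add[OF A_lin] distrib_left)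
    show "?D (r *\<^sub>R v) = r *\<^sub>R ?D v" for r v
    proof -
      have "?D (r *\<^sub>R v) = (\<integral>\<omega>. r * (c \<omega> * dd \<eta> (A \<omega> w + a \<omega>) (A \<omega> v)) \<partial>M)"
        by (simp add: linear_cmul[OF lin] linear_cmul[OF A_lin] mult_ac)
      then show ?thesis by simp
    qed
  qed
  then have bl: "bounded_linear ?D" by (rule linear_conv_bounded_linear[THEN iffD1])
  show ?thesis
  proof (rule has_derivative_quadratic[OF bl, where C="(\<integral>\<omega>. \<bar>c \<omega>\<bar> \<partial>M) * Q * B\<^sup>2"])
    fix h
    have "par_int M A a c \<eta> (w + h) - par_int M A a c \<eta> w - ?D h =
      (\<integral>\<omega>. c \<omega> * (\<eta> (A \<omega> w + a \<omega> + A \<omega> h) - \<eta> (A \<omega> w + a \<omega>) - dd \<eta> (A \<omega> w + a \<omega>) (A \<omega> h)) \<partial>M)"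
      unfolding par_int_def
      using par_int_integrable[OF c \<eta>, of "w + h"] par_int_integrable[OF c \<eta>, of w] i[of w h]
      by (simp add: right_diff_distrib linear_add[OF A_lin] add_ac)
    also have "\<bar>\<dots>\<bar> \<le> (\<integral>\<omega>. \<bar>c \<omega>\<bar> * (Q * B\<^sup>2 * (norm h)\<^sup>2) \<partial>M)"
    proof (rule order.trans[OF integral_abs_bound integral_mono])
      have "integrable M (\<lambda>\<omega>. c \<omega> * \<eta> (A \<omega> (w + h) + a \<omega>) - c \<omega> * \<eta> (A \<omega> w + a \<omega>) - c \<omega> * dd \<eta> (A \<omega> w + a \<omega>) (A \<omega> h))"
        using par_int_integrable[OF c \<eta>, of "w + h"] par_int_integrable[OF c \<eta>, of w] i[of w h] by simp
      then show "integrable M (\<lambda>\<omega>. \<bar>c \<omega> * (\<eta> (A \<omega> w + a \<omega> + A \<omega> h) - \<eta> (A \<omega> w + a \<omega>) - dd \<eta> (A \<omega> w + a \<omega>) (A \<omega> h))\<bar>)"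
        by (intro integrable_abs) (simp add: right_diff_distrib linear_add[OF A_lin] add_ac)
      show "integrable M (\<lambda>\<omega>. \<bar>c \<omega>\<bar> * (Q * B\<^sup>2 * (norm h)\<^sup>2))" using c by simp
      fix \<omega> assume "\<omega> \<in> space M"
      have "\<bar>\<eta> (A \<omega> w + a \<omega> + A \<omega> h) - \<eta> (A \<omega> w + a \<omega>) - dd \<eta> (A \<omega> w + a \<omega>) (A \<omega> h)\<bar> \<le> Q * (norm (A \<omega> h))\<^sup>2"
        using Q(2)[of "A \<omega> w + a \<omega>" "A \<omega> h"] by simp
      also have "\<dots> \<le> Q * (B * norm h)\<^sup>2"
        using A_bd[OF \<open>\<omega> \<in> space M\<close>] Q(1) by (intro mult_left_mono power_mono) auto
      finally show "\<bar>c \<omega> * (\<eta> (A \<omega> w + a \<omega> + A \<omega> h) - \<eta> (A \<omega> w + a \<omega>) - dd \<eta> (A \<omega> w + a \<omega>) (A \<omega> h))\<bar>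
          \<le> \<bar>c \<omega>\<bar> * (Q * B\<^sup>2 * (norm h)\<^sup>2)"
        unfolding abs_mult by (intro mult_left_mono) (auto simp: power_mult_distrib mult_ac)
    qed
    also have "\<dots> = (\<integral>\<omega>. \<bar>c \<omega>\<bar> \<partial>M) * Q * B\<^sup>2 * (norm h)\<^sup>2" by simp
    finally show "norm (par_int M A a c \<eta> (w + h) - par_int M A a c \<eta> w - ?D h) \<le> (\<integral>\<omega>. \<bar>c \<omega>\<bar> \<partial>M) * Q * B\<^sup>2 * (norm h)\<^sup>2"
      by simp
  qed
qed

lemma par_int_dd:
  assumes "integrable M c" "test_fn V \<eta>"
  shows "dd (par_int M A a c \<eta>) w v = (\<integral>\<omega>. c \<omega> * dd \<eta> (A \<omega> w + a \<omega>) (A \<omega> v) \<partial>M)"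
  by (rule dd_eq[OF par_int_has_derivative[OF assms]])

lemma par_int_smooth:
  assumes "integrable M c" "test_fn V \<eta>"
  shows "smooth (par_int M A a c \<eta>)"
proof -
  \<comment> \<open>A directional derivative is a sum over basis vectors b with new weights
    \<open>c \<omega> * (A \<omega> v \<bullet> b)\<close> and new kernels
    \<open>dd \<eta> x b\<close>, so the invariant consists of finite sums. Lists serve as an index
    type in which prefixing b yields the indices of the next sum.\<close>
  define X where "X f \<longleftrightarrow> (\<exists>I c \<eta>. finite (I::'a list set) \<and> (\<forall>i\<in>I. integrable M (c i) \<and> test_fn V (\<eta> i)) \<and>
    f = (\<lambda>w. \<Sum>i\<in>I. par_int M A a (c i) (\<eta> i) w))" for f
  show ?thesis
  proof (rule smooth_coinduct[of X])
    show "X (par_int M A a c \<eta>)"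
      unfolding X_def using assms
      by (intro exI[of _ "{[]}"] exI[of _ "\<lambda>_. c"] exI[of _ "\<lambda>_. \<eta>"]) auto
    fix f assume "X f"
    then obtain I and c :: "'a list \<Rightarrow> 's \<Rightarrow> real" and \<eta> where I: "finite I" "\<And>i. i \<in> I \<Longrightarrow> integrable M (c i)" "\<And>i. i \<in> I \<Longrightarrow> test_fn V (\<eta> i)"
      and f: "f = (\<lambda>w. \<Sum>i\<in>I. par_int M A a (c i) (\<eta> i) w)" unfolding X_def by blast
    define D where "D w v = (\<Sum>i\<in>I. \<integral>\<omega>. c i \<omega> * dd (\<eta> i) (A \<omega> w + a \<omega>) (A \<omega> v) \<partial>M)" for w v
    have D: "(f has_derivative D w) (at w)" for w
      unfolding f D_def by (rule has_derivative_sum) (rule par_int_has_derivative[OF I(2,3)])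
    have "X (\<lambda>w. D w v)" for v
    proof -
      let ?J = "(\<lambda>(b, i). b # i) ` (Basis \<times> I)"
      have inj: "inj_on (\<lambda>(b, i). b # i) (Basis \<times> I)" by (auto simp: inj_on_def)
      have "(\<lambda>w. D w v) = (\<lambda>w. \<Sum>j\<in>?J. par_int M A a (\<lambda>\<omega>. c (tl j) \<omega> * (A \<omega> v \<bullet> hd j)) (\<lambda>x. dd (\<eta> (tl j)) x (hd j)) w)"
      proof
        fix w
        have "D w v = (\<Sum>i\<in>I. \<Sum>b\<in>Basis. par_int M A a (\<lambda>\<omega>. c i \<omega> * (A \<omega> v \<bullet> b)) (\<lambda>x. dd (\<eta> i) x b) w)"
          unfolding D_def by (rule sum.cong[OF refl]) (rule par_int_dd_expand(2)[OF I(2,3)])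
        also have "\<dots> = (\<Sum>b\<in>Basis. \<Sum>i\<in>I. par_int M A a (\<lambda>\<omega>. c i \<omega> * (A \<omega> v \<bullet> b)) (\<lambda>x. dd (\<eta> i) x b) w)"
          by (rule sum.swap)
        also have "\<dots> = (\<Sum>(b, i)\<in>Basis \<times> I. par_int M A a (\<lambda>\<omega>. c i \<omega> * (A \<omega> v \<bullet> b)) (\<lambda>x. dd (\<eta> i) x b) w)"
          by (rule sum.cartesian_product)
        also have "\<dots> = (\<Sum>j\<in>?J. par_int M A a (\<lambda>\<omega>. c (tl j) \<omega> * (A \<omega> v \<bullet> hd j)) (\<lambda>x. dd (\<eta> (tl j)) x (hd j)) w)"
          by (subst sum.reindex[OF inj]) (auto intro!: sum.cong)
        finally show "D w v = \<dots>" .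
      qed
      then show ?thesis
        unfolding X_def using I
        by (intro exI[of _ ?J] exI[of _ "\<lambda>j \<omega>. c (tl j) \<omega> * (A \<omega> v \<bullet> hd j)"] exI[of _ "\<lambda>j x. dd (\<eta> (tl j)) x (hd j)"])
           (auto intro!: par_int_coeff test_fn_dd)
    qed
    with D show "\<exists>D. (\<forall>x. (f has_derivative D x) (at x)) \<and> (\<forall>v. X (\<lambda>x. D x v) \<or> smooth (\<lambda>x. D x v))"
      by (intro exI[of _ D]) simp
  qed
qed

end

lemma correlation_smooth:
  fixes c :: "'a::euclidean_space \<Rightarrow> real"
  assumes "integrable lborel c" "test_fn V \<eta>"
  shows "smooth (\<lambda>w. \<integral>z. c z * \<eta> (z - w) \<partial>lborel)"
    and "dd (\<lambda>w. \<integral>z. c z * \<eta> (z - w) \<partial>lborel) w v = - (\<integral>z. c z * dd \<eta> (z - w) v \<partial>lborel)"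
proof -
  have l: "linear (\<lambda>v::'a. - v)" by (simp add: linear_iff)
  have neg: "dd \<eta> x (- v) = - dd \<eta> x v" for x
    using linear_neg[OF bounded_linear.linear[OF smooth_dd_linear[OF test_fn_smooth[OF assms(2)]]]] .
  show "smooth (\<lambda>w. \<integral>z. c z * \<eta> (z - w) \<partial>lborel)"
    using par_int_smooth[of "\<lambda>_ v. - v" lborel 1 "\<lambda>z. z", OF l _ _ _ _ assms]
    by (simp add: par_int_def[abs_def] add.commute[of "- _"])
  show "dd (\<lambda>w. \<integral>z. c z * \<eta> (z - w) \<partial>lborel) w v = - (\<integral>z. c z * dd \<eta> (z - w) v \<partial>lborel)"
    using par_int_dd[of "\<lambda>_ v. - v" lborel 1 "\<lambda>z. z", OF l _ _ _ _ assms, of w v]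
    by (simp add: par_int_def[abs_def] neg add.commute[of "- _"])
qed

lemma convolution_smooth:
  fixes c :: "'a::euclidean_space \<Rightarrow> real"
  assumes "integrable lborel c" "test_fn V \<eta>"
  shows "smooth (\<lambda>w. \<integral>z. c z * \<eta> (w - z) \<partial>lborel)"
    and "dd (\<lambda>w. \<integral>z. c z * \<eta> (w - z) \<partial>lborel) w v = (\<integral>z. c z * dd \<eta> (w - z) v \<partial>lborel)"
proof -
  have l: "linear (\<lambda>v::'a. v)" by (simp add: linear_iff)
  show "smooth (\<lambda>w. \<integral>z. c z * \<eta> (w - z) \<partial>lborel)"
    using par_int_smooth[of "\<lambda>_ v. v" lborel 1 "\<lambda>z. - z", OF l _ _ _ _ assms]
    by (simp add: par_int_def[abs_def])
  show "dd (\<lambda>w. \<integral>z. c z * \<eta> (w - z) \<partial>lborel) w v = (\<integral>z. c z * dd \<eta> (w - z) v \<partial>lborel)"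
    using par_int_dd[of "\<lambda>_ v. v" lborel 1 "\<lambda>z. - z", OF l _ _ _ _ assms, of w v]
    by (simp add: par_int_def[abs_def])
qed

text \<open>No profile is fixed and no scaling is imposed: the kernels used later change their shape
  from matrix to matrix and depend on the scale.\<close>

definition mollifier :: "real \<Rightarrow> ('a::euclidean_space \<Rightarrow> real) \<Rightarrow> bool" where
  "mollifier r \<eta> \<longleftrightarrow> test_fn (ball 0 r) \<eta> \<and> (\<forall>x. 0 \<le> \<eta> x) \<and> (\<integral>x. \<eta> x \<partial>lborel) = 1"

lemma mollifier_exists:
  assumes "r > 0" shows "\<exists>\<eta>::'a::euclidean_space \<Rightarrow> real. mollifier r \<eta>"
proof -
  define g :: "'a \<Rightarrow> real" where "g x = bump1 (r\<^sup>2 / 4 - (norm x)\<^sup>2)" for x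
  have sg: "smooth g"
    unfolding g_def by (rule smooth_comp[OF smooth_diff[OF smooth_const smooth_norm_sq] bump1(1)])
  have z: "g x = 0" if "x \<notin> cball 0 (r/2)" for x
  proof -
    have "r / 2 < norm x" using that by simp
    then have "(r/2)\<^sup>2 < (norm x)\<^sup>2" using assms by (intro power_strict_mono) auto
    then show ?thesis unfolding g_def by (intro bump1) (simp add: power_divide)
  qed
  have p: "g x > 0" if "x \<in> ball 0 (r/2)" for x
  proof -
    have "norm x < r / 2" using that by simp
    then have "(norm x)\<^sup>2 < (r/2)\<^sup>2" by (intro power_strict_mono) auto
    then show ?thesis unfolding g_def by (intro bump1) (simp add: power_divide)
  qed
  have tg: "test_fn (ball 0 r) g"
    using assms z by (intro test_fnI[of _ "cball 0 (r/2)"] sg) (auto simp: subset_iff)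
  have g0: "g x \<ge> 0" for x unfolding g_def by (rule bump1)
  have ig: "integrable lborel g" using tg by (rule test_fn_integrable)
  \<comment> \<open>Normalisation needs positive mass: \<open>g\<close> is positive on a ball of
    positive measure.\<close>
  have "(\<integral>x. g x \<partial>lborel) \<noteq> 0"
  proof
    assume "(\<integral>x. g x \<partial>lborel) = 0"
    then have "AE x in lborel. g x = 0"
      using integral_nonneg_eq_0_iff_AE[OF ig] g0 by simp
    then have "AE x in lborel. x \<notin> ball (0::'a) (r/2)"
    proof eventually_elim
      case (elim x) then show ?case using p[of x] by auto
    qed
    then have "emeasure lborel (ball (0::'a) (r/2)) = 0"
      using AE_iff_null_sets[of "ball (0::'a) (r/2)" lborel] by auto
    moreover have "open (ball (0::'a) (r/2))" "ball (0::'a) (r/2) \<noteq> {}" using assms by auto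
    ultimately show False
      by (metis open_ball content_ball_pos assms half_gt_zero measure_eq_emeasure_eq_ennreal measure_def enn2real_0 less_irrefl)
  qed
  moreover have "(\<integral>x. g x \<partial>lborel) \<ge> 0" using g0 by (intro integral_nonneg_AE) auto
  ultimately have I: "(\<integral>x. g x \<partial>lborel) > 0" by simp
  show ?thesis
    using I g0 ig
    by (intro exI[of _ "\<lambda>x. g x * inverse (\<integral>x. g x \<partial>lborel)"]) (auto simp: mollifier_def intro!: test_fn_mult tg)
qed

lemma mollifier_mono: "mollifier r \<eta> \<Longrightarrow> r \<le> s \<Longrightarrow> mollifier s \<eta>"
  unfolding mollifier_def by (auto intro: test_fn_mono)

lemma test_fn_outside: "test_fn U \<phi> \<Longrightarrow> x \<notin> U \<Longrightarrow> \<phi> x = 0"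
  using test_fnD by blast

section \<open>Double integrals against a kernel of the difference\<close>

lemma integrable_pair_conv:
  fixes f g :: "'a::euclidean_space \<Rightarrow> real"
  assumes f: "integrable lborel f" and g: "integrable lborel g"
  shows "integrable (lborel \<Otimes>\<^sub>M lborel) (\<lambda>(y, w). g y * f (w + y))"
proof (rule lborel_pair.Fubini_integrable)
  have [measurable]: "f \<in> borel_measurable borel" "g \<in> borel_measurable borel" using f g by auto
  show "(\<lambda>(y, w). g y * f (w + y)) \<in> borel_measurable (lborel \<Otimes>\<^sub>M lborel)" by measurable
  have "(\<integral>w. norm (case (y, w) of (y, w) \<Rightarrow> g y * f (w + y)) \<partial>lborel) = \<bar>g y\<bar> * (\<integral>w. \<bar>f w\<bar> \<partial>lborel)" for y
    using integral_shift(1)[of "\<lambda>x. \<bar>f x\<bar>" y] by (simp add: abs_mult)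
  then show "integrable lborel (\<lambda>y. \<integral>w. norm (case (y, w) of (y, w) \<Rightarrow> g y * f (w + y)) \<partial>lborel)"
    using g by simp
  show "AE y in lborel. integrable lborel (\<lambda>w. case (y, w) of (y, w) \<Rightarrow> g y * f (w + y))"
    using integrable_shift(1)[OF f] by (intro AE_I2) simp
qed

lemma integrable_pair_mult:
  fixes f :: "'a::euclidean_space \<Rightarrow> real" and g :: "'b::euclidean_space \<Rightarrow> real"
  assumes f: "integrable lborel f" and g: "integrable lborel g"
  shows "integrable (lborel \<Otimes>\<^sub>M lborel) (\<lambda>(y, w). g y * f w)"
proof (rule lborel_pair.Fubini_integrable)
  have [measurable]: "f \<in> borel_measurable borel" "g \<in> borel_measurable borel" using f g by auto
  show "(\<lambda>(y, w). g y * f w) \<in> borel_measurable (lborel \<Otimes>\<^sub>M lborel)" by measurable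
qed (use f g in \<open>auto simp: abs_mult\<close>)

text \<open>The double integral of b(w) a(z) k(z - w). Every term produced by doubling the variables
  has this shape, with the test function carried by the second argument.\<close>

definition br :: "('a::euclidean_space \<Rightarrow> real) \<Rightarrow> ('a \<Rightarrow> real) \<Rightarrow> ('a \<Rightarrow> real) \<Rightarrow> real" where
  "br a b k = (\<integral>w. b w * (\<integral>z. a z * k (z - w) \<partial>lborel) \<partial>lborel)"

lemma br_integrable_pair:
  fixes a b k :: "'a::euclidean_space \<Rightarrow> real"
  assumes a: "integrable lborel a" and b: "integrable lborel b" and k: "test_fn V k"
  shows "integrable (lborel \<Otimes>\<^sub>M lborel) (\<lambda>(w, z). b w * (a z * k (z - w)))"
proof -
  obtain C where C: "\<And>x. norm (k x) \<le> C" using test_fn_bounded[OF k] by blast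
  note [measurable] = borel_measurable_integrable[OF a] borel_measurable_integrable[OF b] test_fn_measurable[OF k]
  have i: "integrable (lborel \<Otimes>\<^sub>M lborel) (\<lambda>z. (\<lambda>(w, z). b w * a z) z * C)"
    by (intro integrable_mult_left integrable_pair_mult a b)
  show ?thesis
  proof (rule Bochner_Integration.integrable_bound[OF i])
    show "AE x in lborel \<Otimes>\<^sub>M lborel. norm (case x of (w, z) \<Rightarrow> b w * (a z * k (z - w))) \<le> norm ((case x of (w, z) \<Rightarrow> b w * a z) * C)"
    proof (rule AE_I2, clarify)
      fix w z
      show "norm (b w * (a z * k (z - w))) \<le> norm (b w * a z * C)"
        using C[of "z - w"] by (auto simp: abs_mult mult.assoc intro!: mult_left_mono)
    qed
  qed measurable
qed

lemma br_integrable: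
  fixes a b k :: "'a::euclidean_space \<Rightarrow> real"
  assumes a: "integrable lborel a" and b: "integrable lborel b" and k: "test_fn V k"
  shows "integrable lborel (\<lambda>z. a z * k (z - w))"
    and "integrable lborel (\<lambda>w. b w * (\<integral>z. a z * k (z - w) \<partial>lborel))"
    and "integrable lborel (\<lambda>w. b w * k (z - w))"
    and "integrable lborel (\<lambda>z. a z * (\<integral>w. b w * k (z - w) \<partial>lborel))"
proof -
  obtain C where "\<And>x. norm (k x) \<le> C" using test_fn_bounded[OF k] by blast
  then have C: "\<bar>k x\<bar> \<le> \<bar>C\<bar>" for x by (metis abs_ge_self order_trans real_norm_def)
  note [measurable] = borel_measurable_integrable[OF a] borel_measurable_integrable[OF b] test_fn_measurable[OF k]
  show "integrable lborel (\<lambda>z. a z * k (z - w))" for w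
    by (rule Bochner_Integration.integrable_bound[of _ "\<lambda>z. a z * C"])
       (use a C in \<open>auto simp: abs_mult intro!: AE_I2 mult_left_mono intro: order_trans\<close>)
  show "integrable lborel (\<lambda>w. b w * k (z - w))" for z
    by (rule Bochner_Integration.integrable_bound[of _ "\<lambda>z. b z * C"])
       (use b C in \<open>auto simp: abs_mult intro!: AE_I2 mult_left_mono intro: order_trans\<close>)
  show "integrable lborel (\<lambda>w. b w * (\<integral>z. a z * k (z - w) \<partial>lborel))"
    using lborel_pair.integrable_fst[OF br_integrable_pair[OF a b k]] by simp
  have "integrable lborel (\<lambda>z. \<integral>w. b w * (a z * k (z - w)) \<partial>lborel)"
    using lborel_pair.integrable_snd[OF br_integrable_pair[OF a b k]] by simp
  then show "integrable lborel (\<lambda>z. a z * (\<integral>w. b w * k (z - w) \<partial>lborel))"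
    by (simp add: mult.left_commute[of "b _"])
qed

lemma br_swap:
  fixes a b k :: "'a::euclidean_space \<Rightarrow> real"
  assumes a: "integrable lborel a" and b: "integrable lborel b" and k: "test_fn V k"
  shows "br a b k = (\<integral>z. a z * (\<integral>w. b w * k (z - w) \<partial>lborel) \<partial>lborel)"
proof -
  have "br a b k = (\<integral>w. (\<integral>z. b w * (a z * k (z - w)) \<partial>lborel) \<partial>lborel)" by (simp add: br_def)
  also have "\<dots> = (\<integral>z. (\<integral>w. b w * (a z * k (z - w)) \<partial>lborel) \<partial>lborel)"
    by (rule lborel_pair.Fubini_integral[OF br_integrable_pair[OF a b k], symmetric])
  finally show ?thesis by (simp add: mult.left_commute[of "b _"])
qed

text \<open>After z = w + y the error is an average over |y| < r of integrals of b(w) (a(w + y) -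
  a(w)), each at most B times the L1 modulus of \<open>a\<close>. The radius depends on
  \<open>b\<close> only through its bound, which the duality argument of
  \<open>mollification_tendsto_L1\<close> exploits.\<close>

lemma br_approx_uniform:
  fixes a :: "'a::euclidean_space \<Rightarrow> real"
  assumes a: "integrable lborel a" and B0: "B \<ge> 0" and "e > 0"
  shows "\<exists>r>0. \<forall>b \<eta>. b \<in> borel_measurable borel \<longrightarrow> (\<forall>x. \<bar>b x\<bar> \<le> B) \<longrightarrow> mollifier r \<eta> \<longrightarrow>
    \<bar>br a b \<eta> - (\<integral>x. a x * b x \<partial>lborel)\<bar> \<le> e"
proof -
  obtain d where d: "d > 0" "\<And>h. norm h < d \<Longrightarrow> L1_shift a h \<le> e / (B + 1)"
    using L1_shift_small[OF a, of "e / (B + 1)"] \<open>e > 0\<close> B0 by auto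
  show ?thesis
  proof (intro exI[of _ d] conjI d(1) allI impI)
    fix b \<eta> :: "'a \<Rightarrow> real" assume "mollifier d \<eta>" and b: "b \<in> borel_measurable borel" and "\<forall>x. \<bar>b x\<bar> \<le> B"
    then have \<eta>: "test_fn (ball 0 d) \<eta>" "\<And>x. \<eta> x \<ge> 0" "(\<integral>x. \<eta> x \<partial>lborel) = 1" and B: "\<And>x. \<bar>b x\<bar> \<le> B"
      by (auto simp: mollifier_def)
    have i\<eta>: "integrable lborel \<eta>" using \<eta>(1) by (rule test_fn_integrable)
    note [measurable] = b borel_measurable_integrable[OF a] test_fn_measurable[OF \<eta>(1)]
    have bd: "norm (b w * x) \<le> norm (B * x)" for w x using B[of w] B0 by (auto simp: abs_mult intro!: mult_right_mono)
    have i1: "integrable (lborel \<Otimes>\<^sub>M lborel) (\<lambda>(y, w). b w * (\<eta> y * a (w + y)))"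
      by (rule Bochner_Integration.integrable_bound[of _ "\<lambda>x. B * (\<lambda>(y, w). \<eta> y * a (w + y)) x"])
         (use bd in \<open>auto intro!: integrable_pair_conv a i\<eta>\<close>)
    have i2: "integrable (lborel \<Otimes>\<^sub>M lborel) (\<lambda>(y, w). b w * (\<eta> y * a w))"
      by (rule Bochner_Integration.integrable_bound[of _ "\<lambda>x. B * (\<lambda>(y, w). \<eta> y * a w) x"])
         (use bd in \<open>auto intro!: integrable_pair_mult a i\<eta>\<close>)
    have iab: "integrable lborel (\<lambda>w. b w * a w)"
      by (rule Bochner_Integration.integrable_bound[of _ "\<lambda>x. B * a x"]) (use bd a in auto)
    have iab': "integrable lborel (\<lambda>w. b w * a (w + y))" for y
      by (rule Bochner_Integration.integrable_bound[of _ "\<lambda>x. B * a (x + y)"]) (use bd integrable_shift(1)[OF a] in auto)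
    have in1: "(\<integral>z. a z * \<eta> (z - w) \<partial>lborel) = (\<integral>y. \<eta> y * a (w + y) \<partial>lborel)" for w
      using lborel_translate(1)[of "\<lambda>z. a z * \<eta> (z - w)" w] by (simp add: mult.commute)
    have e1: "br a b \<eta> = (\<integral>y. (\<integral>w. b w * (\<eta> y * a (w + y)) \<partial>lborel) \<partial>lborel)"
      unfolding br_def in1 using lborel_pair.Fubini_integral[OF i1] by simp
    have e2: "(\<integral>x. a x * b x \<partial>lborel) = (\<integral>y. (\<integral>w. b w * (\<eta> y * a w) \<partial>lborel) \<partial>lborel)"
      using \<eta>(3) by (simp add: mult_ac)
    have "br a b \<eta> - (\<integral>x. a x * b x \<partial>lborel) =
       (\<integral>y. (\<integral>w. b w * (\<eta> y * a (w + y)) \<partial>lborel) - (\<integral>w. b w * (\<eta> y * a w) \<partial>lborel) \<partial>lborel)"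
      unfolding e1 e2
      using lborel_pair.integrable_fst[OF i1] lborel_pair.integrable_fst[OF i2] by simp
    also have "\<bar>\<dots>\<bar> \<le> (\<integral>y. \<eta> y * e \<partial>lborel)"
    proof (rule order.trans[OF integral_abs_bound integral_mono])
      show "integrable lborel (\<lambda>y. \<bar>(\<integral>w. b w * (\<eta> y * a (w + y)) \<partial>lborel) - (\<integral>w. b w * (\<eta> y * a w) \<partial>lborel)\<bar>)"
        using lborel_pair.integrable_fst[OF i1] lborel_pair.integrable_fst[OF i2]
        by (intro integrable_abs Bochner_Integration.integrable_diff) auto
      show "integrable lborel (\<lambda>y. \<eta> y * e)" using i\<eta> by simp
      fix y
      have "(\<integral>w. b w * (\<eta> y * a (w + y)) \<partial>lborel) - (\<integral>w. b w * (\<eta> y * a w) \<partial>lborel)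
          = \<eta> y * (\<integral>w. b w * (a (w + y) - a w) \<partial>lborel)"
        using iab iab'[of y] by (simp add: right_diff_distrib mult.left_commute[of "b _"])
      also have "\<bar>\<dots>\<bar> = \<eta> y * \<bar>\<integral>w. b w * (a (w + y) - a w) \<partial>lborel\<bar>" using \<eta>(2)[of y] by (simp add: abs_mult)
      also have "\<dots> \<le> \<eta> y * e"
      proof (cases "y \<in> ball 0 d")
        case True
        have "\<bar>\<integral>w. b w * (a (w + y) - a w) \<partial>lborel\<bar> \<le> (\<integral>w. B * \<bar>a (w + y) - a w\<bar> \<partial>lborel)"
        proof (rule order.trans[OF integral_abs_bound integral_mono])
          show "integrable lborel (\<lambda>w. \<bar>b w * (a (w + y) - a w)\<bar>)"
            using iab iab'[of y] by (simp add: right_diff_distrib)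
          show "integrable lborel (\<lambda>w. B * \<bar>a (w + y) - a w\<bar>)"
            using a integrable_shift(1)[OF a, of y] by simp
          show "\<bar>b w * (a (w + y) - a w)\<bar> \<le> B * \<bar>a (w + y) - a w\<bar>" for w
            using B[of w] by (auto simp: abs_mult intro!: mult_right_mono)
        qed
        also have "\<dots> = B * L1_shift a y" by (simp add: L1_shift_def)
        also have "\<dots> \<le> B * (e / (B + 1))" using d(2)[of y] True B0 by (intro mult_left_mono) auto
        also have "\<dots> \<le> e" using B0 \<open>e > 0\<close> by (simp add: field_simps)
        finally show ?thesis using \<eta>(2) by (intro mult_left_mono) auto
      next
        case False
        then show ?thesis using test_fn_outside[OF \<eta>(1)] by simp
      qed
      finally show "\<bar>(\<integral>w. b w * (\<eta> y * a (w + y)) \<partial>lborel) - (\<integral>w. b w * (\<eta> y * a w) \<partial>lborel)\<bar> \<le> \<eta> y * e" .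
    qed
    also have "\<dots> = e" using \<eta>(3) by simp
    finally show "\<bar>br a b \<eta> - (\<integral>x. a x * b x \<partial>lborel)\<bar> \<le> e" .
  qed
qed

lemma br_approx:
  fixes a b :: "'a::euclidean_space \<Rightarrow> real"
  assumes a: "integrable lborel a" and b: "b \<in> borel_measurable borel" and B: "\<And>x. \<bar>b x\<bar> \<le> B" and "e > 0"
  shows "\<exists>r>0. \<forall>\<eta>. mollifier r \<eta> \<longrightarrow> \<bar>br a b \<eta> - (\<integral>x. a x * b x \<partial>lborel)\<bar> \<le> e"
proof -
  have "B \<ge> 0" using B[of 0] by simp
  from br_approx_uniform[OF a this \<open>e > 0\<close>] b B show ?thesis by blast
qed

lemma mollifier_reflect:
  assumes "mollifier r \<eta>" shows "mollifier r (\<lambda>x. \<eta> (- x))"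
proof -
  from assms have \<eta>: "test_fn (ball 0 r) \<eta>" "\<And>x. \<eta> x \<ge> 0" "(\<integral>x. \<eta> x \<partial>lborel) = 1"
    by (auto simp: mollifier_def)
  from test_fnD[OF \<eta>(1)] obtain K where K: "smooth \<eta>" "compact K" "K \<subseteq> ball 0 r" "\<And>x. x \<notin> K \<Longrightarrow> \<eta> x = 0"
    by blast
  have "test_fn (ball 0 r) (\<lambda>x. \<eta> (- x))"
  proof (rule test_fnI[of _ "uminus ` K"])
    show "smooth (\<lambda>x. \<eta> (- x))"
      using smooth_affine[OF bounded_linear_minus[OF bounded_linear_ident] K(1), of 0] by simp
    show "compact (uminus ` K)" using K(2) by (rule compact_negations)
  qed (use K in \<open>force+\<close>)
  moreover have "(\<integral>x. \<eta> (- x) \<partial>lborel) = 1"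
    using lborel_reflect(1)[OF test_fn_measurable[OF \<eta>(1)], of 0] \<eta>(3) by simp
  ultimately show ?thesis using \<eta>(2) by (auto simp: mollifier_def)
qed

text \<open>Exchanging the two factors reflects the kernel, so it is enough that \<open>a\<close> is
  bounded. This covers the terms in which the merely integrable pressure or force sits at w together
  with the test function.\<close>

lemma br_approx':
  fixes a b :: "'a::euclidean_space \<Rightarrow> real"
  assumes a: "integrable lborel a" "integrable lborel b" and B: "\<And>x. \<bar>a x\<bar> \<le> B" and "e > 0"
  shows "\<exists>r>0. \<forall>\<eta>. mollifier r \<eta> \<longrightarrow> \<bar>br a b \<eta> - (\<integral>x. a x * b x \<partial>lborel)\<bar> \<le> e"
proof -
  obtain r where r: "r > 0" "\<And>\<eta>. mollifier r \<eta> \<Longrightarrow> \<bar>br b a \<eta> - (\<integral>x. b x * a x \<partial>lborel)\<bar> \<le> e"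
    using br_approx[of b a B e, OF a(2) _ B \<open>e > 0\<close>] borel_measurable_integrable[OF a(1)] by auto
  have "br a b \<eta> = br b a (\<lambda>x. \<eta> (- x))" if "mollifier r \<eta>" for \<eta>
    using that unfolding mollifier_def by (subst br_swap[OF a]) (auto simp: br_def)
  then show ?thesis
    using r mollifier_reflect by (intro exI[of _ r]) (auto simp: mult.commute)
qed

lemma mollification_L1:
  fixes a :: "'a::euclidean_space \<Rightarrow> real"
  assumes a: "integrable lborel a" and \<eta>: "mollifier r \<eta>"
  shows "integrable lborel (\<lambda>w. \<integral>z. a z * \<eta> (z - w) \<partial>lborel)"
proof -
  have \<eta>': "test_fn (ball 0 r) \<eta>" using \<eta> by (simp add: mollifier_def)
  note [measurable] = borel_measurable_integrable[OF a] test_fn_measurable[OF \<eta>']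
  have in1: "(\<integral>z. a z * \<eta> (z - w) \<partial>lborel) = (\<integral>y. \<eta> y * a (w + y) \<partial>lborel)" for w
    using lborel_translate(1)[of "\<lambda>z. a z * \<eta> (z - w)" w] by (simp add: mult.commute)
  show ?thesis
    unfolding in1 by (rule lborel_pair.integrable_snd[OF integrable_pair_conv[OF a test_fn_integrable[OF \<eta>']]])
qed

text \<open>The L1 norm of the error is its pairing with its own sign. That sign depends on
  \<open>\<eta>\<close>, which is harmless because the approximation is uniform over all
  \<open>b\<close> bounded by 1.\<close>

lemma mollification_tendsto_L1:
  fixes a :: "'a::euclidean_space \<Rightarrow> real"
  assumes a: "integrable lborel a" and "e > 0"
  shows "\<exists>r>0. \<forall>\<eta>. mollifier r \<eta> \<longrightarrow> (\<integral>w. \<bar>(\<integral>z. a z * \<eta> (z - w) \<partial>lborel) - a w\<bar> \<partial>lborel) \<le> e"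
proof -
  obtain r where r: "r > 0" "\<And>b \<eta>. b \<in> borel_measurable borel \<Longrightarrow> (\<And>x. \<bar>b x\<bar> \<le> 1) \<Longrightarrow> mollifier r \<eta> \<Longrightarrow>
    \<bar>br a b \<eta> - (\<integral>x. a x * b x \<partial>lborel)\<bar> \<le> e"
    using br_approx_uniform[OF a, of 1 e] \<open>e > 0\<close> by auto
  show ?thesis
  proof (intro exI[of _ r] conjI r(1) allI impI)
    fix \<eta> :: "'a \<Rightarrow> real" assume \<eta>: "mollifier r \<eta>"
    define c where "c w = (\<integral>z. a z * \<eta> (z - w) \<partial>lborel)" for w
    have ic: "integrable lborel c" unfolding c_def[abs_def] by (rule mollification_L1[OF a \<eta>])
    note [measurable] = borel_measurable_integrable[OF a] borel_measurable_integrable[OF ic]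
    define b where "b w = sgn (c w - a w)" for w
    have bm: "b \<in> borel_measurable borel" unfolding b_def[abs_def] by measurable
    have bb: "\<bar>b x\<bar> \<le> 1" for x by (auto simp: b_def sgn_if)
    have i: "integrable lborel (\<lambda>w. b w * c w)" "integrable lborel (\<lambda>w. a w * b w)"
    proof -
      show "integrable lborel (\<lambda>w. b w * c w)"
        by (rule Bochner_Integration.integrable_bound[OF ic]) (use bm bb in \<open>auto simp: abs_mult intro!: AE_I2 mult_left_le_one_le\<close>)
      show "integrable lborel (\<lambda>w. a w * b w)"
        by (rule Bochner_Integration.integrable_bound[OF a]) (use bm bb in \<open>auto simp: abs_mult intro!: AE_I2 mult_right_le_one_le\<close>)
    qed
    have "(\<integral>w. \<bar>c w - a w\<bar> \<partial>lborel) = (\<integral>w. b w * c w - a w * b w \<partial>lborel)"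
      by (intro Bochner_Integration.integral_cong refl) (auto simp: b_def sgn_if)
    also have "\<dots> = br a b \<eta> - (\<integral>x. a x * b x \<partial>lborel)"
      using i by (simp add: br_def c_def)
    also have "\<dots> \<le> e" using r(2)[OF bm bb \<eta>] by linarith
    finally show "(\<integral>w. \<bar>(\<integral>z. a z * \<eta> (z - w) \<partial>lborel) - a w\<bar> \<partial>lborel) \<le> e" by (simp add: c_def)
  qed
qed

section \<open>The energy balance by doubling of variables\<close>

definition bdd_borel :: "('a::topological_space \<Rightarrow> real) \<Rightarrow> bool" where
  "bdd_borel g \<longleftrightarrow> g \<in> borel_measurable borel \<and> (\<exists>C. \<forall>x. \<bar>g x\<bar> \<le> C)"

lemma bdd_borel_mult: "bdd_borel f \<Longrightarrow> bdd_borel g \<Longrightarrow> bdd_borel (\<lambda>x. f x * g x)"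
proof -
  assume "bdd_borel f" "bdd_borel g"
  then obtain C D where "f \<in> borel_measurable borel" "g \<in> borel_measurable borel" "\<And>x. \<bar>f x\<bar> \<le> C" "\<And>x. \<bar>g x\<bar> \<le> D"
    by (auto simp: bdd_borel_def)
  moreover from this(3,4) have "\<bar>f x * g x\<bar> \<le> C * D" for x
    unfolding abs_mult by (intro mult_mono) (auto intro: order_trans[OF abs_ge_zero])
  ultimately show ?thesis by (auto simp: bdd_borel_def)
qed

lemma bdd_borel_test_fn: "test_fn U \<phi> \<Longrightarrow> bdd_borel \<phi>"
  using test_fn_bounded[of U \<phi>] test_fn_measurable[of U \<phi>] by (auto simp: bdd_borel_def)

lemma bdd_borel_dd: "test_fn U \<phi> \<Longrightarrow> bdd_borel (\<lambda>x. dd \<phi> x v)"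
  by (rule bdd_borel_test_fn[OF test_fn_dd])

lemma integrable_mult_bdd:
  fixes f :: "'a::euclidean_space \<Rightarrow> real"
  assumes "integrable lborel f" "bdd_borel g"
  shows "integrable lborel (\<lambda>x. f x * g x)" "integrable lborel (\<lambda>x. g x * f x)"
proof -
  obtain C where g: "g \<in> borel_measurable borel" "\<And>x. \<bar>g x\<bar> \<le> C" using assms(2) by (auto simp: bdd_borel_def)
  then have C: "\<bar>g x\<bar> \<le> \<bar>C\<bar>" for x by (meson abs_ge_self order_trans)
  show "integrable lborel (\<lambda>x. f x * g x)"
    by (rule Bochner_Integration.integrable_bound[of _ "\<lambda>x. f x * C"])
       (use assms g C in \<open>auto simp: abs_mult intro!: AE_I2 mult_left_mono\<close>)
  then show "integrable lborel (\<lambda>x. g x * f x)" by (simp add: mult.commute)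
qed

text \<open>Convergence along this filter means: the support shrinks to the origin, uniformly over
  all shapes of kernel. Such a limit may be evaluated along kernels chosen adaptively.\<close>

definition mollifiers :: "('a::euclidean_space \<Rightarrow> real) filter" where
  "mollifiers = (INF r\<in>{0<..}. principal {\<eta>. mollifier r \<eta>})"

lemma eventually_mollifiers:
  "eventually P mollifiers \<longleftrightarrow> (\<exists>r>0. \<forall>\<eta>. mollifier r \<eta> \<longrightarrow> P \<eta>)"
proof -
  have "eventually P mollifiers \<longleftrightarrow> (\<exists>r\<in>{0<..}. eventually P (principal {\<eta>. mollifier r \<eta>}))"
    unfolding mollifiers_def
  proof (rule eventually_INF_base)
    fix a b :: real assume "a \<in> {0<..}" "b \<in> {0<..}"
    then show "\<exists>x\<in>{0<..}. principal {\<eta>. mollifier x \<eta>} \<le> inf (principal {\<eta>. mollifier a \<eta>}) (principal {\<eta>. mollifier b \<eta>})"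
      by (intro bexI[of _ "min a b"]) (auto intro: mollifier_mono)
  qed auto
  then show ?thesis by (auto simp: eventually_principal)
qed

lemma eventually_mollifier: "r > 0 \<Longrightarrow> eventually (mollifier r) mollifiers"
  unfolding eventually_mollifiers by blast

lemma br_tendsto:
  assumes "integrable lborel a" "bdd_borel b"
  shows "(br a b \<longlongrightarrow> (\<integral>x. a x * b x \<partial>lborel)) mollifiers"
proof (rule tendstoI)
  fix e :: real assume "e > 0"
  obtain C where C: "b \<in> borel_measurable borel" "\<And>x. \<bar>b x\<bar> \<le> C" using assms(2) by (auto simp: bdd_borel_def)
  from br_approx[OF assms(1) C, of "e/2"] \<open>e > 0\<close> obtain r where
    "r > 0" "\<And>\<eta>. mollifier r \<eta> \<Longrightarrow> \<bar>br a b \<eta> - (\<integral>x. a x * b x \<partial>lborel)\<bar> \<le> e / 2" by auto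
  then show "eventually (\<lambda>\<eta>. dist (br a b \<eta>) (\<integral>x. a x * b x \<partial>lborel) < e) mollifiers"
    unfolding eventually_mollifiers dist_real_def using \<open>e > 0\<close>
    by (intro exI[of _ r]) (fastforce intro: le_less_trans)
qed

lemma br_tendsto':
  assumes "bdd_borel a" "integrable lborel a" "integrable lborel b"
  shows "(br a b \<longlongrightarrow> (\<integral>x. a x * b x \<partial>lborel)) mollifiers"
proof (rule tendstoI)
  fix e :: real assume "e > 0"
  obtain C where C: "\<And>x. \<bar>a x\<bar> \<le> C" using assms(1) by (auto simp: bdd_borel_def)
  from br_approx'[OF assms(2,3) C, of "e/2"] \<open>e > 0\<close> obtain r where
    "r > 0" "\<And>\<eta>. mollifier r \<eta> \<Longrightarrow> \<bar>br a b \<eta> - (\<integral>x. a x * b x \<partial>lborel)\<bar> \<le> e / 2" by auto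
  then show "eventually (\<lambda>\<eta>. dist (br a b \<eta>) (\<integral>x. a x * b x \<partial>lborel) < e) mollifiers"
    unfolding eventually_mollifiers dist_real_def using \<open>e > 0\<close>
    by (intro exI[of _ r]) (fastforce intro: le_less_trans)
qed

text \<open>The Lebesgue number of the cover of \<open>K\<close> by the single open set
  \<open>Q\<close>.\<close>

lemma compact_ball_subset:
  fixes K Q :: "'a::metric_space set"
  assumes "compact K" "open Q" "K \<subseteq> Q"
  shows "\<exists>r>0. \<forall>w\<in>K. ball w r \<subseteq> Q"
proof -
  have "K \<subseteq> \<Union>{Q}" using assms(3) by simp
  from Heine_Borel_lemma[OF assms(1) this] assms(2)
  obtain e where "0 < e" "\<And>x. x \<in> K \<Longrightarrow> \<exists>G\<in>{Q}. ball x e \<subseteq> G" by blast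
  then show ?thesis by auto
qed

text \<open>Fields on the whole space-time, bounded everywhere and integrable, that satisfy the
  equations when tested inside \<open>Q\<close>. The given fields are brought into this form at the
  end by truncation. The momentum equation is stated by components, so that all test functions are
  scalar.\<close>

locale euler_L1 =
  fixes Q :: "((real^'n::finite) \<times> real) set" and U :: "(real^'n) \<times> real \<Rightarrow> real^'n"
    and P :: "(real^'n) \<times> real \<Rightarrow> real" and F :: "(real^'n) \<times> real \<Rightarrow> real^'n" and M :: real
  assumes Q_open: "open Q"
    and U_int: "integrable lborel U" and U_bd: "\<And>z. norm (U z) \<le> M"
    and P_int: "integrable lborel P" and F_int: "integrable lborel F"
    and momentum: "\<And>\<phi> i. test_fn Q \<phi> \<Longrightarrow>
      (\<integral>z. U z $ i * dd \<phi> z tdir + (\<Sum>j\<in>UNIV. U z $ i * U z $ j * dd \<phi> z (xdir j))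
         + P z * dd \<phi> z (xdir i) + F z $ i * \<phi> z \<partial>lborel) = 0"
    and divfree: "\<And>\<phi>. test_fn Q \<phi> \<Longrightarrow> (\<integral>z. (\<Sum>j\<in>UNIV. U z $ j * dd \<phi> z (xdir j)) \<partial>lborel) = 0"
begin

definition u :: "'n \<Rightarrow> (real^'n) \<times> real \<Rightarrow> real" where "u i z = U z $ i"
definition nsq :: "(real^'n) \<times> real \<Rightarrow> real" where "nsq z = (norm (U z))\<^sup>2"

lemma nsq_eq: "nsq z = (\<Sum>i\<in>UNIV. u i z * u i z)"
  by (simp add: nsq_def u_def power2_norm_eq_inner inner_vec_def)

lemma U_meas [measurable]: "U \<in> borel_measurable borel" using U_int by auto
lemma int_u: "integrable lborel (u i)"
  unfolding u_def[abs_def] by (rule integrable_bounded_linear[OF bounded_linear_vec_nth U_int])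
lemma u_meas [measurable]: "u i \<in> borel_measurable borel" using int_u[of i] by auto
lemma M_nonneg: "M \<ge> 0" using norm_ge_zero U_bd order_trans by blast
lemma u_bd: "\<bar>u i z\<bar> \<le> M" unfolding u_def using component_le_norm_cart U_bd order_trans by blast
lemma bdd_u: "bdd_borel (u i)" using u_bd by (auto simp: bdd_borel_def)
lemma bdd_nsq: "bdd_borel nsq"
  unfolding bdd_borel_def nsq_def[abs_def] using U_bd by (auto intro!: exI[of _ "M\<^sup>2"] power_mono)
lemma int_F: "integrable lborel (\<lambda>z. F z $ i)"
  by (rule integrable_bounded_linear[OF bounded_linear_vec_nth F_int])
lemma int_uu: "integrable lborel (\<lambda>z. u i z * u j z)"
  by (rule integrable_mult_bdd[OF int_u bdd_u])
lemma int_nsq: "integrable lborel nsq"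
  unfolding nsq_eq[abs_def] by (intro Bochner_Integration.integrable_sum int_uu)

definition cubic :: "((real^'n) \<times> real \<Rightarrow> real) \<Rightarrow> ((real^'n) \<times> real \<Rightarrow> real) \<Rightarrow> real" where
  "cubic \<psi> \<eta> = (\<Sum>j\<in>UNIV. \<integral>w. \<psi> w * (\<integral>z. (norm (U z - U w))\<^sup>2 * (u j z - u j w) * dd \<eta> (z - w) (xdir j) \<partial>lborel) \<partial>lborel)"

text \<open>The integral in \<open>DR_defect\<close>, written with components for the truncated
  fields; it agrees with that functional by \<open>DR_eq_energy_flux\<close>.\<close>

definition energy_flux :: "((real^'n) \<times> real \<Rightarrow> real) \<Rightarrow> real" where
  "energy_flux \<psi> = (\<integral>z. nsq z / 2 * dd \<psi> z tdir + (nsq z / 2 + P z) * (\<Sum>j\<in>UNIV. u j z * dd \<psi> z (xdir j))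
     + (\<Sum>i\<in>UNIV. F z $ i * u i z) * \<psi> z \<partial>lborel)"

context
  fixes \<psi> \<eta> :: "(real^'n) \<times> real \<Rightarrow> real" and r :: real
  assumes \<psi>: "test_fn Q \<psi>" and \<eta>: "test_fn (ball 0 r) \<eta>"
    and sub: "\<And>w. \<psi> w \<noteq> 0 \<Longrightarrow> ball w r \<subseteq> Q"
begin

lemma k_test: "test_fn (ball 0 r) (\<lambda>x. dd \<eta> x v)" by (rule test_fn_dd[OF \<eta>])

text \<open>Where \<open>\<psi>\<close> does not vanish, the ball of radius \<open>r\<close> about
  \<open>w\<close> lies in \<open>Q\<close>, so the translated kernel is admissible as a test
  function of z.\<close>

lemma shifted_test:
  assumes "\<psi> w \<noteq> 0" shows "test_fn Q (\<lambda>z. \<eta> (z - w))" "dd (\<lambda>z. \<eta> (z - w)) z v = dd \<eta> (z - w) v"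
proof -
  from test_fnD[OF \<eta>] obtain K where K: "smooth \<eta>" "compact K" "K \<subseteq> ball 0 r" "\<And>x. x \<notin> K \<Longrightarrow> \<eta> x = 0"
    by blast
  show "test_fn Q (\<lambda>z. \<eta> (z - w))"
  proof (rule test_fnI[of _ "(\<lambda>z. z + w) ` K"])
    show "smooth (\<lambda>z. \<eta> (z - w))" using smooth_affine[OF bounded_linear_ident K(1), of "-w"] by simp
    show "compact ((\<lambda>z. z + w) ` K)" using K(2) compact_translation[of K w] by (simp add: add.commute)
    show "(\<lambda>z. z + w) ` K \<subseteq> Q" using K(3) sub[OF assms] by (force simp: dist_norm)
    show "\<eta> (x - w) = 0" if "x \<notin> (\<lambda>z. z + w) ` K" for x
    proof (rule K(4), rule notI)
      assume "x - w \<in> K"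
      then show False using that by (auto simp: image_iff intro: bexI[of _ "x - w"])
    qed
  qed
  show "dd (\<lambda>z. \<eta> (z - w)) z v = dd \<eta> (z - w) v"
    using dd_affine[OF bounded_linear_ident K(1), of "-w" z v] by simp
qed

text \<open>As a function of w the kernel is multiplied by \<open>\<psi>\<close>, which already
  confines the support to \<open>Q\<close>. Differentiation in w falls on z - w and changes sign;
  the cancellations below come from this sign.\<close>

lemma reflected_test:
  "test_fn Q (\<lambda>w. \<psi> w * \<eta> (z - w))"
  "dd (\<lambda>w. \<psi> w * \<eta> (z - w)) w v = dd \<psi> w v * \<eta> (z - w) - \<psi> w * dd \<eta> (z - w) v"
proof -
  have bl: "bounded_linear (\<lambda>w::(real^'n) \<times> real. - w)" by (rule bounded_linear_minus[OF bounded_linear_ident])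
  have s: "smooth \<eta>" using \<eta> by (rule test_fn_smooth)
  have sm: "smooth (\<lambda>w. \<eta> (z - w))" using smooth_affine[OF bl s, of z] by simp
  then show "test_fn Q (\<lambda>w. \<psi> w * \<eta> (z - w))" by (rule test_fn_mult[OF \<psi>])
  have "dd (\<lambda>w. \<eta> (z - w)) w v = dd \<eta> (z - w) (- v)" using dd_affine[OF bl s, of z w v] by simp
  also have "\<dots> = - dd \<eta> (z - w) v"
    using linear_neg[OF bounded_linear.linear[OF smooth_dd_linear[OF s]]] .
  finally show "dd (\<lambda>w. \<psi> w * \<eta> (z - w)) w v = dd \<psi> w v * \<eta> (z - w) - \<psi> w * dd \<eta> (z - w) v"
    by (subst dd_mult[OF test_fn_smooth[OF \<psi>] sm]) simp
qed

lemmas int_k = br_integrable(1)[OF _ int_u \<eta>] br_integrable(1)[OF _ int_u k_test]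
lemmas int_k' = br_integrable(3)[OF int_u _ \<eta>] br_integrable(3)[OF int_u _ k_test]
lemmas int_b = br_integrable(2)[OF _ _ \<eta>] br_integrable(2)[OF _ _ k_test]
lemmas int_b' = br_integrable(4)[OF _ _ \<eta>] br_integrable(4)[OF _ _ k_test]

lemma int_\<psi>:
  "integrable lborel f \<Longrightarrow> integrable lborel (\<lambda>z. f z * \<psi> z)"
  "integrable lborel f \<Longrightarrow> integrable lborel (\<lambda>z. f z * dd \<psi> z v)"
  by (auto intro: integrable_mult_bdd bdd_borel_test_fn[OF \<psi>] bdd_borel_dd[OF \<psi>])

abbreviation (input) dk :: "(real^'n) \<times> real \<Rightarrow> (real^'n) \<times> real \<Rightarrow> real" where "dk v \<equiv> \<lambda>x. dd \<eta> x v"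

text \<open>The momentum equation at z tested with the kernel centred at w, then multiplied by
  \<open>u i w * \<psi> w\<close> and integrated over w.\<close>

lemma br_momentum_first:
  "br (u i) (\<lambda>w. u i w * \<psi> w) (dk tdir) + (\<Sum>j\<in>UNIV. br (\<lambda>z. u i z * u j z) (\<lambda>w. u i w * \<psi> w) (dk (xdir j)))
    + br P (\<lambda>w. u i w * \<psi> w) (dk (xdir i)) + br (\<lambda>z. F z $ i) (\<lambda>w. u i w * \<psi> w) \<eta> = 0"
proof -
  let ?b = "\<lambda>w. u i w * \<psi> w"
  have ib: "integrable lborel ?b" by (intro int_\<psi> int_u)
  let ?X = "\<lambda>w. (\<integral>z. u i z * dd \<eta> (z - w) tdir \<partial>lborel) + (\<Sum>j\<in>UNIV. \<integral>z. (u i z * u j z) * dd \<eta> (z - w) (xdir j) \<partial>lborel)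
      + (\<integral>z. P z * dd \<eta> (z - w) (xdir i) \<partial>lborel) + (\<integral>z. F z $ i * \<eta> (z - w) \<partial>lborel)"
  have "?X w = 0" if "\<psi> w \<noteq> 0" for w
  proof -
    have "?X w = (\<integral>z. U z $ i * dd (\<lambda>z. \<eta> (z - w)) z tdir + (\<Sum>j\<in>UNIV. U z $ i * U z $ j * dd (\<lambda>z. \<eta> (z - w)) z (xdir j))
         + P z * dd (\<lambda>z. \<eta> (z - w)) z (xdir i) + F z $ i * \<eta> (z - w) \<partial>lborel)"
      using int_k[OF int_u] int_k[OF int_uu] int_k[OF P_int] int_k[OF int_F]
      unfolding shifted_test(2)[OF that] u_def[symmetric]
      by (simp add: Bochner_Integration.integral_add Bochner_Integration.integral_sum)
    also have "\<dots> = 0" by (rule momentum[OF shifted_test(1)[OF that]])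
    finally show ?thesis .
  qed
  \<comment> \<open>Where \<open>\<psi>\<close> vanishes the equation cannot be tested, but there
    the weight itself is 0.\<close>
  then have z: "?b w * ?X w = 0" for w by (cases "\<psi> w = 0") auto
  have "(\<integral>w. ?b w * ?X w \<partial>lborel) = br (u i) ?b (dk tdir) + (\<Sum>j\<in>UNIV. br (\<lambda>z. u i z * u j z) ?b (dk (xdir j)))
    + br P ?b (dk (xdir i)) + br (\<lambda>z. F z $ i) ?b \<eta>"
    unfolding br_def
    using int_b[OF int_u ib] int_b[OF int_uu ib] int_b[OF P_int ib] int_b[OF int_F ib]
    by (simp add: distrib_left sum_distrib_left Bochner_Integration.integral_add Bochner_Integration.integral_sum)
  then show ?thesis unfolding z by simp
qed

text \<open>The momentum equation at w tested with \<open>\<psi> w * \<eta> (z - w)\<close>, then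
  multiplied by \<open>u i z\<close> and integrated over z. Derivatives on \<open>\<psi>\<close>
  leave harmless terms, derivatives on the kernel appear with a minus sign.\<close>

lemma br_momentum_second:
  "br (u i) (\<lambda>w. u i w * dd \<psi> w tdir) \<eta> - br (u i) (\<lambda>w. u i w * \<psi> w) (dk tdir)
   + (\<Sum>j\<in>UNIV. br (u i) (\<lambda>w. u i w * u j w * dd \<psi> w (xdir j)) \<eta> - br (u i) (\<lambda>w. u i w * u j w * \<psi> w) (dk (xdir j)))
   + br (u i) (\<lambda>w. P w * dd \<psi> w (xdir i)) \<eta> - br (u i) (\<lambda>w. P w * \<psi> w) (dk (xdir i))
   + br (u i) (\<lambda>w. F w $ i * \<psi> w) \<eta> = 0"
proof -
  note ib = int_\<psi>[OF int_u[of i]] int_\<psi>[OF int_uu[of i]] int_\<psi>[OF P_int] int_\<psi>[OF int_F[of i]]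
  let ?X = "\<lambda>z. (\<integral>w. (u i w * dd \<psi> w tdir) * \<eta> (z - w) \<partial>lborel) - (\<integral>w. (u i w * \<psi> w) * dd \<eta> (z - w) tdir \<partial>lborel)
     + (\<Sum>j\<in>UNIV. (\<integral>w. (u i w * u j w * dd \<psi> w (xdir j)) * \<eta> (z - w) \<partial>lborel) - (\<integral>w. (u i w * u j w * \<psi> w) * dd \<eta> (z - w) (xdir j) \<partial>lborel))
     + (\<integral>w. (P w * dd \<psi> w (xdir i)) * \<eta> (z - w) \<partial>lborel) - (\<integral>w. (P w * \<psi> w) * dd \<eta> (z - w) (xdir i) \<partial>lborel)
     + (\<integral>w. (F w $ i * \<psi> w) * \<eta> (z - w) \<partial>lborel)"
  have z: "?X z = 0" for z
  proof -
    have "?X z = (\<integral>w. (u i w * dd \<psi> w tdir) * \<eta> (z - w) - (u i w * \<psi> w) * dd \<eta> (z - w) tdir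
     + (\<Sum>j\<in>UNIV. (u i w * u j w * dd \<psi> w (xdir j)) * \<eta> (z - w) - (u i w * u j w * \<psi> w) * dd \<eta> (z - w) (xdir j))
     + (P w * dd \<psi> w (xdir i)) * \<eta> (z - w) - (P w * \<psi> w) * dd \<eta> (z - w) (xdir i)
     + (F w $ i * \<psi> w) * \<eta> (z - w) \<partial>lborel)"
      using ib[THEN int_k'(1)] ib[THEN int_k'(2)]
      by (simp add: Bochner_Integration.integral_add Bochner_Integration.integral_diff Bochner_Integration.integral_sum)
    also have "\<dots> = (\<integral>w. U w $ i * dd (\<lambda>w. \<psi> w * \<eta> (z - w)) w tdir + (\<Sum>j\<in>UNIV. U w $ i * U w $ j * dd (\<lambda>w. \<psi> w * \<eta> (z - w)) w (xdir j))
         + P w * dd (\<lambda>w. \<psi> w * \<eta> (z - w)) w (xdir i) + F w $ i * (\<psi> w * \<eta> (z - w)) \<partial>lborel)"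
      unfolding reflected_test(2) u_def by (simp add: algebra_simps)
    also have "\<dots> = 0" by (rule momentum[OF reflected_test(1)])
    finally show ?thesis .
  qed
  note sw = br_swap[OF int_u _ \<eta>] br_swap[OF int_u _ k_test]
  have "(\<integral>z. u i z * ?X z \<partial>lborel) = br (u i) (\<lambda>w. u i w * dd \<psi> w tdir) \<eta> - br (u i) (\<lambda>w. u i w * \<psi> w) (dk tdir)
   + (\<Sum>j\<in>UNIV. br (u i) (\<lambda>w. u i w * u j w * dd \<psi> w (xdir j)) \<eta> - br (u i) (\<lambda>w. u i w * u j w * \<psi> w) (dk (xdir j)))
   + br (u i) (\<lambda>w. P w * dd \<psi> w (xdir i)) \<eta> - br (u i) (\<lambda>w. P w * \<psi> w) (dk (xdir i))
   + br (u i) (\<lambda>w. F w $ i * \<psi> w) \<eta>"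
    using ib[THEN int_b'(1)[OF int_u[of i]]] ib[THEN int_b'(2)[OF int_u[of i]]]
    by (simp add: sw ib distrib_left right_diff_distrib sum_distrib_left
        Bochner_Integration.integral_add Bochner_Integration.integral_diff Bochner_Integration.integral_sum)
  then show ?thesis unfolding z by simp
qed

text \<open>Incompressibility at z: the velocity at z paired with the gradient of the kernel
  vanishes for each w, whatever scalar weight is carried at w.\<close>

lemma br_divfree_first:
  assumes b: "integrable lborel b"
  shows "(\<Sum>j\<in>UNIV. br (u j) (\<lambda>w. b w * \<psi> w) (dk (xdir j))) = 0"
proof -
  have ib: "integrable lborel (\<lambda>w. b w * \<psi> w)" by (rule int_\<psi>[OF b])
  let ?X = "\<lambda>w. \<Sum>j\<in>UNIV. \<integral>z. u j z * dd \<eta> (z - w) (xdir j) \<partial>lborel"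
  have "?X w = 0" if "\<psi> w \<noteq> 0" for w
  proof -
    have "?X w = (\<integral>z. (\<Sum>j\<in>UNIV. U z $ j * dd (\<lambda>z. \<eta> (z - w)) z (xdir j)) \<partial>lborel)"
      using int_k(2)[OF int_u] unfolding shifted_test(2)[OF that] u_def[symmetric]
      by (simp add: Bochner_Integration.integral_sum)
    also have "\<dots> = 0" by (rule divfree[OF shifted_test(1)[OF that]])
    finally show ?thesis .
  qed
  then have z: "b w * \<psi> w * ?X w = 0" for w by (cases "\<psi> w = 0") auto
  have "(\<integral>w. b w * \<psi> w * ?X w \<partial>lborel) = (\<Sum>j\<in>UNIV. br (u j) (\<lambda>w. b w * \<psi> w) (dk (xdir j)))"
    unfolding br_def using int_b(2)[OF int_u ib]
    by (simp add: sum_distrib_left Bochner_Integration.integral_sum)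
  then show ?thesis unfolding z by simp
qed

text \<open>Incompressibility at w: the transport derivative moves from the kernel to
  \<open>\<psi>\<close>, whatever scalar is carried at z.\<close>

lemma br_divfree_second:
  assumes a: "integrable lborel a"
  shows "(\<Sum>j\<in>UNIV. br a (\<lambda>w. u j w * \<psi> w) (dk (xdir j))) = (\<Sum>j\<in>UNIV. br a (\<lambda>w. u j w * dd \<psi> w (xdir j)) \<eta>)"
proof -
  note ib = int_\<psi>[OF int_u]
  let ?X = "\<lambda>z. \<Sum>j\<in>UNIV. (\<integral>w. (u j w * dd \<psi> w (xdir j)) * \<eta> (z - w) \<partial>lborel) - (\<integral>w. (u j w * \<psi> w) * dd \<eta> (z - w) (xdir j) \<partial>lborel)"
  have z: "?X z = 0" for z
  proof -
    have "?X z = (\<integral>w. (\<Sum>j\<in>UNIV. (u j w * dd \<psi> w (xdir j)) * \<eta> (z - w) - (u j w * \<psi> w) * dd \<eta> (z - w) (xdir j)) \<partial>lborel)"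
      using ib[THEN int_k'(1)] ib[THEN int_k'(2)]
      by (simp add: Bochner_Integration.integral_diff Bochner_Integration.integral_sum)
    also have "\<dots> = (\<integral>w. (\<Sum>j\<in>UNIV. U w $ j * dd (\<lambda>w. \<psi> w * \<eta> (z - w)) w (xdir j)) \<partial>lborel)"
      unfolding reflected_test(2) u_def by (simp add: algebra_simps)
    also have "\<dots> = 0" by (rule divfree[OF reflected_test(1)])
    finally show ?thesis .
  qed
  note sw = br_swap[OF a _ \<eta>] br_swap[OF a _ k_test]
  have "(\<integral>z. a z * ?X z \<partial>lborel) = (\<Sum>j\<in>UNIV. br a (\<lambda>w. u j w * dd \<psi> w (xdir j)) \<eta> - br a (\<lambda>w. u j w * \<psi> w) (dk (xdir j)))"
    using ib[THEN int_b'(1)[OF a]] ib[THEN int_b'(2)[OF a]]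
    by (simp add: sw ib right_diff_distrib sum_distrib_left
        Bochner_Integration.integral_diff Bochner_Integration.integral_sum)
  then show ?thesis unfolding z by (simp add: sum_subtractf)
qed

lemma br_parts:
  assumes a: "integrable lborel a"
  shows "br a \<psi> (dk v) = br a (\<lambda>w. dd \<psi> w v) \<eta>"
proof -
  note i\<psi> = test_fn_integrable[OF \<psi>] test_fn_integrable[OF test_fn_dd[OF \<psi>]]
  have z: "(\<integral>w. dd \<psi> w v * \<eta> (z - w) \<partial>lborel) = (\<integral>w. \<psi> w * dd \<eta> (z - w) v \<partial>lborel)" for z
    using test_fn_integral_dd[OF reflected_test(1), of z v] int_k'(1)[OF i\<psi>(2), of v z] int_k'(2)[OF i\<psi>(1), of z v]
    unfolding reflected_test(2) by simp
  show ?thesis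
    unfolding br_swap[OF a i\<psi>(1) k_test] br_swap[OF a i\<psi>(2) \<eta>] z ..
qed

lemma int_k_zero: "(\<integral>z. dd \<eta> (z - w) v \<partial>lborel) = 0"
  using integral_shift(2)[OF test_fn_measurable[OF k_test[of v]], of w] test_fn_integral_dd[OF \<eta>, of v] by simp

lemma int_nu: "integrable lborel (\<lambda>z. nsq z * u j z)"
  by (rule integrable_mult_bdd[OF int_nsq bdd_u])

lemma int_uuu: "integrable lborel (\<lambda>w. u i w * u j w * \<psi> w)"
  by (rule int_\<psi>[OF int_uu])

text \<open>Expansion of the cube of the increment. The part that depends on w alone multiplies the
  integral of a derivative of the kernel, which is 0.\<close>

lemma cubic_inner:
  "(\<integral>z. (norm (U z - U w))\<^sup>2 * (u j z - u j w) * dd \<eta> (z - w) v \<partial>lborel) =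
    (\<integral>z. (nsq z * u j z) * dd \<eta> (z - w) v \<partial>lborel) - u j w * (\<integral>z. nsq z * dd \<eta> (z - w) v \<partial>lborel)
    + nsq w * (\<integral>z. u j z * dd \<eta> (z - w) v \<partial>lborel)
    - 2 * (\<Sum>i\<in>UNIV. u i w * (\<integral>z. (u i z * u j z) * dd \<eta> (z - w) v \<partial>lborel)
           - u i w * u j w * (\<integral>z. u i z * dd \<eta> (z - w) v \<partial>lborel))"
proof -
  have n: "(norm (U z - U w))\<^sup>2 = nsq z + nsq w - 2 * (\<Sum>i\<in>UNIV. u i z * u i w)" for z
    unfolding nsq_def power2_norm_eq_inner
    by (simp add: inner_diff_left inner_diff_right inner_commute) (simp add: u_def inner_vec_def mult.commute)
  have ik: "integrable lborel (\<lambda>z. dd \<eta> (z - w) v)"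
    using integrable_shift(4)[OF test_fn_integrable[OF k_test]] by simp
  have "(\<integral>z. (norm (U z - U w))\<^sup>2 * (u j z - u j w) * dd \<eta> (z - w) v \<partial>lborel) =
     (\<integral>z. (nsq z * u j z) * dd \<eta> (z - w) v - u j w * (nsq z * dd \<eta> (z - w) v)
       + nsq w * (u j z * dd \<eta> (z - w) v) - nsq w * u j w * dd \<eta> (z - w) v
       - 2 * (\<Sum>i\<in>UNIV. u i w * ((u i z * u j z) * dd \<eta> (z - w) v)
           - u i w * u j w * (u i z * dd \<eta> (z - w) v)) \<partial>lborel)"
    unfolding n
    by (intro Bochner_Integration.integral_cong refl)
       (simp add: algebra_simps sum_distrib_left sum_distrib_right sum_subtractf sum.distrib)
  also have "\<dots> = (\<integral>z. (nsq z * u j z) * dd \<eta> (z - w) v \<partial>lborel) - u j w * (\<integral>z. nsq z * dd \<eta> (z - w) v \<partial>lborel)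
    + nsq w * (\<integral>z. u j z * dd \<eta> (z - w) v \<partial>lborel) - nsq w * u j w * (\<integral>z. dd \<eta> (z - w) v \<partial>lborel)
    - 2 * (\<Sum>i\<in>UNIV. u i w * (\<integral>z. (u i z * u j z) * dd \<eta> (z - w) v \<partial>lborel)
           - u i w * u j w * (\<integral>z. u i z * dd \<eta> (z - w) v \<partial>lborel))"
    using int_k(2)[OF int_nu] int_k(2)[OF int_nsq] int_k(2)[OF int_u] int_k(2)[OF int_uu] ik
    by (simp add: Bochner_Integration.integral_add Bochner_Integration.integral_diff Bochner_Integration.integral_sum)
  finally show ?thesis unfolding int_k_zero by simp
qed

lemma cubic_expand:
  "cubic \<psi> \<eta> = (\<Sum>j\<in>UNIV. br (\<lambda>z. nsq z * u j z) \<psi> (dk (xdir j)) - br nsq (\<lambda>w. u j w * \<psi> w) (dk (xdir j))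
     + br (u j) (\<lambda>w. nsq w * \<psi> w) (dk (xdir j))
     - 2 * (\<Sum>i\<in>UNIV. br (\<lambda>z. u i z * u j z) (\<lambda>w. u i w * \<psi> w) (dk (xdir j))
         - br (u i) (\<lambda>w. u i w * u j w * \<psi> w) (dk (xdir j))))"
  unfolding cubic_def
proof (rule sum.cong[OF refl])
  fix j
  let ?v = "xdir j :: (real^'n) \<times> real"
  let ?I = "\<lambda>a w. \<integral>z. a z * dd \<eta> (z - w) ?v \<partial>lborel"
  have "(\<integral>w. \<psi> w * (\<integral>z. (norm (U z - U w))\<^sup>2 * (u j z - u j w) * dd \<eta> (z - w) ?v \<partial>lborel) \<partial>lborel) =
    (\<integral>w. \<psi> w * ?I (\<lambda>z. nsq z * u j z) w - (u j w * \<psi> w) * ?I nsq w + (nsq w * \<psi> w) * ?I (u j) w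
      - 2 * (\<Sum>i\<in>UNIV. (u i w * \<psi> w) * ?I (\<lambda>z. u i z * u j z) w - (u i w * u j w * \<psi> w) * ?I (u i) w) \<partial>lborel)"
    unfolding cubic_inner
    by (intro Bochner_Integration.integral_cong refl)
       (simp add: right_diff_distrib distrib_left sum_distrib_left mult_ac)
  also have "\<dots> = br (\<lambda>z. nsq z * u j z) \<psi> (dk ?v) - br nsq (\<lambda>w. u j w * \<psi> w) (dk ?v)
     + br (u j) (\<lambda>w. nsq w * \<psi> w) (dk ?v)
     - 2 * (\<Sum>i\<in>UNIV. br (\<lambda>z. u i z * u j z) (\<lambda>w. u i w * \<psi> w) (dk ?v)
         - br (u i) (\<lambda>w. u i w * u j w * \<psi> w) (dk ?v))"
  proof -
    have "integrable lborel (\<lambda>w. (u i w * \<psi> w) * ?I (\<lambda>z. u i z * u j z) w)"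
      "integrable lborel (\<lambda>w. (u i w * u j w * \<psi> w) * ?I (u i) w)" for i
      by (rule int_b(2)[OF int_uu int_\<psi>(1)[OF int_u]], rule int_b(2)[OF int_u int_uuu])
    then show ?thesis
    unfolding br_def
    using int_b(2)[OF int_nu test_fn_integrable[OF \<psi>], of j ?v] int_b(2)[OF int_nsq int_\<psi>(1)[OF int_u], of j ?v]
      int_b(2)[OF int_u int_\<psi>(1)[OF int_nsq], of j ?v]
    by (simp add: Bochner_Integration.integral_add Bochner_Integration.integral_diff Bochner_Integration.integral_sum)
  qed
  finally show "(\<integral>w. \<psi> w * (\<integral>z. (norm (U z - U w))\<^sup>2 * (u j z - u j w) * dd \<eta> (z - w) ?v \<partial>lborel) \<partial>lborel) = \<dots>" .
qed

text \<open>No derivative of the kernel survives. Adding both momentum identities cancels its time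
  derivative, since the two occurrences have opposite signs. The mixed quadratic terms of the cube
  are exactly the convective terms of these identities. The remaining gradients, for |u|^2 and for
  the pressure, are removed or moved to \<open>\<psi>\<close> by incompressibility, and
  \<open>br_parts\<close> treats the term with everything at z.\<close>

lemma cubic_energy:
  "cubic \<psi> \<eta> = (\<Sum>j\<in>UNIV. br (\<lambda>z. nsq z * u j z) (\<lambda>w. dd \<psi> w (xdir j)) \<eta> - br nsq (\<lambda>w. u j w * dd \<psi> w (xdir j)) \<eta>)
    + 2 * (\<Sum>i\<in>UNIV. br (u i) (\<lambda>w. u i w * dd \<psi> w tdir) \<eta>
      + (\<Sum>j\<in>UNIV. br (u i) (\<lambda>w. u i w * u j w * dd \<psi> w (xdir j)) \<eta>)
      + br P (\<lambda>w. u i w * dd \<psi> w (xdir i)) \<eta> + br (u i) (\<lambda>w. P w * dd \<psi> w (xdir i)) \<eta>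
      + br (\<lambda>z. F z $ i) (\<lambda>w. u i w * \<psi> w) \<eta> + br (u i) (\<lambda>w. F w $ i * \<psi> w) \<eta>)"
proof -
  define S where "S = (\<Sum>i\<in>UNIV. \<Sum>j\<in>UNIV. br (\<lambda>z. u i z * u j z) (\<lambda>w. u i w * \<psi> w) (dk (xdir j))
         - br (u i) (\<lambda>w. u i w * u j w * \<psi> w) (dk (xdir j)))"
  have "cubic \<psi> \<eta> = (\<Sum>j\<in>UNIV. br (\<lambda>z. nsq z * u j z) (\<lambda>w. dd \<psi> w (xdir j)) \<eta>)
     - (\<Sum>j\<in>UNIV. br nsq (\<lambda>w. u j w * \<psi> w) (dk (xdir j)))
     + (\<Sum>j\<in>UNIV. br (u j) (\<lambda>w. nsq w * \<psi> w) (dk (xdir j))) - 2 * S"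
    unfolding cubic_expand br_parts[OF int_nu] S_def
    by (subst sum.swap[of _ UNIV UNIV]) (simp add: sum.distrib sum_subtractf sum_distrib_left)
  also have "\<dots> = (\<Sum>j\<in>UNIV. br (\<lambda>z. nsq z * u j z) (\<lambda>w. dd \<psi> w (xdir j)) \<eta> - br nsq (\<lambda>w. u j w * dd \<psi> w (xdir j)) \<eta>) - 2 * S"
    unfolding br_divfree_first[OF int_nsq] br_divfree_second[OF int_nsq] by (simp add: sum_subtractf)
  finally have 1: "cubic \<psi> \<eta> = \<dots>" .
  have "(\<Sum>i\<in>UNIV. (br (u i) (\<lambda>w. u i w * \<psi> w) (dk tdir) + (\<Sum>j\<in>UNIV. br (\<lambda>z. u i z * u j z) (\<lambda>w. u i w * \<psi> w) (dk (xdir j)))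
    + br P (\<lambda>w. u i w * \<psi> w) (dk (xdir i)) + br (\<lambda>z. F z $ i) (\<lambda>w. u i w * \<psi> w) \<eta>)
    + (br (u i) (\<lambda>w. u i w * dd \<psi> w tdir) \<eta> - br (u i) (\<lambda>w. u i w * \<psi> w) (dk tdir)
   + (\<Sum>j\<in>UNIV. br (u i) (\<lambda>w. u i w * u j w * dd \<psi> w (xdir j)) \<eta> - br (u i) (\<lambda>w. u i w * u j w * \<psi> w) (dk (xdir j)))
   + br (u i) (\<lambda>w. P w * dd \<psi> w (xdir i)) \<eta> - br (u i) (\<lambda>w. P w * \<psi> w) (dk (xdir i))
   + br (u i) (\<lambda>w. F w $ i * \<psi> w) \<eta>)) = 0"
    unfolding br_momentum_first br_momentum_second by simp
  then have "S + (\<Sum>i\<in>UNIV. br P (\<lambda>w. u i w * \<psi> w) (dk (xdir i))) - (\<Sum>i\<in>UNIV. br (u i) (\<lambda>w. P w * \<psi> w) (dk (xdir i)))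
    + (\<Sum>i\<in>UNIV. br (\<lambda>z. F z $ i) (\<lambda>w. u i w * \<psi> w) \<eta>) + (\<Sum>i\<in>UNIV. br (u i) (\<lambda>w. u i w * dd \<psi> w tdir) \<eta>)
    + (\<Sum>i\<in>UNIV. \<Sum>j\<in>UNIV. br (u i) (\<lambda>w. u i w * u j w * dd \<psi> w (xdir j)) \<eta>)
    + (\<Sum>i\<in>UNIV. br (u i) (\<lambda>w. P w * dd \<psi> w (xdir i)) \<eta>) + (\<Sum>i\<in>UNIV. br (u i) (\<lambda>w. F w $ i * \<psi> w) \<eta>) = 0"
    unfolding S_def by (simp add: sum.distrib sum_subtractf)
  then have 2: "S = - ((\<Sum>i\<in>UNIV. br P (\<lambda>w. u i w * dd \<psi> w (xdir i)) \<eta>)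
    + (\<Sum>i\<in>UNIV. br (\<lambda>z. F z $ i) (\<lambda>w. u i w * \<psi> w) \<eta>) + (\<Sum>i\<in>UNIV. br (u i) (\<lambda>w. u i w * dd \<psi> w tdir) \<eta>)
    + (\<Sum>i\<in>UNIV. \<Sum>j\<in>UNIV. br (u i) (\<lambda>w. u i w * u j w * dd \<psi> w (xdir j)) \<eta>)
    + (\<Sum>i\<in>UNIV. br (u i) (\<lambda>w. P w * dd \<psi> w (xdir i)) \<eta>) + (\<Sum>i\<in>UNIV. br (u i) (\<lambda>w. F w $ i * \<psi> w) \<eta>))"
    unfolding br_divfree_first[OF P_int] br_divfree_second[OF P_int] by simp
  show ?thesis unfolding 1 2 by (simp add: sum.distrib)
qed

end

text \<open>Each term of \<open>cubic_energy\<close> pairs against the kernel itself, hence tends to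
  the integral on the diagonal.\<close>

lemma cubic_tendsto:
  assumes \<psi>: "test_fn Q \<psi>"
  shows "(cubic \<psi> \<longlongrightarrow> 4 * energy_flux \<psi>) mollifiers"
proof -
  have bt: "bdd_borel (\<lambda>w. dd \<psi> w v)" for v by (rule bdd_borel_dd[OF \<psi>])
  have b\<psi>: "bdd_borel \<psi>" by (rule bdd_borel_test_fn[OF \<psi>])
  note bm = bdd_borel_mult bdd_u bt b\<psi> bdd_nsq
  have iPt: "integrable lborel (\<lambda>z. P z * dd \<psi> z v)" for v by (rule integrable_mult_bdd[OF P_int bt])
  have iF\<psi>: "integrable lborel (\<lambda>z. F z $ i * \<psi> z)" for i by (rule integrable_mult_bdd[OF int_F b\<psi>])
  have i1: "integrable lborel (\<lambda>z. nsq z * u j z)" for j by (rule integrable_mult_bdd[OF int_nsq bdd_u])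
  have lim: "((\<lambda>\<eta>. (\<Sum>j\<in>UNIV. br (\<lambda>z. nsq z * u j z) (\<lambda>w. dd \<psi> w (xdir j)) \<eta> - br nsq (\<lambda>w. u j w * dd \<psi> w (xdir j)) \<eta>)
    + 2 * (\<Sum>i\<in>UNIV. br (u i) (\<lambda>w. u i w * dd \<psi> w tdir) \<eta>
      + (\<Sum>j\<in>UNIV. br (u i) (\<lambda>w. u i w * u j w * dd \<psi> w (xdir j)) \<eta>)
      + br P (\<lambda>w. u i w * dd \<psi> w (xdir i)) \<eta> + br (u i) (\<lambda>w. P w * dd \<psi> w (xdir i)) \<eta>
      + br (\<lambda>z. F z $ i) (\<lambda>w. u i w * \<psi> w) \<eta> + br (u i) (\<lambda>w. F w $ i * \<psi> w) \<eta>)) \<longlongrightarrow>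
    (\<Sum>j\<in>UNIV. (\<integral>z. (nsq z * u j z) * dd \<psi> z (xdir j) \<partial>lborel) - (\<integral>z. nsq z * (u j z * dd \<psi> z (xdir j)) \<partial>lborel))
    + 2 * (\<Sum>i\<in>UNIV. (\<integral>z. u i z * (u i z * dd \<psi> z tdir) \<partial>lborel)
      + (\<Sum>j\<in>UNIV. (\<integral>z. u i z * (u i z * u j z * dd \<psi> z (xdir j)) \<partial>lborel))
      + (\<integral>z. P z * (u i z * dd \<psi> z (xdir i)) \<partial>lborel) + (\<integral>z. u i z * (P z * dd \<psi> z (xdir i)) \<partial>lborel)
      + (\<integral>z. F z $ i * (u i z * \<psi> z) \<partial>lborel) + (\<integral>z. u i z * (F z $ i * \<psi> z) \<partial>lborel))) mollifiers"
    by (intro tendsto_intros br_tendsto[OF i1 bt] br_tendsto[OF int_nsq] br_tendsto[OF P_int] br_tendsto[OF int_F]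
        br_tendsto'[OF bdd_u int_u iPt] br_tendsto'[OF bdd_u int_u iF\<psi>] br_tendsto[OF int_u] bm)
  \<comment> \<open>On the diagonal the first sum cancels. Pressure and force each occur twice, once
    from z and once from w; with the prefactor 2 and the halves in the kinetic energy this gives 4
    times the flux.\<close>
  have val: "(\<Sum>j\<in>UNIV. (\<integral>z. (nsq z * u j z) * dd \<psi> z (xdir j) \<partial>lborel) - (\<integral>z. nsq z * (u j z * dd \<psi> z (xdir j)) \<partial>lborel))
    + 2 * (\<Sum>i\<in>UNIV. (\<integral>z. u i z * (u i z * dd \<psi> z tdir) \<partial>lborel)
      + (\<Sum>j\<in>UNIV. (\<integral>z. u i z * (u i z * u j z * dd \<psi> z (xdir j)) \<partial>lborel))
      + (\<integral>z. P z * (u i z * dd \<psi> z (xdir i)) \<partial>lborel) + (\<integral>z. u i z * (P z * dd \<psi> z (xdir i)) \<partial>lborel)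
      + (\<integral>z. F z $ i * (u i z * \<psi> z) \<partial>lborel) + (\<integral>z. u i z * (F z $ i * \<psi> z) \<partial>lborel)) = 4 * energy_flux \<psi>"
  proof -
    have a1: "integrable lborel (\<lambda>z. u i z * (u i z * dd \<psi> z tdir))" for i
      by (rule integrable_mult_bdd[OF int_u]) (intro bm)
    have a2: "integrable lborel (\<lambda>z. u i z * (u i z * (u j z * dd \<psi> z (xdir j))))" for i j
      by (rule integrable_mult_bdd[OF int_u]) (intro bm)
    have a3: "integrable lborel (\<lambda>z. P z * (u i z * dd \<psi> z (xdir i)))" for i
      by (rule integrable_mult_bdd[OF P_int]) (intro bm)
    have a4: "integrable lborel (\<lambda>z. F z $ i * (u i z * \<psi> z))" for i
      by (rule integrable_mult_bdd[OF int_F]) (intro bm)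
    have "energy_flux \<psi> = (\<integral>z. (1/2) * (\<Sum>i\<in>UNIV. u i z * (u i z * dd \<psi> z tdir))
        + (1/2) * (\<Sum>i\<in>UNIV. \<Sum>j\<in>UNIV. u i z * (u i z * (u j z * dd \<psi> z (xdir j))))
        + (\<Sum>i\<in>UNIV. P z * (u i z * dd \<psi> z (xdir i))) + (\<Sum>i\<in>UNIV. F z $ i * (u i z * \<psi> z)) \<partial>lborel)"
      unfolding energy_flux_def nsq_eq
      by (intro Bochner_Integration.integral_cong refl)
         (simp add: sum_distrib_left sum_distrib_right sum_divide_distrib algebra_simps)
    also have "\<dots> = (1/2) * (\<Sum>i\<in>UNIV. \<integral>z. u i z * (u i z * dd \<psi> z tdir) \<partial>lborel)
        + (1/2) * (\<Sum>i\<in>UNIV. \<Sum>j\<in>UNIV. \<integral>z. u i z * (u i z * (u j z * dd \<psi> z (xdir j))) \<partial>lborel)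
        + (\<Sum>i\<in>UNIV. \<integral>z. P z * (u i z * dd \<psi> z (xdir i)) \<partial>lborel) + (\<Sum>i\<in>UNIV. \<integral>z. F z $ i * (u i z * \<psi> z) \<partial>lborel)"
      using a1 a2 a3 a4 by (simp add: Bochner_Integration.integral_add Bochner_Integration.integral_sum)
    finally show ?thesis by (simp add: sum.distrib mult_ac flip: sum_distrib_left)
  qed
  from test_fnD[OF \<psi>] obtain K where K: "compact K" "K \<subseteq> Q" "\<And>x. x \<notin> K \<Longrightarrow> \<psi> x = 0" by blast
  obtain r where r: "r > 0" "\<And>w. w \<in> K \<Longrightarrow> ball w r \<subseteq> Q"
    using compact_ball_subset[OF K(1) Q_open K(2)] by blast
  have "eventually (mollifier r) mollifiers" using r(1) by (rule eventually_mollifier)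
  then have "eventually (\<lambda>\<eta>. cubic \<psi> \<eta> = (\<Sum>j\<in>UNIV. br (\<lambda>z. nsq z * u j z) (\<lambda>w. dd \<psi> w (xdir j)) \<eta> - br nsq (\<lambda>w. u j w * dd \<psi> w (xdir j)) \<eta>)
    + 2 * (\<Sum>i\<in>UNIV. br (u i) (\<lambda>w. u i w * dd \<psi> w tdir) \<eta>
      + (\<Sum>j\<in>UNIV. br (u i) (\<lambda>w. u i w * u j w * dd \<psi> w (xdir j)) \<eta>)
      + br P (\<lambda>w. u i w * dd \<psi> w (xdir i)) \<eta> + br (u i) (\<lambda>w. P w * dd \<psi> w (xdir i)) \<eta>
      + br (\<lambda>z. F z $ i) (\<lambda>w. u i w * \<psi> w) \<eta> + br (u i) (\<lambda>w. F w $ i * \<psi> w) \<eta>)) mollifiers"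
  proof eventually_elim
    case (elim \<eta>)
    show ?case
      by (rule cubic_energy[OF \<psi>, of r]) (use elim r K(3) in \<open>auto simp: mollifier_def\<close>)
  qed
  then show ?thesis
    using lim[unfolded val] by (simp add: tendsto_cong)
qed

end

section \<open>Alberti's kernels\<close>

lemma norm_matrix_vector_le:
  fixes A :: "real^'n::finite^'m::finite"
  shows "norm (A *v v) \<le> (\<Sum>i\<in>UNIV. \<Sum>j\<in>UNIV. \<bar>A $ i $ j\<bar>) * norm v"
proof -
  have "norm (A *v v) \<le> (\<Sum>i\<in>UNIV. \<bar>(A *v v) $ i\<bar>)" by (rule norm_le_l1_cart)
  also have "\<dots> \<le> (\<Sum>i\<in>UNIV. \<Sum>j\<in>UNIV. \<bar>A $ i $ j\<bar> * norm v)"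
  proof (rule sum_mono)
    fix i
    have "\<bar>(A *v v) $ i\<bar> \<le> (\<Sum>j\<in>UNIV. \<bar>A $ i $ j * v $ j\<bar>)"
      unfolding matrix_vector_mult_def by simp
    also have "\<dots> \<le> (\<Sum>j\<in>UNIV. \<bar>A $ i $ j\<bar> * norm v)"
      by (intro sum_mono) (auto simp: abs_mult intro!: mult_left_mono component_le_norm_cart)
    finally show "\<bar>(A *v v) $ i\<bar> \<le> (\<Sum>j\<in>UNIV. \<bar>A $ i $ j\<bar> * norm v)" .
  qed
  finally show ?thesis by (simp add: sum_distrib_right)
qed

section \<open>The matrix exponential\<close>

primrec mpow :: "real^'n^'n \<Rightarrow> nat \<Rightarrow> real^'n::finite^'n" where
  "mpow N 0 = mat 1"
| "mpow N (Suc k) = N ** mpow N k"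

lemma mpow_Suc_right: "mpow N (Suc k) = mpow N k ** N"
  by (induction k) (simp_all add: matrix_mul_assoc)

definition msize :: "real^'n^'n::finite \<Rightarrow> real" where
  "msize N = 1 + (\<Sum>i\<in>UNIV. \<Sum>j\<in>UNIV. \<bar>N $ i $ j\<bar>)"

lemma msize_ge_1: "msize N \<ge> 1" by (auto simp: msize_def intro!: sum_nonneg)

lemma mpow_bound: "\<bar>mpow N k $ i $ j\<bar> \<le> msize N ^ k"
proof (induction k arbitrary: i j)
  case 0 then show ?case by (simp add: mat_def)
next
  case (Suc k)
  have "\<bar>mpow N (Suc k) $ i $ j\<bar> \<le> (\<Sum>l\<in>UNIV. \<bar>N $ i $ l * mpow N k $ l $ j\<bar>)"
    by (simp add: matrix_matrix_mult_def)
  also have "\<dots> \<le> (\<Sum>l\<in>UNIV. \<bar>N $ i $ l\<bar> * msize N ^ k)"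
    unfolding abs_mult by (intro sum_mono mult_left_mono Suc.IH) auto
  also have "\<dots> = (\<Sum>l\<in>UNIV. \<bar>N $ i $ l\<bar>) * msize N ^ k" by (simp add: sum_distrib_right)
  also have "\<dots> \<le> msize N * msize N ^ k"
  proof (rule mult_right_mono)
    have "(\<Sum>l\<in>UNIV. \<bar>N $ i $ l\<bar>) \<le> (\<Sum>i\<in>UNIV. \<Sum>l\<in>UNIV. \<bar>N $ i $ l\<bar>)"
      by (rule member_le_sum) (auto intro: sum_nonneg)
    then show "(\<Sum>l\<in>UNIV. \<bar>N $ i $ l\<bar>) \<le> msize N" by (simp add: msize_def)
  qed (use msize_ge_1[of N] in auto)
  finally show ?case by simp
qed

text \<open>The exponential of t N, as a matrix of real power series, so that termwise
  differentiation of scalar series applies entry by entry.\<close>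

definition mexp :: "real^'n^'n \<Rightarrow> real \<Rightarrow> real^'n::finite^'n" where
  "mexp N t = (\<chi> i j. \<Sum>k. mpow N k $ i $ j / fact k * t ^ k)"

lemma mexp_dom: "summable (\<lambda>k. (msize N * \<bar>t\<bar>) ^ k / fact k)"
  using summable_exp[of "msize N * \<bar>t\<bar>"] by (simp add: field_simps)

lemma mexp_term: "norm (mpow N k $ i $ j / fact k * t ^ k) \<le> (msize N * \<bar>t\<bar>) ^ k / fact k"
proof -
  have "norm (mpow N k $ i $ j / fact k * t ^ k) = \<bar>mpow N k $ i $ j\<bar> * \<bar>t\<bar> ^ k / fact k"
    by (simp add: abs_mult power_abs)
  also have "\<dots> \<le> msize N ^ k * \<bar>t\<bar> ^ k / fact k"
    by (intro divide_right_mono mult_right_mono mpow_bound) auto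
  finally show ?thesis by (simp add: power_mult_distrib)
qed

lemma mexp_summable: "summable (\<lambda>k. mpow N k $ i $ j / fact k * t ^ k)"
  by (rule summable_comparison_test'[OF mexp_dom mexp_term])

lemma mexp_bound: "\<bar>mexp N t $ i $ j\<bar> \<le> exp (msize N * \<bar>t\<bar>)"
proof -
  have s: "summable (\<lambda>k. norm (mpow N k $ i $ j / fact k * t ^ k))"
    by (rule summable_comparison_test'[OF mexp_dom[of N t]]) (use mexp_term in auto)
  have "\<bar>mexp N t $ i $ j\<bar> \<le> (\<Sum>k. norm (mpow N k $ i $ j / fact k * t ^ k))"
    using summable_norm[OF s] by (simp add: mexp_def)
  also have "\<dots> \<le> (\<Sum>k. (msize N * \<bar>t\<bar>) ^ k / fact k)"
    by (rule suminf_le[OF mexp_term s mexp_dom])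
  also have "\<dots> = exp (msize N * \<bar>t\<bar>)" by (simp add: exp_def field_simps)
  finally show ?thesis .
qed

lemma mexp_0: "mexp N 0 = mat 1"
proof -
  have "(\<Sum>k. mpow N k $ i $ j / fact k * 0 ^ k) = mat 1 $ i $ j" for i j
    using suminf_finite[of "{0}" "\<lambda>k. mpow N k $ i $ j / fact k * 0 ^ k"] by simp
  then show ?thesis by (simp add: mexp_def vec_eq_iff)
qed

text \<open>Left and right multiplication by \<open>N\<close> in one statement: the coefficients
  \<open>c\<close> and the index maps \<open>a\<close>, \<open>b\<close> say which row or column is
  contracted.\<close>

lemma mexp_deriv_aux:
  assumes "\<And>k. mpow N (Suc k) $ i $ j = (\<Sum>l\<in>UNIV. c l * mpow N k $ a l $ b l)"
  shows "((\<lambda>t. mexp N t $ i $ j) has_real_derivative (\<Sum>l\<in>UNIV. c l * mexp N t $ a l $ b l)) (at t)"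
proof -
  have d: "diffs (\<lambda>k. mpow N k $ i $ j / fact k) = (\<lambda>k. \<Sum>l\<in>UNIV. c l * (mpow N k $ a l $ b l / fact k))"
    unfolding diffs_def
  proof
    fix k
    have "of_nat (Suc k) * (mpow N (Suc k) $ i $ j / fact (Suc k)) = mpow N (Suc k) $ i $ j / fact k"
      by (simp add: divide_simps del: mpow.simps)
    then show "of_nat (Suc k) * (mpow N (Suc k) $ i $ j / fact (Suc k)) = (\<Sum>l\<in>UNIV. c l * (mpow N k $ a l $ b l / fact k))"
      unfolding assms by (simp add: sum_divide_distrib)
  qed
  have "(\<Sum>k. diffs (\<lambda>k. mpow N k $ i $ j / fact k) k * t ^ k) =
      (\<Sum>k. \<Sum>l\<in>UNIV. c l * (mpow N k $ a l $ b l / fact k * t ^ k))"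
    by (simp only: d sum_distrib_right mult.assoc)
  also have "\<dots> = (\<Sum>l\<in>UNIV. \<Sum>k. c l * (mpow N k $ a l $ b l / fact k * t ^ k))"
    by (rule suminf_sum) (rule summable_mult[OF mexp_summable])
  also have "\<dots> = (\<Sum>l\<in>UNIV. c l * mexp N t $ a l $ b l)"
    by (simp only: suminf_mult[OF mexp_summable] mexp_def vec_lambda_beta)
  finally have "(\<Sum>k. diffs (\<lambda>k. mpow N k $ i $ j / fact k) k * t ^ k) = \<dots>" .
  moreover have "((\<lambda>t. \<Sum>k. mpow N k $ i $ j / fact k * t ^ k) has_real_derivative
      (\<Sum>k. diffs (\<lambda>k. mpow N k $ i $ j / fact k) k * t ^ k)) (at t)"
    by (rule termdiffs_strong_converges_everywhere) (rule mexp_summable)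
  ultimately show ?thesis by (simp add: mexp_def)
qed

lemma mexp_deriv: "((\<lambda>t. mexp N t $ i $ j) has_real_derivative (N ** mexp N t) $ i $ j) (at t)"
  using mexp_deriv_aux[of N i j "\<lambda>l. N $ i $ l" "\<lambda>l. l" "\<lambda>l. j" t]
  by (simp add: matrix_matrix_mult_def)

lemma mexp_deriv': "((\<lambda>t. mexp N t $ i $ j) has_real_derivative (mexp N t ** N) $ i $ j) (at t)"
  using mexp_deriv_aux[of N i j "\<lambda>l. N $ l $ j" "\<lambda>l. i" "\<lambda>l. l" t]
  by (simp add: mpow_Suc_right matrix_matrix_mult_def mult.commute del: mpow.simps)

text \<open>The product has derivative 0 when the first factor is differentiated with
  \<open>N\<close> on its right and the second with \<open>N\<close> on its left; then associativity
  alone gives the cancellation.\<close>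

lemma mexp_inverse: "mexp N (- t) ** mexp N t = mat 1"
proof -
  have "(mexp N (- t) ** mexp N t) $ i $ j = (mexp N (- 0) ** mexp N 0) $ i $ j" for i j
  proof (rule DERIV_isconst_all[of "\<lambda>t. (mexp N (- t) ** mexp N t) $ i $ j"], intro allI)
    fix s
    have n: "((\<lambda>s. mexp N (- s) $ i $ l) has_real_derivative - (mexp N (- s) ** N) $ i $ l) (at s)" for l
      by (rule DERIV_mirror[THEN iffD1, OF mexp_deriv'])
    have "((\<lambda>s. \<Sum>l\<in>UNIV. mexp N (- s) $ i $ l * mexp N s $ l $ j) has_real_derivative
       (\<Sum>l\<in>UNIV. mexp N (- s) $ i $ l * (N ** mexp N s) $ l $ j + - (mexp N (- s) ** N) $ i $ l * mexp N s $ l $ j)) (at s)"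
      by (intro DERIV_sum DERIV_mult'[OF n mexp_deriv])
    also have "(\<Sum>l\<in>UNIV. mexp N (- s) $ i $ l * (N ** mexp N s) $ l $ j + - (mexp N (- s) ** N) $ i $ l * mexp N s $ l $ j)
       = (mexp N (- s) ** (N ** mexp N s)) $ i $ j - ((mexp N (- s) ** N) ** mexp N s) $ i $ j"
      by (simp add: matrix_matrix_mult_def[of "mexp N (- s)" "N ** mexp N s"]
          matrix_matrix_mult_def[of "mexp N (- s) ** N" "mexp N s"] sum.distrib sum_negf sum_subtractf)
    also have "\<dots> = 0" by (simp add: matrix_mul_assoc)
    finally show "((\<lambda>t. (mexp N (- t) ** mexp N t) $ i $ j) has_real_derivative 0) (at s)"
      by (simp add: matrix_matrix_mult_def)
  qed
  then show ?thesis by (simp add: vec_eq_iff mexp_0)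
qed

lemma mexp_continuous: "continuous_on S (\<lambda>t. mexp N t *v v)"
proof -
  have "continuous_on S (\<lambda>t. mexp N t $ i $ j)" for i j
    using DERIV_isCont[OF mexp_deriv] by (intro continuous_at_imp_continuous_on) auto
  then show ?thesis
    unfolding matrix_vector_mult_def by (intro continuous_on_vec_lambda continuous_on_sum continuous_on_mult_right)
qed

text \<open>The entry bound \<open>mexp_bound\<close> times the number of entries: an operator bound
  valid for all times in [-T, T], backward flow included.\<close>

definition mexp_size :: "real^'n::finite^'n \<Rightarrow> real \<Rightarrow> real" where
  "mexp_size N T = real CARD('n) * real CARD('n) * exp (msize N * T)"

lemma mexp_norm: 
  fixes N :: "real^'n::finite^'n"
  assumes "\<bar>t\<bar> \<le> T" shows "norm (mexp N t *v v) \<le> mexp_size N T * norm v"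
proof -
  have "exp (msize N * \<bar>t\<bar>) \<le> exp (msize N * T)"
    using assms msize_ge_1[of N] by (simp add: mult_left_mono)
  then have "(\<Sum>i\<in>UNIV. \<Sum>j\<in>UNIV. \<bar>mexp N t $ i $ j\<bar>) \<le> (\<Sum>i\<in>(UNIV::'n set). \<Sum>j\<in>(UNIV::'n set). exp (msize N * T))"
    by (intro sum_mono) (meson mexp_bound order_trans)
  then have "(\<Sum>i\<in>UNIV. \<Sum>j\<in>UNIV. \<bar>mexp N t $ i $ j\<bar>) \<le> mexp_size N T"
    by (simp add: mexp_size_def)
  from mult_right_mono[OF this norm_ge_zero[of v]] show ?thesis
    using norm_matrix_vector_le[of "mexp N t" v] by linarith
qed

lemma mexp_size_pos: "mexp_size N T > 0" unfolding mexp_size_def by simp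

text \<open>The velocity is written with \<open>N\<close> acting first on \<open>y\<close>. In this
  form it is also the derivative in y of the flowed bump in the direction \<open>N *v y\<close>, and
  the two readings together produce the telescoping.\<close>

lemma mexp_flow_derivative:
  fixes f :: "real^'n::finite \<Rightarrow> real"
  assumes "smooth f"
  shows "((\<lambda>t. f (mexp N t *v y)) has_real_derivative dd f (mexp N t *v y) (mexp N t *v (N *v y))) (at t)"
proof -
  have c: "((\<lambda>t. (mexp N t *v y) $ i) has_real_derivative (mexp N t *v (N *v y)) $ i) (at t)" for i
  proof -
    have "((\<lambda>t. \<Sum>j\<in>UNIV. mexp N t $ i $ j * y $ j) has_real_derivative (\<Sum>j\<in>UNIV. (mexp N t ** N) $ i $ j * y $ j)) (at t)"
      by (intro DERIV_sum DERIV_cmult_right mexp_deriv')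
    then show ?thesis unfolding matrix_vector_mul_assoc by (simp add: matrix_vector_mult_def)
  qed
  have "((\<lambda>t. mexp N t *v y) has_derivative (\<lambda>h. h *\<^sub>R (mexp N t *v (N *v y)))) (at t)"
  proof (rule iffD2[OF has_derivative_componentwise_within], rule ballI)
    fix b :: "real^'n" assume "b \<in> Basis"
    then obtain i where b: "b = axis i 1" by (auto simp: Basis_vec_def)
    show "((\<lambda>t. (mexp N t *v y) \<bullet> b) has_derivative (\<lambda>h. (h *\<^sub>R (mexp N t *v (N *v y))) \<bullet> b)) (at t)"
      unfolding b using c[of i] by (simp add: has_field_derivative_def inner_axis mult.commute[of _ "_ $ _"])
  qed
  from has_derivative_compose[OF this smooth_has_derivative[OF assms]]
  show ?thesis unfolding has_field_derivative_def
    by (rule has_derivative_eq_rhs)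
       (auto simp: linear_cmul[OF bounded_linear.linear[OF smooth_dd_linear[OF assms]]] mult.commute)
qed

lemma dd_axis_expand:
  fixes f :: "real^'n::finite \<Rightarrow> real"
  assumes "smooth f" shows "dd f y v = (\<Sum>i\<in>UNIV. v $ i * dd f y (axis i 1))"
proof -
  have lin: "linear (dd f y)" using smooth_dd_linear[OF assms] by (rule bounded_linear.linear)
  have "v = (\<Sum>i\<in>UNIV. (v $ i) *\<^sub>R axis i 1)" by (simp add: basis_expansion flip: scalar_mult_eq_scaleR)
  then have "dd f y v = dd f y (\<Sum>i\<in>UNIV. (v $ i) *\<^sub>R axis i 1)" by simp
  then show ?thesis by (simp add: linear_sum[OF lin] linear_cmul[OF lin])
qed

lemma dd_continuous:
  fixes f :: "'a::euclidean_space \<Rightarrow> real"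
  assumes "smooth f" shows "continuous_on UNIV (\<lambda>(x, v). dd f x v)"
proof -
  have "continuous_on UNIV (\<lambda>p. \<Sum>b\<in>Basis. (snd p \<bullet> b) * dd f (fst p) b)"
    by (intro continuous_intros continuous_on_compose2[OF smooth_continuous[OF smooth_dd[OF assms], of UNIV]]) auto
  then show ?thesis by (simp add: dd_expand[OF assms, symmetric] case_prod_beta)
qed

text \<open>Dilating one fixed bump: the normalisation costs r^(-n) and the derivative one more
  power of r, while the constant \<open>C\<close> is the same for all scales.\<close>

lemma mollifier_scaled:
  "\<exists>C\<ge>0. \<forall>r>0. \<exists>\<eta>::'a::euclidean_space \<Rightarrow> real. mollifier r \<eta> \<and> (\<forall>x v. \<bar>dd \<eta> x v\<bar> \<le> C / r ^ (DIM('a) + 1) * norm v)"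
proof -
  obtain \<eta> :: "'a \<Rightarrow> real" where \<eta>: "mollifier 1 \<eta>" using mollifier_exists[of 1] by auto
  then have \<eta>': "test_fn (ball 0 1) \<eta>" "\<And>x. \<eta> x \<ge> 0" "(\<integral>x. \<eta> x \<partial>lborel) = 1" by (auto simp: mollifier_def)
  have sm: "smooth \<eta>" using \<eta>'(1) by (rule test_fn_smooth)
  obtain C where C: "C \<ge> 0" "\<And>x v. norm (dd \<eta> x v) \<le> C * norm v" using test_fn_dd_bound[OF \<eta>'(1)] by blast
  show ?thesis
  proof (intro exI[of _ C] conjI C(1) allI impI)
    fix r :: real assume r: "r > 0"
    define c where "c = inverse r"
    have c: "c > 0" using r by (simp add: c_def)
    have bl: "bounded_linear (\<lambda>x::'a. c *\<^sub>R x)" by (rule bounded_linear_scaleR_right)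
    define \<theta> where "\<theta> x = \<eta> (c *\<^sub>R x) * c ^ DIM('a)" for x
    have sm1: "smooth (\<lambda>x. \<eta> (c *\<^sub>R x))" using smooth_affine[OF bl sm, of 0] by simp
    have d1: "dd (\<lambda>x. \<eta> (c *\<^sub>R x)) x v = dd \<eta> (c *\<^sub>R x) (c *\<^sub>R v)" for x v
      using dd_affine[OF bl sm, of 0 x v] by simp
    from test_fnD[OF \<eta>'(1)] obtain K where K: "compact K" "K \<subseteq> ball 0 1" "\<And>x. x \<notin> K \<Longrightarrow> \<eta> x = 0" by blast
    have t1: "test_fn (ball 0 r) (\<lambda>x. \<eta> (c *\<^sub>R x))"
    proof (rule test_fnI[OF sm1, of "(\<lambda>x. r *\<^sub>R x) ` K"])
      show "compact ((\<lambda>x. r *\<^sub>R x) ` K)" by (rule compact_scaling[OF K(1)])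
      show "(\<lambda>x. r *\<^sub>R x) ` K \<subseteq> ball 0 r" using K(2) r by (auto simp: subset_iff)
      show "\<eta> (c *\<^sub>R x) = 0" if "x \<notin> (\<lambda>x. r *\<^sub>R x) ` K" for x
      proof (rule K(3), rule notI)
        assume "c *\<^sub>R x \<in> K"
        then have "r *\<^sub>R (c *\<^sub>R x) \<in> (\<lambda>x. r *\<^sub>R x) ` K" by blast
        then show False using that r by (simp add: c_def)
      qed
    qed
    have t: "test_fn (ball 0 r) \<theta>" unfolding \<theta>_def by (rule test_fn_mult[OF t1 smooth_const])
    note [measurable] = test_fn_measurable[OF \<eta>'(1)]
    have "(\<integral>x. \<eta> x \<partial>lborel) = (\<integral>x. \<eta> x \<partial>density (distr lborel borel (\<lambda>x. 0 + c *\<^sub>R x)) (\<lambda>_. \<bar>c\<bar>^DIM('a)))"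
      using c by (subst lborel_affine[of c 0]) auto
    also have "\<dots> = (\<integral>x. \<theta> x \<partial>lborel)"
      using c by (subst integral_density) (auto simp: integral_distr \<theta>_def[abs_def] mult.commute)
    finally have I: "(\<integral>x. \<theta> x \<partial>lborel) = 1" using \<eta>'(3) by simp
    have m: "mollifier r \<theta>" using t I \<eta>'(2) c by (auto simp: mollifier_def \<theta>_def)
    moreover have "\<bar>dd \<theta> x v\<bar> \<le> C / r ^ (DIM('a) + 1) * norm v" for x v
    proof -
      have "dd \<theta> x v = dd \<eta> (c *\<^sub>R x) (c *\<^sub>R v) * c ^ DIM('a)"
        unfolding \<theta>_def by (subst dd_bounded_linear[OF bounded_linear_mult_left sm1]) (simp add: d1)
      also have "\<bar>\<dots>\<bar> \<le> C * norm (c *\<^sub>R v) * c ^ DIM('a)"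
        unfolding abs_mult using C(2)[of "c *\<^sub>R x" "c *\<^sub>R v"] c by (intro mult_mono) auto
      also have "\<dots> = C / r ^ (DIM('a) + 1) * norm v"
        using r by (simp add: c_def field_simps)
      finally show ?thesis .
    qed
    ultimately show "\<exists>\<eta>::'a \<Rightarrow> real. mollifier r \<eta> \<and> (\<forall>x v. \<bar>dd \<eta> x v\<bar> \<le> C / r ^ (DIM('a) + 1) * norm v)"
      by blast
  qed
qed

lemma mollifierD:
  assumes "mollifier r \<eta>"
  shows "test_fn (ball 0 r) \<eta>" "\<eta> x \<ge> 0" "(\<integral>x. \<eta> x \<partial>lborel) = 1"
  using assms by (auto simp: mollifier_def)

section \<open>Averaging a bump along the flow of a trace free matrix\<close>

context
  fixes N :: "real^'n::finite^'n" and T :: real and \<eta> :: "real^'n \<Rightarrow> real" and r :: real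
  assumes tr: "(\<Sum>i\<in>UNIV. N $ i $ i) = 0" and T: "T > 0" and \<eta>: "mollifier r \<eta>"
begin

text \<open>Time is clamped to [0, T] so that the uniform operator bound demanded by
  \<open>par_int\<close> holds on the whole line; the weight vanishes where clamping
  matters.\<close>

definition flow_clamp :: "real \<Rightarrow> real^'n \<Rightarrow> real^'n" where
  "flow_clamp t v = mexp N (max 0 (min T t)) *v v"

definition flow_weight :: "real \<Rightarrow> real" where "flow_weight t = indicator {0..T} t / T"

definition flow_avg :: "real^'n \<Rightarrow> real" where
  "flow_avg = par_int lborel flow_clamp (\<lambda>_. 0) flow_weight \<eta>"

lemmas \<eta>' = mollifierD[OF \<eta>]

lemma flow_clamp_facts:
  "linear (flow_clamp t)" "norm (flow_clamp t v) \<le> mexp_size N T * norm v"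
  "(\<lambda>t. flow_clamp t v) \<in> borel_measurable lborel"
proof -
  show "linear (flow_clamp t)"
    unfolding flow_clamp_def[abs_def] by (rule matrix_vector_mul_linear)
  show "norm (flow_clamp t v) \<le> mexp_size N T * norm v"
    unfolding flow_clamp_def using T by (intro mexp_norm) auto
  have "continuous_on UNIV (\<lambda>t. flow_clamp t v)"
    unfolding flow_clamp_def
    by (rule continuous_on_compose2[OF mexp_continuous[of UNIV]]) (auto intro!: continuous_intros)
  then show "(\<lambda>t. flow_clamp t v) \<in> borel_measurable lborel"
    using borel_measurable_continuous_onI by auto
qed

lemma flow_weight_int: "integrable lborel flow_weight" "(\<integral>t. flow_weight t \<partial>lborel) = 1" "flow_weight t \<ge> 0"
  using T by (auto simp: flow_weight_def[abs_def])

lemma flow_par: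
  "smooth flow_avg"
  "integrable lborel (\<lambda>t. flow_weight t * \<eta> (flow_clamp t y))"
  "integrable lborel (\<lambda>t. flow_weight t * dd \<eta> (flow_clamp t y) (flow_clamp t v))"
  "dd flow_avg y v = (\<integral>t. flow_weight t * dd \<eta> (flow_clamp t y) (flow_clamp t v) \<partial>lborel)"
proof -
  have s: "mexp_size N T \<ge> 0" using mexp_size_pos[of N T] by simp
  have z: "(\<lambda>_. 0) \<in> borel_measurable lborel" by simp
  note a = flow_clamp_facts(1) flow_clamp_facts(2) s flow_clamp_facts(3) z flow_weight_int(1) \<eta>'(1)
  show "smooth flow_avg" unfolding flow_avg_def by (rule par_int_smooth[OF a])
  show "integrable lborel (\<lambda>t. flow_weight t * \<eta> (flow_clamp t y))"
    using par_int_integrable[OF a] by simp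
  show "integrable lborel (\<lambda>t. flow_weight t * dd \<eta> (flow_clamp t y) (flow_clamp t v))"
    using par_int_dd_expand(1)[OF a] by simp
  show "dd flow_avg y v = (\<integral>t. flow_weight t * dd \<eta> (flow_clamp t y) (flow_clamp t v) \<partial>lborel)"
    unfolding flow_avg_def using par_int_dd[OF a] by simp
qed

lemma flow_avg_eq: "flow_avg y = (\<integral>t. flow_weight t * \<eta> (flow_clamp t y) \<partial>lborel)"
  by (simp add: flow_avg_def par_int_def)

text \<open>Flowing backwards enlarges norms by at most \<open>mexp_size N T\<close>, so a far point
  cannot be carried into the support of the bump.\<close>

lemma flow_outside:
  fixes y :: "real^'n"
  assumes "norm y \<ge> mexp_size N T * r" shows "\<eta> (flow_clamp t y) = 0"
proof (rule test_fn_outside[OF \<eta>'(1)], rule notI)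
  assume "flow_clamp t y \<in> ball 0 r"
  then have lt: "norm (flow_clamp t y) < r" by simp
  define s where "s = max 0 (min T t)"
  have "y = mexp N (- s) *v (mexp N s *v y)"
    by (simp add: matrix_vector_mul_assoc mexp_inverse)
  then have "norm y = norm (mexp N (- s) *v (mexp N s *v y))" by simp
  also have "\<dots> \<le> mexp_size N T * norm (mexp N s *v y)"
    using T by (intro mexp_norm) (auto simp: s_def)
  also have "\<dots> < mexp_size N T * r"
    using lt mexp_size_pos[of N T] by (simp add: flow_clamp_def s_def)
  finally show False using assms by simp
qed

lemma flow_avg_test: "mexp_size N T * r < r' \<Longrightarrow> test_fn (ball 0 r') flow_avg"
proof (rule test_fnI[OF flow_par(1), of "cball 0 (mexp_size N T * r)"])
  fix y :: "real^'n" assume "y \<notin> cball 0 (mexp_size N T * r)"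
  then have "\<eta> (flow_clamp t y) = 0" for t by (intro flow_outside) auto
  then show "flow_avg y = 0" by (simp add: flow_avg_eq)
qed auto

lemma flow_avg_test': "test_fn (ball 0 (mexp_size N T * r + 1)) flow_avg"
  by (rule flow_avg_test) simp

text \<open>Along \<open>N *v y\<close> the derivative of the average is the average of time
  derivatives, and the fundamental theorem leaves only the two end points, divided by T.\<close>

lemma flow_dd_telescope: "dd flow_avg y (N *v y) = (\<eta> (mexp N T *v y) - \<eta> y) / T"
proof -
  have sm: "smooth \<eta>" using \<eta>'(1) by (rule test_fn_smooth)
  let ?f = "\<lambda>t. dd \<eta> (mexp N t *v y) (mexp N t *v (N *v y))"
  have "dd flow_avg y (N *v y) = (\<integral>t. (indicator {0..T} t *\<^sub>R ?f t) / T \<partial>lborel)"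
    unfolding flow_par(4) by (intro Bochner_Integration.integral_cong refl) (auto simp: flow_weight_def flow_clamp_def indicator_def)
  also have "\<dots> = (\<integral>t. indicator {0..T} t *\<^sub>R ?f t \<partial>lborel) / T" by simp
  also have "(\<integral>t. indicator {0..T} t *\<^sub>R ?f t \<partial>lborel) = \<eta> (mexp N T *v y) - \<eta> (mexp N 0 *v y)"
  proof (rule integral_FTC_atLeastAtMost)
    show "continuous_on {0..T} ?f"
      by (rule continuous_on_compose2[OF dd_continuous[OF sm], of _ "\<lambda>t. (mexp N t *v y, mexp N t *v (N *v y))", simplified])
         (intro continuous_intros mexp_continuous)
    fix t
    show "((\<lambda>t. \<eta> (mexp N t *v y)) has_vector_derivative ?f t) (at t within {0..T})"
      using mexp_flow_derivative[OF sm, of N y t]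
      by (simp add: has_real_derivative_iff_has_vector_derivative has_vector_derivative_at_within)
  qed (use T in auto)
  finally show ?thesis by (simp add: mexp_0)
qed

text \<open>Integration by parts: the derivative in direction i times the coordinate j integrates to
  minus the mass if i = j and to 0 otherwise. Summation against \<open>N\<close> leaves the
  trace.\<close>

lemma flow_dd_integral: "(\<integral>y. dd flow_avg y (N *v y) \<partial>lborel) = 0"
proof -
  note t = flow_avg_test'
  have sm: "smooth flow_avg" by (rule flow_par(1))
  have smj: "smooth (\<lambda>y::real^'n. y $ j)" for j by (rule smooth_linear[OF bounded_linear_vec_nth])
  have ddj: "dd (\<lambda>y::real^'n. y $ j) y v = v $ j" for j y v
    by (rule dd_eq[OF bounded_linear_imp_has_derivative[OF bounded_linear_vec_nth]])
  have tj: "test_fn (ball 0 (mexp_size N T * r + 1)) (\<lambda>y. flow_avg y * y $ j)" for j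
    by (rule test_fn_mult[OF t smj])
  have tij: "test_fn (ball 0 (mexp_size N T * r + 1)) (\<lambda>y. dd flow_avg y v * y $ j)" for j v
    by (rule test_fn_mult[OF test_fn_dd[OF t] smj])
  note int = test_fn_integrable[OF tij] test_fn_integrable[OF t]
  have e: "(\<integral>y. dd flow_avg y (axis i 1) * y $ j \<partial>lborel) = - (if i = j then \<integral>y. flow_avg y \<partial>lborel else 0)" for i j
    using test_fn_integral_dd[OF tj, of j "axis i 1"] int
    by (simp add: dd_mult[OF sm smj] ddj axis_def split: if_splits)
  have "dd flow_avg y (N *v y) = (\<Sum>i\<in>UNIV. \<Sum>j\<in>UNIV. N $ i $ j * (dd flow_avg y (axis i 1) * y $ j))" for y
  proof -
    have c: "(N *v y) $ i = (\<Sum>j\<in>UNIV. N $ i $ j * y $ j)" for i by (simp add: matrix_vector_mult_def)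
    show ?thesis unfolding dd_axis_expand[OF sm, of y "N *v y"] c by (simp add: sum_distrib_right sum_distrib_left mult_ac)
  qed
  then have "(\<integral>y. dd flow_avg y (N *v y) \<partial>lborel) = (\<Sum>i\<in>UNIV. \<Sum>j\<in>UNIV. N $ i $ j * (\<integral>y. dd flow_avg y (axis i 1) * y $ j \<partial>lborel))"
    using int by (simp add: Bochner_Integration.integral_sum)
  also have "\<dots> = - (\<Sum>i\<in>UNIV. N $ i $ i) * (\<integral>y. flow_avg y \<partial>lborel)"
    unfolding e by (simp add: sum_distrib_right sum_negf if_distrib[of "\<lambda>x. - x"] if_distrib[of "\<lambda>x. _ * x"] cong: if_cong)
  finally show ?thesis using tr by simp
qed

text \<open>Volume preservation without determinants: integrate \<open>flow_dd_telescope\<close>,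
  whose left side has integral 0, so both end points carry the same mass.\<close>

lemma flow_jacobian:
  "integrable lborel (\<lambda>y. \<eta> (mexp N T *v y))" "(\<integral>y. \<eta> (mexp N T *v y) \<partial>lborel) = 1"
proof -
  have i\<eta>: "integrable lborel \<eta>" by (rule test_fn_integrable[OF \<eta>'(1)])
  have eq: "\<eta> (mexp N T *v y) = T * dd flow_avg y (N *v y) + \<eta> y" for y
    unfolding flow_dd_telescope using T by simp
  have "test_fn (ball 0 (mexp_size N T * r + 1)) (\<lambda>y. dd flow_avg y (N *v y))"
  proof -
    note t = flow_avg_test'
    have "dd flow_avg y (N *v y) = (\<Sum>i\<in>UNIV. dd flow_avg y (axis i 1) * ((N *v y) $ i))" for y
      by (subst dd_axis_expand[OF flow_par(1)]) (simp add: mult.commute)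
    moreover have "smooth (\<lambda>y. (N *v y) $ i)" for i
      by (rule smooth_linear[OF bounded_linear_compose[OF bounded_linear_vec_nth matrix_vector_mul_bounded_linear]])
    ultimately show ?thesis by (simp add: test_fn_sum test_fn_mult[OF test_fn_dd[OF t]])
  qed
  from test_fn_integrable[OF this] i\<eta>
  show "integrable lborel (\<lambda>y. \<eta> (mexp N T *v y))" "(\<integral>y. \<eta> (mexp N T *v y) \<partial>lborel) = 1"
    unfolding eq using flow_dd_integral \<eta>'(3) by auto
qed

text \<open>The two end points are bumps of mass 1, so dividing by T makes the cost decay like 2 /
  T.\<close>

lemma flow_dd_L1: "(\<integral>y. \<bar>dd flow_avg y (N *v y)\<bar> \<partial>lborel) \<le> 2 / T"
proof -
  note i = flow_jacobian(1) test_fn_integrable[OF \<eta>'(1)]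
  have "(\<integral>y. \<bar>dd flow_avg y (N *v y)\<bar> \<partial>lborel) \<le> (\<integral>y. (\<eta> (mexp N T *v y) + \<eta> y) / T \<partial>lborel)"
  proof (rule integral_mono)
    show "integrable lborel (\<lambda>y. \<bar>dd flow_avg y (N *v y)\<bar>)"
      unfolding flow_dd_telescope using i by simp
    show "integrable lborel (\<lambda>y. (\<eta> (mexp N T *v y) + \<eta> y) / T)" using i by simp
    show "\<bar>dd flow_avg y (N *v y)\<bar> \<le> (\<eta> (mexp N T *v y) + \<eta> y) / T" for y
      unfolding flow_dd_telescope using T \<eta>'(2)[of y] \<eta>'(2)[of "mexp N T *v y"] by (simp add: divide_le_cancel)
  qed
  also have "\<dots> = 2 / T" using i flow_jacobian(2) \<eta>'(3) by simp
  finally show ?thesis .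
qed

lemma flow_dd_bound:
  assumes "\<And>x v. \<bar>dd \<eta> x v\<bar> \<le> D * norm v" "D \<ge> 0"
  shows "\<bar>dd flow_avg y v\<bar> \<le> D * mexp_size N T * norm v"
proof -
  have b: "\<bar>flow_weight t * dd \<eta> (flow_clamp t y) (flow_clamp t v)\<bar> \<le> flow_weight t * (D * mexp_size N T * norm v)" for t
  proof -
    have "\<bar>dd \<eta> (flow_clamp t y) (flow_clamp t v)\<bar> \<le> D * norm (flow_clamp t v)" by (rule assms)
    also have "\<dots> \<le> D * (mexp_size N T * norm v)" using assms(2) flow_clamp_facts(2) by (intro mult_left_mono)
    finally show ?thesis using flow_weight_int(3)[of t] by (auto simp: abs_mult mult.assoc intro!: mult_left_mono)
  qed
  have "\<bar>dd flow_avg y v\<bar> \<le> (\<integral>t. flow_weight t * (D * mexp_size N T * norm v) \<partial>lborel)"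
    unfolding flow_par(4)
    by (rule order.trans[OF integral_abs_bound integral_mono]) (use flow_par(3)[of y v] flow_weight_int(1) b in auto)
  also have "\<dots> = D * mexp_size N T * norm v" using flow_weight_int(2) by simp
  finally show ?thesis .
qed

end

lemma flow_avg_mollifier:
  fixes N :: "real^'n::finite^'n"
  assumes tr: "(\<Sum>i\<in>UNIV. N $ i $ i) = 0" and T: "T > 0" and \<eta>: "mollifier r \<eta>" and r': "mexp_size N T * r < r'"
  shows "mollifier r' (flow_avg N T \<eta>)"
proof -
  note \<eta>' = mollifierD[OF \<eta>]
  note fw = flow_weight_int[OF tr T \<eta>] 
  note fa = flow_avg_eq[OF tr T \<eta>]
  have m1 [measurable]: "\<eta> \<in> borel_measurable borel" by (rule test_fn_measurable[OF \<eta>'(1)])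
  have m2 [measurable]: "flow_weight T \<in> borel_measurable borel" using fw(1) by auto
  have cl: "continuous_on UNIV (\<lambda>p. flow_clamp N T (fst p) (snd p))"
  proof -
    have "continuous_on UNIV (\<lambda>t. mexp N t $ i $ j)" for i j
      using DERIV_isCont[OF mexp_deriv] by (intro continuous_at_imp_continuous_on) auto
    then have cc: "continuous_on UNIV (\<lambda>p::real \<times> (real^'n). mexp N (max 0 (min T (fst p))) $ i $ j)" for i j
      by (rule continuous_on_compose2) (auto intro!: continuous_intros)
    show ?thesis
      unfolding flow_clamp_def[OF tr T \<eta>] matrix_vector_mult_def
      by (intro continuous_on_vec_lambda continuous_on_sum continuous_on_mult)
         (rule cc, intro continuous_on_component continuous_on_snd continuous_on_id)
  qed
  have m3 [measurable]: "(\<lambda>p. flow_clamp N T (fst p) (snd p)) \<in> borel_measurable (lborel \<Otimes>\<^sub>M lborel)"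
    using borel_measurable_continuous_onI[OF cl] by (simp add: lborel_prod)
  have J: "integrable lborel (\<lambda>y. flow_weight T t * \<eta> (flow_clamp N T t y))"
    "(\<integral>y. flow_weight T t * \<eta> (flow_clamp N T t y) \<partial>lborel) = flow_weight T t" for t
  proof -
    have "integrable lborel (\<lambda>y. flow_weight T t * \<eta> (flow_clamp N T t y)) \<and>
      (\<integral>y. flow_weight T t * \<eta> (flow_clamp N T t y) \<partial>lborel) = flow_weight T t"
    proof (cases "t \<in> {0..T}")
      case False
      then have "flow_weight T t = 0" by (simp add: flow_weight_def[OF tr T \<eta>])
      then show ?thesis by simp
    next
      case True
      then have c: "flow_clamp N T t y = mexp N t *v y" for y by (simp add: flow_clamp_def[OF tr T \<eta>])
      show ?thesis
      \<comment> \<open>\<open>flow_jacobian\<close> speaks of the end of a time interval of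
        positive length, so it is applied with horizon t; at t = 0 the flow is the identity.\<close>
      proof (cases "t = 0")
        case True
        then show ?thesis unfolding c using \<eta>' test_fn_integrable[OF \<eta>'(1)] by (simp add: mexp_0)
      next
        case False
        with \<open>t \<in> {0..T}\<close> have "t > 0" by simp
        from flow_jacobian[OF tr this \<eta>] show ?thesis unfolding c by simp
      qed
    qed
    then show "integrable lborel (\<lambda>y. flow_weight T t * \<eta> (flow_clamp N T t y))"
      "(\<integral>y. flow_weight T t * \<eta> (flow_clamp N T t y) \<partial>lborel) = flow_weight T t" by auto
  qed
  have i2: "integrable (lborel \<Otimes>\<^sub>M lborel) (\<lambda>(t, y). flow_weight T t * \<eta> (flow_clamp N T t y))"
  proof (rule lborel_pair.Fubini_integrable)
    show "(\<lambda>(t, y). flow_weight T t * \<eta> (flow_clamp N T t y)) \<in> borel_measurable (lborel \<Otimes>\<^sub>M lborel)"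
      unfolding case_prod_beta by measurable
    have "(\<integral>y. norm (flow_weight T t * \<eta> (flow_clamp N T t y)) \<partial>lborel) = flow_weight T t" for t
      using J(2)[of t] \<eta>'(2) fw(3) by (simp add: abs_mult)
    then show "integrable lborel (\<lambda>t. \<integral>y. norm (case (t, y) of (t, y) \<Rightarrow> flow_weight T t * \<eta> (flow_clamp N T t y)) \<partial>lborel)"
      using fw(1) by simp
    show "AE t in lborel. integrable lborel (\<lambda>y. case (t, y) of (t, y) \<Rightarrow> flow_weight T t * \<eta> (flow_clamp N T t y))"
      using J(1) by simp
  qed
  have "(\<integral>y. flow_avg N T \<eta> y \<partial>lborel) = (\<integral>y. (\<integral>t. flow_weight T t * \<eta> (flow_clamp N T t y) \<partial>lborel) \<partial>lborel)"
    unfolding fa ..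
  also have "\<dots> = (\<integral>t. (\<integral>y. flow_weight T t * \<eta> (flow_clamp N T t y) \<partial>lborel) \<partial>lborel)"
    by (rule lborel_pair.Fubini_integral[OF i2])
  also have "\<dots> = 1" unfolding J(2) by (rule fw(2))
  finally have "(\<integral>y. flow_avg N T \<eta> y \<partial>lborel) = 1" .
  moreover have "flow_avg N T \<eta> y \<ge> 0" for y
    unfolding fa by (rule integral_nonneg_AE) (use \<eta>'(2) fw(3) in auto)
  ultimately show ?thesis
    using flow_avg_test[OF tr T \<eta> r'] by (auto simp: mollifier_def)
qed

text \<open>Alberti's kernels: averaging a bump along the volume preserving flow \<open>exp (t N)\<close> over a long time
  makes it nearly invariant, with an \<open>L\<^sup>1\<close> cost that is invariant under rescaling.\<close>

lemma alberti_kernel: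
  fixes N :: "real^'n::finite^'n"
  assumes tr: "(\<Sum>i\<in>UNIV. N $ i $ i) = 0" and "\<kappa> > 0"
  shows "\<exists>R>0. \<forall>r>0. \<exists>\<rho>. mollifier r \<rho> \<and> (\<integral>y. \<bar>dd \<rho> y (N *v y)\<bar> \<partial>lborel) \<le> \<kappa>
    \<and> (\<integral>y. (\<Sum>j\<in>UNIV. \<bar>dd \<rho> y (axis j 1)\<bar>) * norm y \<partial>lborel) \<le> R"
proof -
  \<comment> \<open>Flowing this long makes the bound 2 / T of \<open>flow_dd_L1\<close> equal to
    \<open>\<kappa>\<close>.\<close>
  define T where "T = 2 / \<kappa>"
  have T: "T > 0" using assms(2) by (simp add: T_def)
  \<comment> \<open>The flow may spread the support by the factor \<open>mexp_size N T\<close>; the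
    added 1 makes the inclusion strict. The bump is therefore started at radius r' / L.\<close>
  define L where "L = mexp_size N T + 1"
  have L: "L > mexp_size N T" "L > 0" using mexp_size_pos[of N T] by (auto simp: L_def)
  let ?n = "CARD('n)"
  obtain C where C: "C \<ge> 0" and ex: "\<And>r. r > 0 \<Longrightarrow> \<exists>\<eta>::real^'n \<Rightarrow> real. mollifier r \<eta> \<and> (\<forall>x v. \<bar>dd \<eta> x v\<bar> \<le> C / r ^ (?n + 1) * norm v)"
    using mollifier_scaled[where 'a="real^'n"] by auto
  define V where "V = measure lborel (ball (0::real^'n) 1)"
  have V: "V \<ge> 0" by (simp add: V_def)
  define R where "R = real ?n * (C * L ^ (?n + 2) * V) + 1"
  have Rp: "R > 0" using C L V by (auto simp: R_def intro!: add_nonneg_pos mult_nonneg_nonneg)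
  show ?thesis
  proof (intro exI[of _ R] conjI Rp allI impI)
    fix r' :: real assume r': "r' > 0"
    define r where "r = r' / L"
    have r: "r > 0" "r' = L * r" using r' L by (auto simp: r_def)
    obtain \<eta> :: "real^'n \<Rightarrow> real" where \<eta>: "mollifier r \<eta>" "\<And>x v. \<bar>dd \<eta> x v\<bar> \<le> C / r ^ (?n + 1) * norm v"
      using ex[OF r(1)] by blast
    let ?\<rho> = "flow_avg N T \<eta>"
    have lt: "mexp_size N T * r < r'" using L r by simp
    have m: "mollifier r' ?\<rho>" by (rule flow_avg_mollifier[OF tr T \<eta>(1) lt])
    then have t: "test_fn (ball 0 r') ?\<rho>" by (simp add: mollifier_def)
    have "(\<integral>y. \<bar>dd ?\<rho> y (N *v y)\<bar> \<partial>lborel) \<le> 2 / T" by (rule flow_dd_L1[OF tr T \<eta>(1)])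
    then have k: "(\<integral>y. \<bar>dd ?\<rho> y (N *v y)\<bar> \<partial>lborel) \<le> \<kappa>" using assms(2) by (simp add: T_def)
    define D where "D = C / r ^ (?n + 1)"
    have D: "D \<ge> 0" using C r by (simp add: D_def)
    have db: "\<bar>dd ?\<rho> y v\<bar> \<le> D * L * norm v" for y v
    proof -
      have "\<bar>dd ?\<rho> y v\<bar> \<le> D * mexp_size N T * norm v"
        by (rule flow_dd_bound[OF tr T \<eta>(1)]) (use \<eta>(2) D in \<open>auto simp: D_def\<close>)
      also have "\<dots> \<le> D * L * norm v" using D L by (intro mult_right_mono mult_left_mono) auto
      finally show ?thesis .
    qed
    have tj: "test_fn (ball 0 r') (\<lambda>y. dd ?\<rho> y (axis j 1))" for j by (rule test_fn_dd[OF t])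
    have bd: "(\<Sum>j\<in>UNIV. \<bar>dd ?\<rho> y (axis j 1)\<bar>) * norm y \<le> indicator (ball 0 r') y * (real ?n * (D * L) * r')" for y
    proof (cases "y \<in> ball 0 r'")
      case True
      have "(\<Sum>j\<in>UNIV. \<bar>dd ?\<rho> y (axis j 1)\<bar>) \<le> (\<Sum>j\<in>(UNIV::'n set). D * L)"
      proof (rule sum_mono)
        fix j show "\<bar>dd ?\<rho> y (axis j 1)\<bar> \<le> D * L" using db[of y "axis j 1"] by (simp add: norm_axis_1)
      qed
      then have "(\<Sum>j\<in>UNIV. \<bar>dd ?\<rho> y (axis j 1)\<bar>) * norm y \<le> (real ?n * (D * L)) * r'"
        using True D L by (intro mult_mono) auto
      then show ?thesis using True by simp
    next
      case False
      then show ?thesis using test_fn_outside[OF tj] by simp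
    qed
    have "(\<integral>y. (\<Sum>j\<in>UNIV. \<bar>dd ?\<rho> y (axis j 1)\<bar>) * norm y \<partial>lborel) \<le> (\<integral>y. indicator (ball (0::real^'n) r') y * (real ?n * (D * L) * r') \<partial>lborel)"
    proof (rule integral_mono[OF _ _ bd])
      show i: "integrable lborel (\<lambda>y. indicator (ball (0::real^'n) r') y * (real ?n * (D * L) * r'))"
        by (intro integrable_mult_left integrable_real_indicator emeasure_lborel_ball_finite) simp
      show "integrable lborel (\<lambda>y. (\<Sum>j\<in>UNIV. \<bar>dd ?\<rho> y (axis j 1)\<bar>) * norm y)"
      proof (rule Bochner_Integration.integrable_bound[OF i])
        show "(\<lambda>y. (\<Sum>j\<in>UNIV. \<bar>dd ?\<rho> y (axis j 1)\<bar>) * norm y) \<in> borel_measurable lborel"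
          using test_fn_measurable[OF tj] by simp
        show "AE y in lborel. norm ((\<Sum>j\<in>UNIV. \<bar>dd ?\<rho> y (axis j 1)\<bar>) * norm y) \<le> norm (indicator (ball (0::real^'n) r') y * (real ?n * (D * L) * r'))"
          using bd by (intro AE_I2) (simp add: sum_nonneg order_trans[OF _ abs_ge_self])
      qed
    qed
    also have "\<dots> = measure lborel (ball (0::real^'n) r') * (real ?n * (D * L) * r')" by simp
    also have "measure lborel (ball (0::real^'n) r') = r' ^ ?n * V"
      unfolding V_def using content_ball_conv_unit_ball[of r' "0::real^'n"] r' by simp
    \<comment> \<open>The scale cancels: volume and |y| contribute n + 1 powers of r' = L r, the
      gradient bound contributes r^(-(n + 1)). Hence \<open>R\<close> depends on \<open>N\<close>
      and \<open>\<kappa>\<close> but not on the radius.\<close>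
    also have "r' ^ ?n * V * (real ?n * (D * L) * r') = real ?n * (C * L ^ (?n + 2) * V)"
      using r by (simp add: D_def r(2) power_mult_distrib field_simps)
    also have "\<dots> \<le> R" by (simp add: R_def)
    finally show "\<exists>\<rho>. mollifier r' \<rho> \<and> (\<integral>y. \<bar>dd \<rho> y (N *v y)\<bar> \<partial>lborel) \<le> \<kappa>
      \<and> (\<integral>y. (\<Sum>j\<in>UNIV. \<bar>dd \<rho> y (axis j 1)\<bar>) * norm y \<partial>lborel) \<le> R"
      using m k by blast
  qed
qed

section \<open>Passage to spatial increments\<close>

definition prod_kernel :: "('a \<Rightarrow> real) \<Rightarrow> (real \<Rightarrow> real) \<Rightarrow> 'a \<times> real \<Rightarrow> real" where
  "prod_kernel \<rho> \<zeta> v = \<rho> (fst v) * \<zeta> (snd v)"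

lemma integral_lborel_prod_mult:
  fixes f :: "'a::euclidean_space \<Rightarrow> real" and g :: "'b::euclidean_space \<Rightarrow> real"
  assumes "integrable lborel f" "integrable lborel g"
  shows "integrable lborel (\<lambda>v. f (fst v) * g (snd v))"
    "(\<integral>v. f (fst v) * g (snd v) \<partial>lborel) = (\<integral>x. f x \<partial>lborel) * (\<integral>x. g x \<partial>lborel)"
proof -
  have i: "integrable (lborel \<Otimes>\<^sub>M lborel) (\<lambda>(x, y). f x * g y)"
    by (rule integrable_pair_mult[OF assms(2,1)])
  then show "integrable lborel (\<lambda>v. f (fst v) * g (snd v))" by (simp add: lborel_prod case_prod_beta')
  show "(\<integral>v. f (fst v) * g (snd v) \<partial>lborel) = (\<integral>x. f x \<partial>lborel) * (\<integral>x. g x \<partial>lborel)"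
    using lborel_pair.integral_fst[OF i] by (simp add: lborel_prod case_prod_beta')
qed

lemma prod_kernel:
  fixes \<rho> :: "real^'n::finite \<Rightarrow> real"
  assumes "mollifier r \<rho>" "mollifier \<tau> \<zeta>"
  shows "mollifier (r + \<tau>) (prod_kernel \<rho> \<zeta>)"
    and "dd (prod_kernel \<rho> \<zeta>) v (xdir j) = dd \<rho> (fst v) (axis j 1) * \<zeta> (snd v)"
proof -
  note \<rho> = mollifierD[OF assms(1)] and \<zeta> = mollifierD[OF assms(2)]
  note s = test_fn_smooth[OF \<rho>(1)] test_fn_smooth[OF \<zeta>(1)]
  have s1: "smooth (\<lambda>v::(real^'n) \<times> real. \<rho> (fst v))"
    using smooth_affine[OF bounded_linear_fst s(1), of 0] by simp
  have s2: "smooth (\<lambda>v::(real^'n) \<times> real. \<zeta> (snd v))"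
    using smooth_affine[OF bounded_linear_snd s(2), of 0] by simp
  from test_fnD[OF \<rho>(1)] obtain K where K: "compact K" "K \<subseteq> ball 0 r" "\<And>x. x \<notin> K \<Longrightarrow> \<rho> x = 0" by blast
  from test_fnD[OF \<zeta>(1)] obtain L where L: "compact L" "L \<subseteq> ball 0 \<tau>" "\<And>x. x \<notin> L \<Longrightarrow> \<zeta> x = 0" by blast
  have "test_fn (ball 0 (r + \<tau>)) (prod_kernel \<rho> \<zeta>)"
  proof (rule test_fnI[of _ "K \<times> L"])
    show "smooth (prod_kernel \<rho> \<zeta>)" unfolding prod_kernel_def[abs_def] by (rule smooth_mult[OF s1 s2])
    show "compact (K \<times> L)" by (rule compact_Times[OF K(1) L(1)])
    show "K \<times> L \<subseteq> ball 0 (r + \<tau>)"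
    proof
      fix v assume "v \<in> K \<times> L"
      then have "norm (fst v) < r" "norm (snd v) < \<tau>" using K(2) L(2) by (auto simp: subset_iff)
      moreover have "norm v \<le> norm (fst v) + norm (snd v)" using norm_Pair_le[of "fst v" "snd v"] by simp
      ultimately show "v \<in> ball 0 (r + \<tau>)" by simp
    qed
    show "prod_kernel \<rho> \<zeta> x = 0" if "x \<notin> K \<times> L" for x
      using that K(3) L(3) by (cases x) (auto simp: prod_kernel_def)
  qed
  then show "mollifier (r + \<tau>) (prod_kernel \<rho> \<zeta>)"
    using \<rho> \<zeta> integral_lborel_prod_mult(2)[OF test_fn_integrable[OF \<rho>(1)] test_fn_integrable[OF \<zeta>(1)]]
    by (auto simp: mollifier_def prod_kernel_def)
  have "dd (\<lambda>v::(real^'n) \<times> real. \<rho> (fst v)) v (xdir j) = dd \<rho> (fst v) (axis j 1)"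
    using dd_affine[OF bounded_linear_fst s(1), of 0 v "xdir j"] by (simp add: xdir_def)
  moreover have "dd (\<lambda>v::(real^'n) \<times> real. \<zeta> (snd v)) v (xdir j) = 0"
    using dd_affine[OF bounded_linear_snd s(2), of 0 v "xdir j"]
      linear_0[OF bounded_linear.linear[OF smooth_dd_linear[OF s(2)]]] by (simp add: xdir_def)
  ultimately show "dd (prod_kernel \<rho> \<zeta>) v (xdir j) = dd \<rho> (fst v) (axis j 1) * \<zeta> (snd v)"
    unfolding prod_kernel_def[abs_def] by (simp add: dd_mult[OF s1 s2])
qed

text \<open>Difference of squares: the change of the squared norm is at most 4M |a - a'|, times a
  component bounded by 2M; the change of the component is multiplied by at most (2M)^2. Together 8 +
  4 = 12.\<close>

lemma cube_lipschitz:
  fixes a a' b :: "real^'n::finite"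
  assumes "norm a \<le> M" "norm a' \<le> M" "norm b \<le> M"
  shows "\<bar>(norm (a - b))\<^sup>2 * (a $ j - b $ j) - (norm (a' - b))\<^sup>2 * (a' $ j - b $ j)\<bar> \<le> 12 * M\<^sup>2 * norm (a - a')"
proof -
  have M: "M \<ge> 0" using assms(1) norm_ge_zero order_trans by blast
  have n: "norm (a - b) \<le> 2 * M" "norm (a' - b) \<le> 2 * M"
    using norm_triangle_ineq4[of a b] norm_triangle_ineq4[of a' b] assms by linarith+
  have c: "\<bar>a $ j - b $ j\<bar> \<le> 2 * M" using component_le_norm_cart[of "a - b" j] n by simp
  have c': "\<bar>a $ j - a' $ j\<bar> \<le> norm (a - a')" using component_le_norm_cart[of "a - a'" j] by simp
  have d: "\<bar>norm (a - b) - norm (a' - b)\<bar> \<le> norm (a - a')"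
    using norm_triangle_ineq3[of "a - b" "a' - b"] by simp
  have "\<bar>(norm (a - b))\<^sup>2 - (norm (a' - b))\<^sup>2\<bar> = \<bar>norm (a - b) - norm (a' - b)\<bar> * (norm (a - b) + norm (a' - b))"
    by (simp add: power2_eq_square square_diff_square_factored abs_mult mult.commute)
  also have "\<dots> \<le> norm (a - a') * (4 * M)"
    using d n by (intro mult_mono) auto
  finally have 1: "\<bar>(norm (a - b))\<^sup>2 - (norm (a' - b))\<^sup>2\<bar> * \<bar>a $ j - b $ j\<bar> \<le> norm (a - a') * (4 * M) * (2 * M)"
    using c M by (intro mult_mono) auto
  have "(norm (a' - b))\<^sup>2 \<le> (2 * M)\<^sup>2" using n by (intro power_mono) auto
  then have 2: "(norm (a' - b))\<^sup>2 * \<bar>a $ j - a' $ j\<bar> \<le> (2 * M)\<^sup>2 * norm (a - a')"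
    using c' by (intro mult_mono) auto
  have "(norm (a - b))\<^sup>2 * (a $ j - b $ j) - (norm (a' - b))\<^sup>2 * (a' $ j - b $ j) =
    ((norm (a - b))\<^sup>2 - (norm (a' - b))\<^sup>2) * (a $ j - b $ j) + (norm (a' - b))\<^sup>2 * (a $ j - a' $ j)"
    by (simp add: algebra_simps)
  also have "\<bar>\<dots>\<bar> \<le> \<bar>(norm (a - b))\<^sup>2 - (norm (a' - b))\<^sup>2\<bar> * \<bar>a $ j - b $ j\<bar> + (norm (a' - b))\<^sup>2 * \<bar>a $ j - a' $ j\<bar>"
    by (rule order.trans[OF abs_triangle_ineq]) (simp add: abs_mult)
  also have "\<dots> \<le> norm (a - a') * (4 * M) * (2 * M) + (2 * M)\<^sup>2 * norm (a - a')" using 1 2 by linarith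
  finally show ?thesis by (simp add: power2_eq_square algebra_simps)
qed

context euler_L1
begin

definition incr :: "'n \<Rightarrow> (real^'n) \<times> real \<Rightarrow> (real^'n) \<times> real \<Rightarrow> real" where
  "incr j w v = (norm (U (w + v) - U w))\<^sup>2 * (u j (w + v) - u j w)"

text \<open>What \<open>cubic\<close> becomes on product kernels once the time factor is
  concentrated at 0: increments are taken at equal times.\<close>

definition spatial_cubic :: "((real^'n) \<times> real \<Rightarrow> real) \<Rightarrow> (real^'n \<Rightarrow> real) \<Rightarrow> real" where
  "spatial_cubic \<psi> \<rho> = (\<Sum>j\<in>UNIV. \<integral>w. \<psi> w * (\<integral>y. incr j w (y, 0) * dd \<rho> y (axis j 1) \<partial>lborel) \<partial>lborel)"

text \<open>The Lipschitz estimate, compared with the increment zero.\<close>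

lemma incr_bound: "\<bar>incr j w v\<bar> \<le> 12 * M\<^sup>2 * (2 * M)"
proof -
  have "\<bar>incr j w v\<bar> \<le> 12 * M\<^sup>2 * norm (U (w + v) - U w)"
    using cube_lipschitz[of "U (w + v)" M "U w" "U w" j] U_bd by (simp add: incr_def u_def)
  also have "\<dots> \<le> 12 * M\<^sup>2 * (2 * M)"
  proof (rule mult_left_mono)
    show "norm (U (w + v) - U w) \<le> 2 * M"
      using norm_triangle_ineq4[of "U (w + v)" "U w"] U_bd[of "w + v"] U_bd[of w] by linarith
  qed simp
  finally show ?thesis .
qed

lemma incr_lipschitz: "\<bar>incr j w v - incr j w v'\<bar> \<le> 12 * M\<^sup>2 * (\<Sum>i\<in>UNIV. \<bar>u i (w + v) - u i (w + v')\<bar>)"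
proof -
  have "\<bar>incr j w v - incr j w v'\<bar> \<le> 12 * M\<^sup>2 * norm (U (w + v) - U (w + v'))"
    using cube_lipschitz[OF U_bd U_bd U_bd, of "w + v" w j "w + v'"] by (simp add: incr_def u_def)
  also have "\<dots> \<le> 12 * M\<^sup>2 * (\<Sum>i\<in>UNIV. \<bar>u i (w + v) - u i (w + v')\<bar>)"
    using norm_le_l1_cart[of "U (w + v) - U (w + v')"] by (intro mult_left_mono) (auto simp: u_def)
  finally show ?thesis .
qed

lemma incr_meas [measurable]:
  assumes [measurable]: "f \<in> borel_measurable N" "g \<in> borel_measurable N"
  shows "(\<lambda>x. incr j (f x) (g x)) \<in> borel_measurable N"
  unfolding incr_def by measurable

lemma incr_integrable:
  assumes \<psi>: "integrable lborel \<psi>" and q: "integrable lborel q" and g [measurable]: "g \<in> borel_measurable borel"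
  shows "integrable (lborel \<Otimes>\<^sub>M lborel) (\<lambda>(w, v). \<psi> w * (incr j w (g v) * q v))"
proof -
  note [measurable] = borel_measurable_integrable[OF \<psi>] borel_measurable_integrable[OF q]
  have i: "integrable (lborel \<Otimes>\<^sub>M lborel) (\<lambda>x. (12 * M\<^sup>2 * (2 * M)) * (case x of (w, v) \<Rightarrow> \<psi> w * q v))"
    by (intro integrable_mult_right integrable_pair_mult q \<psi>)
  show ?thesis
  proof (rule Bochner_Integration.integrable_bound[OF i])
    show "AE x in lborel \<Otimes>\<^sub>M lborel. norm (case x of (w, v) \<Rightarrow> \<psi> w * (incr j w (g v) * q v)) \<le>
      norm ((12 * M\<^sup>2 * (2 * M)) * (case x of (w, v) \<Rightarrow> \<psi> w * q v))"
    proof (rule AE_I2, clarify)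
      fix w v
      have "norm (\<psi> w * (incr j w (g v) * q v)) = \<bar>incr j w (g v)\<bar> * \<bar>\<psi> w * q v\<bar>" by (simp add: abs_mult)
      also have "\<dots> \<le> 12 * M\<^sup>2 * (2 * M) * \<bar>\<psi> w * q v\<bar>" by (intro mult_right_mono incr_bound) simp
      also have "\<dots> = norm (12 * M\<^sup>2 * (2 * M) * (\<psi> w * q v))" using M_nonneg by (simp add: abs_mult)
      finally show "norm (\<psi> w * (incr j w (g v) * q v)) \<le> norm (12 * M\<^sup>2 * (2 * M) * (\<psi> w * q v))" .
    qed
    show "(\<lambda>(w, v). \<psi> w * (incr j w (g v) * q v)) \<in> borel_measurable (lborel \<Otimes>\<^sub>M lborel)"
      unfolding case_prod_beta by measurable
  qed
qed

text \<open>The two expressions differ only by the time component of the displacement, so the error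
  is governed by the L1 modulus of the velocity in time. The factor in front is the L1 norm of the
  gradient of \<open>\<rho>\<close>, so \<open>\<tau>\<close> has to be chosen after
  \<open>\<rho>\<close>.\<close>

lemma cubic_prod_kernel_diff:
  assumes \<psi>: "test_fn Q \<psi>" and B: "\<And>w. \<bar>\<psi> w\<bar> \<le> B" and \<rho>: "mollifier r \<rho>" and \<zeta>: "mollifier \<tau> \<zeta>"
    and e: "\<And>i s. \<bar>s\<bar> < \<tau> \<Longrightarrow> L1_shift (u i) (0, s) \<le> e" and e0: "e \<ge> 0"
  shows "\<bar>cubic \<psi> (prod_kernel \<rho> \<zeta>) - spatial_cubic \<psi> \<rho>\<bar> \<le>
    (\<Sum>j\<in>UNIV. \<integral>y. \<bar>dd \<rho> y (axis j 1)\<bar> \<partial>lborel) * (B * (12 * M\<^sup>2 * (real CARD('n) * e)))"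
proof -
  note \<rho>' = mollifierD[OF \<rho>] and \<zeta>' = mollifierD[OF \<zeta>]
  have i\<psi>: "integrable lborel \<psi>" by (rule test_fn_integrable[OF \<psi>])
  have i\<rho>: "integrable lborel (\<lambda>y. dd \<rho> y (axis j 1))" for j by (rule test_fn_integrable[OF test_fn_dd[OF \<rho>'(1)]])
  have i\<zeta>: "integrable lborel \<zeta>" by (rule test_fn_integrable[OF \<zeta>'(1)])
  have B0: "B \<ge> 0" using B[of 0] by simp
  define q where "q j v = dd \<rho> (fst v) (axis j 1) * \<zeta> (snd v)" for j v
  have iq: "integrable lborel (q j)" for j
    unfolding q_def[abs_def] by (rule integral_lborel_prod_mult(1)[OF i\<rho> i\<zeta>])
  note [measurable] = borel_measurable_integrable[OF i\<psi>] borel_measurable_integrable[OF iq]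
    borel_measurable_integrable[OF i\<rho>] borel_measurable_integrable[OF i\<zeta>]
  let ?p = "\<lambda>v::(real^'n) \<times> real. (fst v, 0::real)"
  have pm [measurable]: "?p \<in> borel_measurable borel"
    by (intro borel_measurable_continuous_onI continuous_intros)
  have i1: "integrable (lborel \<Otimes>\<^sub>M lborel) (\<lambda>(w, v). \<psi> w * (incr j w v * q j v))" for j
    using incr_integrable[OF i\<psi> iq, of "\<lambda>v. v"] by simp
  have i2: "integrable (lborel \<Otimes>\<^sub>M lborel) (\<lambda>(w, v). \<psi> w * (incr j w (?p v) * q j v))" for j
    by (rule incr_integrable[OF i\<psi> iq pm])
  have e1: "cubic \<psi> (prod_kernel \<rho> \<zeta>) = (\<Sum>j\<in>UNIV. \<integral>v. (\<integral>w. \<psi> w * (incr j w v * q j v) \<partial>lborel) \<partial>lborel)"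
    unfolding cubic_def
  proof (rule sum.cong[OF refl])
    fix j
    have "(\<integral>z. (norm (U z - U w))\<^sup>2 * (u j z - u j w) * dd (prod_kernel \<rho> \<zeta>) (z - w) (xdir j) \<partial>lborel) =
      (\<integral>v. incr j w v * q j v \<partial>lborel)" for w
      using lborel_translate(1)[of "\<lambda>z. (norm (U z - U w))\<^sup>2 * (u j z - u j w) * q j (z - w)" w]
      unfolding prod_kernel(2)[OF \<rho> \<zeta>] q_def[symmetric] by (simp add: incr_def)
    then have "(\<integral>w. \<psi> w * (\<integral>z. (norm (U z - U w))\<^sup>2 * (u j z - u j w) * dd (prod_kernel \<rho> \<zeta>) (z - w) (xdir j) \<partial>lborel) \<partial>lborel) =
      (\<integral>w. (\<integral>v. \<psi> w * (incr j w v * q j v) \<partial>lborel) \<partial>lborel)" by simp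
    then show "(\<integral>w. \<psi> w * (\<integral>z. (norm (U z - U w))\<^sup>2 * (u j z - u j w) * dd (prod_kernel \<rho> \<zeta>) (z - w) (xdir j) \<partial>lborel) \<partial>lborel) =
      (\<integral>v. (\<integral>w. \<psi> w * (incr j w v * q j v) \<partial>lborel) \<partial>lborel)"
      using lborel_pair.Fubini_integral[OF i1[of j]] by simp
  qed
  have e2: "spatial_cubic \<psi> \<rho> = (\<Sum>j\<in>UNIV. \<integral>v. (\<integral>w. \<psi> w * (incr j w (?p v) * q j v) \<partial>lborel) \<partial>lborel)"
    unfolding spatial_cubic_def
  proof (rule sum.cong[OF refl])
    fix j
    have ii: "integrable lborel (\<lambda>y. incr j w (y, 0) * dd \<rho> y (axis j 1))" for w
    proof (rule integrable_mult_bdd(2)[OF i\<rho>])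
      have "(\<lambda>y::real^'n. (y, 0::real)) \<in> borel_measurable borel"
        by (intro borel_measurable_continuous_onI continuous_intros)
      then have "(\<lambda>y. incr j w (y, 0)) \<in> borel_measurable borel" by (intro incr_meas) auto
      then show "bdd_borel (\<lambda>y. incr j w (y, 0))" unfolding bdd_borel_def using incr_bound by blast
    qed
    have "(\<integral>y. incr j w (y, 0) * dd \<rho> y (axis j 1) \<partial>lborel) = (\<integral>v. incr j w (?p v) * q j v \<partial>lborel)" for w
      using integral_lborel_prod_mult(2)[OF ii i\<zeta>, of w] \<zeta>'(3) by (simp add: q_def mult.assoc)
    then have "(\<integral>w. \<psi> w * (\<integral>y. incr j w (y, 0) * dd \<rho> y (axis j 1) \<partial>lborel) \<partial>lborel) =
      (\<integral>w. (\<integral>v. \<psi> w * (incr j w (?p v) * q j v) \<partial>lborel) \<partial>lborel)" by simp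
    then show "(\<integral>w. \<psi> w * (\<integral>y. incr j w (y, 0) * dd \<rho> y (axis j 1) \<partial>lborel) \<partial>lborel) =
      (\<integral>v. (\<integral>w. \<psi> w * (incr j w (?p v) * q j v) \<partial>lborel) \<partial>lborel)"
      using lborel_pair.Fubini_integral[OF i2[of j]] by simp
  qed
  have key: "\<bar>(\<integral>w. \<psi> w * (incr j w v * q j v) \<partial>lborel) - (\<integral>w. \<psi> w * (incr j w (?p v) * q j v) \<partial>lborel)\<bar>
      \<le> \<bar>q j v\<bar> * (B * (12 * M\<^sup>2 * (real CARD('n) * e)))" for j v
  proof (cases "\<bar>snd v\<bar> < \<tau>")
    case False
    then have "\<zeta> (snd v) = 0" using test_fn_outside[OF \<zeta>'(1), of "snd v"] by simp
    then show ?thesis by (simp add: q_def)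
  next
    case True
    have ib: "integrable lborel (\<lambda>w. \<psi> w * (incr j w v' * q j v))" for v'
    proof (rule integrable_mult_bdd(1)[OF i\<psi>])
      have "\<bar>incr j w v' * q j v\<bar> \<le> 12 * M\<^sup>2 * (2 * M) * \<bar>q j v\<bar>" for w
        unfolding abs_mult by (intro mult_right_mono incr_bound) simp
      moreover have "(\<lambda>w. incr j w v' * q j v) \<in> borel_measurable borel"
        by (intro borel_measurable_times incr_meas) auto
      ultimately show "bdd_borel (\<lambda>w. incr j w v' * q j v)" unfolding bdd_borel_def by blast
    qed
    have iu: "integrable lborel (\<lambda>w. u i (w + v) - u i (w + ?p v))" for i
      using integrable_shift(1)[OF int_u] by auto
    \<comment> \<open>Translating by the spatial part of the displacement leaves a pure shift in
      time.\<close>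
    have sh: "(\<integral>w. \<bar>u i (w + v) - u i (w + ?p v)\<bar> \<partial>lborel) = L1_shift (u i) (0, snd v)" for i
    proof -
      have "(\<integral>w. \<bar>u i (w + v) - u i (w + ?p v)\<bar> \<partial>lborel) = (\<integral>w. \<bar>u i ((w + ?p v) + (0, snd v)) - u i (w + ?p v)\<bar> \<partial>lborel)"
        by (simp add: add.assoc)
      also have "\<dots> = L1_shift (u i) (0, snd v)"
        unfolding L1_shift_def by (rule integral_shift(1)[of "\<lambda>w. \<bar>u i (w + (0, snd v)) - u i w\<bar>"]) measurable
      finally show ?thesis .
    qed
    have "\<bar>(\<integral>w. \<psi> w * (incr j w v * q j v) \<partial>lborel) - (\<integral>w. \<psi> w * (incr j w (?p v) * q j v) \<partial>lborel)\<bar>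
      = \<bar>\<integral>w. \<psi> w * (incr j w v * q j v) - \<psi> w * (incr j w (?p v) * q j v) \<partial>lborel\<bar>"
      using ib by simp
    also have "\<dots> \<le> (\<integral>w. \<bar>q j v\<bar> * (B * (12 * M\<^sup>2 * (\<Sum>i\<in>UNIV. \<bar>u i (w + v) - u i (w + ?p v)\<bar>))) \<partial>lborel)"
    proof (rule order.trans[OF integral_abs_bound integral_mono])
      show "integrable lborel (\<lambda>w. \<bar>\<psi> w * (incr j w v * q j v) - \<psi> w * (incr j w (?p v) * q j v)\<bar>)"
        using ib by (intro integrable_abs Bochner_Integration.integrable_diff)
      show "integrable lborel (\<lambda>w. \<bar>q j v\<bar> * (B * (12 * M\<^sup>2 * (\<Sum>i\<in>UNIV. \<bar>u i (w + v) - u i (w + ?p v)\<bar>))))"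
        using iu by (intro integrable_mult_right Bochner_Integration.integrable_sum integrable_abs)
      fix w
      have "\<bar>\<psi> w * (incr j w v * q j v) - \<psi> w * (incr j w (?p v) * q j v)\<bar> = \<bar>q j v\<bar> * (\<bar>\<psi> w\<bar> * \<bar>incr j w v - incr j w (?p v)\<bar>)"
        by (simp add: abs_mult[symmetric] algebra_simps)
      also have "\<dots> \<le> \<bar>q j v\<bar> * (B * (12 * M\<^sup>2 * (\<Sum>i\<in>UNIV. \<bar>u i (w + v) - u i (w + ?p v)\<bar>)))"
        using B B0 incr_lipschitz by (intro mult_left_mono mult_mono) auto
      finally show "\<bar>\<psi> w * (incr j w v * q j v) - \<psi> w * (incr j w (?p v) * q j v)\<bar> \<le> \<dots>" .
    qed
    also have "\<dots> = \<bar>q j v\<bar> * (B * (12 * M\<^sup>2 * (\<Sum>i\<in>UNIV. L1_shift (u i) (0, snd v))))"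
      using iu by (simp add: Bochner_Integration.integral_sum sh)
    also have "\<dots> \<le> \<bar>q j v\<bar> * (B * (12 * M\<^sup>2 * (\<Sum>i\<in>(UNIV::'n set). e)))"
      using e[OF True] B0 by (intro mult_left_mono sum_mono) auto
    finally show ?thesis by simp
  qed
  \<comment> \<open>The time factor is nonnegative with mass 1, so it disappears from the norm
    however concentrated it is.\<close>
  have qn: "(\<integral>v. \<bar>q j v\<bar> \<partial>lborel) = (\<integral>y. \<bar>dd \<rho> y (axis j 1)\<bar> \<partial>lborel)" for j
    using integral_lborel_prod_mult(2)[of "\<lambda>y. \<bar>dd \<rho> y (axis j 1)\<bar>" \<zeta>] i\<rho>[of j] i\<zeta> \<zeta>'(2,3)
    by (simp add: q_def abs_mult)
  have "\<bar>cubic \<psi> (prod_kernel \<rho> \<zeta>) - spatial_cubic \<psi> \<rho>\<bar> \<le> (\<Sum>j\<in>UNIV. \<bar>(\<integral>v. (\<integral>w. \<psi> w * (incr j w v * q j v) \<partial>lborel) \<partial>lborel)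
      - (\<integral>v. (\<integral>w. \<psi> w * (incr j w (?p v) * q j v) \<partial>lborel) \<partial>lborel)\<bar>)"
    unfolding e1 e2 sum_subtractf[symmetric] by (rule sum_abs)
  also have "\<dots> \<le> (\<Sum>j\<in>UNIV. (\<integral>y. \<bar>dd \<rho> y (axis j 1)\<bar> \<partial>lborel) * (B * (12 * M\<^sup>2 * (real CARD('n) * e))))"
  proof (rule sum_mono)
    fix j
    note f1 = lborel_pair.integrable_snd[OF i1[of j]] and f2 = lborel_pair.integrable_snd[OF i2[of j]]
    have "\<bar>(\<integral>v. (\<integral>w. \<psi> w * (incr j w v * q j v) \<partial>lborel) \<partial>lborel) - (\<integral>v. (\<integral>w. \<psi> w * (incr j w (?p v) * q j v) \<partial>lborel) \<partial>lborel)\<bar>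
      = \<bar>\<integral>v. (\<integral>w. \<psi> w * (incr j w v * q j v) \<partial>lborel) - (\<integral>w. \<psi> w * (incr j w (?p v) * q j v) \<partial>lborel) \<partial>lborel\<bar>"
      using f1 f2 by simp
    also have "\<dots> \<le> (\<integral>v. \<bar>q j v\<bar> * (B * (12 * M\<^sup>2 * (real CARD('n) * e))) \<partial>lborel)"
    proof (rule order.trans[OF integral_abs_bound integral_mono[OF _ _ key]])
      show "integrable lborel (\<lambda>v. \<bar>(\<integral>w. \<psi> w * (incr j w v * q j v) \<partial>lborel) - (\<integral>w. \<psi> w * (incr j w (?p v) * q j v) \<partial>lborel)\<bar>)"
        using f1 f2 by (intro integrable_abs Bochner_Integration.integrable_diff)
      show "integrable lborel (\<lambda>v. \<bar>q j v\<bar> * (B * (12 * M\<^sup>2 * (real CARD('n) * e))))"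
        using iq[of j] by (intro integrable_mult_left integrable_abs)
    qed
    also have "\<dots> = (\<integral>y. \<bar>dd \<rho> y (axis j 1)\<bar> \<partial>lborel) * (B * (12 * M\<^sup>2 * (real CARD('n) * e)))" by (simp add: qn)
    finally show "\<bar>(\<integral>v. (\<integral>w. \<psi> w * (incr j w v * q j v) \<partial>lborel) \<partial>lborel) - (\<integral>v. (\<integral>w. \<psi> w * (incr j w (?p v) * q j v) \<partial>lborel) \<partial>lborel)\<bar> \<le> \<dots>" .
  qed
  finally show ?thesis by (simp add: sum_distrib_right)
qed

lemma cubic_prod_kernel_approx:
  assumes \<psi>: "test_fn Q \<psi>" and \<rho>: "mollifier r \<rho>" and "e > 0"
  shows "\<exists>\<tau>>0. \<forall>\<zeta>. mollifier \<tau> \<zeta> \<longrightarrow> \<bar>cubic \<psi> (prod_kernel \<rho> \<zeta>) - spatial_cubic \<psi> \<rho>\<bar> \<le> e"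
proof -
  obtain B where B: "B \<ge> 0" "\<And>w. norm (\<psi> w) \<le> B" using test_fn_bounded[OF \<psi>] by blast
  define C where "C = (\<Sum>j\<in>UNIV. \<integral>y. \<bar>dd \<rho> y (axis j 1)\<bar> \<partial>lborel) * (B * (12 * M\<^sup>2 * real CARD('n)))"
  have C: "C \<ge> 0" unfolding C_def using B by (intro mult_nonneg_nonneg sum_nonneg integral_nonneg_AE) auto
  define d where "d = e / (C + 1)"
  have d: "d > 0" using \<open>e > 0\<close> C by (simp add: d_def)
  have "\<forall>i. \<exists>\<tau>>0. \<forall>h. norm h < \<tau> \<longrightarrow> L1_shift (u i) h \<le> d" using L1_shift_small[OF int_u d] by metis
  then obtain t where t: "\<And>i. t i > 0" "\<And>i h. norm h < t i \<Longrightarrow> L1_shift (u i) h \<le> d" by metis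
  define \<tau> where "\<tau> = Min (range t)"
  have \<tau>: "\<tau> > 0" "\<And>i. \<tau> \<le> t i" unfolding \<tau>_def using t(1) by (auto simp: Min_gr_iff)
  show ?thesis
  proof (intro exI[of _ \<tau>] conjI \<tau>(1) allI impI)
    fix \<zeta> :: "real \<Rightarrow> real" assume \<zeta>: "mollifier \<tau> \<zeta>"
    have "\<bar>cubic \<psi> (prod_kernel \<rho> \<zeta>) - spatial_cubic \<psi> \<rho>\<bar> \<le>
      (\<Sum>j\<in>UNIV. \<integral>y. \<bar>dd \<rho> y (axis j 1)\<bar> \<partial>lborel) * (B * (12 * M\<^sup>2 * (real CARD('n) * d)))"
    proof (rule cubic_prod_kernel_diff[OF \<psi> _ \<rho> \<zeta>])
      show "\<bar>\<psi> w\<bar> \<le> B" for w using B(2)[of w] by simp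
      show "L1_shift (u i) (0, s) \<le> d" if "\<bar>s\<bar> < \<tau>" for i s
        using that \<tau>(2)[of i] by (intro t(2)) (auto simp: norm_Pair)
    qed (use d in simp)
    also have "\<dots> = C * d" by (simp add: C_def mult_ac)
    also have "\<dots> \<le> e" using C \<open>e > 0\<close> by (simp add: d_def field_simps)
    finally show "\<bar>cubic \<psi> (prod_kernel \<rho> \<zeta>) - spatial_cubic \<psi> \<rho>\<bar> \<le> e" .
  qed
qed

text \<open>For each \<open>\<rho>\<close> a time kernel is chosen depending on
  \<open>\<rho>\<close> and then eliminated. The threshold \<open>r0\<close> comes from
  \<open>cubic_tendsto\<close>, so it holds for all shapes of \<open>\<rho>\<close>
  simultaneously.\<close>

lemma energy_flux_spatial_cubic:
  assumes \<psi>: "test_fn Q \<psi>" and "e > 0"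
  shows "\<exists>r0>0. \<forall>\<rho>. mollifier r0 \<rho> \<longrightarrow> \<bar>4 * energy_flux \<psi> - spatial_cubic \<psi> \<rho>\<bar> \<le> e"
proof -
  have "eventually (\<lambda>\<eta>. dist (cubic \<psi> \<eta>) (4 * energy_flux \<psi>) < e / 2) mollifiers"
    using cubic_tendsto[OF \<psi>] \<open>e > 0\<close> by (intro tendstoD) auto
  then obtain R where R: "R > 0" "\<And>\<eta>. mollifier R \<eta> \<Longrightarrow> \<bar>cubic \<psi> \<eta> - 4 * energy_flux \<psi>\<bar> < e / 2"
    unfolding eventually_mollifiers dist_real_def by blast
  show ?thesis
  proof (intro exI[of _ "R / 2"] conjI allI impI)
    \<comment> \<open>Half of the radius goes to the space factor and at most the other half to the
      time factor, because radii add in \<open>prod_kernel\<close>.\<close>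
    show "R / 2 > 0" using R by simp
    fix \<rho> :: "real^'n \<Rightarrow> real" assume \<rho>: "mollifier (R / 2) \<rho>"
    obtain \<tau> where \<tau>: "\<tau> > 0" "\<And>\<zeta>. mollifier \<tau> \<zeta> \<Longrightarrow> \<bar>cubic \<psi> (prod_kernel \<rho> \<zeta>) - spatial_cubic \<psi> \<rho>\<bar> \<le> e / 2"
      using cubic_prod_kernel_approx[OF \<psi> \<rho>, of "e / 2"] \<open>e > 0\<close> by auto
    have "min \<tau> (R / 2) > 0" using \<tau> R by simp
    then obtain \<zeta> :: "real \<Rightarrow> real" where \<zeta>: "mollifier (min \<tau> (R / 2)) \<zeta>" using mollifier_exists by blast
    have "mollifier R (prod_kernel \<rho> \<zeta>)"
      using prod_kernel(1)[OF \<rho> mollifier_mono[OF \<zeta>, of "R / 2"]] by simp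
    from R(2)[OF this] \<tau>(2)[OF mollifier_mono[OF \<zeta>, of \<tau>]]
    show "\<bar>4 * energy_flux \<psi> - spatial_cubic \<psi> \<rho>\<bar> \<le> e" by linarith
  qed
qed

end

section \<open>Mollified gradients and near-optimal fields\<close>

lemma bounded_linear_entry: "bounded_linear (\<lambda>A::real^'n::finite^'m::finite. A $ i $ j)"
  by (rule bounded_linear_compose[OF bounded_linear_vec_nth bounded_linear_vec_nth])

lemma matrix_basis_sum: "(\<chi> i j. a i j) = (\<Sum>i\<in>UNIV. \<Sum>j\<in>UNIV. a i j *\<^sub>R axis i (axis j (1::real)))"
  for a :: "'m::finite \<Rightarrow> 'n::finite \<Rightarrow> real"
proof -
  have "(\<Sum>i\<in>UNIV. \<Sum>j\<in>UNIV. a i j *\<^sub>R axis i (axis j (1::real))) $ k $ l = a k l" for k l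
  proof -
    have "(\<Sum>i\<in>UNIV. \<Sum>j\<in>UNIV. a i j *\<^sub>R axis i (axis j (1::real))) $ k $ l
        = (\<Sum>i\<in>UNIV. \<Sum>j\<in>UNIV. if i = k then (if j = l then a i j else 0) else 0)"
      by (auto simp: axis_def intro!: sum.cong)
    also have "\<dots> = (\<Sum>i\<in>UNIV. if i = k then (\<Sum>j\<in>UNIV. if j = l then a i j else 0) else 0)"
      by (intro sum.cong refl) auto
    finally show ?thesis by simp
  qed
  then show ?thesis by (simp add: vec_eq_iff)
qed

lemma test_fn_entry: "test_fn U \<Phi> \<Longrightarrow> test_fn U (\<lambda>w. \<Phi> w $ i $ j)"
  for \<Phi> :: "'a::real_normed_vector \<Rightarrow> real^'n::finite^'m::finite"
  by (rule test_fn_bounded_linear[OF bounded_linear_entry])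

lemma test_fn_matrix:
  fixes a :: "'m::finite \<Rightarrow> 'n::finite \<Rightarrow> 'a::real_normed_vector \<Rightarrow> real"
  assumes "\<And>i j. test_fn U (a i j)" shows "test_fn U (\<lambda>w. \<chi> i j. a i j w)"
  unfolding matrix_basis_sum
  by (intro test_fn_sum test_fn_bounded_linear[OF bounded_linear_scaleR_left] assms)

lemma inner_matrix: "A \<bullet> B = (\<Sum>i\<in>UNIV. \<Sum>j\<in>UNIV. A $ i $ j * B $ i $ j)"
  for A B :: "real^'n::finite^'m::finite"
  by (simp add: inner_vec_def)

lemma br_lin:
  fixes a b c k :: "'a::euclidean_space \<Rightarrow> real"
  assumes "integrable lborel a" "integrable lborel b" "integrable lborel c" "test_fn V k"
  shows "br a (\<lambda>w. b w + s * c w) k = br a b k + s * br a c k"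
  using br_integrable(2)[OF assms(1,2,4)] br_integrable(2)[OF assms(1,3,4)]
  unfolding br_def by (simp add: distrib_right mult.assoc)

context euler_L1
begin

text \<open>Minus the pairing of \<open>\<Phi>\<close> with the spatial distributional gradient of
  \<open>U\<close> in space-time; time derivatives do not enter.\<close>

definition dvf :: "((real^'n) \<times> real \<Rightarrow> real^'n^'n) \<Rightarrow> real" where
  "dvf \<Phi> = (\<integral>z. (\<Sum>i\<in>UNIV. u i z * (\<Sum>j\<in>UNIV. dd (\<lambda>w. \<Phi> w $ i $ j) z (xdir j))) \<partial>lborel)"

text \<open>\<open>ell \<theta> \<Psi>\<close> is the pairing of \<open>\<Psi>\<close> with the gradient of the mollification of \<open>U\<close> by \<open>\<theta>\<close>.\<close>

definition ell :: "((real^'n) \<times> real \<Rightarrow> real) \<Rightarrow> ((real^'n) \<times> real \<Rightarrow> real^'n^'n) \<Rightarrow> real" where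
  "ell \<theta> \<Psi> = - (\<Sum>i\<in>UNIV. \<Sum>j\<in>UNIV. br (u i) (\<lambda>w. \<Psi> w $ i $ j) (\<lambda>x. dd \<theta> x (xdir j)))"

lemma int_u_dd: "test_fn Q \<phi> \<Longrightarrow> integrable lborel (\<lambda>z. u i z * dd \<phi> z v)"
  by (rule integrable_mult_bdd[OF int_u bdd_borel_dd])

lemma dvf_eq:
  assumes "test_fn Q \<Phi>"
  shows "dvf \<Phi> = (\<Sum>i\<in>UNIV. \<Sum>j\<in>UNIV. \<integral>z. u i z * dd (\<lambda>w. \<Phi> w $ i $ j) z (xdir j) \<partial>lborel)"
  unfolding dvf_def sum_distrib_left
  by (subst Bochner_Integration.integral_sum; (intro Bochner_Integration.integrable_sum int_u_dd test_fn_entry assms)?)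
     (intro sum.cong refl Bochner_Integration.integral_sum int_u_dd test_fn_entry assms)

lemma dvf_scaleR:
  assumes "test_fn Q \<Phi>" shows "dvf (\<lambda>w. c *\<^sub>R \<Phi> w) = c * dvf \<Phi>"
proof -
  have "test_fn Q (\<lambda>w. c *\<^sub>R \<Phi> w)" by (rule test_fn_bounded_linear[OF bounded_linear_scaleR_right assms])
  moreover have "dd (\<lambda>w. (c *\<^sub>R \<Phi> w) $ i $ j) z v = c * dd (\<lambda>w. \<Phi> w $ i $ j) z v" for i j z v
    using dd_bounded_linear[OF bounded_linear_mult_right[of c] test_fn_smooth[OF test_fn_entry[OF assms, of i j]]]
    by simp
  ultimately show ?thesis
    using assms by (simp add: dvf_eq mult.left_commute[of _ c] sum_distrib_left)
qed

text \<open>On multiples of the identity matrix the pairing tests the divergence, which vanishes.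
  This makes the removal of the trace free of charge.\<close>

lemma dvf_scalar_identity:
  assumes "test_fn Q g" shows "dvf (\<lambda>w. g w *\<^sub>R mat 1) = 0"
proof -
  have t: "test_fn Q (\<lambda>w. g w *\<^sub>R (mat 1 :: real^'n^'n))"
    by (rule test_fn_bounded_linear[OF bounded_linear_scaleR_left assms])
  have e: "dd (\<lambda>w. (g w *\<^sub>R (mat 1 :: real^'n^'n)) $ i $ j) z v = (if i = j then dd g z v else 0)" for i j z v
    using dd_bounded_linear[OF bounded_linear_mult_left[of 0] test_fn_smooth[OF assms]] by (simp add: mat_def)
  have "dvf (\<lambda>w. g w *\<^sub>R mat 1) = (\<integral>z. (\<Sum>i\<in>UNIV. U z $ i * dd g z (xdir i)) \<partial>lborel)"
    unfolding dvf_def e by (simp add: u_def)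
  then show ?thesis using divfree[OF assms] by simp
qed

lemma dvf_diff:
  assumes "test_fn Q \<Phi>" "test_fn Q \<Psi>"
  shows "dvf (\<lambda>w. \<Phi> w - \<Psi> w) = dvf \<Phi> - dvf \<Psi>"
proof -
  have "test_fn Q (\<lambda>w. \<Phi> w + (- 1) *\<^sub>R \<Psi> w)"
    by (rule test_fn_add[OF assms(1) test_fn_bounded_linear[OF bounded_linear_scaleR_right assms(2)]])
  then have t: "test_fn Q (\<lambda>w. \<Phi> w - \<Psi> w)" by simp
  have "dd (\<lambda>w. (\<Phi> w - \<Psi> w) $ i $ j) z v = dd (\<lambda>w. \<Phi> w $ i $ j) z v - dd (\<lambda>w. \<Psi> w $ i $ j) z v" for i j z v
    using dd_eq[OF has_derivative_diff[OF smooth_has_derivative[OF test_fn_smooth[OF test_fn_entry[OF assms(1), of i j]]]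
        smooth_has_derivative[OF test_fn_smooth[OF test_fn_entry[OF assms(2), of i j]]]], of z v] by simp
  then show ?thesis
    using int_u_dd[OF test_fn_entry[OF assms(1)]] int_u_dd[OF test_fn_entry[OF assms(2)]]
    by (simp add: dvf_eq assms t right_diff_distrib sum_subtractf)
qed

text \<open>\<open>ell\<close> has the derivative on the mollified velocity and \<open>dvf\<close>
  has it on the field; integration by parts accounts for the minus sign.\<close>

lemma ell_tendsto:
  assumes \<Phi>: "test_fn Q \<Phi>"
  shows "((\<lambda>\<theta>. ell \<theta> \<Phi>) \<longlongrightarrow> - dvf \<Phi>) mollifiers"
proof -
  note te = test_fn_entry[OF \<Phi>]
  from test_fnD[OF \<Phi>] obtain K where K: "compact K" "K \<subseteq> Q" "\<And>x. x \<notin> K \<Longrightarrow> \<Phi> x = 0" by blast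
  obtain r where r: "r > 0" "\<And>w. w \<in> K \<Longrightarrow> ball w r \<subseteq> Q"
    using compact_ball_subset[OF K(1) Q_open K(2)] by blast
  have lim: "((\<lambda>\<theta>. - (\<Sum>i\<in>UNIV. \<Sum>j\<in>UNIV. br (u i) (\<lambda>w. dd (\<lambda>w. \<Phi> w $ i $ j) w (xdir j)) \<theta>)) \<longlongrightarrow> - dvf \<Phi>) mollifiers"
    unfolding dvf_eq[OF \<Phi>]
    by (intro tendsto_minus tendsto_sum br_tendsto int_u bdd_borel_dd[OF te])
  have "eventually (mollifier r) mollifiers" using r(1) by (rule eventually_mollifier)
  then have "eventually (\<lambda>\<theta>. ell \<theta> \<Phi> = - (\<Sum>i\<in>UNIV. \<Sum>j\<in>UNIV. br (u i) (\<lambda>w. dd (\<lambda>w. \<Phi> w $ i $ j) w (xdir j)) \<theta>)) mollifiers"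
  proof eventually_elim
    case (elim \<theta>)
    have "br (u i) (\<lambda>w. \<Phi> w $ i $ j) (\<lambda>x. dd \<theta> x v) = br (u i) (\<lambda>w. dd (\<lambda>w. \<Phi> w $ i $ j) w v) \<theta>" for i j v
    proof (rule br_parts[OF te _ _ int_u])
      show "test_fn (ball 0 r) \<theta>" using elim by (simp add: mollifier_def)
      show "ball w r \<subseteq> Q" if "\<Phi> w $ i $ j \<noteq> 0" for w
        using that r(2)[of w] K(3)[of w] by force
    qed
    then show ?case by (simp add: ell_def)
  qed
  then show ?thesis using lim by (simp add: tendsto_cong)
qed

text \<open>The mollifier is moved from the velocity to \<open>\<Psi>\<close>. The convolution is a
  smooth admissible field, and being an average it keeps the pointwise bound \<open>c\<close>, so
  the variation bound becomes available for measurable \<open>\<Psi>\<close>.\<close>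

lemma mollify_field:
  assumes \<Psi>: "\<Psi> \<in> borel_measurable borel" "\<And>w. norm (\<Psi> w) \<le> c" "compact K" "\<And>w. w \<notin> K \<Longrightarrow> \<Psi> w = 0"
    and \<theta>: "mollifier \<sigma> \<theta>" and sub: "\<And>w. w \<in> K \<Longrightarrow> ball w \<sigma> \<subseteq> Q"
  shows "\<exists>\<Phi>. test_fn Q \<Phi> \<and> (\<forall>z. norm (\<Phi> z) \<le> c) \<and> dvf \<Phi> = - ell \<theta> \<Psi>"
proof -
  note \<theta>' = mollifierD[OF \<theta>]
  have i\<Psi>: "integrable lborel \<Psi>" by (rule integrable_compact_support[OF \<Psi>(1,3,4,2)])
  have i\<Psi>e: "integrable lborel (\<lambda>w. \<Psi> w $ i $ j)" for i j
    by (rule integrable_bounded_linear[OF bounded_linear_entry i\<Psi>])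
  have i\<theta>: "integrable lborel (\<lambda>w. \<theta> (z - w))" "(\<integral>w. \<theta> (z - w) \<partial>lborel) = 1" for z
    using lborel_reflect[OF test_fn_measurable[OF \<theta>'(1)], of z] test_fn_integrable[OF \<theta>'(1)] \<theta>'(3) by auto
  have [measurable]: "\<theta> \<in> borel_measurable borel" by (rule test_fn_measurable[OF \<theta>'(1)])
  have [measurable]: "\<Psi> \<in> borel_measurable borel" by (rule \<Psi>(1))
  from test_fnD[OF \<theta>'(1)] obtain L where L: "compact L" "L \<subseteq> ball 0 \<sigma>" "\<And>x. x \<notin> L \<Longrightarrow> \<theta> x = 0" by blast
  define a where "a i j z = (\<integral>w. \<Psi> w $ i $ j * \<theta> (z - w) \<partial>lborel)" for i j z
  define \<Phi> where "\<Phi> z = (\<chi> i j. a i j z)" for z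
  let ?K = "{x + y | x y. x \<in> K \<and> y \<in> L}"
  have K: "compact ?K" by (rule compact_sums[OF \<Psi>(3) L(1)])
  have KQ: "?K \<subseteq> Q" using sub L(2) by (force simp: dist_norm)
  have z: "\<Psi> w = 0 \<or> \<theta> (z - w) = 0" if "z \<notin> ?K" for z w
  proof (rule ccontr)
    assume "\<not> ?thesis"
    then have "w \<in> K" "z - w \<in> L" using \<Psi>(4) L(3) by blast+
    then have "w + (z - w) \<in> ?K" by blast
    moreover have "w + (z - w) = z" by (rule add.commute[THEN trans, OF diff_add_cancel])
    ultimately show False using that by metis
  qed
  have ta: "test_fn Q (a i j)" for i j
  proof (rule test_fnI[OF _ K KQ])
    show "smooth (a i j)" unfolding a_def[abs_def] by (rule convolution_smooth(1)[OF i\<Psi>e \<theta>'(1)])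
    show "a i j x = 0" if "x \<notin> ?K" for x
    proof -
      have "(\<lambda>w. \<Psi> w $ i $ j * \<theta> (x - w)) = (\<lambda>w. 0)" using z[OF that] by (intro ext) (metis mult_eq_0_iff zero_index)
      then show ?thesis unfolding a_def by simp
    qed
  qed
  have t\<Phi>: "test_fn Q \<Phi>" unfolding \<Phi>_def[abs_def] by (rule test_fn_matrix[OF ta])
  have n\<Phi>: "norm (\<Phi> z) \<le> c" for z
  proof -
    have i1: "integrable lborel (\<lambda>w. \<theta> (z - w) *\<^sub>R \<Psi> w)"
    proof (rule Bochner_Integration.integrable_bound)
      show "integrable lborel (\<lambda>w. \<theta> (z - w) * c)" using i\<theta> by simp
      show "AE w in lborel. norm (\<theta> (z - w) *\<^sub>R \<Psi> w) \<le> norm (\<theta> (z - w) * c)"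
        using \<Psi>(2) by (intro AE_I2) (auto simp: abs_mult intro!: mult_left_mono intro: order_trans[OF _ abs_ge_self])
    qed measurable
    have "\<Phi> z = (\<integral>w. \<theta> (z - w) *\<^sub>R \<Psi> w \<partial>lborel)"
    proof -
      have "(\<integral>w. \<theta> (z - w) *\<^sub>R \<Psi> w \<partial>lborel) $ i $ j = a i j z" for i j
        using integral_bounded_linear[OF bounded_linear_entry i1, of i j] by (simp add: a_def mult.commute)
      then show ?thesis by (simp add: \<Phi>_def vec_eq_iff)
    qed
    then have "norm (\<Phi> z) \<le> (\<integral>w. norm (\<theta> (z - w) *\<^sub>R \<Psi> w) \<partial>lborel)"
      by (simp only:) (rule integral_norm_bound)
    also have "\<dots> \<le> (\<integral>w. \<theta> (z - w) * c \<partial>lborel)"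
    proof (rule integral_mono)
      show "integrable lborel (\<lambda>w. norm (\<theta> (z - w) *\<^sub>R \<Psi> w))" by (rule integrable_norm[OF i1])
      show "integrable lborel (\<lambda>w. \<theta> (z - w) * c)" using i\<theta> by simp
      show "norm (\<theta> (z - w) *\<^sub>R \<Psi> w) \<le> \<theta> (z - w) * c" for w
        using \<Psi>(2)[of w] \<theta>'(2)[of "z - w"] by (simp add: mult_left_mono)
    qed
    also have "\<dots> = c" using i\<theta> by simp
    finally show ?thesis .
  qed
  have "(\<integral>z. u i z * dd (a i j) z v \<partial>lborel) = br (u i) (\<lambda>w. \<Psi> w $ i $ j) (\<lambda>x. dd \<theta> x v)" for i j v
    unfolding a_def[abs_def] convolution_smooth(2)[OF i\<Psi>e \<theta>'(1)]
    by (rule br_swap[OF int_u i\<Psi>e test_fn_dd[OF \<theta>'(1)], symmetric])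
  then have "dvf \<Phi> = - ell \<theta> \<Psi>"
    unfolding dvf_eq[OF t\<Phi>] ell_def by (simp add: \<Phi>_def)
  with t\<Phi> n\<Phi> show ?thesis by blast
qed

end

section \<open>The variation as a supremum and its near maximizers\<close>

locale euler_bv = euler_L1 +
  fixes W0 :: real
  assumes var_bound: "\<And>\<Phi> :: (real^'a) \<times> real \<Rightarrow> real^'a^'a. test_fn Q \<Phi> \<Longrightarrow> (\<And>z. norm (\<Phi> z) \<le> 1) \<Longrightarrow> dvf \<Phi> \<le> W0"
begin

text \<open>The total variation of the spatial gradient over \<open>Q\<close>. The assumed bound
  \<open>W0\<close> makes the supremum finite, but the perturbation argument needs the supremum
  itself, since it compares with fields that nearly attain it.\<close>

definition W :: real where
  "W = (SUP \<Phi>\<in>{\<Phi>. test_fn Q \<Phi> \<and> (\<forall>z. norm (\<Phi> z) \<le> 1)}. dvf \<Phi>)"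

lemma W_upper: "test_fn Q \<Phi> \<Longrightarrow> (\<And>z. norm (\<Phi> z) \<le> 1) \<Longrightarrow> dvf \<Phi> \<le> W"
  unfolding W_def by (rule cSUP_upper) (auto intro!: bdd_aboveI2[of _ _ W0] var_bound)

lemma W_nonneg: "W \<ge> 0"
proof -
  have "dvf (\<lambda>w. 0 *\<^sub>R (\<lambda>w. 0) w) = 0 * dvf (\<lambda>w. 0)" by (rule dvf_scaleR[OF test_fn_zero])
  then show ?thesis using W_upper[OF test_fn_zero] by simp
qed

lemma dvf_le:
  assumes "test_fn Q \<Phi>" "\<And>z. norm (\<Phi> z) \<le> c" "c > 0" shows "dvf \<Phi> \<le> c * W"
proof -
  have "dvf (\<lambda>w. inverse c *\<^sub>R \<Phi> w) \<le> W"
    using assms by (intro W_upper test_fn_bounded_linear[OF bounded_linear_scaleR_right]) (auto simp: field_simps)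
  then show ?thesis using assms(3) by (simp add: dvf_scaleR[OF assms(1)] field_simps)
qed

text \<open>Through \<open>mollify_field\<close>, a bounded measurable field obeys the same
  variation bound as a smooth one.\<close>

lemma ell_le:
  assumes \<Psi>: "\<Psi> \<in> borel_measurable borel" "\<And>w. norm (\<Psi> w) \<le> c" "compact K" "\<And>w. w \<notin> K \<Longrightarrow> \<Psi> w = 0"
    and \<theta>: "mollifier \<sigma> \<theta>" and sub: "\<And>w. w \<in> K \<Longrightarrow> ball w \<sigma> \<subseteq> Q" and c: "c > 0"
  shows "ell \<theta> \<Psi> \<le> c * W"
proof -
  obtain \<Phi> where \<Phi>: "test_fn Q \<Phi>" "\<And>z. norm (\<Phi> z) \<le> c" "dvf \<Phi> = - ell \<theta> \<Psi>"
    using mollify_field[OF \<Psi> \<theta> sub] by blast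
  have "dvf (\<lambda>w. (- 1) *\<^sub>R \<Phi> w) \<le> c * W"
    by (rule dvf_le[OF test_fn_bounded_linear[OF bounded_linear_scaleR_right \<Phi>(1)] _ c]) (use \<Phi>(2) in simp)
  then show ?thesis using dvf_scaleR[OF \<Phi>(1), of "-1"] \<Phi>(3) by simp
qed

lemma near_optimal_field:
  assumes "\<delta> > 0"
  shows "\<exists>\<Phi>. test_fn Q \<Phi> \<and> (\<forall>z. norm (\<Phi> z) \<le> 1) \<and> (\<forall>z. (\<Sum>i\<in>UNIV. \<Phi> z $ i $ i) = 0) \<and>
    eventually (\<lambda>\<theta>. W - \<delta> \<le> ell \<theta> \<Phi>) mollifiers"
proof -
  have "\<exists>\<Phi>\<in>{\<Phi>. test_fn Q \<Phi> \<and> (\<forall>z. norm (\<Phi> z) \<le> 1)}. W - \<delta> < dvf \<Phi>"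
    unfolding W_def
    by (rule less_cSUP_iff[THEN iffD1])
       (use assms test_fn_zero in \<open>auto intro!: bdd_aboveI2[of _ _ W0] var_bound exI[of _ "\<lambda>_. 0"]\<close>)
  then obtain \<Phi> where \<Phi>: "test_fn Q \<Phi>" "\<And>z. norm (\<Phi> z) \<le> 1" "W - \<delta> < dvf \<Phi>" by blast
  define n where "n = real CARD('a)"
  have n: "n > 0" by (simp add: n_def)
  define g where "g z = (\<Sum>i\<in>UNIV. \<Phi> z $ i $ i) / n" for z
  have tg: "test_fn Q g"
    unfolding g_def[abs_def] divide_inverse
    by (intro test_fn_mult[OF test_fn_sum[OF test_fn_entry[OF \<Phi>(1)]] smooth_const])
  \<comment> \<open>Minus the trace free part: the sign compensates the one in
    \<open>ell_tendsto\<close>, so that \<open>ell\<close>, not \<open>dvf\<close>, is nearly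
    maximal.\<close>
  define \<Phi>0 where "\<Phi>0 z = g z *\<^sub>R mat 1 - \<Phi> z" for z
  have tI: "test_fn Q (\<lambda>w. g w *\<^sub>R (mat 1 :: real^'a^'a))"
    by (rule test_fn_bounded_linear[OF bounded_linear_scaleR_left tg])
  have t0: "test_fn Q \<Phi>0"
  proof -
    have "test_fn Q (\<lambda>w. g w *\<^sub>R (mat 1 :: real^'a^'a) + (- 1) *\<^sub>R \<Phi> w)"
      by (rule test_fn_add[OF tI test_fn_bounded_linear[OF bounded_linear_scaleR_right \<Phi>(1)]])
    then show ?thesis by (simp add: \<Phi>0_def[abs_def])
  qed
  have tr: "(\<Sum>i\<in>UNIV. \<Phi>0 z $ i $ i) = 0" for z
    using n by (simp add: \<Phi>0_def sum_subtractf mat_def g_def n_def)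
  \<comment> \<open>The trace free part is orthogonal to the multiples of the identity, so by
    Pythagoras the projection does not increase the norm.\<close>
  have nm: "norm (\<Phi>0 z) \<le> 1" for z
  proof -
    have "\<Phi>0 z \<bullet> (g z *\<^sub>R mat 1) = g z * (\<Sum>i\<in>UNIV. \<Phi>0 z $ i $ i)"
      by (simp add: inner_matrix mat_def if_distrib[of "\<lambda>x. _ * x"] sum_distrib_left mult.commute cong: if_cong)
    then have o: "\<Phi>0 z \<bullet> (g z *\<^sub>R mat 1) = 0" by (simp add: tr)
    define A where "A = g z *\<^sub>R (mat 1 :: real^'a^'a)"
    have "\<Phi> z = A - \<Phi>0 z" "\<Phi>0 z \<bullet> A = 0" using o by (simp_all add: \<Phi>0_def A_def)
    then have "(norm (\<Phi> z))\<^sup>2 = (norm A)\<^sup>2 + (norm (\<Phi>0 z))\<^sup>2"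
      unfolding power2_norm_eq_inner by (simp add: inner_diff_left inner_diff_right inner_commute)
    then have "(norm (\<Phi>0 z))\<^sup>2 \<le> (norm (\<Phi> z))\<^sup>2" by simp
    then have "norm (\<Phi>0 z) \<le> norm (\<Phi> z)" by (rule power2_le_imp_le) simp
    then show ?thesis using \<Phi>(2)[of z] by simp
  qed
  have "dvf \<Phi>0 = - dvf \<Phi>"
    unfolding \<Phi>0_def[abs_def] by (subst dvf_diff[OF tI \<Phi>(1)]) (simp add: dvf_scalar_identity[OF tg])
  then have "((\<lambda>\<theta>. ell \<theta> \<Phi>0) \<longlongrightarrow> dvf \<Phi>) mollifiers" using ell_tendsto[OF t0] by simp
  then have "eventually (\<lambda>\<theta>. W - \<delta> < ell \<theta> \<Phi>0) mollifiers" using \<Phi>(3) by (rule order_tendstoD(1))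
  then have "eventually (\<lambda>\<theta>. W - \<delta> \<le> ell \<theta> \<Phi>0) mollifiers" by eventually_elim simp
  with t0 nm tr show ?thesis by blast
qed

text \<open>A field that is pointwise almost orthogonal to a near maximizer \<open>\<Phi>\<close> has a small pairing:
  otherwise \<open>\<Phi> + s \<Psi>\<close> would beat the supremum.\<close>

lemma ell_near_orthogonal:
  assumes \<Phi>: "test_fn Q \<Phi>" "\<And>z. norm (\<Phi> z) \<le> 1" and opt: "W - \<delta> \<le> ell \<theta> \<Phi>"
    and \<Psi>: "\<Psi> \<in> borel_measurable borel" "\<And>w. norm (\<Psi> w) \<le> C" "\<And>w. w \<notin> K \<Longrightarrow> \<Psi> w = 0"
    and orth: "\<And>w. \<Phi> w \<bullet> \<Psi> w \<le> k" and K: "compact K" "\<And>w. w \<notin> K \<Longrightarrow> \<Phi> w = 0"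
    and \<theta>: "mollifier \<sigma> \<theta>" and sub: "\<And>w. w \<in> K \<Longrightarrow> ball w \<sigma> \<subseteq> Q"
    and s: "s > 0" and k: "k \<ge> 0"
  shows "ell \<theta> \<Psi> \<le> W * (k + s * C\<^sup>2 / 2) + \<delta> / s"
proof -
  note \<theta>' = mollifierD[OF \<theta>]
  have i1: "integrable lborel (\<lambda>w. \<Phi> w $ i $ j)" for i j by (rule test_fn_integrable[OF test_fn_entry[OF \<Phi>(1)]])
  have i2: "integrable lborel (\<lambda>w. \<Psi> w $ i $ j)" for i j
    by (rule integrable_bounded_linear[OF bounded_linear_entry integrable_compact_support[OF \<Psi>(1) K(1) \<Psi>(3,2)]])
  have lin: "ell \<theta> (\<lambda>w. \<Phi> w + s *\<^sub>R \<Psi> w) = ell \<theta> \<Phi> + s * ell \<theta> \<Psi>"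
    unfolding ell_def using br_lin[OF int_u i1 i2 test_fn_dd[OF \<theta>'(1)]]
    by (simp add: sum.distrib sum_distrib_left)
  have C: "C \<ge> 0" using \<Psi>(2) norm_ge_zero order_trans by blast
  \<comment> \<open>Since sqrt(1 + 2x) is at most 1 + x, this is a bound for the norm of the
    perturbed field, with x = s k + s^2 C^2 / 2.\<close>
  define c where "c = 1 + s * k + s\<^sup>2 * C\<^sup>2 / 2"
  have c: "c > 0" using s k by (auto simp: c_def intro!: add_pos_nonneg)
  have "ell \<theta> (\<lambda>w. \<Phi> w + s *\<^sub>R \<Psi> w) \<le> c * W"
  proof (rule ell_le[OF _ _ K(1) _ \<theta> sub c])
    show "(\<lambda>w. \<Phi> w + s *\<^sub>R \<Psi> w) \<in> borel_measurable borel"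
      using test_fn_measurable[OF \<Phi>(1)] \<Psi>(1) by measurable
    show "\<Phi> w + s *\<^sub>R \<Psi> w = 0" if "w \<notin> K" for w using that K(2) \<Psi>(3) by simp
    fix w
    have "(norm (\<Phi> w + s *\<^sub>R \<Psi> w))\<^sup>2 = (norm (\<Phi> w))\<^sup>2 + 2 * s * (\<Phi> w \<bullet> \<Psi> w) + s\<^sup>2 * (norm (\<Psi> w))\<^sup>2"
      unfolding power2_norm_eq_inner
      by (simp add: inner_add_left inner_add_right inner_commute power2_eq_square algebra_simps)
    also have "\<dots> \<le> 1\<^sup>2 + 2 * s * k + s\<^sup>2 * C\<^sup>2"
      using \<Phi>(2)[of w] \<Psi>(2)[of w] orth[of w] s
      by (intro add_mono power_mono mult_left_mono) auto
    also have "\<dots> \<le> c\<^sup>2"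
    proof -
      define x where "x = s * k + s\<^sup>2 * C\<^sup>2 / 2"
      have "c\<^sup>2 = 1 + 2 * x + x\<^sup>2" by (simp add: c_def x_def power2_eq_square algebra_simps)
      then have "1 + 2 * x \<le> c\<^sup>2" by simp
      then show ?thesis by (simp add: x_def algebra_simps)
    qed
    finally show "norm (\<Phi> w + s *\<^sub>R \<Psi> w) \<le> c" by (rule power2_le_imp_le) (use c in simp)
  qed
  then have "W - \<delta> + s * ell \<theta> \<Psi> \<le> c * W" using opt lin by linarith
  then have "s * ell \<theta> \<Psi> \<le> s * (W * (k + s * C\<^sup>2 / 2)) + \<delta>"
    by (simp add: c_def algebra_simps power2_eq_square)
  then have "ell \<theta> \<Psi> \<le> (s * (W * (k + s * C\<^sup>2 / 2)) + \<delta>) / s"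
    using s by (simp add: pos_le_divide_eq mult.commute)
  then show ?thesis using s by (simp add: add_divide_distrib)
qed

end

section \<open>Increments as averaged gradients\<close>

abbreviation emb :: "real^'n::finite \<Rightarrow> (real^'n) \<times> real" where "emb y \<equiv> (y, 0)"

lemma emb_xdir: "emb y = (\<Sum>k\<in>UNIV. (y $ k) *\<^sub>R xdir k)"
proof -
  have "fst (\<Sum>k\<in>UNIV. (y $ k) *\<^sub>R (xdir k :: (real^'a) \<times> real)) = (\<Sum>k\<in>UNIV. (y $ k) *\<^sub>R axis k 1)"
    by (simp add: fst_sum xdir_def)
  also have "\<dots> = y" by (simp add: basis_expansion flip: scalar_mult_eq_scaleR)
  finally show ?thesis by (simp add: prod_eq_iff snd_sum xdir_def)
qed

lemma borel_measurable_matrix: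
  fixes f :: "'a \<Rightarrow> real^'n::finite^'m::finite"
  assumes "\<And>i j. (\<lambda>w. f w $ i $ j) \<in> borel_measurable N"
  shows "f \<in> borel_measurable N"
proof -
  have "f = (\<lambda>w. \<Sum>i\<in>UNIV. \<Sum>j\<in>UNIV. f w $ i $ j *\<^sub>R axis i (axis j (1::real)))"
    unfolding matrix_basis_sum[symmetric] by (simp add: vec_eq_iff fun_eq_iff)
  moreover have "(\<lambda>w. \<Sum>i\<in>UNIV. \<Sum>j\<in>UNIV. f w $ i $ j *\<^sub>R axis i (axis j (1::real))) \<in> borel_measurable N"
    using assms by (intro borel_measurable_sum borel_measurable_scaleR) auto
  ultimately show ?thesis by simp
qed

lemma diff_mult_diff: "g * (a - b) - g * (c - d) = g * ((a - c) - (b - d))" for g :: real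
  by (simp add: algebra_simps)

lemma mult_le_abs_mult: "x * y \<le> \<bar>x\<bar> * \<bar>y\<bar>" for x y :: real
  by (metis abs_ge_self abs_mult)

lemma abs_mult_remainder: "\<bar>g * a - g * b - (g * d) * t\<bar> = \<bar>g\<bar> * \<bar>a - b - t * d\<bar>" for g :: real
  by (simp add: abs_mult[symmetric] algebra_simps)

context euler_L1
begin

text \<open>The mollified component of the velocity. Its derivative is minus the correlation with
  the derivative of \<open>\<theta>\<close>, so \<open>ell \<theta> \<Psi>\<close> is the integral
  of \<open>\<Psi>\<close> against its gradient.\<close>

definition us :: "((real^'n) \<times> real \<Rightarrow> real) \<Rightarrow> 'n \<Rightarrow> (real^'n) \<times> real \<Rightarrow> real" where
  "us \<theta> i w = (\<integral>z. u i z * \<theta> (z - w) \<partial>lborel)"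

lemma us_smooth:
  assumes "mollifier \<sigma> \<theta>"
  shows "smooth (us \<theta> i)" "dd (us \<theta> i) w v = - (\<integral>z. u i z * dd \<theta> (z - w) v \<partial>lborel)"
  unfolding us_def[abs_def]
  using correlation_smooth[OF int_u mollifierD(1)[OF assms], of i] by auto

lemma us_bound:
  assumes "mollifier \<sigma> \<theta>" shows "\<bar>us \<theta> i w\<bar> \<le> M"
proof -
  note \<theta>' = mollifierD[OF assms]
  have i: "integrable lborel (\<lambda>z. \<theta> (z - w))" "(\<integral>z. \<theta> (z - w) \<partial>lborel) = 1"
    using integrable_shift(4)[OF test_fn_integrable[OF \<theta>'(1)]] integral_shift(2)[OF test_fn_measurable[OF \<theta>'(1)]] \<theta>'(3) by auto
  have "\<bar>us \<theta> i w\<bar> \<le> (\<integral>z. M * \<theta> (z - w) \<partial>lborel)"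
    unfolding us_def
  proof (rule order.trans[OF integral_abs_bound integral_mono])
    show "integrable lborel (\<lambda>z. \<bar>u i z * \<theta> (z - w)\<bar>)"
      by (intro integrable_abs br_integrable(1)[OF int_u int_u \<theta>'(1)])
    show "\<bar>u i z * \<theta> (z - w)\<bar> \<le> M * \<theta> (z - w)" for z
      using \<theta>'(2)[of "z - w"] u_bd[of i z] by (auto simp: abs_mult intro!: mult_right_mono)
  qed (use i in simp)
  also have "\<dots> = M" using i by simp
  finally show ?thesis .
qed

lemma us_quadratic:
  assumes "mollifier \<sigma> \<theta>"
  shows "\<exists>C\<ge>0. \<forall>w h. \<bar>us \<theta> i (w + h) - us \<theta> i w - dd (us \<theta> i) w h\<bar> \<le> C * (norm h)\<^sup>2"
proof -
  note \<theta>' = mollifierD[OF assms]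
  obtain q where q: "q \<ge> 0" "\<And>x h. norm (\<theta> (x + h) - \<theta> x - dd \<theta> x h) \<le> q * (norm h)\<^sup>2"
    using test_fn_quadratic[OF \<theta>'(1)] by blast
  have neg: "dd \<theta> x (- h) = - dd \<theta> x h" for x h
    using linear_neg[OF bounded_linear.linear[OF smooth_dd_linear[OF test_fn_smooth[OF \<theta>'(1)]]]] .
  have "\<bar>us \<theta> i (w + h) - us \<theta> i w - dd (us \<theta> i) w h\<bar> \<le> (\<integral>z. \<bar>u i z\<bar> \<partial>lborel) * q * (norm h)\<^sup>2" for w h
  proof -
    note i = br_integrable(1)[OF int_u[of i] int_u \<theta>'(1)] br_integrable(1)[OF int_u[of i] int_u test_fn_dd[OF \<theta>'(1)]]
    have "us \<theta> i (w + h) - us \<theta> i w - dd (us \<theta> i) w h =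
      (\<integral>z. u i z * \<theta> (z - (w + h)) - u i z * \<theta> (z - w) + u i z * dd \<theta> (z - w) h \<partial>lborel)"
      unfolding us_smooth(2)[OF assms] unfolding us_def using i by simp
    also have "\<bar>\<dots>\<bar> \<le> (\<integral>z. \<bar>u i z\<bar> * (q * (norm h)\<^sup>2) \<partial>lborel)"
    proof (rule order.trans[OF integral_abs_bound integral_mono])
      show "integrable lborel (\<lambda>z. \<bar>u i z * \<theta> (z - (w + h)) - u i z * \<theta> (z - w) + u i z * dd \<theta> (z - w) h\<bar>)"
        by (intro integrable_abs Bochner_Integration.integrable_add Bochner_Integration.integrable_diff i)
      show "integrable lborel (\<lambda>z. \<bar>u i z\<bar> * (q * (norm h)\<^sup>2))" using int_u by simp
      fix z
      have "u i z * \<theta> (z - (w + h)) - u i z * \<theta> (z - w) + u i z * dd \<theta> (z - w) h =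
        u i z * (\<theta> ((z - w) + (- h)) - \<theta> (z - w) - dd \<theta> (z - w) (- h))"
        by (simp add: neg algebra_simps)
      also have "\<bar>\<dots>\<bar> \<le> \<bar>u i z\<bar> * (q * (norm h)\<^sup>2)"
        unfolding abs_mult using q(2)[of "z - w" "- h"] by (intro mult_left_mono) auto
      finally show "\<bar>u i z * \<theta> (z - (w + h)) - u i z * \<theta> (z - w) + u i z * dd \<theta> (z - w) h\<bar> \<le> \<bar>u i z\<bar> * (q * (norm h)\<^sup>2)" .
    qed
    finally show ?thesis by simp
  qed
  then show ?thesis using q(1) by (intro exI[of _ "(\<integral>z. \<bar>u i z\<bar> \<partial>lborel) * q"]) auto
qed

lemma us_dd_bound:
  assumes "mollifier \<sigma> \<theta>"
  shows "\<exists>C\<ge>0. \<forall>w v. \<bar>dd (us \<theta> i) w v\<bar> \<le> C * norm v"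
proof -
  note \<theta>' = mollifierD[OF assms]
  obtain q where q: "q \<ge> 0" "\<And>x v. norm (dd \<theta> x v) \<le> q * norm v"
    using test_fn_dd_bound[OF \<theta>'(1)] by blast
  have "\<bar>dd (us \<theta> i) w v\<bar> \<le> (\<integral>z. \<bar>u i z\<bar> \<partial>lborel) * q * norm v" for w v
  proof -
    have "\<bar>dd (us \<theta> i) w v\<bar> = \<bar>\<integral>z. u i z * dd \<theta> (z - w) v \<partial>lborel\<bar>"
      unfolding us_smooth(2)[OF assms] by simp
    also have "\<dots> \<le> (\<integral>z. \<bar>u i z\<bar> * (q * norm v) \<partial>lborel)"
    proof (rule order.trans[OF integral_abs_bound integral_mono])
      show "integrable lborel (\<lambda>z. \<bar>u i z * dd \<theta> (z - w) v\<bar>)"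
        by (intro integrable_abs br_integrable(1)[OF int_u int_u test_fn_dd[OF \<theta>'(1)]])
      show "integrable lborel (\<lambda>z. \<bar>u i z\<bar> * (q * norm v))" using int_u by simp
      show "\<bar>u i z * dd \<theta> (z - w) v\<bar> \<le> \<bar>u i z\<bar> * (q * norm v)" for z
        unfolding abs_mult using q(2)[of "z - w" v] by (intro mult_left_mono) auto
    qed
    finally show ?thesis by simp
  qed
  then show ?thesis using q(1) by (intro exI[of _ "(\<integral>z. \<bar>u i z\<bar> \<partial>lborel) * q"]) auto
qed

definition pairing ::
  "('n \<Rightarrow> (real^'n) \<times> real \<Rightarrow> real^'n \<Rightarrow> real) \<Rightarrow> ('n \<Rightarrow> (real^'n) \<times> real \<Rightarrow> real) \<Rightarrow> real" where
  "pairing G f = (\<Sum>i\<in>UNIV. \<integral>p. G i (fst p) (snd p) * (f i (fst p + emb (snd p)) - f i (fst p)) \<partial>lborel)"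

text \<open>The matrix field obtained by inserting u(w + y) - u(w) = integral over s of grad u(w + s
  y) y into \<open>pairing\<close> and substituting w - s y for w: the weight that then stands in
  front of the gradient at w.\<close>

definition shifted_field ::
  "('n \<Rightarrow> (real^'n) \<times> real \<Rightarrow> real^'n \<Rightarrow> real) \<Rightarrow> real \<Rightarrow> (real^'n) \<times> real \<Rightarrow> real^'n^'n" where
  "shifted_field G s w = (\<chi> i k. \<integral>y. G i (w - s *\<^sub>R emb y) y * y $ k \<partial>lborel)"

context
  fixes G :: "'n \<Rightarrow> (real^'n) \<times> real \<Rightarrow> real^'n \<Rightarrow> real" and K0 K :: "((real^'n) \<times> real) set" and B r :: real
  assumes G_meas: "\<And>i. (\<lambda>p. G i (fst p) (snd p)) \<in> borel_measurable borel"
    and G_bound: "\<And>i w y. \<bar>G i w y\<bar> \<le> B"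
    and G_supp: "\<And>i w y. w \<notin> K0 \<or> r < norm y \<Longrightarrow> G i w y = 0"
    and K0: "compact K0" and K: "compact K"
    and K0K: "\<And>w y s. w \<in> K0 \<Longrightarrow> norm y \<le> r \<Longrightarrow> 0 \<le> s \<Longrightarrow> s \<le> 1 \<Longrightarrow> w + s *\<^sub>R emb y \<in> K"
begin

lemma G_int: "integrable lborel (\<lambda>p. G i (fst p) (snd p))"
proof (rule integrable_compact_support[OF G_meas])
  show "compact (K0 \<times> cball (0::real^'n) r)" using K0 by (intro compact_Times) auto
  show "G i (fst p) (snd p) = 0" if "p \<notin> K0 \<times> cball 0 r" for p
    using that by (intro G_supp) (auto simp: mem_Times_iff)
  show "norm (G i (fst p) (snd p)) \<le> B" for p using G_bound by simp
qed

lemma shift_continuous: "continuous_on UNIV (\<lambda>p::((real^'n) \<times> real) \<times> (real^'n). fst p + s *\<^sub>R emb (snd p))"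
  by (intro continuous_intros)

text \<open>The Taylor remainder of \<open>us\<close> is quadratic in s |y|, and |y| is at most r
  wherever \<open>G\<close> does not vanish, so the remainder integrates to a quadratic one in
  s.\<close>

lemma pairing_derivative:
  assumes \<theta>: "mollifier \<sigma> \<theta>"
  shows "((\<lambda>s. \<integral>p. G i (fst p) (snd p) * us \<theta> i (fst p + s *\<^sub>R emb (snd p)) \<partial>lborel) has_real_derivative
    (\<integral>p. G i (fst p) (snd p) * dd (us \<theta> i) (fst p + s *\<^sub>R emb (snd p)) (emb (snd p)) \<partial>lborel)) (at s)"
    and "integrable lborel (\<lambda>p. G i (fst p) (snd p) * us \<theta> i (fst p + s *\<^sub>R emb (snd p)))"
proof -
  note sm = us_smooth(1)[OF \<theta>, of i]
  obtain C where C: "C \<ge> 0" "\<And>w h. \<bar>us \<theta> i (w + h) - us \<theta> i w - dd (us \<theta> i) w h\<bar> \<le> C * (norm h)\<^sup>2"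
    using us_quadratic[OF \<theta>] by blast
  obtain D where D: "D \<ge> 0" "\<And>w v. \<bar>dd (us \<theta> i) w v\<bar> \<le> D * norm v"
    using us_dd_bound[OF \<theta>] by blast
  have cu: "continuous_on UNIV (\<lambda>p. us \<theta> i (fst p + s *\<^sub>R emb (snd p)))" for s
    by (rule continuous_on_compose2[OF smooth_continuous[OF sm, of UNIV] shift_continuous]) auto
  have iu: "integrable lborel (\<lambda>p. G i (fst p) (snd p) * us \<theta> i (fst p + s *\<^sub>R emb (snd p)))" for s
    by (rule integrable_mult_bdd(1)[OF G_int])
       (use us_bound[OF \<theta>] borel_measurable_continuous_onI[OF cu] in \<open>auto simp: bdd_borel_def\<close>)
  show "integrable lborel (\<lambda>p. G i (fst p) (snd p) * us \<theta> i (fst p + s *\<^sub>R emb (snd p)))" by (rule iu)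
  have cd: "continuous_on UNIV (\<lambda>p. dd (us \<theta> i) (fst p + s *\<^sub>R emb (snd p)) (emb (snd p)))"
  proof -
    have "continuous_on UNIV (\<lambda>p::((real^'n) \<times> real) \<times> (real^'n). (fst p + s *\<^sub>R emb (snd p), emb (snd p)))"
      by (intro continuous_intros)
    from continuous_on_compose2[OF dd_continuous[OF sm] this] show ?thesis by simp
  qed
  have Gy: "\<bar>G i (fst p) (snd p)\<bar> * norm (snd p) \<le> \<bar>G i (fst p) (snd p)\<bar> * r" for p
    using G_supp[of "fst p" "snd p" i] by (cases "r < norm (snd p)") (auto intro!: mult_left_mono)
  have idd: "integrable lborel (\<lambda>p. G i (fst p) (snd p) * dd (us \<theta> i) (fst p + s *\<^sub>R emb (snd p)) (emb (snd p)))"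
  proof (rule Bochner_Integration.integrable_bound)
    show "integrable lborel (\<lambda>p. \<bar>G i (fst p) (snd p)\<bar> * r * D)" using G_int by simp
    show "(\<lambda>p. G i (fst p) (snd p) * dd (us \<theta> i) (fst p + s *\<^sub>R emb (snd p)) (emb (snd p))) \<in> borel_measurable lborel"
      using G_meas borel_measurable_continuous_onI[OF cd] by (intro borel_measurable_times) auto
    show "AE p in lborel. norm (G i (fst p) (snd p) * dd (us \<theta> i) (fst p + s *\<^sub>R emb (snd p)) (emb (snd p)))
        \<le> norm (\<bar>G i (fst p) (snd p)\<bar> * r * D)"
    proof (rule AE_I2)
      fix p
      have "norm (G i (fst p) (snd p) * dd (us \<theta> i) (fst p + s *\<^sub>R emb (snd p)) (emb (snd p)))
        \<le> \<bar>G i (fst p) (snd p)\<bar> * (D * norm (snd p))"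
        using D(2)[of "fst p + s *\<^sub>R emb (snd p)" "emb (snd p)"] by (auto simp: abs_mult norm_Pair intro!: mult_left_mono)
      also have "\<dots> = (\<bar>G i (fst p) (snd p)\<bar> * norm (snd p)) * D" by simp
      also have "\<dots> \<le> \<bar>G i (fst p) (snd p)\<bar> * r * D" by (intro mult_right_mono Gy D)
      finally show "norm (G i (fst p) (snd p) * dd (us \<theta> i) (fst p + s *\<^sub>R emb (snd p)) (emb (snd p)))
        \<le> norm (\<bar>G i (fst p) (snd p)\<bar> * r * D)" by (simp add: order_trans[OF _ abs_ge_self])
    qed
  qed
  let ?D = "\<integral>p. G i (fst p) (snd p) * dd (us \<theta> i) (fst p + s *\<^sub>R emb (snd p)) (emb (snd p)) \<partial>lborel"
  have lin: "linear (dd (us \<theta> i) x)" for x using smooth_dd_linear[OF sm] by (rule bounded_linear.linear)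
  show "((\<lambda>s. \<integral>p. G i (fst p) (snd p) * us \<theta> i (fst p + s *\<^sub>R emb (snd p)) \<partial>lborel) has_real_derivative ?D) (at s)"
    unfolding has_field_derivative_def
  proof (rule has_derivative_quadratic[OF bounded_linear_mult_right, where C="(\<integral>p. \<bar>G i (fst p) (snd p)\<bar> \<partial>lborel) * C * r\<^sup>2"])
    fix t
    have e1: "(\<integral>p. G i (fst p) (snd p) * us \<theta> i (fst p + (s + t) *\<^sub>R emb (snd p)) \<partial>lborel)
        - (\<integral>p. G i (fst p) (snd p) * us \<theta> i (fst p + s *\<^sub>R emb (snd p)) \<partial>lborel) - ?D * t =
      (\<integral>p. G i (fst p) (snd p) * us \<theta> i (fst p + (s + t) *\<^sub>R emb (snd p))
        - G i (fst p) (snd p) * us \<theta> i (fst p + s *\<^sub>R emb (snd p))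
        - (G i (fst p) (snd p) * dd (us \<theta> i) (fst p + s *\<^sub>R emb (snd p)) (emb (snd p))) * t \<partial>lborel)"
      using iu[of "s + t"] iu[of s] idd by simp
    have e2: "\<bar>\<integral>p. G i (fst p) (snd p) * us \<theta> i (fst p + (s + t) *\<^sub>R emb (snd p))
        - G i (fst p) (snd p) * us \<theta> i (fst p + s *\<^sub>R emb (snd p))
        - (G i (fst p) (snd p) * dd (us \<theta> i) (fst p + s *\<^sub>R emb (snd p)) (emb (snd p))) * t \<partial>lborel\<bar>
      \<le> (\<integral>p. \<bar>G i (fst p) (snd p)\<bar> * (C * r\<^sup>2 * t\<^sup>2) \<partial>lborel)"
    proof (rule order.trans[OF integral_abs_bound integral_mono])
      show "integrable lborel (\<lambda>p. \<bar>G i (fst p) (snd p) * us \<theta> i (fst p + (s + t) *\<^sub>R emb (snd p))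
        - G i (fst p) (snd p) * us \<theta> i (fst p + s *\<^sub>R emb (snd p))
        - (G i (fst p) (snd p) * dd (us \<theta> i) (fst p + s *\<^sub>R emb (snd p)) (emb (snd p))) * t\<bar>)"
        by (intro integrable_abs Bochner_Integration.integrable_diff integrable_mult_left iu idd)
      show "integrable lborel (\<lambda>p. \<bar>G i (fst p) (snd p)\<bar> * (C * r\<^sup>2 * t\<^sup>2))" using G_int by simp
      fix p :: "((real^'n) \<times> real) \<times> (real^'n)"
      let ?x = "fst p + s *\<^sub>R emb (snd p)" and ?g = "G i (fst p) (snd p)"
      have tl: "dd (us \<theta> i) ?x (t *\<^sub>R emb (snd p)) = t * dd (us \<theta> i) ?x (emb (snd p))"
        by (simp add: linear_cmul[OF lin] del: scaleR_Pair)
      have sx: "fst p + (s + t) *\<^sub>R emb (snd p) = ?x + t *\<^sub>R emb (snd p)"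
        by (simp only: scaleR_add_left add.assoc)
      have "\<bar>?g * us \<theta> i (fst p + (s + t) *\<^sub>R emb (snd p)) - ?g * us \<theta> i ?x - (?g * dd (us \<theta> i) ?x (emb (snd p))) * t\<bar>
        = \<bar>?g\<bar> * \<bar>us \<theta> i (?x + t *\<^sub>R emb (snd p)) - us \<theta> i ?x - dd (us \<theta> i) ?x (t *\<^sub>R emb (snd p))\<bar>"
        unfolding tl sx by (rule abs_mult_remainder)
      also have "\<dots> \<le> \<bar>?g\<bar> * (C * (norm (t *\<^sub>R emb (snd p)))\<^sup>2)" by (intro mult_left_mono C) simp
      also have "\<dots> \<le> \<bar>?g\<bar> * (C * r\<^sup>2 * t\<^sup>2)"
      proof (cases "r < norm (snd p)")
        case True then show ?thesis using G_supp[of "fst p" "snd p" i] by simp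
      next
        case False
        have "(norm (t *\<^sub>R emb (snd p)))\<^sup>2 = (norm (snd p))\<^sup>2 * t\<^sup>2" by (simp add: norm_Pair power_mult_distrib)
        also have "\<dots> \<le> r\<^sup>2 * t\<^sup>2" using False by (intro mult_right_mono power_mono) auto
        finally have "(norm (t *\<^sub>R emb (snd p)))\<^sup>2 \<le> r\<^sup>2 * t\<^sup>2" .
        then show ?thesis using C(1) by (auto simp: mult.assoc intro!: mult_left_mono)
      qed
      finally show "\<bar>?g * us \<theta> i (fst p + (s + t) *\<^sub>R emb (snd p)) - ?g * us \<theta> i ?x - (?g * dd (us \<theta> i) ?x (emb (snd p))) * t\<bar>
        \<le> \<bar>?g\<bar> * (C * r\<^sup>2 * t\<^sup>2)" .
    qed
    show "norm ((\<integral>p. G i (fst p) (snd p) * us \<theta> i (fst p + (s + t) *\<^sub>R emb (snd p)) \<partial>lborel)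
        - (\<integral>p. G i (fst p) (snd p) * us \<theta> i (fst p + s *\<^sub>R emb (snd p)) \<partial>lborel) - ?D * t)
        \<le> (\<integral>p. \<bar>G i (fst p) (snd p)\<bar> \<partial>lborel) * C * r\<^sup>2 * (norm t)\<^sup>2"
      unfolding e1 real_norm_def power2_abs mult.assoc
      using e2 by (simp only: integral_mult_left_zero mult.assoc)
  qed
qed

lemma shifted_G_meas: "(\<lambda>p. G i (fst p - s *\<^sub>R emb (snd p)) (snd p)) \<in> borel_measurable borel"
proof -
  have "(\<lambda>p::((real^'n) \<times> real) \<times> (real^'n). (fst p - s *\<^sub>R emb (snd p), snd p)) \<in> borel_measurable borel"
    by (intro borel_measurable_continuous_onI continuous_intros)
  from measurable_compose[OF this G_meas[of i]] show ?thesis by simp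
qed

lemma shifted_G_supp:
  assumes "0 \<le> s" "s \<le> 1" "w \<notin> K \<or> r < norm y" shows "G i (w - s *\<^sub>R emb y) y = 0"
proof (rule G_supp, rule ccontr)
  assume "\<not> (w - s *\<^sub>R emb y \<notin> K0 \<or> r < norm y)"
  then have "(w - s *\<^sub>R emb y) + s *\<^sub>R emb y \<in> K" using assms by (intro K0K) auto
  moreover have "(w - s *\<^sub>R emb y) + s *\<^sub>R emb y = w" by (rule diff_add_cancel)
  ultimately show False using assms \<open>\<not> (w - s *\<^sub>R emb y \<notin> K0 \<or> r < norm y)\<close> by metis
qed

lemma shifted_int:
  assumes s: "0 \<le> s" "s \<le> 1" and g: "g \<in> borel_measurable borel" "\<And>w. \<bar>g w\<bar> \<le> A"
  shows "integrable lborel (\<lambda>p. G i (fst p - s *\<^sub>R emb (snd p)) (snd p) * snd p $ k * g (fst p))"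
proof (rule integrable_compact_support)
  have "(\<lambda>p::((real^'n) \<times> real) \<times> (real^'n). snd p $ k) \<in> borel_measurable borel"
    by (intro borel_measurable_continuous_onI continuous_intros)
  moreover have "(\<lambda>p::((real^'n) \<times> real) \<times> (real^'n). fst p) \<in> borel_measurable borel"
    by (intro borel_measurable_continuous_onI continuous_intros)
  then have "(\<lambda>p::((real^'n) \<times> real) \<times> (real^'n). g (fst p)) \<in> borel_measurable borel"
    by (rule measurable_compose[OF _ g(1)])
  ultimately show "(\<lambda>p. G i (fst p - s *\<^sub>R emb (snd p)) (snd p) * snd p $ k * g (fst p)) \<in> borel_measurable borel"
    by (intro borel_measurable_times shifted_G_meas)
  show "compact (K \<times> cball (0::real^'n) r)" using K by (intro compact_Times) auto
  fix p :: "((real^'n) \<times> real) \<times> (real^'n)"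
  have A: "A \<ge> 0" using g(2)[of 0] by simp
  have B: "B \<ge> 0" using G_bound[of i 0 0] by simp
  show z: "G i (fst p - s *\<^sub>R emb (snd p)) (snd p) * snd p $ k * g (fst p) = 0" if "p \<notin> K \<times> cball 0 r"
    using that shifted_G_supp[OF s, of "fst p" "snd p" i] by (auto simp: mem_Times_iff)
  show "norm (G i (fst p - s *\<^sub>R emb (snd p)) (snd p) * snd p $ k * g (fst p)) \<le> B * \<bar>r\<bar> * A"
  proof (cases "p \<in> K \<times> cball 0 r")
    case False
    from z[OF this] show ?thesis using A B by (simp only: norm_zero) simp
  next
    case True
    then have "\<bar>snd p $ k\<bar> \<le> \<bar>r\<bar>" using component_le_norm_cart[of "snd p" k] by (auto simp: mem_Times_iff)
    then show ?thesis unfolding real_norm_def abs_mult using G_bound g(2) A B by (intro mult_mono) auto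
  qed
qed

lemma shifted_field_facts:
  assumes s: "0 \<le> s" "s \<le> 1"
  shows "shifted_field G s \<in> borel_measurable borel" "w \<notin> K \<Longrightarrow> shifted_field G s w = 0"
proof -
  have "(\<lambda>w. \<integral>y. G i (w - s *\<^sub>R emb y) y * y $ k \<partial>lborel) \<in> borel_measurable borel" for i k
  proof -
    have "(\<lambda>p. G i (fst p - s *\<^sub>R emb (snd p)) (snd p) * snd p $ k) \<in> borel_measurable borel"
      by (intro borel_measurable_times shifted_G_meas borel_measurable_continuous_onI continuous_intros)
    then have "(\<lambda>(w, y). G i (w - s *\<^sub>R emb y) y * y $ k) \<in> borel_measurable (lborel \<Otimes>\<^sub>M lborel)"
      by (simp add: case_prod_beta' lborel_prod)
    from lborel.borel_measurable_lebesgue_integral[OF this] show ?thesis by simp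
  qed
  then show "shifted_field G s \<in> borel_measurable borel"
    by (intro borel_measurable_matrix) (simp add: shifted_field_def)
  show "shifted_field G s w = 0" if "w \<notin> K"
    using shifted_G_supp[OF s, of w] that by (simp add: shifted_field_def vec_eq_iff)
qed

text \<open>Fubini, the translation of w by - s y for fixed y, and Fubini back. The expansion of
  \<open>emb y\<close> in the directions \<open>xdir k\<close> produces the columns of the matrix
  field.\<close>

lemma derivative_eq_ell:
  assumes \<theta>: "mollifier \<sigma> \<theta>" and s: "0 \<le> s" "s \<le> 1"
  shows "(\<Sum>i\<in>UNIV. \<integral>p. G i (fst p) (snd p) * dd (us \<theta> i) (fst p + s *\<^sub>R emb (snd p)) (emb (snd p)) \<partial>lborel)
    = ell \<theta> (shifted_field G s)"
proof -
  have "(\<integral>p. G i (fst p) (snd p) * dd (us \<theta> i) (fst p + s *\<^sub>R emb (snd p)) (emb (snd p)) \<partial>lborel) =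
    (\<Sum>k\<in>UNIV. - br (u i) (\<lambda>w. shifted_field G s w $ i $ k) (\<lambda>x. dd \<theta> x (xdir k)))" for i
  proof -
    note sm = us_smooth(1)[OF \<theta>, of i]
    obtain D where D: "D \<ge> 0" "\<And>w v. \<bar>dd (us \<theta> i) w v\<bar> \<le> D * norm v"
      using us_dd_bound[OF \<theta>] by blast
    define d where "d k w = dd (us \<theta> i) w (xdir k)" for k w
    have dm: "d k \<in> borel_measurable borel" for k unfolding d_def[abs_def] by (rule smooth_measurable[OF smooth_dd[OF sm]])
    have db: "\<bar>d k w\<bar> \<le> D" for k w
      using D(2)[of w "xdir k"] by (simp add: d_def xdir_def norm_Pair norm_axis_1)
    note si = shifted_int[OF s dm db]
    have gi: "integrable lborel (\<lambda>p. G i (fst p) (snd p) * snd p $ k * d k (fst p + s *\<^sub>R emb (snd p)))" for k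
    proof -
      have c: "continuous_on UNIV (\<lambda>p::((real^'n) \<times> real) \<times> (real^'n). d k (fst p + s *\<^sub>R emb (snd p)))"
        unfolding d_def by (rule continuous_on_compose2[OF smooth_continuous[OF smooth_dd[OF sm], of UNIV] shift_continuous]) auto
      have i0: "integrable lborel (\<lambda>p. G i (fst p - 0 *\<^sub>R emb (snd p)) (snd p) * snd p $ k * 1)"
        by (rule shifted_int[of 0 "\<lambda>_. 1" 1]) auto
      then have "integrable lborel (\<lambda>p. G i (fst p) (snd p) * snd p $ k)" by (simp add: zero_prod_def[symmetric])
      then show ?thesis
        by (rule integrable_mult_bdd(1)) (use db borel_measurable_continuous_onI[OF c] in \<open>auto simp: bdd_borel_def\<close>)
    qed
    have lin: "linear (dd (us \<theta> i) x)" for x using smooth_dd_linear[OF sm] by (rule bounded_linear.linear)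
    have ex: "dd (us \<theta> i) x (emb y) = (\<Sum>k\<in>UNIV. y $ k * d k x)" for x y
      unfolding d_def by (subst emb_xdir) (simp only: linear_sum[OF lin] linear_cmul[OF lin] o_def real_scaleR_def)
    have "(\<integral>p. G i (fst p) (snd p) * dd (us \<theta> i) (fst p + s *\<^sub>R emb (snd p)) (emb (snd p)) \<partial>lborel) =
      (\<integral>p. (\<Sum>k\<in>UNIV. G i (fst p) (snd p) * snd p $ k * d k (fst p + s *\<^sub>R emb (snd p))) \<partial>lborel)"
      unfolding ex sum_distrib_left by (simp only: mult.assoc)
    also have "\<dots> = (\<Sum>k\<in>UNIV. \<integral>p. G i (fst p) (snd p) * snd p $ k * d k (fst p + s *\<^sub>R emb (snd p)) \<partial>lborel)"
      by (rule Bochner_Integration.integral_sum) (rule gi)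
    also have "\<dots> = (\<Sum>k\<in>UNIV. - br (u i) (\<lambda>w. shifted_field G s w $ i $ k) (\<lambda>x. dd \<theta> x (xdir k)))"
    proof (rule sum.cong[OF refl])
      fix k
      have m1: "(\<lambda>w. G i w y * y $ k * d k (w + s *\<^sub>R emb y)) \<in> borel_measurable borel" for y
      proof -
        have "(\<lambda>w::(real^'n) \<times> real. (w, y)) \<in> borel_measurable borel"
          by (intro borel_measurable_continuous_onI continuous_intros)
        from measurable_compose[OF this borel_measurable_integrable[OF gi[of k], simplified]]
        show ?thesis by simp
      qed
      have "(\<integral>p. G i (fst p) (snd p) * snd p $ k * d k (fst p + s *\<^sub>R emb (snd p)) \<partial>lborel) =
        (\<integral>y. (\<integral>w. G i w y * y $ k * d k (w + s *\<^sub>R emb y) \<partial>lborel) \<partial>lborel)"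
        using lborel_pair.integral_snd[of "\<lambda>w y. G i w y * y $ k * d k (w + s *\<^sub>R emb y)"] gi[of k]
        by (simp add: lborel_prod case_prod_beta')
      also have "\<dots> = (\<integral>y. (\<integral>w. G i (w - s *\<^sub>R emb y) y * y $ k * d k w \<partial>lborel) \<partial>lborel)"
      proof -
        have "(\<integral>w. G i w y * y $ k * d k (w + s *\<^sub>R emb y) \<partial>lborel) = (\<integral>w. G i (w - s *\<^sub>R emb y) y * y $ k * d k w \<partial>lborel)" for y
          using integral_shift(2)[OF m1[of y], of "s *\<^sub>R emb y"] by (simp del: scaleR_Pair)
        then show ?thesis by simp
      qed
      also have "\<dots> = (\<integral>w. (\<integral>y. G i (w - s *\<^sub>R emb y) y * y $ k * d k w \<partial>lborel) \<partial>lborel)"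
        by (rule lborel_pair.Fubini_integral) (use si[of i k k] in \<open>simp add: lborel_prod case_prod_beta'\<close>)
      also have "\<dots> = (\<integral>w. shifted_field G s w $ i $ k * d k w \<partial>lborel)"
        by (simp add: shifted_field_def)
      also have "\<dots> = - br (u i) (\<lambda>w. shifted_field G s w $ i $ k) (\<lambda>x. dd \<theta> x (xdir k))"
        unfolding br_def d_def us_smooth(2)[OF \<theta>] by simp
      finally show "(\<integral>p. G i (fst p) (snd p) * snd p $ k * d k (fst p + s *\<^sub>R emb (snd p)) \<partial>lborel) = \<dots>" .
    qed
    finally show ?thesis .
  qed
  then show ?thesis by (simp add: ell_def sum_negf)
qed

text \<open>The mean value theorem in s replaces the average over the segment by a single
  intermediate s, so only one field has to be estimated, uniformly in s.\<close>

lemma pairing_us_eq_ell: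
  assumes \<theta>: "mollifier \<sigma> \<theta>"
  shows "\<exists>s. 0 \<le> s \<and> s \<le> 1 \<and> pairing G (us \<theta>) = ell \<theta> (shifted_field G s)"
proof -
  define g where "g s = (\<Sum>i\<in>UNIV. \<integral>p. G i (fst p) (snd p) * us \<theta> i (fst p + s *\<^sub>R emb (snd p)) \<partial>lborel)" for s
  define g' where "g' s = (\<Sum>i\<in>UNIV. \<integral>p. G i (fst p) (snd p) * dd (us \<theta> i) (fst p + s *\<^sub>R emb (snd p)) (emb (snd p)) \<partial>lborel)" for s
  have "(g has_real_derivative g' s) (at s)" for s
    unfolding g_def[abs_def] g'_def by (intro DERIV_sum pairing_derivative(1)[OF \<theta>])
  then obtain s where s: "0 < s" "s < 1" "g 1 - g 0 = (1 - 0) * g' s"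
    using MVT2[of 0 1 g g'] by auto
  have "pairing G (us \<theta>) = g 1 - g 0"
    using pairing_derivative(2)[OF \<theta>, of _ 1] pairing_derivative(2)[OF \<theta>, of _ 0]
    unfolding pairing_def g_def sum_subtractf[symmetric] by (simp add: right_diff_distrib zero_prod_def[symmetric])
  also have "\<dots> = ell \<theta> (shifted_field G s)"
    using s derivative_eq_ell[OF \<theta>, of s] by (simp add: g'_def)
  finally show ?thesis using s by (intro exI[of _ s]) auto
qed

lemma pairing_us_approx:
  assumes "e > 0"
  shows "eventually (\<lambda>\<theta>. pairing G u \<le> pairing G (us \<theta>) + e) mollifiers"
proof -
  define V where "V = measure lborel (cball (0::real^'n) r)"
  have V: "V \<ge> 0" by (simp add: V_def)
  have B: "B \<ge> 0" using G_bound[of undefined 0 0] by simp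
  \<comment> \<open>Each component contributes at most 2 B V d, one share from the shifted point and
    one from the base point; the added 1 keeps the denominator positive.\<close>
  define d where "d = e / (2 * real CARD('n) * (B * V + 1))"
  have d: "d > 0" using assms B V by (simp add: d_def add_nonneg_pos)
  have "\<forall>i. \<exists>\<sigma>>0. \<forall>\<theta>. mollifier \<sigma> \<theta> \<longrightarrow> (\<integral>w. \<bar>us \<theta> i w - u i w\<bar> \<partial>lborel) \<le> d"
    unfolding us_def using mollification_tendsto_L1[OF int_u d] by blast
  then obtain t where t: "\<And>i. t i > 0" "\<And>i \<theta>. mollifier (t i) \<theta> \<Longrightarrow> (\<integral>w. \<bar>us \<theta> i w - u i w\<bar> \<partial>lborel) \<le> d" by metis
  define \<sigma> where "\<sigma> = Min (range t)"
  have \<sigma>: "\<sigma> > 0" "\<And>i. \<sigma> \<le> t i" unfolding \<sigma>_def using t(1) by (auto simp: Min_gr_iff)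
  have "pairing G u \<le> pairing G (us \<theta>) + e" if \<theta>: "mollifier \<sigma> \<theta>" for \<theta>
  proof -
    define f where "f i w = \<bar>us \<theta> i w - u i w\<bar>" for i w
    have ius: "integrable lborel (us \<theta> i)" for i unfolding us_def[abs_def] by (rule mollification_L1[OF int_u \<theta>])
    have fi: "integrable lborel (f i)" for i unfolding f_def[abs_def] using ius int_u by simp
    have fd: "(\<integral>w. f i w \<partial>lborel) \<le> d" for i
      unfolding f_def using t(2)[OF mollifier_mono[OF \<theta> \<sigma>(2)]] .
    have cb: "integrable lborel (indicator (cball (0::real^'n) r) :: _ \<Rightarrow> real)"
      by (intro integrable_real_indicator emeasure_compact_finite compact_cball) simp
    have m0: "(\<lambda>p::((real^'n) \<times> real) \<times> (real^'n). fst p + emb (snd p)) \<in> borel_measurable borel"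
      by (intro borel_measurable_continuous_onI continuous_intros)
    have mf: "(\<lambda>p::((real^'n) \<times> real) \<times> (real^'n). fst p) \<in> borel_measurable borel"
      by (intro borel_measurable_continuous_onI continuous_intros)
    have i1: "integrable lborel (\<lambda>p::((real^'n) \<times> real) \<times> (real^'n). f i (fst p) * indicator (cball (0::real^'n) r) (snd p))"
      "(\<integral>p. f i (fst p) * indicator (cball (0::real^'n) r) (snd p) \<partial>lborel) \<le> d * V" for i
      using integral_lborel_prod_mult[OF fi cb] fd V by (auto simp: V_def intro!: mult_right_mono)
    have i2: "integrable lborel (\<lambda>p::((real^'n) \<times> real) \<times> (real^'n). f i (fst p + emb (snd p)) * indicator (cball (0::real^'n) r) (snd p))"
      "(\<integral>p. f i (fst p + emb (snd p)) * indicator (cball (0::real^'n) r) (snd p) \<partial>lborel) \<le> d * V" for i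
    proof -
      have fm: "f i \<in> borel_measurable borel" using fi by auto
      have sh: "integrable lborel (\<lambda>w. f i (w + emb y))" "(\<integral>w. f i (w + emb y) \<partial>lborel) = (\<integral>w. f i w \<partial>lborel)" for y
        by (rule integrable_shift(1)[OF fi], rule integral_shift(1)[OF fm])
      have mm: "(\<lambda>p::((real^'n) \<times> real) \<times> (real^'n). f i (fst p + emb (snd p)) * indicator (cball (0::real^'n) r) (snd p)) \<in> borel_measurable borel"
      proof (intro borel_measurable_times)
        show "(\<lambda>p::((real^'n) \<times> real) \<times> (real^'n). f i (fst p + emb (snd p))) \<in> borel_measurable borel"
          by (rule measurable_compose[OF m0 fm])
        have "(snd :: ((real^'n) \<times> real) \<times> (real^'n) \<Rightarrow> real^'n) \<in> borel_measurable borel"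
          by (intro borel_measurable_continuous_onI continuous_on_snd continuous_on_id)
        moreover have "(indicator (cball (0::real^'n) r) :: _ \<Rightarrow> real) \<in> borel_measurable borel"
          using borel_measurable_integrable[OF cb] by simp
        ultimately show "(\<lambda>p::((real^'n) \<times> real) \<times> (real^'n). indicator (cball 0 r) (snd p) :: real) \<in> borel_measurable borel"
          by (rule measurable_compose)
      qed
      have ii: "integrable (lborel \<Otimes>\<^sub>M lborel) (\<lambda>(y, w). f i (w + emb y) * indicator (cball (0::real^'n) r) y)"
      proof (rule lborel_pair.Fubini_integrable)
        have "(\<lambda>q::(real^'n) \<times> ((real^'n) \<times> real). (snd q, fst q)) \<in> borel_measurable borel"
          by (intro borel_measurable_continuous_onI continuous_intros)
        from measurable_compose[OF this mm]
        show "(\<lambda>(y, w). f i (w + emb y) * indicator (cball (0::real^'n) r) y) \<in> borel_measurable (lborel \<Otimes>\<^sub>M lborel)"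
          by (simp add: case_prod_beta' lborel_prod)
        have "(\<integral>w. norm (f i (w + emb y) * indicator (cball (0::real^'n) r) y) \<partial>lborel) = (\<integral>w. f i w \<partial>lborel) * indicator (cball (0::real^'n) r) y" for y
        proof -
          have "norm (f i (w + emb y) * indicator (cball (0::real^'n) r) y) = f i (w + emb y) * indicator (cball (0::real^'n) r) y" for w
            by (simp add: f_def)
          then show ?thesis using sh by simp
        qed
        then show "integrable lborel (\<lambda>y. \<integral>w. norm (case (y, w) of (y, w) \<Rightarrow> f i (w + emb y) * indicator (cball (0::real^'n) r) y) \<partial>lborel)"
          using cb by simp
        show "AE y in lborel. integrable lborel (\<lambda>w. case (y, w) of (y, w) \<Rightarrow> f i (w + emb y) * indicator (cball (0::real^'n) r) y)"
          using sh by simp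
      qed
      from lborel_pair.integrable_product_swap[OF ii]
      have ii': "integrable (lborel \<Otimes>\<^sub>M lborel) (\<lambda>(w, y). f i (w + emb y) * indicator (cball (0::real^'n) r) y)"
        by (simp add: case_prod_beta')
      then show "integrable lborel (\<lambda>p::((real^'n) \<times> real) \<times> (real^'n). f i (fst p + emb (snd p)) * indicator (cball (0::real^'n) r) (snd p))"
        by (simp add: lborel_prod case_prod_beta')
      have "(\<integral>p. f i (fst p + emb (snd p)) * indicator (cball (0::real^'n) r) (snd p) \<partial>lborel)
         = (\<integral>y. (\<integral>w. f i (w + emb y) * indicator (cball (0::real^'n) r) y \<partial>lborel) \<partial>lborel)"
        using lborel_pair.integral_snd[OF ii'] by (simp add: lborel_prod case_prod_beta')
      also have "\<dots> = (\<integral>w. f i w \<partial>lborel) * V" using sh by (simp add: V_def)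
      also have "\<dots> \<le> d * V" using fd V by (intro mult_right_mono)
      finally show "(\<integral>p. f i (fst p + emb (snd p)) * indicator (cball (0::real^'n) r) (snd p) \<partial>lborel) \<le> d * V" .
    qed
    have bu: "integrable lborel (\<lambda>p. G i (fst p) (snd p) * (h (fst p + emb (snd p)) - h (fst p)))"
      if "bdd_borel h" for h i
    proof (rule integrable_mult_bdd(1)[OF G_int])
      from that obtain c where c: "h \<in> borel_measurable borel" "\<And>x. \<bar>h x\<bar> \<le> c" by (auto simp: bdd_borel_def)
      have "\<bar>h (fst p + emb (snd p)) - h (fst p)\<bar> \<le> 2 * c" for p :: "((real^'n) \<times> real) \<times> (real^'n)"
        using c(2)[of "fst p + emb (snd p)"] c(2)[of "fst p"] by linarith
      moreover have "(\<lambda>p. h (fst p + emb (snd p)) - h (fst p)) \<in> borel_measurable borel"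
        using measurable_compose[OF m0 c(1)] measurable_compose[OF mf c(1)] by measurable
      ultimately show "bdd_borel (\<lambda>p. h (fst p + emb (snd p)) - h (fst p))" unfolding bdd_borel_def by blast
    qed
    have bdus: "bdd_borel (us \<theta> i)" for i
      using us_bound[OF \<theta>] smooth_measurable[OF us_smooth(1)[OF \<theta>]] by (auto simp: bdd_borel_def)
    have "pairing G u - pairing G (us \<theta>) = (\<Sum>i\<in>UNIV. \<integral>p. G i (fst p) (snd p) * (u i (fst p + emb (snd p)) - u i (fst p))
       - G i (fst p) (snd p) * (us \<theta> i (fst p + emb (snd p)) - us \<theta> i (fst p)) \<partial>lborel)"
      unfolding pairing_def sum_subtractf[symmetric] using bu[OF bdd_u] bu[OF bdus] by simp
    also have "\<dots> \<le> (\<Sum>i\<in>(UNIV::'n set). B * (d * V + d * V))"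
    proof (rule sum_mono)
      fix i
      have "(\<integral>p. G i (fst p) (snd p) * (u i (fst p + emb (snd p)) - u i (fst p))
       - G i (fst p) (snd p) * (us \<theta> i (fst p + emb (snd p)) - us \<theta> i (fst p)) \<partial>lborel) \<le>
       (\<integral>p. B * (f i (fst p + emb (snd p)) * indicator (cball 0 r) (snd p) + f i (fst p) * indicator (cball 0 r) (snd p)) \<partial>lborel)"
      proof (rule integral_mono)
        show "integrable lborel (\<lambda>p. G i (fst p) (snd p) * (u i (fst p + emb (snd p)) - u i (fst p))
       - G i (fst p) (snd p) * (us \<theta> i (fst p + emb (snd p)) - us \<theta> i (fst p)))"
          by (rule Bochner_Integration.integrable_diff[OF bu[OF bdd_u] bu[OF bdus]])
        show "integrable lborel (\<lambda>p. B * (f i (fst p + emb (snd p)) * indicator (cball 0 r) (snd p) + f i (fst p) * indicator (cball 0 r) (snd p)))"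
          by (intro integrable_mult_right Bochner_Integration.integrable_add i1 i2)
        fix p :: "((real^'n) \<times> real) \<times> (real^'n)"
        let ?a = "u i (fst p + emb (snd p)) - us \<theta> i (fst p + emb (snd p))" and ?b = "u i (fst p) - us \<theta> i (fst p)"
        have le: "G i (fst p) (snd p) * (?a - ?b) \<le>
          B * (f i (fst p + emb (snd p)) * indicator (cball 0 r) (snd p) + f i (fst p) * indicator (cball 0 r) (snd p))"
        proof (cases "snd p \<in> cball 0 r")
          case True
          have "\<bar>G i (fst p) (snd p)\<bar> * \<bar>?a - ?b\<bar> \<le> B * (\<bar>?a\<bar> + \<bar>?b\<bar>)"
            by (intro mult_mono abs_triangle_ineq4 G_bound B abs_ge_zero)
          then have "G i (fst p) (snd p) * (?a - ?b) \<le> B * (\<bar>?a\<bar> + \<bar>?b\<bar>)"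
            by (rule order_trans[OF mult_le_abs_mult])
          then show ?thesis using True by (simp only: f_def abs_minus_commute indicator_simps mult_1_right)
        next
          case False
          then show ?thesis using G_supp[of "fst p" "snd p" i] by simp
        qed
        show "G i (fst p) (snd p) * (u i (fst p + emb (snd p)) - u i (fst p))
          - G i (fst p) (snd p) * (us \<theta> i (fst p + emb (snd p)) - us \<theta> i (fst p)) \<le>
          B * (f i (fst p + emb (snd p)) * indicator (cball 0 r) (snd p) + f i (fst p) * indicator (cball 0 r) (snd p))"
          unfolding diff_mult_diff by (rule le)
      qed
      also have "\<dots> = B * ((\<integral>p. f i (fst p + emb (snd p)) * indicator (cball 0 r) (snd p) \<partial>lborel) + (\<integral>p. f i (fst p) * indicator (cball (0::real^'n) r) (snd p) \<partial>lborel))"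
        using i1(1)[of i] i2(1)[of i] by simp
      also have "\<dots> \<le> B * (d * V + d * V)"
        by (intro mult_left_mono add_mono i1(2) i2(2) B)
      finally show "(\<integral>p. G i (fst p) (snd p) * (u i (fst p + emb (snd p)) - u i (fst p))
       - G i (fst p) (snd p) * (us \<theta> i (fst p + emb (snd p)) - us \<theta> i (fst p)) \<partial>lborel) \<le> B * (d * V + d * V)" .
    qed
    also have "\<dots> = e * (B * V / (B * V + 1))"
    proof -
      have "d * (2 * real CARD('n)) = e / (B * V + 1)" by (simp add: d_def)
      moreover have "(\<Sum>i\<in>(UNIV::'n set). B * (d * V + d * V)) = (d * (2 * real CARD('n))) * (B * V)"
        by (simp add: algebra_simps)
      ultimately show ?thesis by simp
    qed
    also have "\<dots> \<le> e * 1"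
      using assms B V by (intro mult_left_mono) (auto simp: divide_le_eq add_nonneg_pos)
    finally show ?thesis by simp
  qed
  then show ?thesis unfolding eventually_mollifiers using \<sigma>(1) by blast
qed

end

end

section \<open>Fields built from finitely many kernels\<close>

lemma integrable_continuous_compact_support:
  fixes f :: "'a::euclidean_space \<Rightarrow> real"
  assumes "continuous_on UNIV f" "compact K" "\<And>x. x \<notin> K \<Longrightarrow> f x = 0"
  shows "integrable lborel f"
proof -
  have "bounded (f ` K)"
    using assms by (intro compact_imp_bounded compact_continuous_image continuous_on_subset[OF assms(1)]) auto
  then obtain B where B: "\<And>x. x \<in> K \<Longrightarrow> norm (f x) \<le> B" by (auto simp: bounded_iff)
  have bd: "norm (f x) \<le> \<bar>B\<bar>" for x
    using B[of x] assms(3)[of x] by (cases "x \<in> K") auto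
  show ?thesis
    by (rule integrable_compact_support[OF _ assms(2,3) bd]) (rule borel_measurable_continuous_onI[OF assms(1)])
qed

lemma norm_matrix_le_sum: "norm A \<le> (\<Sum>i\<in>UNIV. \<Sum>j\<in>UNIV. \<bar>A $ i $ j\<bar>)"
  for A :: "real^'n::finite^'m::finite"
proof -
  have "norm A \<le> (\<Sum>i\<in>UNIV. norm (A $ i))" unfolding norm_vec_def by (rule L2_set_le_sum) simp
  also have "\<dots> \<le> (\<Sum>i\<in>UNIV. \<Sum>j\<in>UNIV. \<bar>A $ i $ j\<bar>)" by (intro sum_mono norm_le_l1_cart)
  finally show ?thesis .
qed

text \<open>The right factor is the quantity whose integral is bounded by \<open>R\<close> at every
  scale, so a perturbation of the matrix costs an amount independent of the radius.\<close>

lemma dd_matrix_bound: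
  fixes \<rho> :: "real^'n::finite \<Rightarrow> real"
  assumes "smooth \<rho>"
  shows "\<bar>dd \<rho> y (A *v y)\<bar> \<le> norm A * ((\<Sum>j\<in>UNIV. \<bar>dd \<rho> y (axis j 1)\<bar>) * norm y)"
proof -
  have c: "\<bar>(A *v y) $ i\<bar> \<le> norm A * norm y" for i
  proof -
    have "(A *v y) $ i = A $ i \<bullet> y" by (simp add: matrix_vector_mult_def inner_vec_def)
    then have "\<bar>(A *v y) $ i\<bar> \<le> norm (A $ i) * norm y" using Cauchy_Schwarz_ineq2 by metis
    also have "\<dots> \<le> norm A * norm y" by (intro mult_right_mono Finite_Cartesian_Product.norm_nth_le) simp
    finally show ?thesis .
  qed
  have "\<bar>dd \<rho> y (A *v y)\<bar> \<le> (\<Sum>i\<in>UNIV. \<bar>(A *v y) $ i * dd \<rho> y (axis i 1)\<bar>)"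
    by (subst dd_axis_expand[OF assms]) (rule sum_abs)
  also have "\<dots> \<le> (\<Sum>i\<in>UNIV. (norm A * norm y) * \<bar>dd \<rho> y (axis i 1)\<bar>)"
    unfolding abs_mult by (intro sum_mono mult_right_mono c) simp
  finally show ?thesis by (simp add: sum_distrib_left sum_distrib_right mult_ac)
qed

lemma kernel_integrable:
  fixes \<rho> :: "real^'n::finite \<Rightarrow> real"
  assumes "test_fn V \<rho>"
  shows "integrable lborel (\<lambda>y. (\<Sum>j\<in>UNIV. \<bar>dd \<rho> y (axis j 1)\<bar>) * norm y)"
    and "integrable lborel (\<lambda>y. dd \<rho> y (A *v y))"
proof -
  from test_fnD[OF assms] obtain K where K: "smooth \<rho>" "compact K" "\<And>x. x \<notin> K \<Longrightarrow> \<rho> x = 0" by blast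
  have z: "dd \<rho> y v = 0" if "y \<notin> K" for y v by (rule dd_eq_0_outside[OF K(2)]) (use K that in auto)
  have cj: "continuous_on UNIV (\<lambda>y. dd \<rho> y v)" for v by (rule smooth_continuous[OF smooth_dd[OF K(1)]])
  show "integrable lborel (\<lambda>y. (\<Sum>j\<in>UNIV. \<bar>dd \<rho> y (axis j 1)\<bar>) * norm y)"
    by (rule integrable_continuous_compact_support[OF _ K(2)])
       (use z in \<open>auto intro!: continuous_on_mult continuous_on_sum continuous_on_rabs cj continuous_on_norm_id\<close>)
  have "continuous_on UNIV (\<lambda>y. (y, A *v y))"
    by (intro continuous_on_Pair continuous_on_id linear_continuous_on matrix_vector_mul_bounded_linear)
  from continuous_on_compose2[OF dd_continuous[OF K(1)] this]
  have "continuous_on UNIV (\<lambda>y. dd \<rho> y (A *v y))" by simp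
  then show "integrable lborel (\<lambda>y. dd \<rho> y (A *v y))"
    by (rule integrable_continuous_compact_support[OF _ K(2)]) (use z in auto)
qed

context euler_L1
begin

context
  fixes J :: "(real^'n^'n) set" and pf :: "real^'n^'n \<Rightarrow> (real^'n) \<times> real \<Rightarrow> real" and \<rho> :: "real^'n^'n \<Rightarrow> real^'n \<Rightarrow> real"
    and r B L :: real and R :: "real^'n^'n \<Rightarrow> real" and K0 :: "((real^'n) \<times> real) set"
  assumes J: "finite J" and pf: "\<And>N. N \<in> J \<Longrightarrow> test_fn Q (pf N)" and pf_sum: "\<And>w. (\<Sum>N\<in>J. \<bar>pf N w\<bar>) \<le> B"
    and pf_supp: "\<And>N w. N \<in> J \<Longrightarrow> w \<notin> K0 \<Longrightarrow> pf N w = 0"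
    and \<rho>: "\<And>N. N \<in> J \<Longrightarrow> mollifier r (\<rho> N)"
    and R: "\<And>N. N \<in> J \<Longrightarrow> (\<integral>y. (\<Sum>j\<in>UNIV. \<bar>dd (\<rho> N) y (axis j 1)\<bar>) * norm y \<partial>lborel) \<le> R N"
begin

text \<open>Of the cubic expression only one factor of the increment is left to
  \<open>pairing\<close>, to be replaced by a gradient. The squared norm stays in the weight, where
  just its bound 4 M^2 is used.\<close>

definition flux_field :: "'n \<Rightarrow> (real^'n) \<times> real \<Rightarrow> real^'n \<Rightarrow> real" where
  "flux_field i w y = (\<Sum>N\<in>J. pf N w * (norm (U (w + emb y) - U w))\<^sup>2 * dd (\<rho> N) y (axis i 1))"

lemma B_nonneg: "B \<ge> 0" using pf_sum[of 0] by (meson abs_ge_zero order_trans sum_nonneg)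

lemma pf_le: "N \<in> J \<Longrightarrow> \<bar>pf N w\<bar> \<le> B"
  using pf_sum[of w] member_le_sum[of N J "\<lambda>N. \<bar>pf N w\<bar>"] J by fastforce

lemma h_bound: "(norm (U (w + v) - U w))\<^sup>2 \<le> 4 * M\<^sup>2"
proof -
  have "norm (U (w + v) - U w) \<le> 2 * M"
    using norm_triangle_ineq4[of "U (w + v)" "U w"] U_bd[of "w + v"] U_bd[of w] by linarith
  then have "(norm (U (w + v) - U w))\<^sup>2 \<le> (2 * M)\<^sup>2" by (intro power_mono) auto
  then show ?thesis by (simp add: power_mult_distrib)
qed

lemma \<rho>_smooth: "N \<in> J \<Longrightarrow> smooth (\<rho> N)" by (rule test_fn_smooth[OF mollifierD(1)[OF \<rho>]])

lemma dd_\<rho>_outside: "N \<in> J \<Longrightarrow> r \<le> norm y \<Longrightarrow> dd (\<rho> N) y v = 0"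
  using test_fn_outside[OF test_fn_dd[OF mollifierD(1)[OF \<rho>]], of N y v] by simp

lemma pair_maps:
  "(\<lambda>p::((real^'n) \<times> real) \<times> (real^'n). fst p + emb (snd p)) \<in> borel_measurable borel"
  "(\<lambda>p::((real^'n) \<times> real) \<times> (real^'n). fst p) \<in> borel_measurable borel"
  "(\<lambda>p::((real^'n) \<times> real) \<times> (real^'n). snd p) \<in> borel_measurable borel"
  "(\<lambda>p::((real^'n) \<times> real) \<times> (real^'n). emb (snd p)) \<in> borel_measurable borel"
  by (intro borel_measurable_continuous_onI continuous_intros)+

lemma flux_term_meas:
  assumes "N \<in> J"
  shows "(\<lambda>p. pf N (fst p) * (norm (U (fst p + emb (snd p)) - U (fst p)))\<^sup>2 * dd (\<rho> N) (snd p) (axis i 1)) \<in> borel_measurable borel"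
proof -
  have U1: "(\<lambda>p::((real^'n) \<times> real) \<times> (real^'n). U (fst p + emb (snd p))) \<in> borel_measurable borel"
    by (rule measurable_compose[OF pair_maps(1) U_meas])
  have U2: "(\<lambda>p::((real^'n) \<times> real) \<times> (real^'n). U (fst p)) \<in> borel_measurable borel"
    by (rule measurable_compose[OF pair_maps(2) U_meas])
  note h = borel_measurable_power[OF measurable_compose[OF borel_measurable_diff[OF U1 U2] borel_measurable_norm], of 2]
  show ?thesis
    by (rule borel_measurable_times[OF borel_measurable_times[OF
          measurable_compose[OF pair_maps(2) test_fn_measurable[OF pf[OF assms]]] h]
          measurable_compose[OF pair_maps(3) smooth_measurable[OF smooth_dd[OF \<rho>_smooth[OF assms]]]]])
qed

lemma flux_meas: "(\<lambda>p. flux_field i (fst p) (snd p)) \<in> borel_measurable borel"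
  unfolding flux_field_def by (intro borel_measurable_sum flux_term_meas)

lemma flux_abs_le:
  "\<bar>flux_field i w y\<bar> \<le> 4 * M\<^sup>2 * B * (\<Sum>N\<in>J. \<bar>dd (\<rho> N) y (axis i 1)\<bar>)"
proof -
  have "\<bar>flux_field i w y\<bar> \<le> (\<Sum>N\<in>J. \<bar>pf N w\<bar> * (norm (U (w + emb y) - U w))\<^sup>2 * \<bar>dd (\<rho> N) y (axis i 1)\<bar>)"
    unfolding flux_field_def by (rule order.trans[OF sum_abs]) (simp add: abs_mult)
  also have "\<dots> \<le> (\<Sum>N\<in>J. B * (4 * M\<^sup>2) * \<bar>dd (\<rho> N) y (axis i 1)\<bar>)"
    by (intro sum_mono mult_right_mono mult_mono pf_le h_bound) (auto simp: B_nonneg)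
  finally show ?thesis by (simp add: sum_distrib_left mult_ac)
qed

text \<open>A qualitative bound that depends on the chosen kernels; it enters integrability and
  approximation only. The quantitative, scale free bound is
  \<open>flux_shifted_norm\<close>.\<close>

lemma flux_bounded: "\<exists>C. \<forall>i w y. \<bar>flux_field i w y\<bar> \<le> C"
proof -
  have "\<forall>N\<in>J. \<exists>D\<ge>0. \<forall>y v. \<bar>dd (\<rho> N) y v\<bar> \<le> D * norm v"
    using test_fn_dd_bound[OF mollifierD(1)[OF \<rho>]] unfolding real_norm_def by blast
  then obtain D where D: "\<And>N y v. N \<in> J \<Longrightarrow> \<bar>dd (\<rho> N) y v\<bar> \<le> D N * norm v" by metis
  have "\<bar>flux_field i w y\<bar> \<le> 4 * M\<^sup>2 * B * (\<Sum>N\<in>J. D N)" for i w y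
  proof (rule order.trans[OF flux_abs_le mult_left_mono])
    show "(\<Sum>N\<in>J. \<bar>dd (\<rho> N) y (axis i 1)\<bar>) \<le> (\<Sum>N\<in>J. D N)"
    proof (rule sum_mono)
      fix N assume "N \<in> J"
      from D[OF this, of y "axis i 1"] show "\<bar>dd (\<rho> N) y (axis i 1)\<bar> \<le> D N" by (simp add: norm_axis_1)
    qed
  qed (use B_nonneg in simp)
  then show ?thesis by blast
qed

lemma flux_supp: "w \<notin> K0 \<or> r < norm y \<Longrightarrow> flux_field i w y = 0"
  unfolding flux_field_def
proof (intro sum.neutral ballI)
  fix N assume "w \<notin> K0 \<or> r < norm y" "N \<in> J"
  then show "pf N w * (norm (U (w + emb y) - U w))\<^sup>2 * dd (\<rho> N) y (axis i 1) = 0"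
    using pf_supp[of N w] dd_\<rho>_outside[of N y "axis i 1"] by auto
qed

text \<open>The left-over factor of the increment restores the cube, and Fubini separates w from
  y.\<close>

lemma pairing_flux: "pairing flux_field u = (\<Sum>N\<in>J. spatial_cubic (pf N) (\<rho> N))"
proof -
  let ?X = "\<lambda>N i p. pf N (fst p) * dd (\<rho> N) (snd p) (axis i 1) * incr i (fst p) (emb (snd p))"
  have ix: "integrable lborel (?X N i)" if "N \<in> J" for N i
  proof (rule integrable_mult_bdd(1))
    show "integrable lborel (\<lambda>p::((real^'n) \<times> real) \<times> (real^'n). pf N (fst p) * dd (\<rho> N) (snd p) (axis i 1))"
      by (rule integral_lborel_prod_mult(1)[OF test_fn_integrable[OF pf[OF that]]
          test_fn_integrable[OF test_fn_dd[OF mollifierD(1)[OF \<rho>[OF that]]]]])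
    show "bdd_borel (\<lambda>p::((real^'n) \<times> real) \<times> (real^'n). incr i (fst p) (emb (snd p)))"
      unfolding bdd_borel_def using incr_bound incr_meas[OF pair_maps(2,4)] by blast
  qed
  have "pairing flux_field u = (\<Sum>i\<in>UNIV. \<integral>p. (\<Sum>N\<in>J. ?X N i p) \<partial>lborel)"
    unfolding pairing_def flux_field_def incr_def by (simp add: sum_distrib_right sum_distrib_left mult_ac)
  also have "\<dots> = (\<Sum>i\<in>UNIV. \<Sum>N\<in>J. \<integral>p. ?X N i p \<partial>lborel)"
    by (intro sum.cong refl Bochner_Integration.integral_sum ix)
  also have "\<dots> = (\<Sum>N\<in>J. \<Sum>i\<in>UNIV. \<integral>p. ?X N i p \<partial>lborel)" by (rule sum.swap)
  also have "\<dots> = (\<Sum>N\<in>J. spatial_cubic (pf N) (\<rho> N))"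
    unfolding spatial_cubic_def
  proof (intro sum.cong refl)
    fix N i assume "N \<in> J"
    have "(\<integral>p. ?X N i p \<partial>lborel) = (\<integral>w. (\<integral>y. pf N w * dd (\<rho> N) y (axis i 1) * incr i w (emb y) \<partial>lborel) \<partial>lborel)"
      using lborel_pair.integral_fst[of "\<lambda>w y. pf N w * dd (\<rho> N) y (axis i 1) * incr i w (emb y)"] ix[OF \<open>N \<in> J\<close>, of i]
      by (simp add: lborel_prod case_prod_beta')
    also have "\<dots> = (\<integral>w. pf N w * (\<integral>y. incr i w (emb y) * dd (\<rho> N) y (axis i 1) \<partial>lborel) \<partial>lborel)"
      by (simp add: mult.assoc mult.commute[of "dd (\<rho> N) _ _"])
    finally show "(\<integral>p. ?X N i p \<partial>lborel) = \<dots>" .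
  qed
  finally show ?thesis .
qed

lemma flux_int:
  "integrable lborel (\<lambda>y. flux_field i (w - s *\<^sub>R emb y) y * y $ k)"
  "(\<integral>y. \<bar>flux_field i (w - s *\<^sub>R emb y) y * y $ k\<bar> \<partial>lborel) \<le> 4 * M\<^sup>2 * B * (\<Sum>N\<in>J. R N)"
proof -
  let ?d = "\<lambda>y. 4 * M\<^sup>2 * B * (\<Sum>N\<in>J. (\<Sum>j\<in>UNIV. \<bar>dd (\<rho> N) y (axis j 1)\<bar>) * norm y)"
  note ki = kernel_integrable(1)[OF mollifierD(1)[OF \<rho>]]
  have id: "integrable lborel ?d" by (intro integrable_mult_right Bochner_Integration.integrable_sum ki)
  have le: "\<bar>flux_field i (w - s *\<^sub>R emb y) y * y $ k\<bar> \<le> ?d y" for y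
  proof -
    have "\<bar>flux_field i (w - s *\<^sub>R emb y) y * y $ k\<bar> \<le> (4 * M\<^sup>2 * B * (\<Sum>N\<in>J. \<bar>dd (\<rho> N) y (axis i 1)\<bar>)) * norm y"
      unfolding abs_mult by (intro mult_mono flux_abs_le component_le_norm_cart) (auto intro!: mult_nonneg_nonneg sum_nonneg B_nonneg)
    also have "\<dots> \<le> (4 * M\<^sup>2 * B * (\<Sum>N\<in>J. (\<Sum>j\<in>UNIV. \<bar>dd (\<rho> N) y (axis j 1)\<bar>))) * norm y"
      by (intro mult_right_mono mult_left_mono sum_mono member_le_sum) (auto intro!: mult_nonneg_nonneg B_nonneg)
    finally show ?thesis by (simp add: sum_distrib_right mult.assoc)
  qed
  have d0: "0 \<le> ?d y" for y using le[of y] by (meson abs_ge_zero order_trans)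
  have c1: "(\<lambda>y::real^'n. (w - s *\<^sub>R emb y, y)) \<in> borel_measurable borel"
    by (intro borel_measurable_continuous_onI continuous_intros)
  have c2: "(\<lambda>y::real^'n. y $ k) \<in> borel_measurable borel"
    by (intro borel_measurable_continuous_onI continuous_intros)
  have m: "(\<lambda>y. flux_field i (w - s *\<^sub>R emb y) y * y $ k) \<in> borel_measurable borel"
    using measurable_compose[OF c1 flux_meas[of i]] by (intro borel_measurable_times c2) simp
  show "integrable lborel (\<lambda>y. flux_field i (w - s *\<^sub>R emb y) y * y $ k)"
    by (rule Bochner_Integration.integrable_bound[OF id])
       (use m le d0 in \<open>auto simp del: scaleR_Pair diff_Pair intro!: AE_I2\<close>)
  have "(\<integral>y. \<bar>flux_field i (w - s *\<^sub>R emb y) y * y $ k\<bar> \<partial>lborel) \<le> (\<integral>y. ?d y \<partial>lborel)"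
    by (rule integral_mono'[OF id le d0])
  also have "\<dots> = 4 * M\<^sup>2 * B * (\<Sum>N\<in>J. \<integral>y. (\<Sum>j\<in>UNIV. \<bar>dd (\<rho> N) y (axis j 1)\<bar>) * norm y \<partial>lborel)"
    using ki by (simp add: Bochner_Integration.integral_sum)
  also have "\<dots> \<le> 4 * M\<^sup>2 * B * (\<Sum>N\<in>J. R N)"
    by (intro mult_left_mono sum_mono R) (auto simp: B_nonneg)
  finally show "(\<integral>y. \<bar>flux_field i (w - s *\<^sub>R emb y) y * y $ k\<bar> \<partial>lborel) \<le> 4 * M\<^sup>2 * B * (\<Sum>N\<in>J. R N)" .
qed

text \<open>Each entry is an integral of |grad rho| against |y|, controlled by the moments
  \<open>R N\<close>. The radius of the kernels is absent, so this bound can be fixed before the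
  scale.\<close>

lemma flux_shifted_norm:
  "norm (shifted_field flux_field s w) \<le> real CARD('n) * real CARD('n) * (4 * M\<^sup>2 * B * (\<Sum>N\<in>J. R N))"
proof -
  have "norm (shifted_field flux_field s w) \<le> (\<Sum>i\<in>UNIV. \<Sum>k\<in>UNIV. \<bar>shifted_field flux_field s w $ i $ k\<bar>)"
    by (rule norm_matrix_le_sum)
  also have "\<dots> \<le> (\<Sum>i\<in>(UNIV::'n set). \<Sum>k\<in>(UNIV::'n set). 4 * M\<^sup>2 * B * (\<Sum>N\<in>J. R N))"
  proof (intro sum_mono)
    fix i k
    have "\<bar>shifted_field flux_field s w $ i $ k\<bar> \<le> (\<integral>y. \<bar>flux_field i (w - s *\<^sub>R emb y) y * y $ k\<bar> \<partial>lborel)"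
      unfolding shifted_field_def vec_lambda_beta by (rule integral_abs_bound)
    with flux_int(2)[of i w s k] show "\<bar>shifted_field flux_field s w $ i $ k\<bar> \<le> 4 * M\<^sup>2 * B * (\<Sum>N\<in>J. R N)" by linarith
  qed
  finally show ?thesis by simp
qed

text \<open>Contracting the columns against \<open>A\<close> assembles the derivative of each kernel
  in the direction \<open>A *v y\<close>, which is the quantity made small by averaging. The cut-off
  is evaluated at the shifted point w - s y; moving it back to w costs \<open>L * r\<close>, because
  |s y| is at most r on the support.\<close>

lemma flux_shifted_inner:
  assumes lip: "\<And>N x y. N \<in> J \<Longrightarrow> \<bar>pf N x - pf N y\<bar> \<le> L * norm (x - y)" and L: "L \<ge> 0" and s: "0 \<le> s" "s \<le> 1"
  shows "A \<bullet> shifted_field flux_field s w \<le> 4 * M\<^sup>2 * (\<Sum>N\<in>J. (\<bar>pf N w\<bar> + L * r) * (\<integral>y. \<bar>dd (\<rho> N) y (A *v y)\<bar> \<partial>lborel))"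
proof -
  have "A \<bullet> shifted_field flux_field s w = (\<integral>y. (\<Sum>i\<in>UNIV. \<Sum>k\<in>UNIV. A $ i $ k * (flux_field i (w - s *\<^sub>R emb y) y * y $ k)) \<partial>lborel)"
    unfolding inner_matrix shifted_field_def vec_lambda_beta
    using flux_int(1)[of _ w s]
    by (subst Bochner_Integration.integral_sum; (intro Bochner_Integration.integrable_sum integrable_mult_right)?)
       (simp_all only: integral_mult_right_zero Bochner_Integration.integral_sum integrable_mult_right)
  also have "\<dots> \<le> (\<integral>y. 4 * M\<^sup>2 * (\<Sum>N\<in>J. (\<bar>pf N w\<bar> + L * r) * \<bar>dd (\<rho> N) y (A *v y)\<bar>) \<partial>lborel)"
  proof (rule integral_mono')
    show "integrable lborel (\<lambda>y. 4 * M\<^sup>2 * (\<Sum>N\<in>J. (\<bar>pf N w\<bar> + L * r) * \<bar>dd (\<rho> N) y (A *v y)\<bar>))"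
      by (intro integrable_mult_right Bochner_Integration.integrable_sum integrable_abs kernel_integrable(2)[OF mollifierD(1)[OF \<rho>]])
    have pw: "(\<Sum>i\<in>UNIV. \<Sum>k\<in>UNIV. A $ i $ k * (flux_field i (w - s *\<^sub>R emb y) y * y $ k))
        \<le> 4 * M\<^sup>2 * (\<Sum>N\<in>J. (\<bar>pf N w\<bar> + L * r) * \<bar>dd (\<rho> N) y (A *v y)\<bar>)"
      and p0: "0 \<le> 4 * M\<^sup>2 * (\<Sum>N\<in>J. (\<bar>pf N w\<bar> + L * r) * \<bar>dd (\<rho> N) y (A *v y)\<bar>)" for y
    proof -
      let ?w = "w - s *\<^sub>R emb y" and ?h = "(norm (U (w - s *\<^sub>R emb y + emb y) - U (w - s *\<^sub>R emb y)))\<^sup>2"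
      have "(\<Sum>i\<in>UNIV. \<Sum>k\<in>UNIV. A $ i $ k * (flux_field i ?w y * y $ k)) = (\<Sum>i\<in>UNIV. (A *v y) $ i * flux_field i ?w y)"
        by (simp only: matrix_vector_mult_def vec_lambda_beta sum_distrib_right mult_ac)
      also have "\<dots> = (\<Sum>i\<in>UNIV. \<Sum>N\<in>J. pf N ?w * ?h * ((A *v y) $ i * dd (\<rho> N) y (axis i 1)))"
        unfolding flux_field_def sum_distrib_left by (simp only: mult_ac)
      also have "\<dots> = (\<Sum>N\<in>J. pf N ?w * ?h * (\<Sum>i\<in>UNIV. (A *v y) $ i * dd (\<rho> N) y (axis i 1)))"
        by (subst sum.swap) (simp only: sum_distrib_left)
      also have "\<dots> = (\<Sum>N\<in>J. pf N ?w * ?h * dd (\<rho> N) y (A *v y))"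
        by (intro sum.cong refl) (simp only: dd_axis_expand[OF \<rho>_smooth, symmetric])
      also have "\<dots> \<le> (\<Sum>N\<in>J. (\<bar>pf N w\<bar> + L * r) * (4 * M\<^sup>2) * \<bar>dd (\<rho> N) y (A *v y)\<bar>)"
      proof (rule sum_mono)
        fix N assume N: "N \<in> J"
        show "pf N ?w * ?h * dd (\<rho> N) y (A *v y) \<le> (\<bar>pf N w\<bar> + L * r) * (4 * M\<^sup>2) * \<bar>dd (\<rho> N) y (A *v y)\<bar>"
        proof (cases "r \<le> norm y")
          case True then show ?thesis using dd_\<rho>_outside[OF N True] by simp
        next
          case False
          have "norm (s *\<^sub>R emb y) \<le> r" using False s by (auto simp: norm_Pair intro: order_trans[OF mult_left_le_one_le])
          then have "L * norm (?w - w) \<le> L * r" using L by (intro mult_left_mono) (auto simp: norm_minus_commute)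
          then have "\<bar>pf N ?w - pf N w\<bar> \<le> L * r" using lip[OF N, of ?w w] by linarith
          then have p: "\<bar>pf N ?w\<bar> \<le> \<bar>pf N w\<bar> + L * r" by linarith
          have "pf N ?w * ?h * dd (\<rho> N) y (A *v y) \<le> \<bar>pf N ?w * ?h * dd (\<rho> N) y (A *v y)\<bar>" by (rule abs_ge_self)
          also have "\<dots> = \<bar>pf N ?w\<bar> * ?h * \<bar>dd (\<rho> N) y (A *v y)\<bar>" by (simp only: abs_mult abs_power2)
          also have "\<dots> \<le> (\<bar>pf N w\<bar> + L * r) * (4 * M\<^sup>2) * \<bar>dd (\<rho> N) y (A *v y)\<bar>"
            using p h_bound[of ?w "emb y"] by (intro mult_right_mono mult_mono) (auto intro: order_trans[OF abs_ge_zero])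
          finally show ?thesis .
        qed
      qed
      finally show "(\<Sum>i\<in>UNIV. \<Sum>k\<in>UNIV. A $ i $ k * (flux_field i ?w y * y $ k))
        \<le> 4 * M\<^sup>2 * (\<Sum>N\<in>J. (\<bar>pf N w\<bar> + L * r) * \<bar>dd (\<rho> N) y (A *v y)\<bar>)"
        by (simp only: sum_distrib_left mult_ac)
      show "0 \<le> 4 * M\<^sup>2 * (\<Sum>N\<in>J. (\<bar>pf N w\<bar> + L * r) * \<bar>dd (\<rho> N) y (A *v y)\<bar>)"
      proof (intro mult_nonneg_nonneg sum_nonneg)
        fix N assume "N \<in> J"
        show "0 \<le> \<bar>pf N w\<bar> + L * r"
        proof -
          \<comment> \<open>A kernel of mass 1 cannot be supported in an empty ball.\<close>
          have "r > 0"
          proof (rule ccontr)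
            assume "\<not> r > 0"
            then have "\<rho> N y = 0" for y using test_fn_outside[OF mollifierD(1)[OF \<rho>[OF \<open>N \<in> J\<close>]], of y] norm_ge_zero[of y] by auto
            then show False using mollifierD(3)[OF \<rho>[OF \<open>N \<in> J\<close>]] by simp
          qed
          then show ?thesis using L by simp
        qed
      qed auto
    qed
    show "\<And>y. (\<Sum>i\<in>UNIV. \<Sum>k\<in>UNIV. A $ i $ k * (flux_field i (w - s *\<^sub>R emb y) y * y $ k))
        \<le> 4 * M\<^sup>2 * (\<Sum>N\<in>J. (\<bar>pf N w\<bar> + L * r) * \<bar>dd (\<rho> N) y (A *v y)\<bar>)" by (rule pw)
    show "\<And>y. 0 \<le> 4 * M\<^sup>2 * (\<Sum>N\<in>J. (\<bar>pf N w\<bar> + L * r) * \<bar>dd (\<rho> N) y (A *v y)\<bar>)" by (rule p0)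
  qed
  also have "\<dots> = 4 * M\<^sup>2 * (\<Sum>N\<in>J. (\<bar>pf N w\<bar> + L * r) * (\<integral>y. \<bar>dd (\<rho> N) y (A *v y)\<bar> \<partial>lborel))"
    using kernel_integrable(2)[OF mollifierD(1)[OF \<rho>]] by (simp add: Bochner_Integration.integral_sum)
  finally show ?thesis .
qed

end

end

section \<open>Vanishing of the energy flux\<close>

lemma dd_sum:
  fixes f :: "'i \<Rightarrow> 'a::real_normed_vector \<Rightarrow> real"
  assumes "\<And>i. i \<in> I \<Longrightarrow> smooth (f i)"
  shows "dd (\<lambda>x. \<Sum>i\<in>I. f i x) x v = (\<Sum>i\<in>I. dd (f i) x v)"
proof (rule dd_eq)
  show "((\<lambda>x. \<Sum>i\<in>I. f i x) has_derivative (\<lambda>v. \<Sum>i\<in>I. dd (f i) x v)) (at x)"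
    by (rule has_derivative_sum) (rule smooth_has_derivative[OF assms])
qed

lemma smooth_dist_sq:
  fixes \<Phi> :: "'a::real_normed_vector \<Rightarrow> real^'n::finite^'m::finite"
  assumes "smooth \<Phi>" shows "smooth (\<lambda>w. (norm (\<Phi> w - N))\<^sup>2)"
proof -
  have e: "smooth (\<lambda>w. (\<Phi> w - N) $ i $ j)" for i j
    using smooth_diff[OF smooth_bounded_linear[OF bounded_linear_entry assms, of i j] smooth_const[of "N $ i $ j"]] by simp
  show ?thesis
    unfolding power2_norm_eq_inner inner_matrix by (intro smooth_sum smooth_mult e)
qed

lemma traceless_compact: "compact {N::real^'n::finite^'n. norm N \<le> 1 \<and> (\<Sum>i\<in>UNIV. N $ i $ i) = 0}"
proof -
  have "closed {N::real^'n^'n. (\<Sum>i\<in>UNIV. N $ i $ i) = 0}"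
    by (intro closed_Collect_eq continuous_intros)
  moreover have "compact (cball (0::real^'n^'n) 1)" by simp
  ultimately have "compact (cball (0::real^'n^'n) 1 \<inter> {N. (\<Sum>i\<in>UNIV. N $ i $ i) = 0})"
    by (intro compact_Int_closed) auto
  moreover have "cball (0::real^'n^'n) 1 \<inter> {N. (\<Sum>i\<in>UNIV. N $ i $ i) = 0} = {N. norm N \<le> 1 \<and> (\<Sum>i\<in>UNIV. N $ i $ i) = 0}"
    by auto
  ultimately show ?thesis by simp
qed

text \<open>The moment \<open>R\<close> measures the sensitivity to the matrix. A kernel adapted to
  \<open>N\<close> remains good for every matrix within distance \<open>\<kappa> / R\<close>, at
  every scale, which fixes the mesh of the net.\<close>

lemma kernel_L1_le:
  fixes \<rho> :: "real^'n::finite \<Rightarrow> real"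
  assumes \<rho>: "mollifier r \<rho>" and R: "(\<integral>y. (\<Sum>j\<in>UNIV. \<bar>dd \<rho> y (axis j 1)\<bar>) * norm y \<partial>lborel) \<le> R"
  shows "(\<integral>y. \<bar>dd \<rho> y (A *v y)\<bar> \<partial>lborel) \<le> (\<integral>y. \<bar>dd \<rho> y (N *v y)\<bar> \<partial>lborel) + norm (A - N) * R"
proof -
  note t = mollifierD(1)[OF \<rho>]
  note sm = test_fn_smooth[OF t]
  let ?X = "\<lambda>y. (\<Sum>j\<in>UNIV. \<bar>dd \<rho> y (axis j 1)\<bar>) * norm y"
  have "(\<integral>y. \<bar>dd \<rho> y (A *v y)\<bar> \<partial>lborel) \<le> (\<integral>y. \<bar>dd \<rho> y (N *v y)\<bar> + norm (A - N) * ?X y \<partial>lborel)"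
  proof (rule integral_mono)
    show "integrable lborel (\<lambda>y. \<bar>dd \<rho> y (A *v y)\<bar>)" by (intro integrable_abs kernel_integrable[OF t])
    show "integrable lborel (\<lambda>y. \<bar>dd \<rho> y (N *v y)\<bar> + norm (A - N) * ?X y)"
      by (intro Bochner_Integration.integrable_add integrable_abs integrable_mult_right kernel_integrable[OF t])
    fix y
    have "A *v y = N *v y + (A - N) *v y" by (simp add: matrix_vector_mult_diff_rdistrib)
    then have "dd \<rho> y (A *v y) = dd \<rho> y (N *v y) + dd \<rho> y ((A - N) *v y)"
      using linear_add[OF bounded_linear.linear[OF smooth_dd_linear[OF sm]]] by metis
    then show "\<bar>dd \<rho> y (A *v y)\<bar> \<le> \<bar>dd \<rho> y (N *v y)\<bar> + norm (A - N) * ?X y"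
      using dd_matrix_bound[OF sm, of y "A - N"] by linarith
  qed
  also have "\<dots> = (\<integral>y. \<bar>dd \<rho> y (N *v y)\<bar> \<partial>lborel) + norm (A - N) * (\<integral>y. ?X y \<partial>lborel)"
    using kernel_integrable[OF t] by simp
  also have "\<dots> \<le> (\<integral>y. \<bar>dd \<rho> y (N *v y)\<bar> \<partial>lborel) + norm (A - N) * R"
    using R by (intro add_left_mono mult_left_mono) auto
  finally show ?thesis .
qed

context euler_L1
begin

lemma energy_flux_integrable:
  assumes \<psi>: "test_fn Q \<psi>"
  shows "integrable lborel (\<lambda>z. nsq z / 2 * dd \<psi> z tdir)"
    "integrable lborel (\<lambda>z. (nsq z / 2 + P z) * (\<Sum>j\<in>UNIV. u j z * dd \<psi> z (xdir j)))"
    "integrable lborel (\<lambda>z. (\<Sum>i\<in>UNIV. F z $ i * u i z) * \<psi> z)"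
proof -
  note bt = bdd_borel_dd[OF \<psi>] and b\<psi> = bdd_borel_test_fn[OF \<psi>]
  have n2: "integrable lborel (\<lambda>z. nsq z / 2)" using int_nsq by simp
  show "integrable lborel (\<lambda>z. nsq z / 2 * dd \<psi> z tdir)" by (rule integrable_mult_bdd(1)[OF n2 bt])
  show "integrable lborel (\<lambda>z. (nsq z / 2 + P z) * (\<Sum>j\<in>UNIV. u j z * dd \<psi> z (xdir j)))"
    unfolding sum_distrib_left
    by (intro Bochner_Integration.integrable_sum integrable_mult_bdd(1) Bochner_Integration.integrable_add n2 P_int
        bdd_borel_mult bdd_u bt)
  show "integrable lborel (\<lambda>z. (\<Sum>i\<in>UNIV. F z $ i * u i z) * \<psi> z)"
    by (intro integrable_mult_bdd(1)[OF _ b\<psi>] Bochner_Integration.integrable_sum integrable_mult_bdd(1) int_F bdd_u)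
qed

lemma energy_flux_eq:
  assumes \<psi>: "test_fn Q \<psi>"
  shows "energy_flux \<psi> = (\<integral>z. nsq z / 2 * dd \<psi> z tdir \<partial>lborel) +
    (\<integral>z. (nsq z / 2 + P z) * (\<Sum>j\<in>UNIV. u j z * dd \<psi> z (xdir j)) \<partial>lborel) +
    (\<integral>z. (\<Sum>i\<in>UNIV. F z $ i * u i z) * \<psi> z \<partial>lborel)"
  unfolding energy_flux_def using energy_flux_integrable[OF \<psi>] by simp

lemma energy_flux_sum:
  assumes "finite J" and t: "\<And>N. N \<in> J \<Longrightarrow> test_fn Q (g N)"
  shows "energy_flux (\<lambda>w. \<Sum>N\<in>J. g N w) = (\<Sum>N\<in>J. energy_flux (g N))"
proof -
  let ?s = "\<lambda>w. \<Sum>N\<in>J. g N w"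
  have ts: "test_fn Q ?s" by (rule test_fn_sum[OF t])
  have d: "dd ?s z v = (\<Sum>N\<in>J. dd (g N) z v)" for z v by (rule dd_sum[OF test_fn_smooth[OF t]])
  have "(\<Sum>N\<in>J. energy_flux (g N)) = (\<Sum>N\<in>J. (\<integral>z. nsq z / 2 * dd (g N) z tdir \<partial>lborel) +
    (\<integral>z. (nsq z / 2 + P z) * (\<Sum>j\<in>UNIV. u j z * dd (g N) z (xdir j)) \<partial>lborel) +
    (\<integral>z. (\<Sum>i\<in>UNIV. F z $ i * u i z) * g N z \<partial>lborel))"
    by (intro sum.cong refl energy_flux_eq t)
  also have "\<dots> = (\<integral>z. (\<Sum>N\<in>J. nsq z / 2 * dd (g N) z tdir) \<partial>lborel) +
    (\<integral>z. (\<Sum>N\<in>J. (nsq z / 2 + P z) * (\<Sum>j\<in>UNIV. u j z * dd (g N) z (xdir j))) \<partial>lborel) +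
    (\<integral>z. (\<Sum>N\<in>J. (\<Sum>i\<in>UNIV. F z $ i * u i z) * g N z) \<partial>lborel)"
    by (simp only: sum.distrib Bochner_Integration.integral_sum[OF energy_flux_integrable(1)[OF t]]
        Bochner_Integration.integral_sum[OF energy_flux_integrable(2)[OF t]]
        Bochner_Integration.integral_sum[OF energy_flux_integrable(3)[OF t]])
  also have "\<dots> = energy_flux ?s"
  proof -
    have "(\<Sum>N\<in>J. (nsq z / 2 + P z) * (\<Sum>j\<in>UNIV. u j z * dd (g N) z (xdir j))) =
      (nsq z / 2 + P z) * (\<Sum>j\<in>UNIV. u j z * dd ?s z (xdir j))" for z
    proof -
      have "(\<Sum>j\<in>UNIV. u j z * dd ?s z (xdir j)) = (\<Sum>N\<in>J. \<Sum>j\<in>UNIV. u j z * dd (g N) z (xdir j))"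
        unfolding d sum_distrib_left by (rule sum.swap)
      then show ?thesis by (simp only: sum_distrib_left)
    qed
    then show ?thesis unfolding energy_flux_eq[OF ts] by (simp only: d sum_distrib_left)
  qed
  finally show ?thesis by simp
qed

lemma energy_flux_minus:
  assumes "test_fn Q \<psi>" shows "energy_flux (\<lambda>w. - \<psi> w) = - energy_flux \<psi>"
proof -
  have d: "dd (\<lambda>w. - \<psi> w) z v = - dd \<psi> z v" for z v
    by (rule dd_eq[OF has_derivative_minus[OF smooth_has_derivative[OF test_fn_smooth[OF assms]]]])
  show ?thesis
    unfolding energy_flux_def d Bochner_Integration.integral_minus[symmetric]
    by (intro Bochner_Integration.integral_cong refl) (simp add: sum_negf algebra_simps)
qed

end

section \<open>The final estimate\<close>

context euler_bv
begin

text \<open>Any sufficiently concentrated \<open>\<theta>\<close> keeps \<open>\<Phi>\<close> nearly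
  optimal, approximates the pairing up to \<open>e\<close>, and stays within \<open>Q\<close>. The
  bound does not involve \<open>\<theta>\<close>, so \<open>e\<close> can be sent to 0.\<close>

lemma pairing_le:
  assumes \<Phi>: "test_fn Q \<Phi>" "\<And>z. norm (\<Phi> z) \<le> 1" and opt: "eventually (\<lambda>\<theta>. W - \<delta> \<le> ell \<theta> \<Phi>) mollifiers"
    and G_meas: "\<And>i. (\<lambda>p. G i (fst p) (snd p)) \<in> borel_measurable borel"
    and G_bound: "\<And>i w y. \<bar>G i w y\<bar> \<le> B"
    and G_supp: "\<And>i w y. w \<notin> K0 \<or> r < norm y \<Longrightarrow> G i w y = 0"
    and K0: "compact K0" and r: "r \<ge> 0" and K0Q: "\<And>w y. w \<in> K0 \<Longrightarrow> norm y \<le> r \<Longrightarrow> w + y \<in> Q"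
    and nrm: "\<And>s w. 0 \<le> s \<Longrightarrow> s \<le> 1 \<Longrightarrow> norm (shifted_field G s w) \<le> C"
    and orth: "\<And>s w. 0 \<le> s \<Longrightarrow> s \<le> 1 \<Longrightarrow> \<Phi> w \<bullet> shifted_field G s w \<le> k"
    and t: "t > 0" and k: "k \<ge> 0"
  shows "pairing G u \<le> W * (k + t * C\<^sup>2 / 2) + \<delta> / t"
proof (rule field_le_epsilon)
  fix e :: real assume e: "e > 0"
  from test_fnD[OF \<Phi>(1)] obtain K1 where K1: "compact K1" "K1 \<subseteq> Q" "\<And>x. x \<notin> K1 \<Longrightarrow> \<Phi> x = 0" by blast
  \<comment> \<open>One compact set in \<open>Q\<close> must carry both the shifted field, for all s
    in [0, 1], and \<open>\<Phi>\<close>, because their sum is the competitor.\<close>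
  define K where "K = {x + y | x y. x \<in> K0 \<and> y \<in> cball 0 r} \<union> K1"
  have K: "compact K" unfolding K_def by (intro compact_Un compact_sums K0 K1(1)) simp
  have KQ: "K \<subseteq> Q" unfolding K_def using K0Q K1(2) by auto
  have K0K: "w + s *\<^sub>R emb y \<in> K" if "w \<in> K0" "norm y \<le> r" "0 \<le> s" "s \<le> 1" for w y s
  proof -
    have "norm (s *\<^sub>R emb y) \<le> r"
      using that by (auto simp: norm_Pair intro: order_trans[OF mult_left_le_one_le])
    then have "s *\<^sub>R emb y \<in> cball 0 r" by (simp only: mem_cball_0)
    with that(1) show ?thesis unfolding K_def by blast
  qed
  obtain \<sigma> where \<sigma>: "\<sigma> > 0" "\<And>w. w \<in> K \<Longrightarrow> ball w \<sigma> \<subseteq> Q" using compact_ball_subset[OF K Q_open KQ] by blast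
  note ctx = G_meas G_bound G_supp K0 K K0K
  have ap: "eventually (\<lambda>\<theta>. pairing G u \<le> pairing G (us \<theta>) + e) mollifiers"
    by (rule pairing_us_approx[where G = G and B = B and ?K0.0 = K0 and r = r and K = K]) (fact ctx e)+
  have "eventually (\<lambda>\<theta>. W - \<delta> \<le> ell \<theta> \<Phi> \<and> pairing G u \<le> pairing G (us \<theta>) + e \<and> mollifier \<sigma> \<theta>) mollifiers"
    using opt ap eventually_mollifier[OF \<sigma>(1)] by eventually_elim blast
  then obtain r' where r': "r' > 0" "\<And>\<theta>. mollifier r' \<theta> \<Longrightarrow> W - \<delta> \<le> ell \<theta> \<Phi> \<and> pairing G u \<le> pairing G (us \<theta>) + e \<and> mollifier \<sigma> \<theta>"
    unfolding eventually_mollifiers by blast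
  obtain \<theta> :: "(real^'a) \<times> real \<Rightarrow> real" where "mollifier r' \<theta>" using mollifier_exists[OF r'(1)] by blast
  with r' have \<theta>: "W - \<delta> \<le> ell \<theta> \<Phi>" "pairing G u \<le> pairing G (us \<theta>) + e" "mollifier \<sigma> \<theta>" by auto
  obtain s where s: "0 \<le> s" "s \<le> 1" "pairing G (us \<theta>) = ell \<theta> (shifted_field G s)"
  proof -
    have "\<exists>s. 0 \<le> s \<and> s \<le> 1 \<and> pairing G (us \<theta>) = ell \<theta> (shifted_field G s)"
      by (rule pairing_us_eq_ell[where G = G and B = B and ?K0.0 = K0 and r = r and K = K]) (fact ctx \<theta>(3))+
    then show ?thesis using that by blast
  qed
  have "ell \<theta> (shifted_field G s) \<le> W * (k + t * C\<^sup>2 / 2) + \<delta> / t"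
  proof (rule ell_near_orthogonal[OF \<Phi> \<theta>(1) _ nrm[OF s(1,2)] _ orth[OF s(1,2)] K _ \<theta>(3) \<sigma>(2) t k])
    show "shifted_field G s \<in> borel_measurable borel" 
      by (rule shifted_field_facts(1)[where G = G and B = B and ?K0.0 = K0 and r = r and K = K]) (fact ctx s)+
    show "shifted_field G s w = 0" if "w \<notin> K" for w 
      by (rule shifted_field_facts(2)[where G = G and B = B and ?K0.0 = K0 and r = r and K = K]) (fact ctx s that)+
    show "\<Phi> w = 0" if "w \<notin> K" for w using that K1(3) by (simp add: K_def)
  qed
  then show "pairing G u \<le> W * (k + t * C\<^sup>2 / 2) + \<delta> / t + e" using \<theta>(2) s(3) by linarith
qed

text \<open>Each choice depends only on earlier ones: moments \<open>R\<close>, net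
  \<open>J\<close>, norm bound \<open>C\<close>, step \<open>t\<close>, field \<open>\<Phi>\<close>,
  partition of unity with Lipschitz constant \<open>L\<close>, radius \<open>r\<close>, kernels.
  Every error is then a multiple of \<open>\<kappa>\<close>, with a factor depending on
  \<open>W\<close>, \<open>M\<close> and \<open>Bp\<close> alone.\<close>

lemma energy_flux_estimate:
  assumes \<psi>: "test_fn Q \<psi>" and Bp: "\<And>w. \<bar>\<psi> w\<bar> \<le> Bp" and \<kappa>: "\<kappa> > 0"
  shows "4 * energy_flux \<psi> \<le> \<kappa> * (W * (4 * M\<^sup>2 * (2 * Bp + 1) + 1 / 2) + 2)"
proof -
  define T where "T = {N::real^'a^'a. norm N \<le> 1 \<and> (\<Sum>i\<in>UNIV. N $ i $ i) = 0}"
  have T: "compact T" unfolding T_def by (rule traceless_compact)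
  have Bp0: "Bp \<ge> 0" using Bp[of 0] by simp
  have "\<forall>N\<in>T. \<exists>R>0. \<forall>r>0. \<exists>\<rho>. mollifier r \<rho> \<and> (\<integral>y. \<bar>dd \<rho> y (N *v y)\<bar> \<partial>lborel) \<le> \<kappa>
    \<and> (\<integral>y. (\<Sum>j\<in>UNIV. \<bar>dd \<rho> y (axis j 1)\<bar>) * norm y \<partial>lborel) \<le> R"
  proof (rule ballI)
    fix N assume "N \<in> T"
    then have "(\<Sum>i\<in>UNIV. N $ i $ i) = 0" by (simp add: T_def)
    then show "\<exists>R>0. \<forall>r>0. \<exists>\<rho>. mollifier r \<rho> \<and> (\<integral>y. \<bar>dd \<rho> y (N *v y)\<bar> \<partial>lborel) \<le> \<kappa>
      \<and> (\<integral>y. (\<Sum>j\<in>UNIV. \<bar>dd \<rho> y (axis j 1)\<bar>) * norm y \<partial>lborel) \<le> R"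
      by (rule alberti_kernel[OF _ \<kappa>])
  qed
  from bchoice[OF this] obtain R where R': "\<forall>N\<in>T. R N > 0 \<and> (\<forall>r>0. \<exists>\<rho>. mollifier r \<rho> \<and> (\<integral>y. \<bar>dd \<rho> y (N *v y)\<bar> \<partial>lborel) \<le> \<kappa>
    \<and> (\<integral>y. (\<Sum>j\<in>UNIV. \<bar>dd \<rho> y (axis j 1)\<bar>) * norm y \<partial>lborel) \<le> R N)" by (rule exE)
  have R: "R N > 0" if "N \<in> T" for N using bspec[OF R' that] by (rule conjunct1)
  have ex: "\<And>N r. N \<in> T \<Longrightarrow> r > 0 \<Longrightarrow>
    \<exists>\<rho>. mollifier r \<rho> \<and> (\<integral>y. \<bar>dd \<rho> y (N *v y)\<bar> \<partial>lborel) \<le> \<kappa>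
    \<and> (\<integral>y. (\<Sum>j\<in>UNIV. \<bar>dd \<rho> y (axis j 1)\<bar>) * norm y \<partial>lborel) \<le> R N"
    using R' by (simp only: Ball_def)
  \<comment> \<open>Within this distance, replacing the matrix by \<open>N\<close> costs at most
    \<open>\<kappa>\<close> in \<open>kernel_L1_le\<close>.\<close>
  have "T \<subseteq> (\<Union>N\<in>T. ball N (\<kappa> / R N))" using R \<kappa> by auto
  then obtain J where J: "J \<subseteq> T" "finite J" "T \<subseteq> (\<Union>N\<in>J. ball N (\<kappa> / R N))"
    using compactE_image[OF T, of T "\<lambda>N. ball N (\<kappa> / R N)"] by auto
  have "0 \<in> T" by (simp add: T_def)
  then have Jne: "J \<noteq> {}" using J(3) by auto
  define m where "m = real (card J)"
  have m: "m > 0" using J(2) Jne by (simp add: m_def card_gt_0_iff)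
  \<comment> \<open>The bound of \<open>flux_shifted_norm\<close> for the whole net, made positive
    by the 1; neither \<open>\<Phi>\<close> nor the radius enters.\<close>
  define C where "C = real CARD('a) * real CARD('a) * (4 * M\<^sup>2 * Bp * (\<Sum>N\<in>J. R N)) + 1"
  have RJ: "(\<Sum>N\<in>J. R N) \<ge> 0" using R J(1) by (intro sum_nonneg) (meson less_imp_le subsetD)
  have C: "C > 0" using Bp0 RJ by (auto simp: C_def intro!: add_nonneg_pos mult_nonneg_nonneg)
  \<comment> \<open>Makes t C^2 / 2 equal to \<open>\<kappa> / 2\<close>. Accordingly
    \<open>\<Phi>\<close> is taken optimal up to \<open>\<kappa> * t\<close>, so that the gap
    divided by t is \<open>\<kappa>\<close>.\<close>
  define t where "t = \<kappa> / C\<^sup>2"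
  have t: "t > 0" using \<kappa> C by (simp add: t_def)
  obtain \<Phi> where \<Phi>: "test_fn Q \<Phi>" "\<And>z. norm (\<Phi> z) \<le> 1" "\<And>z. (\<Sum>i\<in>UNIV. \<Phi> z $ i $ i) = 0"
    and opt: "eventually (\<lambda>\<theta>. W - \<kappa> * t \<le> ell \<theta> \<Phi>) mollifiers"
    using near_optimal_field[of "\<kappa> * t"] \<kappa> t by auto
  have \<Phi>T: "\<Phi> w \<in> T" for w using \<Phi>(2,3) by (simp add: T_def)
  \<comment> \<open>The weight of \<open>N\<close> is a bump in the value of \<open>\<Phi>\<close>,
    not in the point: it is positive exactly where \<open>\<Phi> w\<close> lies in the ball about
    \<open>N\<close>. As all values lie in the covered set \<open>T\<close>, the sum
    \<open>bs\<close> never vanishes.\<close>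
  define b where "b N w = bump1 ((\<kappa> / R N)\<^sup>2 - (norm (\<Phi> w - N))\<^sup>2)" for N w
  have b0: "b N w \<ge> 0" for N w unfolding b_def by (rule bump1)
  have b_near: "norm (\<Phi> w - N) < \<kappa> / R N" if "N \<in> J" "b N w \<noteq> 0" for N w
  proof (rule power2_less_imp_less)
    show "(norm (\<Phi> w - N))\<^sup>2 < (\<kappa> / R N)\<^sup>2"
      using that(2) bump1(4)[of "(\<kappa> / R N)\<^sup>2 - (norm (\<Phi> w - N))\<^sup>2"] unfolding b_def by force
    show "0 \<le> \<kappa> / R N" using R[of N] that(1) J(1) \<kappa> by auto
  qed
  define bs where "bs w = (\<Sum>N\<in>J. b N w)" for w
  have bs: "bs w > 0" for w
  proof -
    obtain N where N: "N \<in> J" "\<Phi> w \<in> ball N (\<kappa> / R N)" using \<Phi>T[of w] J(3) by blast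
    then have "norm (\<Phi> w - N) < \<kappa> / R N" by (simp add: dist_norm norm_minus_commute)
    then have "(norm (\<Phi> w - N))\<^sup>2 < (\<kappa> / R N)\<^sup>2" by (intro power_strict_mono) auto
    then have "b N w > 0" unfolding b_def by (intro bump1) simp
    then show ?thesis unfolding bs_def using N(1) J(2) b0 by (intro sum_pos2[of J N]) auto
  qed
  have sb: "smooth (b N)" for N
    unfolding b_def by (intro smooth_comp[OF smooth_diff[OF smooth_const smooth_dist_sq[OF test_fn_smooth[OF \<Phi>(1)]]] bump1(1)])
  have sbs: "smooth bs" unfolding bs_def[abs_def] by (rule smooth_sum[OF sb])
  have bsn: "bs w \<noteq> 0" for w using bs[of w] by simp
  define pf where "pf N w = \<psi> w * (b N w * inverse (bs w))" for N w
  have pf: "test_fn Q (pf N)" for N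
    unfolding pf_def[abs_def] by (rule test_fn_mult[OF \<psi> smooth_mult[OF sb smooth_inverse[OF sbs bsn]]])
  have pf_sum: "(\<Sum>N\<in>J. pf N w) = \<psi> w" for w
  proof -
    have "(\<Sum>N\<in>J. pf N w) = \<psi> w * (bs w * inverse (bs w))"
      unfolding pf_def bs_def by (simp only: sum_distrib_left sum_distrib_right)
    then show ?thesis using bsn[of w] by simp
  qed
  have pf_abs: "(\<Sum>N\<in>J. \<bar>pf N w\<bar>) \<le> Bp" for w
  proof -
    have "(\<Sum>N\<in>J. \<bar>pf N w\<bar>) = (\<Sum>N\<in>J. \<bar>\<psi> w\<bar> * (b N w * inverse (bs w)))"
      using b0 bs[of w] by (intro sum.cong refl) (simp add: pf_def abs_mult)
    also have "\<dots> = \<bar>\<psi> w\<bar> * (bs w * inverse (bs w))"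
      unfolding bs_def by (simp only: sum_distrib_left sum_distrib_right)
    also have "\<dots> = \<bar>\<psi> w\<bar>" using bsn[of w] by simp
    finally show ?thesis using Bp[of w] by simp
  qed
  have "\<forall>N. \<exists>L\<ge>0. \<forall>x y. \<bar>pf N x - pf N y\<bar> \<le> L * norm (x - y)"
    using test_fn_lipschitz[OF pf] by (simp only: real_norm_def) blast
  then obtain l where l: "\<And>N. l N \<ge> 0" "\<And>N x y. \<bar>pf N x - pf N y\<bar> \<le> l N * norm (x - y)"
    unfolding choice_iff by blast
  define L where "L = (\<Sum>N\<in>J. l N)"
  have L: "L \<ge> 0" unfolding L_def by (intro sum_nonneg l)
  have lip: "\<bar>pf N x - pf N y\<bar> \<le> L * norm (x - y)" if "N \<in> J" for N x y
  proof -
    have "l N \<le> L" unfolding L_def using that J(2) l(1) by (intro member_le_sum) auto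
    from mult_right_mono[OF this norm_ge_zero[of "x - y"]] show ?thesis using l(2)[of N x y] by linarith
  qed
  \<comment> \<open>An error of \<open>\<kappa> / m\<close> for each of the \<open>m\<close> pieces
    adds up to \<open>\<kappa>\<close>.\<close>
  have "\<forall>N. \<exists>r0>0. \<forall>\<rho>. mollifier r0 \<rho> \<longrightarrow> \<bar>4 * energy_flux (pf N) - spatial_cubic (pf N) \<rho>\<bar> \<le> \<kappa> / m"
    using energy_flux_spatial_cubic[OF pf] \<kappa> m by simp
  then obtain rs where rs: "\<And>N. rs N > 0" "\<And>N \<rho>. mollifier (rs N) \<rho> \<Longrightarrow> \<bar>4 * energy_flux (pf N) - spatial_cubic (pf N) \<rho>\<bar> \<le> \<kappa> / m"
    unfolding choice_iff by blast
  from test_fnD[OF \<psi>] obtain K0 where K0: "compact K0" "K0 \<subseteq> Q" "\<And>x. x \<notin> K0 \<Longrightarrow> \<psi> x = 0" by blast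
  obtain rQ where rQ: "rQ > 0" "\<And>w. w \<in> K0 \<Longrightarrow> ball w rQ \<subseteq> Q"
    using compact_ball_subset[OF K0(1) Q_open K0(2)] by blast
  \<comment> \<open>Three demands: the flux of each piece is approximated, displacements by at most
    r from the support of \<open>\<psi>\<close> stay in \<open>Q\<close>, and the Lipschitz error of
    the partition, weighted by the moments, is at most \<open>\<kappa>\<close>.\<close>
  define r where "r = min (Min (rs ` J)) (min (rQ / 2) (\<kappa> / (L * (\<Sum>N\<in>J. R N) + 1)))"
  have LR: "L * (\<Sum>N\<in>J. R N) \<ge> 0" using L RJ by simp
  have r: "r > 0" using rs(1) rQ(1) \<kappa> LR J(2) Jne by (simp add: r_def Min_gr_iff add_nonneg_pos)
  have r1: "r \<le> rs N" if "N \<in> J" for N unfolding r_def using J(2) that by (simp add: min.coboundedI1)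
  have r2: "r < rQ" using rQ(1) by (simp add: r_def min_less_iff_disj)
  have r3: "L * r * (\<Sum>N\<in>J. R N) \<le> \<kappa>"
  proof -
    have "r \<le> \<kappa> / (L * (\<Sum>N\<in>J. R N) + 1)" by (simp add: r_def)
    then have "r * (L * (\<Sum>N\<in>J. R N) + 1) \<le> \<kappa>" using LR by (simp add: pos_le_divide_eq add_nonneg_pos)
    then show ?thesis using r by (simp add: algebra_simps)
  qed
  have "\<forall>N\<in>J. \<exists>\<rho>. mollifier r \<rho> \<and> (\<integral>y. \<bar>dd \<rho> y (N *v y)\<bar> \<partial>lborel) \<le> \<kappa>
    \<and> (\<integral>y. (\<Sum>j\<in>UNIV. \<bar>dd \<rho> y (axis j 1)\<bar>) * norm y \<partial>lborel) \<le> R N"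
    by (rule ballI, rule ex[OF subsetD[OF J(1)] r])
  from bchoice[OF this] obtain \<rho> where \<rho>': "\<forall>N\<in>J. mollifier r (\<rho> N) \<and> (\<integral>y. \<bar>dd (\<rho> N) y (N *v y)\<bar> \<partial>lborel) \<le> \<kappa>
    \<and> (\<integral>y. (\<Sum>j\<in>UNIV. \<bar>dd (\<rho> N) y (axis j 1)\<bar>) * norm y \<partial>lborel) \<le> R N" by (rule exE)
  have \<rho>: "mollifier r (\<rho> N)" "(\<integral>y. \<bar>dd (\<rho> N) y (N *v y)\<bar> \<partial>lborel) \<le> \<kappa>"
    "(\<integral>y. (\<Sum>j\<in>UNIV. \<bar>dd (\<rho> N) y (axis j 1)\<bar>) * norm y \<partial>lborel) \<le> R N" if "N \<in> J" for N
    using bspec[OF \<rho>' that] by blast+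
  have pf_supp: "pf N w = 0" if "w \<notin> K0" for N w using K0(3)[OF that] by (simp add: pf_def)
  have pf': "\<And>N. N \<in> J \<Longrightarrow> test_fn Q (pf N)" by (rule pf)
  have pf_supp': "\<And>N w. N \<in> J \<Longrightarrow> w \<notin> K0 \<Longrightarrow> pf N w = 0" by (rule pf_supp)
  note ctx = J(2) pf' pf_abs pf_supp' \<rho>(1) \<rho>(3)
  let ?G = "flux_field J pf \<rho>"
  have "\<exists>C. \<forall>i w y. \<bar>?G i w y\<bar> \<le> C" by (rule flux_bounded[where J = J and pf = pf and \<rho> = \<rho> and r = r and B = Bp and R = R and ?K0.0 = K0]) (fact ctx)+
  then obtain B where B: "\<And>i w y. \<bar>?G i w y\<bar> \<le> B" by blast
  have main: "pairing ?G u \<le> W * (4 * M\<^sup>2 * (2 * Bp + 1) * \<kappa> + t * C\<^sup>2 / 2) + (\<kappa> * t) / t"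
  proof (rule pairing_le[OF \<Phi>(1,2) opt, where B = B and ?K0.0 = K0 and r = r])
    show "(\<lambda>p. ?G i (fst p) (snd p)) \<in> borel_measurable borel" for i 
      by (rule flux_meas[where J = J and pf = pf and \<rho> = \<rho> and r = r and B = Bp and R = R and ?K0.0 = K0]) (fact ctx)+
    show "\<bar>?G i w y\<bar> \<le> B" for i w y by (rule B)
    show "?G i w y = 0" if "w \<notin> K0 \<or> r < norm y" for i w y 
      by (rule flux_supp[where J = J and pf = pf and \<rho> = \<rho> and r = r and B = Bp and R = R and ?K0.0 = K0]) (fact ctx that)+
    show "compact K0" by (rule K0)
    show "r \<ge> 0" using r by simp
    show "w + y \<in> Q" if "w \<in> K0" "norm y \<le> r" for w y
    proof -
      have "w + y \<in> ball w rQ" using that(2) r2 by (simp add: dist_norm)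
      then show ?thesis using rQ(2)[OF that(1)] by blast
    qed
    show "norm (shifted_field ?G s w) \<le> C" for s w
    proof -
      have "norm (shifted_field ?G s w) \<le> real CARD('a) * real CARD('a) * (4 * M\<^sup>2 * Bp * (\<Sum>N\<in>J. R N))"
        by (rule flux_shifted_norm[where J = J and pf = pf and \<rho> = \<rho> and r = r and B = Bp and R = R and ?K0.0 = K0]) (fact ctx)+
      then show ?thesis by (simp add: C_def)
    qed
    show "t > 0" by (rule t)
    show "0 \<le> 4 * M\<^sup>2 * (2 * Bp + 1) * \<kappa>" using Bp0 \<kappa> by simp
    fix s :: real and w :: "(real^'a) \<times> real" assume s: "0 \<le> s" "s \<le> 1"
    \<comment> \<open>Where piece N is active, \<open>\<Phi> w\<close> is near \<open>N\<close> and
      the kernel integral is at most 2 kappa. Where it is inactive only the crude bound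
      \<open>R N\<close> is available, but it is multiplied by the small factor
      \<open>L * r\<close>.\<close>
    have tm: "(\<bar>pf N w\<bar> + L * r) * (\<integral>y. \<bar>dd (\<rho> N) y (\<Phi> w *v y)\<bar> \<partial>lborel) \<le> \<bar>pf N w\<bar> * (2 * \<kappa>) + L * r * R N" if N: "N \<in> J" for N
    proof -
      let ?I = "\<integral>y. \<bar>dd (\<rho> N) y (\<Phi> w *v y)\<bar> \<partial>lborel"
      have RN: "R N > 0" using R N J(1) by blast
      \<comment> \<open>Comparison with the zero matrix turns \<open>kernel_L1_le\<close> into the
        crude bound by the moment.\<close>
      have "(\<integral>y. \<bar>dd (\<rho> N) y (0 *v y)\<bar> \<partial>lborel) = 0"
        using linear_0[OF bounded_linear.linear[OF smooth_dd_linear[OF test_fn_smooth[OF mollifierD(1)[OF \<rho>(1)[OF N]]]]]]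
        by simp
      then have "?I \<le> norm (\<Phi> w) * R N"
        using kernel_L1_le[OF \<rho>(1,3)[OF N], of "\<Phi> w" 0] by simp
      also have "\<dots> \<le> R N" using \<Phi>(2)[of w] RN by (simp add: mult_left_le_one_le)
      finally have I1: "?I \<le> R N" .
      have I2: "?I \<le> 2 * \<kappa>" if "pf N w \<noteq> 0"
      proof -
        have "b N w \<noteq> 0" using that by (auto simp: pf_def)
        then have "norm (\<Phi> w - N) * R N \<le> \<kappa>"
          using b_near[OF N, of w] RN by (simp add: pos_less_divide_eq less_imp_le)
        then show ?thesis using kernel_L1_le[OF \<rho>(1,3)[OF N], of "\<Phi> w" N] \<rho>(2)[OF N] by linarith
      qed
      have "\<bar>pf N w\<bar> * ?I \<le> \<bar>pf N w\<bar> * (2 * \<kappa>)"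
        using I2 by (cases "pf N w = 0") (auto intro: mult_left_mono)
      moreover have "L * r * ?I \<le> L * r * R N" using I1 L r by (intro mult_left_mono) auto
      ultimately show ?thesis by (simp add: distrib_right)
    qed
    have "\<Phi> w \<bullet> shifted_field ?G s w \<le> 4 * M\<^sup>2 * (\<Sum>N\<in>J. (\<bar>pf N w\<bar> + L * r) * (\<integral>y. \<bar>dd (\<rho> N) y (\<Phi> w *v y)\<bar> \<partial>lborel))"
      
      by (rule flux_shifted_inner[where J = J and pf = pf and \<rho> = \<rho> and r = r and L = L and B = Bp and R = R and ?K0.0 = K0]) (fact ctx lip L s)+
    also have "\<dots> \<le> 4 * M\<^sup>2 * (\<Sum>N\<in>J. \<bar>pf N w\<bar> * (2 * \<kappa>) + L * r * R N)"
      by (intro mult_left_mono sum_mono tm) auto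
    also have "(\<Sum>N\<in>J. \<bar>pf N w\<bar> * (2 * \<kappa>) + L * r * R N) = (\<Sum>N\<in>J. \<bar>pf N w\<bar>) * (2 * \<kappa>) + L * r * (\<Sum>N\<in>J. R N)"
      by (simp add: sum.distrib sum_distrib_left sum_distrib_right)
    also have "4 * M\<^sup>2 * ((\<Sum>N\<in>J. \<bar>pf N w\<bar>) * (2 * \<kappa>) + L * r * (\<Sum>N\<in>J. R N)) \<le> 4 * M\<^sup>2 * (Bp * (2 * \<kappa>) + \<kappa>)"
      using pf_abs[of w] r3 \<kappa> by (intro mult_left_mono add_mono mult_right_mono) auto
    also have "\<dots> = 4 * M\<^sup>2 * (2 * Bp + 1) * \<kappa>" by (simp add: algebra_simps)
    finally show "\<Phi> w \<bullet> shifted_field ?G s w \<le> 4 * M\<^sup>2 * (2 * Bp + 1) * \<kappa>" .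
  qed
  have "4 * energy_flux \<psi> = (\<Sum>N\<in>J. 4 * energy_flux (pf N))"
  proof -
    have "energy_flux (\<lambda>w. \<Sum>N\<in>J. pf N w) = (\<Sum>N\<in>J. energy_flux (pf N))"
      by (rule energy_flux_sum[OF J(2)]) (rule pf)
    then show ?thesis unfolding pf_sum by (simp add: sum_distrib_left)
  qed
  also have "\<dots> \<le> (\<Sum>N\<in>J. spatial_cubic (pf N) (\<rho> N) + \<kappa> / m)"
  proof (rule sum_mono)
    fix N assume N: "N \<in> J"
    show "4 * energy_flux (pf N) \<le> spatial_cubic (pf N) (\<rho> N) + \<kappa> / m"
      using rs(2)[OF mollifier_mono[OF \<rho>(1)[OF N] r1[OF N]]] by linarith
  qed
  also have "\<dots> = pairing ?G u + \<kappa>"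
  proof -
    have "pairing ?G u = (\<Sum>N\<in>J. spatial_cubic (pf N) (\<rho> N))"
      by (rule pairing_flux[where J = J and pf = pf and \<rho> = \<rho> and r = r and B = Bp and R = R and ?K0.0 = K0]) (fact ctx)+
    then show ?thesis using m by (simp add: sum.distrib m_def)
  qed
  also have "\<dots> \<le> W * (4 * M\<^sup>2 * (2 * Bp + 1) * \<kappa> + t * C\<^sup>2 / 2) + (\<kappa> * t) / t + \<kappa>" using main by simp
  also have "\<dots> = \<kappa> * (W * (4 * M\<^sup>2 * (2 * Bp + 1) + 1 / 2) + 2)"
  proof -
    have "t * C\<^sup>2 = \<kappa>" "(\<kappa> * t) / t = \<kappa>" using C t by (simp_all add: t_def)
    then show ?thesis by (simp add: algebra_simps)
  qed
  finally show ?thesis .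
qed

lemma energy_flux_nonpos:
  assumes \<psi>: "test_fn Q \<psi>" shows "energy_flux \<psi> \<le> 0"
proof (rule ccontr)
  assume "\<not> energy_flux \<psi> \<le> 0"
  then have E: "energy_flux \<psi> > 0" by simp
  obtain Bp where Bp: "Bp \<ge> 0" "\<And>w. norm (\<psi> w) \<le> Bp" using test_fn_bounded[OF \<psi>] by blast
  define A where "A = W * (4 * M\<^sup>2 * (2 * Bp + 1) + 1 / 2) + 2"
  have A: "A > 0" unfolding A_def using W_nonneg Bp(1) by (intro add_nonneg_pos mult_nonneg_nonneg add_nonneg_nonneg) auto
  \<comment> \<open>With \<open>\<kappa>\<close> equal to the flux divided by \<open>A\<close>, the
    estimate says that four times a positive number is at most that number.\<close>
  have "4 * energy_flux \<psi> \<le> energy_flux \<psi> / A * A"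
    using energy_flux_estimate[OF \<psi>, of Bp "energy_flux \<psi> / A"] Bp(2) E A unfolding A_def[symmetric] by simp
  then show False using A E by simp
qed

text \<open>The one-sided estimate holds for test functions of either sign, and the flux is odd in
  \<open>\<psi>\<close>.\<close>

theorem energy_flux_zero:
  assumes \<psi>: "test_fn Q \<psi>" shows "energy_flux \<psi> = 0"
proof -
  have "test_fn Q (\<lambda>w. - \<psi> w)" by (rule test_fn_bounded_linear[OF bounded_linear_minus[OF bounded_linear_ident] \<psi>])
  from energy_flux_nonpos[OF this] energy_flux_nonpos[OF \<psi>] show ?thesis
    by (simp add: energy_flux_minus[OF \<psi>])
qed

end

section \<open>Reduction to bounded domains\<close>

lemma borel_measurable_nth [measurable (raw)]:
  fixes f :: "'a \<Rightarrow> real^'n::finite"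
  assumes "f \<in> borel_measurable N" shows "(\<lambda>z. f z $ i) \<in> borel_measurable N"
  by (rule measurable_compose[OF assms]) (intro borel_measurable_continuous_onI continuous_intros)

context
  fixes \<Omega> :: "(real^'n::finite) set" and T :: real
    and u :: "(real^'n) \<times> real \<Rightarrow> real^'n"
    and p :: "(real^'n) \<times> real \<Rightarrow> real"
    and f :: "(real^'n) \<times> real \<Rightarrow> real^'n" and M Rb :: real
  assumes open_\<Omega>: "open \<Omega>"
    and u_meas: "set_borel_measurable lborel (\<Omega> \<times> {0<..<T}) u"
    and u_bound: "AE z in lborel. z \<in> \<Omega> \<times> {0<..<T} \<longrightarrow> norm (u z) \<le> M"
    and BV: "L1_BV \<Omega> T u"
    and p_int: "set_integrable lborel (\<Omega> \<times> {0<..<T}) p"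
    and f_int: "set_integrable lborel (\<Omega> \<times> {0<..<T}) f"
    and Euler: "weak_Euler \<Omega> T u p f"
    and M0: "M \<ge> 0"
begin

text \<open>The domain may be unbounded, and a bounded velocity is integrable only after cutting to
  a ball; the ball is chosen to contain the support of the test function.\<close>

definition Qb :: "((real^'n) \<times> real) set" where "Qb = (\<Omega> \<times> {0<..<T}) \<inter> ball 0 Rb"

text \<open>The extension by zero is Borel on the whole space, whereas the given velocity is known
  to be measurable only relative to the domain.\<close>

definition uz :: "(real^'n) \<times> real \<Rightarrow> real^'n" where "uz z = indicator (\<Omega> \<times> {0<..<T}) z *\<^sub>R u z"

text \<open>Values exceeding \<open>M\<close> occur only on a null set of the domain; resetting them
  to 0 makes the bound hold at every point, as \<open>euler_L1\<close> requires.\<close>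

definition ut :: "(real^'n) \<times> real \<Rightarrow> real^'n" where
  "ut z = (if z \<in> Qb \<and> norm (uz z) \<le> M then uz z else 0)"

definition pz :: "(real^'n) \<times> real \<Rightarrow> real" where "pz z = indicator (\<Omega> \<times> {0<..<T}) z *\<^sub>R p z"
definition fz :: "(real^'n) \<times> real \<Rightarrow> real^'n" where "fz z = indicator (\<Omega> \<times> {0<..<T}) z *\<^sub>R f z"

lemma Qb_open: "open Qb"
  unfolding Qb_def using open_\<Omega> by (intro open_Int open_Times) auto

lemma Qb_sub: "Qb \<subseteq> \<Omega> \<times> {0<..<T}" by (auto simp: Qb_def)

lemma on_Qb: "z \<in> Qb \<Longrightarrow> uz z = u z" "z \<in> Qb \<Longrightarrow> pz z = p z" "z \<in> Qb \<Longrightarrow> fz z = f z"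
  using Qb_sub by (auto simp: uz_def pz_def fz_def)

lemma uz_meas [measurable]: "uz \<in> borel_measurable borel"
  using u_meas unfolding set_borel_measurable_def uz_def[abs_def] by simp

lemma ut_meas [measurable]: "ut \<in> borel_measurable borel"
proof -
  have [measurable]: "Qb \<in> sets borel" using Qb_open by simp
  show ?thesis unfolding ut_def[abs_def] by measurable
qed

lemma ut_bound: "norm (ut z) \<le> M" unfolding ut_def using M0 by simp

lemma ut_int: "integrable lborel ut"
proof (rule integrable_compact_support[OF ut_meas _ _ ut_bound])
  show "compact (cball (0::(real^'n) \<times> real) Rb)" by simp
  show "ut x = 0" if "x \<notin> cball 0 Rb" for x using that by (auto simp: ut_def Qb_def)
qed

lemma pz_int: "integrable lborel pz" and fz_int: "integrable lborel fz"
  using p_int f_int unfolding set_integrable_def pz_def[abs_def] fz_def[abs_def] by auto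

lemma pz_meas [measurable]: "pz \<in> borel_measurable borel" using pz_int by auto
lemma fz_meas [measurable]: "fz \<in> borel_measurable borel" using fz_int by auto

lemma AE_ut: "AE z in lborel. z \<in> Qb \<longrightarrow> ut z = uz z"
  using u_bound
proof eventually_elim
  case (elim z)
  then show ?case using Qb_sub on_Qb(1)[of z] by (auto simp: ut_def)
qed

text \<open>Two exchanges: from \<open>u\<close> to \<open>uz\<close> pointwise, because the
  integrand vanishes off \<open>Qb\<close>, and from \<open>uz\<close> to \<open>ut\<close> almost
  everywhere, where both integrands are Borel.\<close>

lemma transfer_integral:
  fixes H :: "real^'n \<Rightarrow> (real^'n) \<times> real \<Rightarrow> real"
  assumes z: "\<And>a z. z \<notin> Qb \<Longrightarrow> H a z = 0"
    and m: "(\<lambda>z. H (uz z) z) \<in> borel_measurable borel" "(\<lambda>z. H (ut z) z) \<in> borel_measurable borel"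
  shows "(\<integral>z. H (u z) z \<partial>lborel) = (\<integral>z. H (ut z) z \<partial>lborel)"
proof -
  have "H (u z) z = H (uz z) z" for z using z[of z] on_Qb(1)[of z] by (cases "z \<in> Qb") auto
  then have "(\<integral>z. H (u z) z \<partial>lborel) = (\<integral>z. H (uz z) z \<partial>lborel)" by simp
  also have "\<dots> = (\<integral>z. H (ut z) z \<partial>lborel)"
  proof (rule integral_cong_AE)
    show "AE z in lborel. H (uz z) z = H (ut z) z"
      using AE_ut
    proof eventually_elim
      case (elim z) then show ?case using z[of z] by (cases "z \<in> Qb") auto
    qed
  qed (use m in auto)
  finally show ?thesis .
qed

lemma Qb_test: "test_fn Qb \<phi> \<Longrightarrow> test_fn (\<Omega> \<times> {0<..<T}) \<phi>"
  by (rule test_fn_mono[OF _ Qb_sub])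

lemma dd_outside_Qb: "test_fn Qb \<phi> \<Longrightarrow> z \<notin> Qb \<Longrightarrow> dd \<phi> z v = 0"
  by (rule test_fn_outside[OF test_fn_dd])

lemma trunc_momentum:
  assumes \<phi>: "test_fn Qb \<phi>"
  shows "(\<integral>z. ut z $ i * dd \<phi> z tdir + (\<Sum>j\<in>UNIV. ut z $ i * ut z $ j * dd \<phi> z (xdir j))
    + pz z * dd \<phi> z (xdir i) + fz z $ i * \<phi> z \<partial>lborel) = 0"
proof -
  note sm = test_fn_smooth[OF \<phi>]
  \<comment> \<open>The vector test field \<open>\<phi>\<close> times the i-th unit vector isolates
    the i-th momentum equation.\<close>
  define \<Phi> where "\<Phi> w = \<phi> w *\<^sub>R (axis i 1 :: real^'n)" for w
  have t: "test_fn Qb \<Phi>" unfolding \<Phi>_def[abs_def] by (rule test_fn_bounded_linear[OF bounded_linear_scaleR_left \<phi>])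
  have d1: "dd \<Phi> z v = dd \<phi> z v *\<^sub>R axis i 1" for z v
    unfolding \<Phi>_def[abs_def] by (rule dd_bounded_linear[OF bounded_linear_scaleR_left sm])
  have d2: "dd (\<lambda>w. \<Phi> w $ k) z v = dd \<Phi> z v $ k" for k z v
    by (rule dd_bounded_linear[OF bounded_linear_vec_nth test_fn_smooth[OF t]])
  have d3: "dd (\<lambda>w. \<Phi> w $ k) z v = (if k = i then dd \<phi> z v else 0)" for k z v
    unfolding d2 d1 by (simp add: axis_def)
  note [measurable] = test_fn_measurable[OF \<phi>] test_fn_measurable[OF test_fn_dd[OF \<phi>]]
  have "(\<integral>z. u z \<bullet> dd \<Phi> z tdir + (\<Sum>i\<in>UNIV. \<Sum>j\<in>UNIV. u z $ i * u z $ j * dd (\<lambda>w. \<Phi> w $ i) z (xdir j))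
      + p z * (\<Sum>i\<in>UNIV. dd (\<lambda>w. \<Phi> w $ i) z (xdir i)) + f z \<bullet> \<Phi> z \<partial>lborel) = 0"
    using Euler Qb_test[OF t] unfolding weak_Euler_def by blast
  also have "(\<lambda>z. u z \<bullet> dd \<Phi> z tdir + (\<Sum>i\<in>UNIV. \<Sum>j\<in>UNIV. u z $ i * u z $ j * dd (\<lambda>w. \<Phi> w $ i) z (xdir j))
      + p z * (\<Sum>i\<in>UNIV. dd (\<lambda>w. \<Phi> w $ i) z (xdir i)) + f z \<bullet> \<Phi> z) =
    (\<lambda>z. u z $ i * dd \<phi> z tdir + (\<Sum>j\<in>UNIV. u z $ i * u z $ j * dd \<phi> z (xdir j))
      + pz z * dd \<phi> z (xdir i) + fz z $ i * \<phi> z)" (is "?A = ?B")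
  proof
    fix z
    have s: "(\<Sum>k\<in>UNIV. \<Sum>j\<in>UNIV. u z $ k * u z $ j * (if k = i then dd \<phi> z (xdir j) else 0)) =
      (\<Sum>j\<in>UNIV. u z $ i * u z $ j * dd \<phi> z (xdir j))"
      by (subst sum.swap) (simp add: if_distrib[of "\<lambda>x. _ * x"] cong: if_cong)
    show "?A z = ?B z"
    proof (cases "z \<in> Qb")
      case True
      then show ?thesis unfolding d3 s d1 by (simp add: \<Phi>_def inner_axis on_Qb mult.commute)
    next
      case False
      then show ?thesis unfolding d3 s d1 using dd_outside_Qb[OF \<phi>] test_fn_outside[OF \<phi>] by (simp add: \<Phi>_def)
    qed
  qed
  also have "(\<integral>z. ?B z \<partial>lborel) = (\<integral>z. ut z $ i * dd \<phi> z tdir + (\<Sum>j\<in>UNIV. ut z $ i * ut z $ j * dd \<phi> z (xdir j))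
    + pz z * dd \<phi> z (xdir i) + fz z $ i * \<phi> z \<partial>lborel)"
    by (rule transfer_integral[of "\<lambda>a z. a $ i * dd \<phi> z tdir + (\<Sum>j\<in>UNIV. a $ i * a $ j * dd \<phi> z (xdir j))
      + pz z * dd \<phi> z (xdir i) + fz z $ i * \<phi> z"]; measurable?)
       (simp add: dd_outside_Qb[OF \<phi>] test_fn_outside[OF \<phi>])
  finally show ?thesis .
qed

lemma trunc_divfree:
  assumes \<phi>: "test_fn Qb \<phi>"
  shows "(\<integral>z. (\<Sum>j\<in>UNIV. ut z $ j * dd \<phi> z (xdir j)) \<partial>lborel) = 0"
proof -
  note [measurable] = test_fn_measurable[OF \<phi>] test_fn_measurable[OF test_fn_dd[OF \<phi>]]
  have "(\<integral>z. (\<Sum>j\<in>UNIV. u z $ j * dd \<phi> z (xdir j)) \<partial>lborel) = 0"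
    using Euler Qb_test[OF \<phi>] unfolding weak_Euler_def by blast
  also have "(\<integral>z. (\<Sum>j\<in>UNIV. u z $ j * dd \<phi> z (xdir j)) \<partial>lborel) = (\<integral>z. (\<Sum>j\<in>UNIV. ut z $ j * dd \<phi> z (xdir j)) \<partial>lborel)"
    by (rule transfer_integral[of "\<lambda>a z. \<Sum>j\<in>UNIV. a $ j * dd \<phi> z (xdir j)"]; measurable?)
       (simp add: dd_outside_Qb[OF \<phi>])
  finally show ?thesis .
qed

lemma trunc_euler: "euler_L1 Qb ut pz fz M"
  by unfold_locales (rule Qb_open ut_int ut_bound pz_int fz_int trunc_momentum trunc_divfree | assumption)+

lemma DR_eq_energy_flux:
  assumes \<psi>: "test_fn Qb \<psi>"
  shows "DR_defect u p f \<psi> = euler_L1.energy_flux ut pz fz \<psi>"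
proof -
  interpret euler_L1 Qb ut pz fz M by (rule trunc_euler)
  note [measurable] = test_fn_measurable[OF \<psi>] test_fn_measurable[OF test_fn_dd[OF \<psi>]]
  let ?H = "\<lambda>a z. (norm a)\<^sup>2 / 2 * dd \<psi> z tdir + ((norm a)\<^sup>2 / 2 + pz z) * (\<Sum>j\<in>UNIV. a $ j * dd \<psi> z (xdir j))
     + (\<Sum>i\<in>UNIV. fz z $ i * a $ i) * \<psi> z"
  have "(norm (u z))\<^sup>2 / 2 * dd \<psi> z tdir + ((norm (u z))\<^sup>2 / 2 + p z) * (\<Sum>j\<in>UNIV. u z $ j * dd \<psi> z (xdir j))
          + (f z \<bullet> u z) * \<psi> z = ?H (u z) z" for z
  proof (cases "z \<in> Qb")
    case True then show ?thesis by (simp add: on_Qb inner_vec_def)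
  next
    case False then show ?thesis using dd_outside_Qb[OF \<psi>] test_fn_outside[OF \<psi>] by simp
  qed
  then have "DR_defect u p f \<psi> = (\<integral>z. ?H (u z) z \<partial>lborel)" unfolding DR_defect_def by (simp only:)
  also have "\<dots> = (\<integral>z. ?H (ut z) z \<partial>lborel)"
    by (rule transfer_integral[of ?H]; measurable?) (simp add: dd_outside_Qb[OF \<psi>] test_fn_outside[OF \<psi>])
  also have "\<dots> = energy_flux \<psi>" unfolding energy_flux_def nsq_def u_def ..
  finally show ?thesis .
qed

lemma section_test:
  fixes \<Phi> :: "(real^'n) \<times> real \<Rightarrow> real^'n^'n"
  assumes \<Phi>: "test_fn Qb \<Phi>"
  shows "test_fn \<Omega> (\<lambda>x. \<Phi> (x, t))"
    and "dd (\<lambda>y. \<Phi> (y, t) $ i $ j) x (axis j 1) = dd (\<lambda>w. \<Phi> w $ i $ j) (x, t) (xdir j)"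
proof -
  have bl: "bounded_linear (\<lambda>y::real^'n. (y, 0::real))"
    by (rule bounded_linear_Pair[OF bounded_linear_ident bounded_linear_zero])
  from test_fnD[OF \<Phi>] obtain K where K: "smooth \<Phi>" "compact K" "K \<subseteq> Qb" "\<And>x. x \<notin> K \<Longrightarrow> \<Phi> x = 0" by blast
  show "test_fn \<Omega> (\<lambda>x. \<Phi> (x, t))"
  proof (rule test_fnI[of _ "fst ` K"])
    show "smooth (\<lambda>x. \<Phi> (x, t))" using smooth_affine[OF bl K(1), of "(0, t)"] by simp
    show "compact (fst ` K)" by (rule compact_continuous_image[OF continuous_on_fst[OF continuous_on_id] K(2)])
    show "fst ` K \<subseteq> \<Omega>" using K(3) Qb_sub by auto
    show "\<Phi> (x, t) = 0" if "x \<notin> fst ` K" for x using that by (intro K(4)) force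
  qed
  show "dd (\<lambda>y. \<Phi> (y, t) $ i $ j) x (axis j 1) = dd (\<lambda>w. \<Phi> w $ i $ j) (x, t) (xdir j)"
    using dd_affine[OF bl test_fn_smooth[OF test_fn_entry[OF \<Phi>, of i j]], of "(0, t)" x "axis j 1"]
    by (simp add: xdir_def)
qed

text \<open>By Fubini the space-time pairing is an integral over t of spatial pairings. At each time
  the section of \<open>\<Phi>\<close> competes in De Giorgi's supremum for \<open>u (x, t)\<close>,
  so integration in t is bounded by the norm in L1(0,T; BV).\<close>

lemma trunc_variation:
  fixes \<Phi> :: "(real^'n) \<times> real \<Rightarrow> real^'n^'n"
  assumes \<Phi>: "test_fn Qb \<Phi>" and n\<Phi>: "\<And>z. norm (\<Phi> z) \<le> 1"
  shows "euler_L1.dvf ut \<Phi> \<le> enn2real (\<integral>\<^sup>+ t. indicator {0<..<T} t * total_variation \<Omega> (\<lambda>x. u (x, t)) \<partial>lborel)"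
proof -
  interpret euler_L1 Qb ut pz fz M by (rule trunc_euler)
  note te = test_fn_entry[OF \<Phi>]
  have [measurable]: "(\<lambda>w. dd (\<lambda>w. \<Phi> w $ i $ j) w (xdir j)) \<in> borel_measurable borel" for i j
    by (rule test_fn_measurable[OF test_fn_dd[OF te]])
  define H where "H a z = (\<Sum>i\<in>UNIV. a $ i * (\<Sum>j\<in>UNIV. dd (\<lambda>w. \<Phi> w $ i $ j) z (xdir j)))" for a :: "real^'n" and z
  have Hz: "H a z = 0" if "z \<notin> Qb" for a z unfolding H_def using dd_outside_Qb[OF te that] by simp
  have mH: "(\<lambda>z. H (uz z) z) \<in> borel_measurable borel" "(\<lambda>z. H (ut z) z) \<in> borel_measurable borel"
    unfolding H_def by measurable
  have iH: "integrable lborel (\<lambda>z. H (ut z) z)"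
    unfolding H_def sum_distrib_left
    by (intro Bochner_Integration.integrable_sum int_u_dd[OF te, unfolded u_def])
  define I where "I t = (\<integral>x. H (ut (x, t)) (x, t) \<partial>lborel)" for t
  have iH2: "integrable (lborel \<Otimes>\<^sub>M lborel) (\<lambda>(x, t). H (ut (x, t)) (x, t))"
    using iH by (simp add: lborel_prod case_prod_beta')
  have iI: "integrable lborel I" unfolding I_def[abs_def] by (rule lborel_pair.integrable_snd[OF iH2])
  have "dvf \<Phi> = (\<integral>z. H (ut z) z \<partial>lborel)" unfolding dvf_def H_def u_def ..
  also have "\<dots> = (\<integral>t. I t \<partial>lborel)"
    unfolding I_def using lborel_pair.integral_snd[OF iH2] by (simp add: lborel_prod case_prod_beta')
  \<comment> \<open>Dropping the negative part of \<open>I\<close> passes to nonnegative integrals,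
    in which the variation is expressed.\<close>
  also have "\<dots> \<le> enn2real (\<integral>\<^sup>+ t. ennreal (I t) \<partial>lborel)"
    using real_lebesgue_integral_def[OF iI] by simp
  also have "\<dots> \<le> enn2real (\<integral>\<^sup>+ t. indicator {0<..<T} t * total_variation \<Omega> (\<lambda>x. u (x, t)) \<partial>lborel)"
  proof (rule enn2real_mono)
    show "(\<integral>\<^sup>+ t. indicator {0<..<T} t * total_variation \<Omega> (\<lambda>x. u (x, t)) \<partial>lborel) < top"
      using BV unfolding L1_BV_def by simp
    show "(\<integral>\<^sup>+ t. ennreal (I t) \<partial>lborel) \<le> (\<integral>\<^sup>+ t. indicator {0<..<T} t * total_variation \<Omega> (\<lambda>x. u (x, t)) \<partial>lborel)"
    proof (rule nn_integral_mono_AE)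
      have "AE q in lborel \<Otimes>\<^sub>M lborel. (case q of (x, t) \<Rightarrow> H (uz (x, t)) (x, t) = H (ut (x, t)) (x, t))"
      proof -
        have "AE z in lborel. H (uz z) z = H (ut z) z"
          using AE_ut
        proof eventually_elim
          case (elim z) then show ?case using Hz[of z] by (cases "z \<in> Qb") auto
        qed
        then show ?thesis unfolding lborel_prod by (simp add: case_prod_beta')
      qed
      then have "AE x in lborel. AE t in lborel. H (uz (x, t)) (x, t) = H (ut (x, t)) (x, t)"
        by (rule lborel_pair.AE_pair[THEN AE_mp, OF _ AE_I2]) simp
      \<comment> \<open>Exchanging the two almost-everywhere quantifiers requires this set to be
        measurable in the product: truncation must be invisible on almost every time slice.\<close>
      moreover have "{q \<in> space (lborel \<Otimes>\<^sub>M lborel). H (uz (fst q, snd q)) (fst q, snd q) = H (ut (fst q, snd q)) (fst q, snd q)}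
          \<in> sets (lborel \<Otimes>\<^sub>M lborel)"
      proof -
        have "{q. H (uz q) q = H (ut q) q} \<in> sets borel"
          using measurable_equality_set[OF mH] by simp
        then show ?thesis unfolding lborel_prod by simp
      qed
      ultimately have "AE t in lborel. AE x in lborel. H (uz (x, t)) (x, t) = H (ut (x, t)) (x, t)"
        using lborel_pair.AE_commute[of "\<lambda>x t. H (uz (x, t)) (x, t) = H (ut (x, t)) (x, t)"] by blast
      then show "AE t in lborel. ennreal (I t) \<le> indicator {0<..<T} t * total_variation \<Omega> (\<lambda>x. u (x, t))"
      proof eventually_elim
        case (elim t)
        have ms: "(\<lambda>x::real^'n. (x, t)) \<in> borel_measurable borel"
          by (intro borel_measurable_continuous_onI continuous_intros)
        have eq: "I t = (\<integral>x. H (u (x, t)) (x, t) \<partial>lborel)"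
        proof -
          have "I t = (\<integral>x. H (uz (x, t)) (x, t) \<partial>lborel)"
            unfolding I_def
          proof (rule integral_cong_AE)
            show "(\<lambda>x. H (ut (x, t)) (x, t)) \<in> borel_measurable lborel"
              using measurable_compose[OF ms mH(2)] by simp
            show "(\<lambda>x. H (uz (x, t)) (x, t)) \<in> borel_measurable lborel"
              using measurable_compose[OF ms mH(1)] by simp
            show "AE x in lborel. H (ut (x, t)) (x, t) = H (uz (x, t)) (x, t)"
              using elim by eventually_elim simp
          qed
          also have "\<dots> = (\<integral>x. H (u (x, t)) (x, t) \<partial>lborel)"
          proof (intro Bochner_Integration.integral_cong refl)
            fix x show "H (uz (x, t)) (x, t) = H (u (x, t)) (x, t)"
              using Hz[of "(x, t)"] on_Qb(1)[of "(x, t)"] by (cases "(x, t) \<in> Qb") auto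
          qed
          finally show ?thesis .
        qed
        show ?case
        proof (cases "t \<in> {0<..<T}")
          case False
          then have "(x, t) \<notin> Qb" for x using Qb_sub by auto
          then have "I t = 0" unfolding I_def using Hz by simp
          then show ?thesis by simp
        next
          case True
          have "ennreal (I t) = ennreal (\<integral>x. (\<Sum>i\<in>UNIV. u (x, t) $ i * (\<Sum>j\<in>UNIV. dd (\<lambda>y. \<Phi> (y, t) $ i $ j) x (axis j 1))) \<partial>lborel)"
            unfolding eq H_def section_test(2)[OF \<Phi>] ..
          also have "\<dots> \<le> total_variation \<Omega> (\<lambda>x. u (x, t))"
            unfolding total_variation_def
            by (rule SUP_upper2[where i = "\<lambda>x. \<Phi> (x, t)"]) (use section_test(1)[OF \<Phi>] n\<Phi> in auto)
          finally show ?thesis using True by simp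
        qed
      qed
    qed
  qed
  finally show ?thesis .
qed

lemma DR_defect_eq_0:
  assumes "smooth \<psi>" "compact K" "K \<subseteq> \<Omega> \<times> {0<..<T}" "K \<subseteq> ball 0 Rb" "\<And>z. z \<notin> K \<Longrightarrow> \<psi> z = 0"
  shows "DR_defect u p f \<psi> = 0"
proof -
  have \<psi>: "test_fn Qb \<psi>" by (rule test_fnI[OF assms(1,2) _ assms(5)]) (use assms(3,4) in \<open>auto simp: Qb_def\<close>)
  interpret E: euler_L1 Qb ut pz fz M by (rule trunc_euler)
  interpret euler_bv Qb ut pz fz M "enn2real (\<integral>\<^sup>+ t. indicator {0<..<T} t * total_variation \<Omega> (\<lambda>x. u (x, t)) \<partial>lborel)"
    by unfold_locales (rule trunc_variation)
  show ?thesis unfolding DR_eq_energy_flux[OF \<psi>] by (rule energy_flux_zero[OF \<psi>])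
qed

end

theorem theorem1p1:
  fixes \<Omega> :: "(real^'n::finite) set" and T :: real
    and u :: "(real^'n) \<times> real \<Rightarrow> real^'n"
    and p :: "(real^'n) \<times> real \<Rightarrow> real"
    and f :: "(real^'n) \<times> real \<Rightarrow> real^'n"
  assumes "open \<Omega>" and "T > 0"
    and "Linfty_on (\<Omega> \<times> {0<..<T}) u"
    and "L1_BV \<Omega> T u"
    and "set_integrable lborel (\<Omega> \<times> {0<..<T}) p"
    and "set_integrable lborel (\<Omega> \<times> {0<..<T}) f"
    and "weak_Euler \<Omega> T u p f"
  shows "\<forall>\<psi> :: (real^'n) \<times> real \<Rightarrow> real. test_fn (\<Omega> \<times> {0<..<T}) \<psi> \<longrightarrow> DR_defect u p f \<psi> = 0"
proof (intro allI impI)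
  fix \<psi> :: "(real^'n) \<times> real \<Rightarrow> real" assume \<psi>: "test_fn (\<Omega> \<times> {0<..<T}) \<psi>"
  from test_fnD[OF \<psi>] obtain K where K: "smooth \<psi>" "compact K" "K \<subseteq> \<Omega> \<times> {0<..<T}" "\<And>x. x \<notin> K \<Longrightarrow> \<psi> x = 0" by blast
  \<comment> \<open>Cutting to this ball does not affect the test function, since its support lies
    inside.\<close>
  obtain R where R: "K \<subseteq> ball 0 R" using bounded_subset_ballD[OF compact_imp_bounded[OF K(2)], of 0] by blast
  obtain M0 where M0: "AE z in lborel. z \<in> \<Omega> \<times> {0<..<T} \<longrightarrow> norm (u z) \<le> M0"
    and um: "set_borel_measurable lborel (\<Omega> \<times> {0<..<T}) u"
    using assms(3) unfolding Linfty_on_def by blast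
  \<comment> \<open>The essential bound could be negative if the domain is null; the truncation
    needs a nonnegative one.\<close>
  from M0 have "AE z in lborel. z \<in> \<Omega> \<times> {0<..<T} \<longrightarrow> norm (u z) \<le> max M0 0" by eventually_elim auto
  then show "DR_defect u p f \<psi> = 0"
    by (rule DR_defect_eq_0[OF assms(1) um _ assms(4-7) max.cobounded2 K(1,2,3) R K(4)])
qed

end
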